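(* Let $f:\mathbb{R}\to\mathbb{R}$ with $f(0)=0$ satisfy conditions (i)–(v) below, let $F(t)=\int_0^tf(s)\,ds$, and let $V:\mathbb{R}^4\to[0,\infty)$ be continuous, satisfying (V1) and (V2) below. Define $$\gamma^{*}=\sup\Big\{\frac{2}{\|u\|_2^2}\int_{\mathbb{R}^4}F(u)\,dx : u\in W^{2,2}(\mathbb{R}^4)\setminus\{0\},\ \|\Delta u\|_2^2\le\frac{32\pi^2}{\alpha_0}\Big\}\in(0,+\infty].$$ If $V_\infty\in(0,\gamma^* )$, then the equation $(-\Delta)^2u+V(x)u=f(u)$ in $\mathbb{R}^4$ admits a ground-state solution.
   Context: Conditions on $f$: (i) there is $\alpha_0>0$ such that $\lim_{|t|\to\infty}|f(t)|/\exp(\alpha t^2)=0$ for every $\alpha>\alpha_0$ and $=+\infty$ for every $\alpha<\alpha_0$; (ii) there is $\mu>2$ with $0<\mu F(t)\le tf(t)$ for all $t\neq0$; (iii) there exist $t_0$ and $M_0>0$ with $F(t)\le M_0|f(t)|$ for $|t|\ge t_0$; (iv) $f(t)=o(t)$ as $t\to0$; (v) $f\in C^1$ and $f(t)/t$ is increasing. Conditions on $V$: (V1) there exist $c_0,\delta>0$ with $V=0$ on $B_\delta(0)$ and $V\ge c_0$ on $\mathbb{R}^4\setminus B_{2\delta}(0)$; (V2) $\sup_{x\in\mathbb{R}^4}V(x)=\lim_{|x|\to\infty}V(x)=V_\infty>0$. The energy functional is $I_V(u)=\frac12\int_{\mathbb{R}^4}(|\Delta u|^2+V(x)u^2)\,dx-\int_{\mathbb{R}^4}F(u)\,dx$;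 a ground-state solution is a nontrivial weak solution in $W^{2,2}(\mathbb{R}^4)$ minimizing $I_V$ among nontrivial weak solutions (equivalently in the paper, a minimizer of $I_V$ on the Nehari manifold $\{u\ne0: \int(|\Delta u|^2+Vu^2)=\int f(u)u\}$).
   Formalization: In (v), "f(t)/t is increasing" is taken as strictly increasing on (0,∞) and strictly decreasing on (-∞,0): increasing on all of R\{0} is incompatible with (ii) and (iv), which force f(t)/t>0 for t<0 and f(t)/t→0 as t→0. *)

theory Defs
  imports "HOL-Analysis.Analysis"
begin

type_synonym R4 = "real^4"

definition partial_dir :: "4 \<Rightarrow> (R4 \<Rightarrow> real) \<Rightarrow> R4 \<Rightarrow> real" where
  "partial_dir i f x = deriv (\<lambda>t. f (x + t *\<^sub>R axis i 1)) 0"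

fun iter_partial :: "4 list \<Rightarrow> (R4 \<Rightarrow> real) \<Rightarrow> R4 \<Rightarrow> real" where
  "iter_partial [] f = f"
| "iter_partial (i # ixs) f = partial_dir i (iter_partial ixs f)"

definition smooth_fun :: "(R4 \<Rightarrow> real) \<Rightarrow> bool" where
  "smooth_fun f \<longleftrightarrow> (\<forall>ixs. continuous_on UNIV (iter_partial ixs f) \<and>
      (\<forall>i x. (\<lambda>t. iter_partial ixs f (x + t *\<^sub>R axis i 1)) differentiable (at 0)))"

definition test_fun :: "(R4 \<Rightarrow> real) \<Rightarrow> bool" where
  "test_fun \<phi> \<longleftrightarrow> smooth_fun \<phi> \<and> bounded {x. \<phi> x \<noteq> 0}"

definition L2 :: "(R4 \<Rightarrow> real) set" where
  "L2 = {u. u \<in> borel_measurable lebesgue \<and> integrable lebesgue (\<lambda>x. (u x)\<^sup>2)}"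

definition weak_deriv :: "4 list \<Rightarrow> (R4 \<Rightarrow> real) \<Rightarrow> (R4 \<Rightarrow> real) \<Rightarrow> bool" where
  "weak_deriv ixs u g \<longleftrightarrow> g \<in> borel_measurable lebesgue \<and>
     (\<forall>\<phi>. test_fun \<phi> \<longrightarrow>
        integrable lebesgue (\<lambda>x. u x * iter_partial ixs \<phi> x) \<and>
        integrable lebesgue (\<lambda>x. g x * \<phi> x) \<and>
        (\<integral>x. u x * iter_partial ixs \<phi> x \<partial>lebesgue) =
          (-1) ^ length ixs * (\<integral>x. g x * \<phi> x \<partial>lebesgue))"

definition W22 :: "(R4 \<Rightarrow> real) set" where
  "W22 = {u. u \<in> L2 \<and> (\<forall>ixs. length ixs \<le> 2 \<longrightarrow> (\<exists>g\<in>L2. weak_deriv ixs u g))}"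

text \<open>Weak Laplacian; unique up to null sets, so integrals of it are well defined.\<close>
definition weak_laplacian :: "(R4 \<Rightarrow> real) \<Rightarrow> (R4 \<Rightarrow> real) \<Rightarrow> bool" where
  "weak_laplacian u w \<longleftrightarrow> w \<in> borel_measurable lebesgue \<and>
     (\<forall>\<phi>. test_fun \<phi> \<longrightarrow>
        integrable lebesgue (\<lambda>x. u x * (\<Sum>i\<in>UNIV. iter_partial [i, i] \<phi> x)) \<and>
        integrable lebesgue (\<lambda>x. w x * \<phi> x) \<and>
        (\<integral>x. u x * (\<Sum>i\<in>UNIV. iter_partial [i, i] \<phi> x) \<partial>lebesgue) =
          (\<integral>x. w x * \<phi> x \<partial>lebesgue))"

definition lap :: "(R4 \<Rightarrow> real) \<Rightarrow> R4 \<Rightarrow> real" where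
  "lap u = (SOME w. weak_laplacian u w)"

definition nontrivial :: "(R4 \<Rightarrow> real) \<Rightarrow> bool" where
  "nontrivial u \<longleftrightarrow> \<not> (AE x in lebesgue. u x = 0)"

definition L2norm_sq :: "(R4 \<Rightarrow> real) \<Rightarrow> real" where
  "L2norm_sq u = (\<integral>x. (u x)\<^sup>2 \<partial>lebesgue)"

definition weak_solution ::
  "(R4 \<Rightarrow> real) \<Rightarrow> (real \<Rightarrow> real) \<Rightarrow> (R4 \<Rightarrow> real) \<Rightarrow> bool" where
  "weak_solution V f u \<longleftrightarrow> u \<in> W22 \<and>
     (\<forall>\<phi>\<in>W22.
        (\<integral>x. lap u x * lap \<phi> x + V x * u x * \<phi> x \<partial>lebesgue) =
        (\<integral>x. f (u x) * \<phi> x \<partial>lebesgue))"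

definition energy ::
  "(R4 \<Rightarrow> real) \<Rightarrow> (real \<Rightarrow> real) \<Rightarrow> (R4 \<Rightarrow> real) \<Rightarrow> real" where
  "energy V F u = (1/2) * (\<integral>x. (lap u x)\<^sup>2 + V x * (u x)\<^sup>2 \<partial>lebesgue)
                   - (\<integral>x. F (u x) \<partial>lebesgue)"

definition ground_state ::
  "(R4 \<Rightarrow> real) \<Rightarrow> (real \<Rightarrow> real) \<Rightarrow> (real \<Rightarrow> real) \<Rightarrow> (R4 \<Rightarrow> real) \<Rightarrow> bool" where
  "ground_state V f F u \<longleftrightarrow> weak_solution V f u \<and> nontrivial u \<and>
     (\<forall>v. weak_solution V f v \<and> nontrivial v \<longrightarrow> energy V F u \<le> energy V F v)"

text \<open>gamma^* as an extended real (value in (0, +infinity]).  The integral of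
  F(u) >= 0 is taken as a nonnegative integral, so it is never silently 0.\<close>
definition gamma_star :: "(real \<Rightarrow> real) \<Rightarrow> real \<Rightarrow> ereal" where
  "gamma_star F \<alpha>0 = Sup {ereal (2 / L2norm_sq u) * enn2ereal (\<integral>\<^sup>+x. ennreal (F (u x)) \<partial>lebesgue)
       | u. u \<in> W22 \<and> nontrivial u \<and>
            (\<integral>x. (lap u x)\<^sup>2 \<partial>lebesgue) \<le> 32 * pi\<^sup>2 / \<alpha>0}"

end

theory Submission
 imports Defs "HOL-Library.Diagonal_Subsequence" "HOL-Real_Asymp.Real_Asymp"
begin

text \<open>Write \<open>E_V\<close> for the energy and \<open>\<Psi> x = sup {E_V (t x) | t \<ge> 0}\<close>; since \<open>f t / t\<close> is increasing, each ray
 meets the Nehari set once, at its maximum, so \<open>m = inf \<Psi>\<close> bounds the energy of every nontrivial solution from below.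
 Ekeland's principle for \<open>\<Psi>\<close> on the unit sphere yields a Palais--Smale sequence on the Nehari set.
 The hypothesis \<open>V_inf < gamma_star\<close> gives, after a dilation, \<open>m < 16 pi\<^sup>2 / \<alpha>0\<close>. If the sequence vanished, its
 Laplacians would have square norm below \<open>32 pi\<^sup>2 / \<alpha>0\<close>, and Adams' inequality, obtained from a Riesz-type potential
 representation with the local kernel \<open>1 / (4 pi\<^sup>2 |x|\<^sup>2)\<close>, would force \<open>m = 0\<close>. So suitable translates converge
 weakly to a nonzero solution for a translate of \<open>V\<close> or for the constant \<open>V_inf\<close>, of energy at most \<open>m\<close> by Fatou.
 The second case contradicts the definition of \<open>m\<close>, because \<open>V\<close> vanishes on a ball on which the limit is nonzero.\<close>

text \<open>All Sobolev theory is drawn from one identity. In dimension 4 the Laplacian of the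
  cut-off kernel \<open>kG s\<close> is \<open>kS s\<close> minus a Dirac mass, so u equals the
  convolution of u with \<open>kS s\<close> minus that of its Laplacian with \<open>kG s\<close>,
  and the latter has norm at most s/4 times the norm of the Laplacian. Hence come second-order
  regularity, local compactness, coercivity although V vanishes on a ball, and the test for
  vanishing. The number \<open>32 pi^2\<close> is 4 times \<open>8 pi^2\<close>: the kernel
  convolved with itself grows like ln(1/|z|) / \<open>(8 pi^2)\<close>, and ln(1/|z|) is, up to a
  constant, a quarter of the logarithm of the inverse volume. Near one fixed function every
  exponential is integrable, since its Laplacian can be truncated; this makes the functional finite
  and continuous, but gives nothing uniform on bounded sets. Differentiability of
  \<open>\<Psi>\<close> is never established: one-sided quotients along perturbed rays, with
  uniqueness of the maximum on a ray, replace it. Dilations come for free because the norm of the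
  Laplacian is invariant under them in dimension 4, while the integrals without derivatives
  scale.\<close>

abbreviation nn_lborel :: "('a::euclidean_space \<Rightarrow> ennreal) \<Rightarrow> ennreal" (binder "NN " 10)
 where "nn_lborel \<equiv> nn_integral lborel"

section \<open>Smooth functions\<close>

text \<open>The flat functions P(1/x) exp(-1/x) form a family closed under differentiation, which
  exp(-1/x) alone is not. \<open>En 1\<close> is the usual building block of bump functions.\<close>

definition En :: "real poly \<Rightarrow> real \<Rightarrow> real" where
 "En p x = (if x > 0 then poly p (1 / x) * exp (- (1 / x)) else 0)"

definition En_deriv :: "real poly \<Rightarrow> real poly" where
 "En_deriv p = [:0, 0, 1:] * (p - pderiv p)"

lemma poly_exp_tendsto_0: "((\<lambda>y. poly p y * exp (- y)) \<longlongrightarrow> (0::real)) at_top"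
proof -
 have "((\<lambda>y. \<Sum>k\<le>degree p. coeff p k * (y ^ k / exp y)) \<longlongrightarrow> (\<Sum>k\<le>degree p. coeff p k * 0)) at_top"
  by (intro tendsto_sum tendsto_mult tendsto_const tendsto_power_div_exp_0)
 then show ?thesis
  by (simp add: poly_altdef sum_divide_distrib exp_minus inverse_eq_divide)
qed

text \<open>This is the difference quotient at the gluing point 0. The factor 1/h only raises the
  degree of the polynomial, so the exponential still wins.\<close>

lemma En_over_tendsto_0: "((\<lambda>h. En p h / h) \<longlongrightarrow> 0) (at 0)"
proof -
 have "((\<lambda>h. poly ([:0,1:] * p) (inverse h) * exp (- inverse h)) \<longlongrightarrow> (0::real)) (at_right 0)"
  by (rule filterlim_compose[OF poly_exp_tendsto_0 filterlim_inverse_at_top_right])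
 then have "((\<lambda>h. En p h / h) \<longlongrightarrow> 0) (at_right 0)"
  by (rule Lim_transform_eventually)
    (auto simp: En_def eventually_at_filter field_simps intro!: always_eventually)
 moreover have "((\<lambda>h. En p h / h) \<longlongrightarrow> 0) (at_left 0)"
  by (rule Lim_transform_eventually[OF tendsto_const])
    (auto simp: En_def eventually_at_filter intro!: always_eventually)
 ultimately show ?thesis by (simp add: filterlim_split_at_real)
qed

lemma En_has_deriv: "(En p has_real_derivative En (En_deriv p) x) (at x)"
proof -
 consider "x > 0" | "x < 0" | "x = 0" by linarith
 then show ?thesis
 proof cases
  case 1
  have "((\<lambda>x. poly p (1 / x) * exp (- (1 / x))) has_real_derivative En (En_deriv p) x) (at x)"
   using 1 by (auto intro!: derivative_eq_intros poly_DERIV[THEN DERIV_chain2]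
     simp: En_def En_deriv_def field_simps power2_eq_square)
  then show ?thesis
   by (rule has_field_derivative_transform_within[where d = x]) (use 1 in \<open>auto simp: En_def dist_real_def\<close>)
 next
  case 2
  have "((\<lambda>x. 0) has_real_derivative En (En_deriv p) x) (at x)"
   using 2 by (auto simp: En_def)
  then show ?thesis
   by (rule has_field_derivative_transform_within[where d = "- x"]) (use 2 in \<open>auto simp: En_def dist_real_def\<close>)
 next
  case 3
  then show ?thesis
   using En_over_tendsto_0[of p] by (simp add: DERIV_def En_def)
 qed
qed

text \<open>\<open>smooth_fun\<close> speaks of all iterated partial derivatives, for which product
  and chain rules are awkward. This class is closed under a single partial derivative, and that is
  enough. Rule \<open>sm_base\<close> puts all smooth functions in, so the two notions
  coincide.\<close>

inductive sm :: "(R4 \<Rightarrow> real) \<Rightarrow> bool" where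
 sm_base: "smooth_fun f \<Longrightarrow> sm f"
| sm_const: "sm (\<lambda>_. c)"
| sm_coord: "sm (\<lambda>x. x $ i)"
| sm_add: "sm f \<Longrightarrow> sm g \<Longrightarrow> sm (\<lambda>x. f x + g x)"
| sm_mult: "sm f \<Longrightarrow> sm g \<Longrightarrow> sm (\<lambda>x. f x * g x)"
| sm_En: "sm f \<Longrightarrow> sm (\<lambda>x. En p (f x))"
| sm_inverse: "sm f \<Longrightarrow> (\<And>x. f x \<noteq> 0) \<Longrightarrow> sm (\<lambda>x. inverse (f x))"

lemma En_continuous [continuous_intros]: "continuous_on S f \<Longrightarrow> continuous_on S (\<lambda>x. En p (f x))"
proof -
 have "continuous_on UNIV (En p)"
 using En_has_deriv DERIV_isCont continuous_at_imp_continuous_on by blast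
 then show "continuous_on S f \<Longrightarrow> continuous_on S (\<lambda>x. En p (f x))"
 using continuous_on_compose2 by blast
qed

lemma iter_partial_append: "iter_partial (xs @ ys) f = iter_partial xs (iter_partial ys f)"
 by (induction xs) auto

lemma smooth_fun_iter: "smooth_fun f \<Longrightarrow> smooth_fun (iter_partial ixs f)"
 unfolding smooth_fun_def iter_partial_append[symmetric] by blast

lemma smooth_fun_continuous: "smooth_fun f \<Longrightarrow> continuous_on UNIV f"
 unfolding smooth_fun_def by (metis iter_partial.simps(1))

lemma smooth_fun_has_deriv:
 assumes "smooth_fun f"
 shows "((\<lambda>t. f (x + t *\<^sub>R axis i 1)) has_real_derivative partial_dir i f x) (at 0)"
proof -
 have "(\<lambda>t. iter_partial [] f (x + t *\<^sub>R axis i 1)) differentiable (at 0)"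
  using assms unfolding smooth_fun_def by blast
 then show ?thesis unfolding partial_dir_def
  by (simp add: DERIV_deriv_iff_real_differentiable)
qed

text \<open>Continuity and the existence of a derivative inside the class go through one rule
  induction; iterating the second part then yields smoothness of every member.\<close>

lemma sm_aux:
 "sm f \<Longrightarrow> continuous_on UNIV f \<and>
  (\<forall>i. \<exists>g. sm g \<and> (\<forall>x. ((\<lambda>t. f (x + t *\<^sub>R axis i 1)) has_real_derivative g x) (at 0)))"
proof (induction rule: sm.induct)
 case (sm_base f)
 then show ?case
  using smooth_fun_has_deriv[OF sm_base] smooth_fun_iter[OF sm_base, of "[_]"]
  by (auto intro!: smooth_fun_continuous sm.intros(1))
next
 case (sm_const c)
 then show ?case by (auto intro!: exI[of _ "\<lambda>_. 0"] sm.sm_const)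
next
 case (sm_coord i)
 have "((\<lambda>t. (x + t *\<^sub>R axis j 1) $ i) has_real_derivative (if i = j then 1 else 0)) (at 0)" for x :: R4 and j
  by (auto simp: axis_def intro!: derivative_eq_intros)
 then show ?case
  by (auto intro!: continuous_intros exI[of _ "\<lambda>_. if i = _ then 1 else 0"] sm.sm_const)
next
 case (sm_add f g)
 show ?case
 proof (intro conjI allI)
  show "continuous_on UNIV (\<lambda>x. f x + g x)" using sm_add by (intro continuous_intros) auto
  fix i
  obtain f' g' where "sm f'" "sm g'"
   "\<And>x. ((\<lambda>t. f (x + t *\<^sub>R axis i 1)) has_real_derivative f' x) (at 0)"
   "\<And>x. ((\<lambda>t. g (x + t *\<^sub>R axis i 1)) has_real_derivative g' x) (at 0)"
   using sm_add by meson
  then show "\<exists>h. sm h \<and> (\<forall>x. ((\<lambda>t. f (x + t *\<^sub>R axis i 1) + g (x + t *\<^sub>R axis i 1)) has_real_derivative h x) (at 0))"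
   by (intro exI[of _ "\<lambda>x. f' x + g' x"]) (auto intro!: sm.sm_add DERIV_add)
 qed
next
 case (sm_mult f g)
 show ?case
 proof (intro conjI allI)
  show "continuous_on UNIV (\<lambda>x. f x * g x)" using sm_mult by (intro continuous_intros) auto
  fix i
  obtain f' g' where 1: "sm f'" "sm g'"
   and d: "\<And>x. ((\<lambda>t. f (x + t *\<^sub>R axis i 1)) has_real_derivative f' x) (at 0)"
   "\<And>x. ((\<lambda>t. g (x + t *\<^sub>R axis i 1)) has_real_derivative g' x) (at 0)"
   using sm_mult by meson
  have "((\<lambda>t. f (x + t *\<^sub>R axis i 1) * g (x + t *\<^sub>R axis i 1)) has_real_derivative f' x * g x + g' x * f x) (at 0)" for x
   using DERIV_mult[OF d(1)[of x] d(2)[of x]] by simp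
  with 1 show "\<exists>h. sm h \<and> (\<forall>x. ((\<lambda>t. f (x + t *\<^sub>R axis i 1) * g (x + t *\<^sub>R axis i 1)) has_real_derivative h x) (at 0))"
   using sm_mult by (intro exI[of _ "\<lambda>x. f' x * g x + g' x * f x"]) (auto intro!: sm.sm_add sm.sm_mult)
 qed
next
 case (sm_En f p)
 show ?case
 proof (intro conjI allI)
  show "continuous_on UNIV (\<lambda>x. En p (f x))" using sm_En by (intro continuous_intros) auto
  fix i
  obtain f' where 1: "sm f'"
   and d: "\<And>x. ((\<lambda>t. f (x + t *\<^sub>R axis i 1)) has_real_derivative f' x) (at 0)"
   using sm_En by meson
  have "((\<lambda>t. En p (f (x + t *\<^sub>R axis i 1))) has_real_derivative En (En_deriv p) (f x) * f' x) (at 0)" for x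
   using DERIV_chain2[OF En_has_deriv d[of x]] by simp
  with 1 show "\<exists>h. sm h \<and> (\<forall>x. ((\<lambda>t. En p (f (x + t *\<^sub>R axis i 1))) has_real_derivative h x) (at 0))"
   using sm_En by (intro exI[of _ "\<lambda>x. En (En_deriv p) (f x) * f' x"]) (auto intro!: sm.sm_En sm.sm_mult)
 qed
next
 case (sm_inverse f)
 show ?case
 proof (intro conjI allI)
  show "continuous_on UNIV (\<lambda>x. inverse (f x))" using sm_inverse by (intro continuous_intros) auto
  fix i
  obtain f' where 1: "sm f'"
   and d: "\<And>x. ((\<lambda>t. f (x + t *\<^sub>R axis i 1)) has_real_derivative f' x) (at 0)"
   using sm_inverse by meson
  have "((\<lambda>t. inverse (f (x + t *\<^sub>R axis i 1))) has_real_derivative (- 1) * (inverse (f x) * f' x * inverse (f x))) (at 0)" for x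
   using DERIV_inverse'[OF d[of x]] sm_inverse by simp
  with 1 show "\<exists>h. sm h \<and> (\<forall>x. ((\<lambda>t. inverse (f (x + t *\<^sub>R axis i 1))) has_real_derivative h x) (at 0))"
   using sm_inverse by (intro exI[of _ "\<lambda>x. (- 1) * (inverse (f x) * f' x * inverse (f x))"])
    (intro conjI sm.sm_mult sm.sm_const sm.sm_inverse allI; simp)
 qed
qed

lemma sm_partial: "sm f \<Longrightarrow> sm (partial_dir i f)"
proof -
 assume "sm f"
 then obtain g where "sm g" "\<And>x. ((\<lambda>t. f (x + t *\<^sub>R axis i 1)) has_real_derivative g x) (at 0)"
  using sm_aux by meson
 moreover from this(2) have "partial_dir i f = g"
  unfolding partial_dir_def by (auto intro!: DERIV_imp_deriv)
 ultimately show ?thesis by simp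
qed

lemma smooth_fun_iff_sm: "smooth_fun f \<longleftrightarrow> sm f"
proof
 assume "sm f"
 then have "sm (iter_partial ixs f)" for ixs
  by (induction ixs) (auto intro: sm_partial)
 then show "smooth_fun f" unfolding smooth_fun_def
  using sm_aux by (meson field_differentiable_imp_differentiable field_differentiable_def real_differentiable_def)
qed (rule sm_base)

lemma partial_dir_eqI:
 "(\<And>x. ((\<lambda>t. f (x + t *\<^sub>R axis i 1)) has_real_derivative g x) (at 0)) \<Longrightarrow> partial_dir i f = g"
 unfolding partial_dir_def by (auto intro!: DERIV_imp_deriv)

lemma line_deriv:
 assumes "smooth_fun f"
 shows "((\<lambda>t. f (x + t *\<^sub>R axis i 1)) has_real_derivative partial_dir i f (x + s *\<^sub>R axis i 1)) (at s)"
proof -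
 have "((\<lambda>t. f ((x + s *\<^sub>R axis i 1) + t *\<^sub>R axis i 1)) has_real_derivative partial_dir i f (x + s *\<^sub>R axis i 1)) (at (s - s))"
  using smooth_fun_has_deriv[OF assms] by simp
 then have "((\<lambda>t. f ((x + s *\<^sub>R axis i 1) + (t - s) *\<^sub>R axis i 1)) has_real_derivative partial_dir i f (x + s *\<^sub>R axis i 1) * 1) (at s)"
  by (rule DERIV_chain2) (auto intro!: derivative_eq_intros)
 then show ?thesis by (simp add: algebra_simps)
qed

text \<open>Supports do not grow: outside a closed ball containing the support the function vanishes
  on a whole neighbourhood, hence so does its derivative.\<close>

lemma test_fun_partial:
 assumes "test_fun f" shows "test_fun (partial_dir i f)"
proof -
 obtain B where B: "\<And>x. f x \<noteq> 0 \<Longrightarrow> norm x \<le> B"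
  using assms unfolding test_fun_def bounded_iff by auto
 have "partial_dir i f x = 0" if "norm x > B" for x
 proof -
  have "open (- cball (0::R4) B)" "x \<in> - cball 0 B" using that by auto
  then obtain e where e: "e > 0" "ball x e \<subseteq> - cball 0 B" by (metis openE)
  have "((\<lambda>t. 0) has_real_derivative 0) (at 0)" by simp
  then have "((\<lambda>t. f (x + t *\<^sub>R axis i 1)) has_real_derivative 0) (at 0)"
  proof (rule has_field_derivative_transform_within[OF _ e(1)])
   fix t :: real assume "dist t 0 < e"
   then have "x + t *\<^sub>R axis i 1 \<in> ball x e" by (simp add: dist_norm)
   then have "\<not> norm (x + t *\<^sub>R axis i 1) \<le> B" using e by auto
   then show "0 = f (x + t *\<^sub>R axis i 1)" using B by metis
  qed auto
  then show ?thesis unfolding partial_dir_def by (rule DERIV_imp_deriv)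
 qed
 then have "bounded {x. partial_dir i f x \<noteq> 0}"
  unfolding bounded_iff by (metis (mono_tags, lifting) linorder_not_le mem_Collect_eq)
 moreover have "smooth_fun (partial_dir i f)"
  using assms smooth_fun_iter[of f "[i]"] by (simp add: test_fun_def)
 ultimately show ?thesis by (simp add: test_fun_def)
qed

lemma test_fun_iter: "test_fun f \<Longrightarrow> test_fun (iter_partial ixs f)"
 by (induction ixs) (auto intro: test_fun_partial)

text \<open>Clairaut: both mixed derivatives are values of the same second difference quotient.\<close>
lemma partial_dir_commute:
 assumes f: "smooth_fun f"
 shows "partial_dir i (partial_dir j f) x = partial_dir j (partial_dir i f) x"
proof -
 let ?e = "\<lambda>i. axis i (1::real) :: R4"
 have mv: "\<exists>s u. 0 < s \<and> s < h \<and> 0 < u \<and> u < h \<and>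
   f (x + h *\<^sub>R ?e k + h *\<^sub>R ?e l) - f (x + h *\<^sub>R ?e k) - f (x + h *\<^sub>R ?e l) + f x
    = h * h * partial_dir l (partial_dir k f) (x + s *\<^sub>R ?e k + u *\<^sub>R ?e l)" if h: "h > 0" for h k l
 proof -
  let ?g = "\<lambda>t. f ((x + h *\<^sub>R ?e l) + t *\<^sub>R ?e k) - f (x + t *\<^sub>R ?e k)"
  let ?g' = "\<lambda>t. partial_dir k f ((x + h *\<^sub>R ?e l) + t *\<^sub>R ?e k) - partial_dir k f (x + t *\<^sub>R ?e k)"
  have "(?g has_real_derivative ?g' t) (at t)" for t
   by (intro derivative_intros line_deriv f)
  then obtain s where s: "0 < s" "s < h" "?g h - ?g 0 = (h - 0) * ?g' s"
   using MVT2[OF h, of ?g ?g'] by blast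
  let ?k = "\<lambda>t. partial_dir k f ((x + s *\<^sub>R ?e k) + t *\<^sub>R ?e l)"
  have "(?k has_real_derivative partial_dir l (partial_dir k f) ((x + s *\<^sub>R ?e k) + t *\<^sub>R ?e l)) (at t)" for t
   using smooth_fun_iter[OF f, of "[k]"] by (intro line_deriv) simp
  then obtain u where u: "0 < u" "u < h" "?k h - ?k 0 = (h - 0) * partial_dir l (partial_dir k f) ((x + s *\<^sub>R ?e k) + u *\<^sub>R ?e l)"
   using MVT2[OF h, of ?k "\<lambda>t. partial_dir l (partial_dir k f) ((x + s *\<^sub>R ?e k) + t *\<^sub>R ?e l)"] by blast
  have "?g h - ?g 0 = h * (?k h - ?k 0)" using s(3) by (simp add: algebra_simps)
  then have "?g h - ?g 0 = h * (h * partial_dir l (partial_dir k f) ((x + s *\<^sub>R ?e k) + u *\<^sub>R ?e l))"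
   using u(3) by simp
  then show ?thesis using s u by (intro exI[of _ s] exI[of _ u]) (simp add: algebra_simps)
 qed
 have lim: "(\<lambda>n. (f (x + inverse (Suc n) *\<^sub>R ?e k + inverse (Suc n) *\<^sub>R ?e l) - f (x + inverse (Suc n) *\<^sub>R ?e k)
   - f (x + inverse (Suc n) *\<^sub>R ?e l) + f x) / (inverse (Suc n) * inverse (Suc n)))
   \<longlonglongrightarrow> partial_dir l (partial_dir k f) x" for k l
 proof -
  have "\<forall>n. \<exists>s u. 0 < s \<and> s < inverse (real (Suc n)) \<and> 0 < u \<and> u < inverse (real (Suc n)) \<and>
   f (x + inverse (Suc n) *\<^sub>R ?e k + inverse (Suc n) *\<^sub>R ?e l) - f (x + inverse (Suc n) *\<^sub>R ?e k)
   - f (x + inverse (Suc n) *\<^sub>R ?e l) + f x = inverse (Suc n) * inverse (Suc n) * partial_dir l (partial_dir k f) (x + s *\<^sub>R ?e k + u *\<^sub>R ?e l)"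
   by (intro allI mv) simp
  then obtain s u where su: "\<And>n. 0 < s n \<and> s n < inverse (real (Suc n)) \<and> 0 < u n \<and> u n < inverse (real (Suc n)) \<and>
   f (x + inverse (Suc n) *\<^sub>R ?e k + inverse (Suc n) *\<^sub>R ?e l) - f (x + inverse (Suc n) *\<^sub>R ?e k)
   - f (x + inverse (Suc n) *\<^sub>R ?e l) + f x = inverse (Suc n) * inverse (Suc n) * partial_dir l (partial_dir k f) (x + s n *\<^sub>R ?e k + u n *\<^sub>R ?e l)"
   by metis
  have "s \<longlonglongrightarrow> 0" "u \<longlonglongrightarrow> 0"
   by (rule tendsto_sandwich[OF _ _ tendsto_const LIMSEQ_inverse_real_of_nat];
     use su in \<open>auto intro!: always_eventually less_imp_le\<close>)+
  then have "(\<lambda>n. x + s n *\<^sub>R ?e k + u n *\<^sub>R ?e l) \<longlonglongrightarrow> x + 0 *\<^sub>R ?e k + 0 *\<^sub>R ?e l"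
   by (intro tendsto_intros)
  moreover have "isCont (partial_dir l (partial_dir k f)) x"
   using smooth_fun_continuous[OF smooth_fun_iter[OF f, of "[l,k]"]]
   by (simp add: continuous_on_eq_continuous_at)
  ultimately have "(\<lambda>n. partial_dir l (partial_dir k f) (x + s n *\<^sub>R ?e k + u n *\<^sub>R ?e l)) \<longlonglongrightarrow> partial_dir l (partial_dir k f) x"
   by (auto intro: isCont_tendsto_compose)
  moreover have "(f (x + inverse (Suc n) *\<^sub>R ?e k + inverse (Suc n) *\<^sub>R ?e l) - f (x + inverse (Suc n) *\<^sub>R ?e k)
   - f (x + inverse (Suc n) *\<^sub>R ?e l) + f x) / (inverse (Suc n) * inverse (Suc n)) = partial_dir l (partial_dir k f) (x + s n *\<^sub>R ?e k + u n *\<^sub>R ?e l)" for n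
   using su[of n] by simp
  ultimately show ?thesis by simp
 qed
 from lim[of j i] lim[of i j] show ?thesis
  by (rule LIMSEQ_unique[OF _ Lim_transform_eventually]) (auto simp: algebra_simps intro!: always_eventually)
qed

section \<open>Weak compactness and Ekeland's principle\<close>

text \<open>A substitute for weak cluster points. Nearly shortest vectors of the convex hulls of the
  tails form a Cauchy sequence by the parallelogram law; the limit lies in every closed convex set
  that contains a tail.\<close>

lemma tail_hull_point:
 fixes v :: "nat \<Rightarrow> 'a::{real_inner,complete_space}"
 assumes B: "\<And>n. norm (v n) \<le> B"
 shows "\<exists>w. \<forall>N K. closed K \<longrightarrow> convex K \<longrightarrow> (\<forall>n\<ge>N. v n \<in> K) \<longrightarrow> w \<in> K"
proof -
 define K where "K n = convex hull (v ` {n..})" for n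
 define d where "d n = (INF z\<in>K n. norm z)" for n
 have ne: "v n \<in> K n" for n unfolding K_def by (intro hull_inc) auto
 have mono: "K m \<subseteq> K n" if "n \<le> m" for n m
  unfolding K_def using that by (intro hull_mono) auto
 have bdd: "bdd_below (norm ` K n)" for n by (rule bdd_belowI[of _ 0]) auto
 have d_le: "d n \<le> norm z" if "z \<in> K n" for n z
  unfolding d_def using that bdd by (intro cINF_lower) auto
 have d0: "0 \<le> d n" for n unfolding d_def using ne by (intro cINF_greatest) auto
 have dB: "d n \<le> B" for n using d_le[OF ne] B order_trans by blast
 have dmono: "d n \<le> d m" if "n \<le> m" for n m
  unfolding d_def using ne bdd mono[OF that] by (intro cINF_superset_mono) auto
 have "\<exists>z\<in>K n. (norm z)\<^sup>2 \<le> (d n)^2 + inverse (real (Suc n))" for n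
 proof -
  have "sqrt ((d n)^2 + inverse (real (Suc n))) > d n"
   using d0[of n] by (intro real_less_rsqrt) auto
  then have "(INF z\<in>K n. norm z) < sqrt ((d n)^2 + inverse (real (Suc n)))"
   by (simp add: d_def)
  then obtain z where "z \<in> K n" "norm z < sqrt ((d n)^2 + inverse (real (Suc n)))"
   using cINF_less_iff[OF _ bdd[of n], THEN iffD1] ne[of n] by auto
  moreover have "(sqrt ((d n)^2 + inverse (real (Suc n))))^2 = (d n)^2 + inverse (real (Suc n))"
   by (intro real_sqrt_pow2) auto
  moreover from calculation(2) have "(norm z)^2 \<le> (sqrt ((d n)^2 + inverse (real (Suc n))))^2"
   by (intro power_mono) auto
  ultimately show ?thesis by (intro bexI[of _ z]) auto
 qed
 then obtain z where zK: "\<And>n. z n \<in> K n" and z: "\<And>n. (norm (z n))\<^sup>2 \<le> (d n)^2 + inverse (real (Suc n))"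
  by metis
 \<comment> \<open>Parallelogram law: the midpoint of \<open>z n\<close> and \<open>z m\<close>
   stays in \<open>K n\<close>, so its norm is at least \<open>d n\<close>.\<close>
 have est: "(norm (z n - z m))^2 \<le> 2 * ((d m)^2 - (d n)\<^sup>2) + 4 * inverse (real (Suc n))" if "n \<le> m" for n m
 proof -
  have "(1/2) *\<^sub>R z n + (1/2) *\<^sub>R z m \<in> K n"
   using zK[of n] zK[of m] mono[OF that] unfolding K_def
   by (intro convexD[OF convex_convex_hull]) auto
  from d_le[OF this] have "d n \<le> norm (z n + z m) / 2"
   by (simp flip: scaleR_add_right)
  then have "4 * (d n)^2 \<le> (norm (z n + z m))^2"
   using power_mono[of "d n" "norm (z n + z m) / 2" 2] d0[of n] by (simp add: power_divide)
  moreover have "(norm (z n - z m))^2 = 2 * (norm (z n))^2 + 2 * (norm (z m))^2 - (norm (z n + z m))\<^sup>2"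
   by (simp add: power2_norm_eq_inner inner_simps inner_commute)
  moreover have "inverse (real (Suc m)) \<le> inverse (real (Suc n))" using that by simp
  moreover define a b where "a = inverse (real (Suc n))" and "b = inverse (real (Suc m))"
  ultimately show ?thesis using z[of n, folded a_def] z[of m, folded b_def] unfolding a_def[symmetric] b_def[symmetric]
   by (smt (verit))
 qed
 have "convergent (\<lambda>n. (d n)^2)"
 proof (rule Bseq_mono_convergent)
  show "Bseq (\<lambda>n. (d n)^2)" using dB d0 by (intro BseqI'[of _ "B^2"]) (auto intro!: power_mono)
 qed (use dmono d0 in \<open>auto intro!: power_mono\<close>)
 then obtain D where D: "(\<lambda>n. (d n)^2) \<longlonglongrightarrow> D" by (auto simp: convergent_def)
 have Dge: "(d n)^2 \<le> D" for n
  by (rule incseq_le[OF _ D]) (use dmono d0 in \<open>auto intro!: power_mono incseq_SucI\<close>)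
 have "Cauchy z"
 proof (rule metric_CauchyI)
  fix e :: real assume e: "e > 0"
  have "(\<lambda>n. 2 * (D - (d n)\<^sup>2) + 4 * inverse (real (Suc n))) \<longlonglongrightarrow> 2 * (D - D) + 4 * 0"
   by (intro tendsto_intros D LIMSEQ_inverse_real_of_nat)
  then have "\<forall>\<^sub>F n in sequentially. 2 * (D - (d n)\<^sup>2) + 4 * inverse (real (Suc n)) < (e/2)^2"
   by (rule order_tendstoD) (use e in auto)
  then obtain M where M: "2 * (D - (d M)\<^sup>2) + 4 * inverse (real (Suc M)) < (e/2)^2"
   by (auto simp: eventually_sequentially)
  have "norm (z M - z n) < e/2" if "n \<ge> M" for n
  proof -
   have "(norm (z M - z n))^2 < (e/2)^2"
    using est[OF that] M Dge[of n] by (smt (verit))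
   then show ?thesis using e power2_less_imp_less by (metis divide_pos_pos less_imp_le zero_less_numeral)
  qed
  then have "dist (z m) (z n) < e" if "n \<ge> M" "m \<ge> M" for m n
   using that dist_triangle_half_r[of "z M" "z m" e "z n"] by (auto simp: dist_norm)
  then show "\<exists>M. \<forall>m\<ge>M. \<forall>n\<ge>M. dist (z m) (z n) < e" by blast
 qed
 then obtain w where w: "z \<longlonglongrightarrow> w" by (auto simp: Cauchy_convergent_iff convergent_def)
 show ?thesis
 proof (intro exI[of _ w] allI impI)
  fix N and C :: "'a set" assume C: "closed C" "convex C" "\<forall>n\<ge>N. v n \<in> C"
  have "z n \<in> C" if "n \<ge> N" for n
  proof -
   have "K n \<subseteq> C" unfolding K_def using C that by (intro hull_minimal) auto
   then show ?thesis using zK by blast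
  qed
  then show "w \<in> C"
   by (intro Lim_in_closed_set[OF C(1) _ _ w]) (auto simp: eventually_sequentially)
 qed
qed

text \<open>The diagonal argument makes the inner products with the members of the sequence itself
  converge, so no countable dense set is required. A tail hull point \<open>w\<close> is the
  candidate limit, and vectors outside the span are handled by a second tail hull point.\<close>

lemma bounded_weak_subseq:
 fixes u :: "nat \<Rightarrow> 'a::{real_inner,complete_space}"
 assumes B: "\<And>n. norm (u n) \<le> B"
 obtains r w where "strict_mono (r :: nat \<Rightarrow> nat)" "\<And>\<phi>. (\<lambda>n. inner (u (r n)) \<phi>) \<longlonglongrightarrow> inner w \<phi>"
proof -
 interpret subseqs "\<lambda>m s. convergent (\<lambda>n. inner (u (s n)) (u m))"
 proof
  fix m and s :: "nat \<Rightarrow> nat" assume "strict_mono s"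
  have "bounded (range (\<lambda>n. inner (u (s n)) (u m)))"
  proof -
   have "\<bar>inner (u (s n)) (u m)\<bar> \<le> B * B" for n
    using Cauchy_Schwarz_ineq2[of "u (s n)" "u m"] mult_mono[OF B[of "s n"] B[of m]]
    by (meson B norm_ge_zero order_trans)
   then show ?thesis unfolding bounded_iff by auto
  qed
  then obtain l r where "strict_mono (r::nat \<Rightarrow> nat)" "((\<lambda>n. inner (u (s n)) (u m)) \<circ> r) \<longlonglongrightarrow> l"
   using bounded_imp_convergent_subsequence by blast
  then show "\<exists>r. strict_mono r \<and> convergent (\<lambda>n. inner (u ((s \<circ> r) n)) (u m))"
   by (auto simp: convergent_def o_def)
 qed
 have conv: "convergent (\<lambda>n. inner (u (diagseq n)) (u m))" for m
 proof -
  have "convergent (\<lambda>n. inner (u ((diagseq \<circ> (+) (Suc m)) n)) (u m))"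
  proof (rule diagseq_holds)
   fix s r :: "nat \<Rightarrow> nat" and n assume "strict_mono r" "convergent (\<lambda>k. inner (u (s k)) (u n))"
   then show "convergent (\<lambda>k. inner (u ((s \<circ> r) k)) (u n))"
    using convergent_subseq_convergent[of "\<lambda>k. inner (u (s k)) (u n)" r] by (simp add: o_def)
  qed
  then show ?thesis
   using convergent_ignore_initial_segment[of "\<lambda>n. inner (u (diagseq n)) (u m)" "Suc m"]
   by (simp add: o_def add.commute)
 qed
 define v where "v n = u (diagseq n)" for n
 have vB: "norm (v n) \<le> B" for n by (simp add: v_def B)
 obtain a where a: "\<And>m. (\<lambda>n. inner (v n) (v m)) \<longlonglongrightarrow> a m"
 proof -
  have "\<forall>m. \<exists>l. (\<lambda>n. inner (v n) (v m)) \<longlonglongrightarrow> l"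
   using conv[of "diagseq _"] unfolding v_def convergent_def by blast
  from choice[OF this] show thesis using that by blast
 qed
 obtain w where w: "\<forall>N K. closed K \<longrightarrow> convex K \<longrightarrow> (\<forall>n\<ge>N. v n \<in> K) \<longrightarrow> w \<in> K"
  using tail_hull_point[of v B] vB by auto
 have slab: "closed {z::'a. \<bar>inner z b - c\<bar> \<le> e}" "convex {z::'a. \<bar>inner z b - c\<bar> \<le> e}" for b c e
 proof -
  have *: "{z::'a. \<bar>inner z b - c\<bar> \<le> e} = {z. inner b z \<le> c + e} \<inter> {z. inner b z \<ge> c - e}"
   by (auto simp: inner_commute abs_le_iff)
  show "closed {z::'a. \<bar>inner z b - c\<bar> \<le> e}"
   unfolding * by (intro closed_Int closed_halfspace_le closed_halfspace_ge)
  show "convex {z::'a. \<bar>inner z b - c\<bar> \<le> e}"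
   unfolding * by (intro convex_Int convex_halfspace_le convex_halfspace_ge)
 qed
 have slab_lim: "inner z b = c"
  if z: "\<forall>N K. closed K \<longrightarrow> convex K \<longrightarrow> (\<forall>n\<ge>N. x n \<in> K) \<longrightarrow> z \<in> K" and l: "(\<lambda>n. inner (x n) b) \<longlonglongrightarrow> c"
  for x :: "nat \<Rightarrow> 'a" and z b :: 'a and c
 proof (rule ccontr)
  assume "inner z b \<noteq> c"
  then have e: "\<bar>inner z b - c\<bar> / 2 > 0" by simp
  then obtain N where "\<And>n. n \<ge> N \<Longrightarrow> \<bar>inner (x n) b - c\<bar> < \<bar>inner z b - c\<bar> / 2"
   using LIMSEQ_D[OF l e] by (auto simp: real_norm_def)
  then have "z \<in> {z. \<bar>inner z b - c\<bar> \<le> \<bar>inner z b - c\<bar> / 2} \<or> z \<in> {y. \<bar>inner y b - c\<bar> \<le> \<bar>inner z b - c\<bar> / 2}"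
   using z[rule_format, OF slab, of N b c "\<bar>inner z b - c\<bar> / 2"] by (simp add: less_imp_le)
  then show False using e by auto
 qed
 \<comment> \<open>The vectors against which \<open>v n - w\<close> tends to 0 form a closed
   subspace. It contains every \<open>v m\<close>, hence also \<open>w\<close> by the defining
   property of \<open>w\<close>.\<close>
 define C where "C = {z. (\<lambda>n. inner (v n - w) z) \<longlonglongrightarrow> 0}"
 have vC: "v m \<in> C" for m
  using slab_lim[OF w a[of m]] tendsto_diff[OF a[of m] tendsto_const[of "a m"]]
  by (simp add: C_def inner_diff_left)
 have subC: "x + c *\<^sub>R y \<in> C" if "x \<in> C" "y \<in> C" for x y c
  using that tendsto_add[OF _ tendsto_mult_left[where c=c and l=0], of "\<lambda>n. inner (v n - w) x" 0 sequentially "\<lambda>n. inner (v n - w) y"]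
  by (simp add: C_def inner_add_right)
 have wC: "w \<in> C"
 proof -
  have "closed C"
   unfolding closed_sequential_limits
  proof (intro allI impI, elim conjE)
   fix x l assume x: "\<forall>n. x n \<in> C" "x \<longlonglongrightarrow> l"
   show "l \<in> C" unfolding C_def mem_Collect_eq
   proof (rule LIMSEQ_I)
    fix e :: real assume e: "e > 0"
    define M where "M = B + norm w + 1"
    have M: "norm (v n - w) < M" for n unfolding M_def
     using norm_triangle_ineq4[of "v n" w] vB[of n] by linarith
    have Mp: "M > 0" using M[of 0] norm_ge_zero[of "v 0 - w"] by linarith
    obtain k where k: "norm (x k - l) < e / (2 * M)"
     using LIMSEQ_D[OF x(2), of "e / (2*M)"] e Mp by auto
    obtain N where N: "\<And>n. n \<ge> N \<Longrightarrow> \<bar>inner (v n - w) (x k)\<bar> < e/2"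
     using LIMSEQ_D[of "\<lambda>n. inner (v n - w) (x k)" 0 "e/2"] x(1)[rule_format, of k] e unfolding C_def by auto
    have "\<bar>inner (v n - w) l\<bar> < e" if "n \<ge> N" for n
    proof -
     have "\<bar>inner (v n - w) (x k - l)\<bar> \<le> M * (e / (2*M))"
      using Cauchy_Schwarz_ineq2[of "v n - w" "x k - l"] mult_mono[of "norm (v n - w)" M "norm (x k - l)" "e / (2 * M)"] M[of n] k Mp
      by (auto simp: less_imp_le)
     then have "\<bar>inner (v n - w) (x k - l)\<bar> \<le> e / 2" using Mp by simp
     then show ?thesis using N[OF that] unfolding inner_diff_right by argo
    qed
    then show "\<exists>no. \<forall>n\<ge>no. norm (inner (v n - w) l - 0) < e" by auto
   qed
  qed
  moreover have "convex C" unfolding convex_alt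
  proof (intro ballI allI impI)
   fix x y u assume "x \<in> C" "y \<in> C"
   then show "(1 - u) *\<^sub>R x + u *\<^sub>R y \<in> C"
    using subC[OF subC[of x x "-u"], of y u] subC[of x x "-u"] by (simp add: algebra_simps)
  qed
  ultimately show ?thesis using w[THEN spec[of _ 0], THEN spec[of _ C]] vC by blast
 qed
 define y where "y n = v n - w" for n
 have yC: "y n \<in> C" for n using subC[OF vC wC, of n "-1"] by (simp add: y_def)
 have yB: "norm (y n) \<le> B + norm w" for n
  unfolding y_def using norm_triangle_ineq4[of "v n" w] vB[of n] by linarith
 \<comment> \<open>A tail hull point \<open>z\<close> of the bad subsequence is orthogonal to all
   its members, hence to itself, so it is 0. Yet it must satisfy
   \<open>inner \<phi> z \<ge> e\<close>.\<close>
 have no: False if s: "strict_mono s" and e: "e > 0" "\<And>n. inner (y (s n)) \<phi> \<ge> e" for s :: "nat \<Rightarrow> nat" and e \<phi>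
 proof -
  obtain z where z: "\<forall>N K. closed K \<longrightarrow> convex K \<longrightarrow> (\<forall>n\<ge>N. y (s n) \<in> K) \<longrightarrow> z \<in> K"
   using tail_hull_point[of "\<lambda>n. y (s n)" "B + norm w"] yB by auto
  have "inner z (y (s m)) = 0" for m
  proof (rule slab_lim[OF z])
   have "(\<lambda>n. inner (y n) (y (s m))) \<longlonglongrightarrow> 0" using yC[of "s m"] by (simp add: C_def y_def)
   then show "(\<lambda>n. inner (y (s n)) (y (s m))) \<longlonglongrightarrow> 0"
    using LIMSEQ_subseq_LIMSEQ[OF _ s] by (auto simp: o_def)
  qed
  then have "z \<in> {x. inner z x = 0}"
   by (intro z[rule_format, of _ 0] closed_hyperplane convex_hyperplane) auto
  then have "z = 0" by simp
  moreover have "z \<in> {x. inner \<phi> x \<ge> e}"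
   using e by (intro z[rule_format, of _ 0] closed_halfspace_ge convex_halfspace_ge) (auto simp: inner_commute)
  ultimately show False using e by simp
 qed
 have "(\<lambda>n. inner (y n) \<phi>) \<longlonglongrightarrow> 0" for \<phi>
 proof (rule ccontr)
  assume "\<not> ?thesis"
  then obtain e where e: "e > 0" "\<And>N. \<exists>n\<ge>N. \<bar>inner (y n) \<phi>\<bar> \<ge> e"
   unfolding lim_sequentially by (auto simp: dist_real_def not_less)
  have "infinite {n. \<bar>inner (y n) \<phi>\<bar> \<ge> e}"
   unfolding infinite_nat_iff_unbounded_le using e(2) by auto
  moreover have "{n. \<bar>inner (y n) \<phi>\<bar> \<ge> e} = {n. inner (y n) \<phi> \<ge> e} \<union> {n. inner (y n) (- \<phi>) \<ge> e}"
   by (auto simp: abs_if split: if_splits)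
  ultimately have "infinite {n. inner (y n) \<phi> \<ge> e} \<or> infinite {n. inner (y n) (- \<phi>) \<ge> e}"
   by simp
  then obtain \<psi> where "infinite {n. inner (y n) \<psi> \<ge> e}" by blast
  then obtain s :: "nat \<Rightarrow> nat" where "strict_mono s" "\<And>n. s n \<in> {n. inner (y n) \<psi> \<ge> e}"
   using infinite_enumerate by blast
  then show False using no[of s e \<psi>] e(1) by auto
 qed
 then have "(\<lambda>n. inner (u (diagseq n)) \<phi>) \<longlonglongrightarrow> inner w \<phi>" for \<phi>
  using tendsto_add[OF _ tendsto_const[of "inner w \<phi>"], of "\<lambda>n. inner (y n) \<phi>" 0]
  by (simp add: y_def v_def inner_diff_left)
 then show thesis using that subseq_diagseq by blast
qed

text \<open>Each step moves inside \<open>T x\<close>, the points that pay for their distance by a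
  decrease of \<open>\<phi>\<close>, and closes at least half of the gap to the infimum over
  \<open>T x\<close>. Lower semicontinuity is demanded only in sequential sublevel form.\<close>

lemma ekeland:
 fixes S :: "'a::complete_space set" and \<phi> :: "'a \<Rightarrow> real"
 assumes S: "closed S" "S \<noteq> {}" and bdd: "bdd_below (\<phi> ` S)" and e: "e > 0"
  and lsc: "\<And>X x c. \<lbrakk>\<And>n. X n \<in> S; X \<longlonglongrightarrow> x; \<And>n. \<phi> (X n) \<le> c\<rbrakk> \<Longrightarrow> \<phi> x \<le> c"
 obtains w where "w \<in> S" "\<phi> w \<le> (INF x\<in>S. \<phi> x) + e" "\<And>v. v \<in> S \<Longrightarrow> \<phi> w - e * dist w v \<le> \<phi> v"
proof -
 define T where "T x = {v\<in>S. \<phi> v + e * dist x v \<le> \<phi> x}" for x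
 have Tself: "x \<in> T x" if "x \<in> S" for x using that by (simp add: T_def)
 have TS: "T x \<subseteq> S" for x by (auto simp: T_def)
 have bddT: "bdd_below (\<phi> ` T x)" for x using bdd TS by (meson bdd_below_mono image_mono)
 have Ttrans: "T y \<subseteq> T x" if "y \<in> T x" for x y
 proof
  fix v assume v: "v \<in> T y"
  have "e * dist x v \<le> e * dist x y + e * dist y v"
   using e dist_triangle[of x v y] by (simp add: distrib_left[symmetric])
  then show "v \<in> T x" using v that unfolding T_def by auto
 qed
 obtain x0 where x0: "x0 \<in> S" "\<phi> x0 < (INF x\<in>S. \<phi> x) + e"
  using cINF_less_iff[OF S(2) bdd, of "(INF x\<in>S. \<phi> x) + e"] e by auto
 have step: "\<exists>y\<in>T x. \<phi> y \<le> (\<phi> x + (INF v\<in>T x. \<phi> v)) / 2" if "x \<in> S" for x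
 proof (cases "(INF v\<in>T x. \<phi> v) < \<phi> x")
  case True
  then have "(INF v\<in>T x. \<phi> v) < (\<phi> x + (INF v\<in>T x. \<phi> v)) / 2" by simp
  then show ?thesis using cINF_less_iff[of "T x" \<phi>] bddT Tself[OF that] by (metis empty_iff less_imp_le)
 next
  case False
  then show ?thesis using Tself[OF that] by (intro bexI[of _ x]) auto
 qed
 have "\<exists>X. X 0 = x0 \<and> (\<forall>n. X n \<in> S \<and> X (Suc n) \<in> T (X n) \<and> \<phi> (X (Suc n)) \<le> (\<phi> (X n) + (INF v\<in>T (X n). \<phi> v)) / 2)"
 proof -
  obtain g where g: "\<And>x. x \<in> S \<Longrightarrow> g x \<in> T x \<and> \<phi> (g x) \<le> (\<phi> x + (INF v\<in>T x. \<phi> v)) / 2"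
   using step by metis
  define X where "X = rec_nat x0 (\<lambda>_. g)"
  have X: "X 0 = x0" "\<And>n. X (Suc n) = g (X n)" by (simp_all add: X_def)
  have "X n \<in> S" for n by (induction n) (use X x0 g TS in auto)
  then show ?thesis using X g by (intro exI[of _ X]) auto
 qed
 then obtain X where X: "X 0 = x0" "\<And>n. X n \<in> S" "\<And>n. X (Suc n) \<in> T (X n)"
  "\<And>n. \<phi> (X (Suc n)) \<le> (\<phi> (X n) + (INF v\<in>T (X n). \<phi> v)) / 2" by blast
 have XT: "X m \<in> T (X n)" if "n \<le> m" for n m
  using that by (induction rule: dec_induct) (use X Tself Ttrans in blast)+
 have dec: "\<phi> (X m) + e * dist (X n) (X m) \<le> \<phi> (X n)" if "n \<le> m" for n m
  using XT[OF that] by (simp add: T_def)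
 obtain b where b: "\<And>x. x \<in> S \<Longrightarrow> b \<le> \<phi> x" using bdd by (auto simp: bdd_below_def)
 have decs: "decseq (\<lambda>n. \<phi> (X n))"
  using dec e by (intro decseq_SucI) (smt (verit) mult_nonneg_nonneg zero_le_dist le_SucI order_refl)
 obtain L where L: "(\<lambda>n. \<phi> (X n)) \<longlonglongrightarrow> L" "\<And>n. L \<le> \<phi> (X n)"
  using decseq_convergent[OF decs, of b] b X(2) by blast
 have "Cauchy X"
 proof (rule metric_CauchyI)
  fix d :: real assume d: "d > 0"
  then obtain M where M: "\<phi> (X M) < L + e * (d / 2)"
   using order_tendstoD(2)[OF L(1), of "L + e * (d/2)"] e by (auto simp: eventually_sequentially)
  have "dist (X M) (X n) < d / 2" if "n \<ge> M" for n
  proof -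
   have "e * dist (X M) (X n) < e * (d/2)" using dec[OF that] L(2)[of n] M by linarith
   then show ?thesis using e by simp
  qed
  then show "\<exists>M. \<forall>m\<ge>M. \<forall>n\<ge>M. dist (X m) (X n) < d"
   using dist_triangle_half_r by blast
 qed
 then obtain w where w: "X \<longlonglongrightarrow> w" by (auto simp: Cauchy_convergent_iff convergent_def)
 have wS: "w \<in> S" using S(1) X(2) w closed_sequentially by blast
 have wT: "w \<in> T (X n)" for n
 proof -
  \<comment> \<open>Lower semicontinuity accepts only a constant upper bound, so the distance term
    is frozen at its limit at the cost of \<open>d\<close>, and an initial segment of the sequence
    is dropped.\<close>
  have "\<phi> w \<le> \<phi> (X n) - e * dist (X n) w + d" if d: "d > 0" for d
  proof -
   have "(\<lambda>m. \<phi> (X n) - e * dist (X n) (X m)) \<longlonglongrightarrow> \<phi> (X n) - e * dist (X n) w"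
    by (intro tendsto_intros w)
   then have "\<forall>\<^sub>F m in sequentially. \<phi> (X n) - e * dist (X n) (X m) < \<phi> (X n) - e * dist (X n) w + d"
    by (rule order_tendstoD) (use d in auto)
   then obtain M where M: "\<And>m. m \<ge> M \<Longrightarrow> \<phi> (X n) - e * dist (X n) (X m) < \<phi> (X n) - e * dist (X n) w + d"
    by (auto simp: eventually_sequentially)
   show ?thesis
   proof (rule lsc[of "\<lambda>k. X (k + max M n)" w])
    show "(\<lambda>k. X (k + max M n)) \<longlonglongrightarrow> w" using w by (rule LIMSEQ_ignore_initial_segment)
    fix k show "\<phi> (X (k + max M n)) \<le> \<phi> (X n) - e * dist (X n) w + d"
     using dec[of n "k + max M n", OF trans_le_add2[OF max.cobounded2]] M[of "k + max M n", OF trans_le_add2[OF max.cobounded1]]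
     by linarith
   qed (use X in auto)
  qed
  then have "\<phi> w \<le> \<phi> (X n) - e * dist (X n) w" by (rule field_le_epsilon)
  then show ?thesis using wS by (simp add: T_def)
 qed
 have "\<phi> w - e * dist w v \<le> \<phi> v" if v: "v \<in> S" for v
 proof (rule ccontr)
  assume "\<not> ?thesis"
  then have vw: "\<phi> v + e * dist w v < \<phi> w" by simp
  then have "v \<in> T w" using v by (simp add: T_def)
  then have "v \<in> T (X n)" for n using Ttrans[OF wT] by blast
  then have "(INF v\<in>T (X n). \<phi> v) \<le> \<phi> v" for n using bddT by (intro cINF_lower) auto
  then have I: "(INF v\<in>T (X n). \<phi> v) \<le> \<phi> v" for n .
  \<comment> \<open>The halving rule read backwards: a point \<open>v\<close> lying in all the sets
    \<open>T (X n)\<close> bounds all these infima from above, hence also the limit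
    \<open>L\<close>.\<close>
  have "2 * \<phi> (X (Suc n)) - \<phi> (X n) \<le> \<phi> v" for n using X(4)[of n] I[of n] by argo
  moreover have "(\<lambda>n. 2 * \<phi> (X (Suc n)) - \<phi> (X n)) \<longlonglongrightarrow> 2 * L - L"
   by (intro tendsto_intros L LIMSEQ_Suc)
  ultimately have "L \<le> \<phi> v" using LIMSEQ_le_const2[of "\<lambda>n. 2 * \<phi> (X (Suc n)) - \<phi> (X n)" "2*L - L" "\<phi> v"] by auto
  moreover have "\<phi> w \<le> L"
  proof (rule LIMSEQ_le_const[OF L(1)])
   show "\<exists>N. \<forall>n\<ge>N. \<phi> w \<le> \<phi> (X n)"
    using wT e unfolding T_def by (smt (verit) mem_Collect_eq mult_nonneg_nonneg zero_le_dist)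
  qed
  ultimately show False using vw e by (smt (verit) mult_nonneg_nonneg zero_le_dist)
 qed
 moreover have "\<phi> w \<le> (INF x\<in>S. \<phi> x) + e"
  using wT[of 0] X(1) x0(2) e unfolding T_def by (smt (verit) mem_Collect_eq mult_nonneg_nonneg zero_le_dist)
 ultimately show thesis using that wS by blast
qed

section \<open>The Hilbert space of square integrable functions\<close>

text \<open>Borel representatives are used throughout, so that compositions and product
  measurability over \<open>lborel\<close> are immediate. The passage to Lebesgue measurable
  functions happens only at the interface with \<open>W22\<close>.\<close>

definition sqint :: "(R4 \<Rightarrow> real) \<Rightarrow> bool" where
 "sqint u \<longleftrightarrow> u \<in> borel_measurable borel \<and> integrable lborel (\<lambda>x. (u x)^2)"

lemma sqint_meas [measurable_dest]: "sqint u \<Longrightarrow> u \<in> borel_measurable borel"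
 by (simp add: sqint_def)

lemma sqint_int: "sqint u \<Longrightarrow> integrable lborel (\<lambda>x. (u x)^2)"
 by (simp add: sqint_def)

lemma sqint_mult:
 assumes "sqint u" "sqint v" shows "integrable lborel (\<lambda>x. u x * v x)"
proof -
 have [measurable]: "u \<in> borel_measurable borel" "v \<in> borel_measurable borel"
  using assms by (auto simp: sqint_def)
 show ?thesis
 proof (rule Bochner_Integration.integrable_bound)
  show "integrable lborel (\<lambda>x. (u x)^2 + (v x)^2)"
   using assms by (auto simp: sqint_def)
  show "AE x in lborel. norm (u x * v x) \<le> norm ((u x)^2 + (v x)^2)"
  proof (intro AE_I2)
   fix x have "2 * (\<bar>u x\<bar> * \<bar>v x\<bar>) \<le> \<bar>u x\<bar>\<^sup>2 + \<bar>v x\<bar>\<^sup>2"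
    using sum_squares_bound[of "\<bar>u x\<bar>" "\<bar>v x\<bar>"] by simp
   moreover have "0 \<le> \<bar>u x\<bar> * \<bar>v x\<bar>" by simp
   ultimately show "norm (u x * v x) \<le> norm ((u x)^2 + (v x)^2)"
    unfolding real_norm_def abs_mult by (simp add: power2_abs) (smt (verit) zero_le_power2)
  qed
 qed simp
qed

lemma sqint_add: "sqint u \<Longrightarrow> sqint v \<Longrightarrow> sqint (\<lambda>x. u x + v x)"
 using sqint_mult[of u v] by (auto simp: sqint_def power2_sum mult.assoc)

lemma sqint_scale: "sqint u \<Longrightarrow> sqint (\<lambda>x. c * u x)"
 by (auto simp: sqint_def power_mult_distrib)

lemma sqint_minus: "sqint u \<Longrightarrow> sqint (\<lambda>x. - u x)"
 by (auto simp: sqint_def)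

lemma sqint_diff: "sqint u \<Longrightarrow> sqint v \<Longrightarrow> sqint (\<lambda>x. u x - v x)"
 using sqint_add[of u "\<lambda>x. - v x"] sqint_minus[of v] by simp

lemma sqint_0: "sqint (\<lambda>x. 0)"
 by (simp add: sqint_def)

lemma sqint_bound:
 assumes "sqint g" "f \<in> borel_measurable borel" "\<And>x. \<bar>f x\<bar> \<le> \<bar>g x\<bar>"
 shows "sqint f"
 unfolding sqint_def
proof (intro conjI Bochner_Integration.integrable_bound[OF sqint_int[OF assms(1)]])
 have "(f x)^2 \<le> (g x)^2" for x using assms(3)[of x] by (simp add: abs_le_square_iff)
 then show "AE x in lborel. norm ((f x)^2) \<le> norm ((g x)^2)" by simp
qed (use assms(2) in auto)

\<comment> \<open>Classes modulo null sets make this a genuine Hilbert space. The map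
  \<open>fn\<close> picks one Borel representative per class, so algebraic identities for
  \<open>fn\<close> hold only almost everywhere.\<close>
quotient_type l2 = "R4 \<Rightarrow> real" / partial: "\<lambda>u v. sqint u \<and> sqint v \<and> (AE x in lborel. u x = v x)"
 morphisms rep_l2 abs_l2
proof (rule part_equivpI)
 show "\<exists>u. sqint u \<and> sqint u \<and> (AE x in lborel. u x = u x)" using sqint_0 by auto
 show "symp (\<lambda>u v. sqint u \<and> sqint v \<and> (AE x in lborel. u x = v x))"
  by (auto simp: symp_def elim: AE_mp)
 show "transp (\<lambda>u v. sqint u \<and> sqint v \<and> (AE x in lborel. u x = v x))"
  by (auto simp: transp_def elim: AE_mp)
qed

abbreviation fn :: "l2 \<Rightarrow> R4 \<Rightarrow> real" where "fn \<equiv> rep_l2"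

lemma fn_sqint: "sqint (fn p)"
 using Quotient_rep_reflp[OF Quotient_l2] by auto

lemma fn_meas [measurable]: "fn p \<in> borel_measurable borel"
 using fn_sqint by (simp add: sqint_def)

lemma abs_fn [simp]: "abs_l2 (fn p) = p"
 by (rule Quotient_abs_rep[OF Quotient_l2])

lemma fn_abs: "sqint u \<Longrightarrow> AE x in lborel. fn (abs_l2 u) x = u x"
 using Quotient_rep_abs[OF Quotient_l2, of u] by auto

lemma abs_l2_eqI: "sqint u \<Longrightarrow> sqint v \<Longrightarrow> AE x in lborel. u x = v x \<Longrightarrow> abs_l2 u = abs_l2 v"
 using Quotient_rel_abs[OF Quotient_l2, of u v] by auto

lemma l2_eqI: "AE x in lborel. fn p x = fn q x \<Longrightarrow> p = q"
 using abs_l2_eqI[OF fn_sqint fn_sqint] abs_fn by metis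

instantiation l2 :: real_inner
begin

lift_definition zero_l2 :: l2 is "\<lambda>_. 0" by (auto simp: sqint_0)
lift_definition plus_l2 :: "l2 \<Rightarrow> l2 \<Rightarrow> l2" is "\<lambda>u v x. u x + v x"
 by (auto simp: sqint_add elim: AE_mp)
lift_definition minus_l2 :: "l2 \<Rightarrow> l2 \<Rightarrow> l2" is "\<lambda>u v x. u x - v x"
 by (auto simp: sqint_diff elim: AE_mp)
lift_definition uminus_l2 :: "l2 \<Rightarrow> l2" is "\<lambda>u x. - u x"
 by (auto simp: sqint_minus elim: AE_mp)
lift_definition scaleR_l2 :: "real \<Rightarrow> l2 \<Rightarrow> l2" is "\<lambda>c u x. c * u x"
 by (auto simp: sqint_scale elim: AE_mp)
definition inner_l2 :: "l2 \<Rightarrow> l2 \<Rightarrow> real" where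
 "inner_l2 p q = (LBINT x. fn p x * fn q x)"
definition norm_l2 :: "l2 \<Rightarrow> real" where "norm_l2 p = sqrt (inner p p)"
definition dist_l2 :: "l2 \<Rightarrow> l2 \<Rightarrow> real" where "dist_l2 p q = norm (p - q)"
definition sgn_l2 :: "l2 \<Rightarrow> l2" where "sgn_l2 p = scaleR (inverse (norm p)) p"
definition uniformity_l2 :: "(l2 \<times> l2) filter" where
 "uniformity_l2 = (INF e\<in>{0 <..}. principal {(x, y). dist x y < e})"
definition open_l2 :: "l2 set \<Rightarrow> bool" where
 "open_l2 U = (\<forall>x\<in>U. eventually (\<lambda>(x', y). x' = x \<longrightarrow> y \<in> U) uniformity)"

lemma fn_add: "AE x in lborel. fn (p + q) x = fn p x + fn q x"
 using fn_abs[OF sqint_add[OF fn_sqint[of p] fn_sqint[of q]]] by (simp add: plus_l2_def)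
lemma fn_diff: "AE x in lborel. fn (p - q) x = fn p x - fn q x"
 using fn_abs[OF sqint_diff[OF fn_sqint[of p] fn_sqint[of q]]] by (simp add: minus_l2_def)
lemma fn_scale: "AE x in lborel. fn (c *\<^sub>R p) x = c * fn p x"
 using fn_abs[OF sqint_scale[OF fn_sqint[of p]], of c] by (simp add: scaleR_l2_def)
lemma fn_0: "AE x in lborel. fn 0 x = 0"
 using fn_abs[OF sqint_0] by (simp add: zero_l2_def)

instance
proof
 fix p q r :: l2 and a b :: real and U :: "l2 set"
 show "dist p q = norm (p - q)" "sgn p = scaleR (inverse (norm p)) p"
  by (simp_all add: dist_l2_def sgn_l2_def)
 show "uniformity = (INF e\<in>{0 <..}. principal {(x::l2, y). dist x y < e})" by (rule uniformity_l2_def)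
 show "open U = (\<forall>x\<in>U. \<forall>\<^sub>F (x', y) in uniformity. x' = x \<longrightarrow> y \<in> U)" by (rule open_l2_def)
 show "p + q + r = p + (q + r)" "p + q = q + p" "0 + p = p" "- p + p = 0" "p - q = p + - q"
  "a *\<^sub>R (p + q) = a *\<^sub>R p + a *\<^sub>R q" "(a + b) *\<^sub>R p = a *\<^sub>R p + b *\<^sub>R p" "a *\<^sub>R b *\<^sub>R p = (a * b) *\<^sub>R p"
  "1 *\<^sub>R p = p"
  by (transfer; auto simp: sqint_0 sqint_add sqint_scale sqint_minus sqint_diff algebra_simps)+
 show "inner p q = inner q p" by (simp add: inner_l2_def mult.commute)
 show "inner (p + q) r = inner p r + inner q r"
 proof -
  have "inner (p + q) r = (LBINT x. fn p x * fn r x + fn q x * fn r x)"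
   unfolding inner_l2_def by (rule integral_cong_AE) (use fn_add[of p q] in \<open>auto simp: algebra_simps\<close>)
  also have "\<dots> = inner p r + inner q r"
   unfolding inner_l2_def by (intro Bochner_Integration.integral_add sqint_mult fn_sqint)
  finally show ?thesis .
 qed
 show "inner (a *\<^sub>R p) q = a * inner p q"
 proof -
  have "inner (a *\<^sub>R p) q = (LBINT x. a * (fn p x * fn q x))"
   unfolding inner_l2_def by (rule integral_cong_AE) (use fn_scale[of a p] in \<open>auto simp: algebra_simps\<close>)
  then show ?thesis by (simp add: inner_l2_def)
 qed
 show "0 \<le> inner p p" by (simp add: inner_l2_def)
 show "inner p p = 0 \<longleftrightarrow> p = 0"
 proof
  assume "inner p p = 0"
  then have "AE x in lborel. fn p x * fn p x = 0"
   unfolding inner_l2_def by (subst (asm) integral_nonneg_eq_0_iff_AE) (auto intro!: sqint_mult fn_sqint)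
  then have "AE x in lborel. fn p x = fn 0 x" using fn_0 by auto
  then show "p = 0" by (rule l2_eqI)
 next
  assume "p = 0"
  have "inner 0 (0::l2) = (\<integral>x. 0 \<partial>(lborel::R4 measure))"
   unfolding inner_l2_def by (rule integral_cong_AE) (use fn_0 in auto)
  with \<open>p = 0\<close> show "inner p p = 0" by simp
 qed
 show "norm p = sqrt (inner p p)" by (rule norm_l2_def)
qed

end

lemma inner_abs: "sqint u \<Longrightarrow> sqint v \<Longrightarrow> inner (abs_l2 u) (abs_l2 v) = (LBINT x. u x * v x)"
 unfolding inner_l2_def
 by (rule integral_cong_AE) (use fn_abs[of u] fn_abs[of v] in \<open>auto simp: sqint_def\<close>)

lemma inner_abs_right: "sqint v \<Longrightarrow> inner p (abs_l2 v) = (LBINT x. fn p x * v x)"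
 using inner_abs[OF fn_sqint[of p], of v] by simp

lemma norm_l2_sq: "(norm (p::l2))^2 = (LBINT x. (fn p x)^2)"
 unfolding power2_norm_eq_inner inner_l2_def by (simp add: power2_eq_square)

lemma norm_abs_sq: "sqint u \<Longrightarrow> (norm (abs_l2 u))^2 = (LBINT x. (u x)^2)"
 unfolding power2_norm_eq_inner by (simp add: inner_abs power2_eq_square)

lemma nn_norm_sq: "(NN x. ennreal ((fn p x)^2)) = ennreal ((norm p)^2)"
 unfolding norm_l2_sq by (rule nn_integral_eq_integral) (use fn_sqint in \<open>auto simp: sqint_def\<close>)

lemma sqint_nn:
 assumes "u \<in> borel_measurable borel" "(NN x. ennreal ((u x)^2)) \<le> ennreal c"
 shows "sqint u"
 unfolding sqint_def using assms by (auto intro!: integrableI_bounded simp: less_top[symmetric] top_unique)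

lemma norm_abs_le:
 assumes u: "u \<in> borel_measurable borel" "(NN x. ennreal ((u x)^2)) \<le> ennreal (c^2)" and c: "0 \<le> c"
 shows "norm (abs_l2 u) \<le> c"
proof -
 have s: "sqint u" by (rule sqint_nn[OF u])
 have "ennreal ((norm (abs_l2 u))^2) = (NN x. ennreal ((u x)^2))"
  unfolding norm_abs_sq[OF s] by (rule nn_integral_eq_integral[symmetric]) (use s in \<open>auto simp: sqint_def\<close>)
 with u(2) have "ennreal ((norm (abs_l2 u))^2) \<le> ennreal (c^2)" by simp
 then have "(norm (abs_l2 u))^2 \<le> c^2" by (subst (asm) ennreal_le_iff) auto
 then show ?thesis using c by (rule power2_le_imp_le)
qed

text \<open>A strictly positive integrable weight turns convergence in norm into weighted L1
  convergence on the whole space, from which almost everywhere convergence follows without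
  exhausting by balls.\<close>

lemma weight_function:
 obtains g :: "R4 \<Rightarrow> real" where "g \<in> borel_measurable borel" "\<And>x. 0 < g x" "\<And>x. g x \<le> 1" "integrable lborel g"
proof -
 obtain g :: "R4 \<Rightarrow> real" where "g \<in> borel_measurable lborel" "\<And>x. 0 < g x" "\<And>x. g x \<le> 1" "integrable lborel g"
  by (rule sigma_finite_measure.obtain_positive_integrable_function[OF lborel.sigma_finite_measure_axioms]) (rule that)
 then show thesis using that by auto
qed

text \<open>Riesz-Fischer: a rapidly converging subsequence has summable weighted L1 increments, so
  it converges almost everywhere; Fatou's lemma identifies the limit in norm.\<close>

instance l2 :: complete_space
proof
 fix X :: "nat \<Rightarrow> l2" assume X: "Cauchy X"
 obtain g :: "R4 \<Rightarrow> real" where g: "g \<in> borel_measurable borel" "\<And>x. 0 < g x" "\<And>x. g x \<le> 1" "integrable lborel g"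
  using weight_function by blast
 note [measurable] = g(1)
 have gs: "sqint g" unfolding sqint_def
 proof (intro conjI g(1) Bochner_Integration.integrable_bound[OF g(4)])
  have "(g x)^2 \<le> g x" for x using g(2,3)[of x] by (simp add: power2_eq_square mult_le_cancel_left1)
  then show "AE x in lborel. norm ((g x)^2) \<le> norm (g x)" using g(2) by (auto simp: less_imp_le)
 qed simp
 have "\<exists>N. \<forall>m\<ge>N. \<forall>n\<ge>N. norm (X m - X n) < (1/2)^k" for k :: nat
  using X[unfolded Cauchy_def, rule_format, of "(1/2)^k"] by (auto simp: dist_norm)
 then obtain N where N: "\<And>k m n. m \<ge> N k \<Longrightarrow> n \<ge> N k \<Longrightarrow> norm (X m - X n) < (1/2)^k" by metis
 \<comment> \<open>Summing the thresholds guarantees \<open>r m \<ge> N k\<close> for all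
   \<open>m \<ge> k\<close>; strict monotonicity of \<open>r\<close> is not at stake.\<close>
 define r where "r k = (\<Sum>j\<le>k. N j)" for k
 have rN: "r m \<ge> N k" if "m \<ge> k" for m k
  unfolding r_def using that member_le_sum[of k "{..m}" N] by auto
 define Y where "Y k = X (r k)" for k
 have Y: "norm (Y m - Y n) < (1/2)^k" if "m \<ge> k" "n \<ge> k" for m n k
  unfolding Y_def by (intro N rN that)
 have Yi: "(NN x. ennreal (\<bar>fn (Y (Suc k)) x - fn (Y k) x\<bar> * g x)) \<le> ennreal ((1/2)^k * norm (abs_l2 g))" for k
 proof -
  have s: "sqint (\<lambda>x. \<bar>fn (Y (Suc k)) x - fn (Y k) x\<bar>)"
   by (rule sqint_bound[OF sqint_diff[OF fn_sqint fn_sqint, of "Y (Suc k)" "Y k"]]) auto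
  have "(NN x. ennreal (\<bar>fn (Y (Suc k)) x - fn (Y k) x\<bar> * g x)) = ennreal (inner (abs_l2 (\<lambda>x. \<bar>fn (Y (Suc k)) x - fn (Y k) x\<bar>)) (abs_l2 g))"
   unfolding inner_abs[OF s gs]
   by (rule nn_integral_eq_integral[OF sqint_mult[OF s gs]]) (auto simp: g(2) less_imp_le)
  also have "\<dots> \<le> ennreal (norm (abs_l2 (\<lambda>x. \<bar>fn (Y (Suc k)) x - fn (Y k) x\<bar>)) * norm (abs_l2 g))"
   by (intro ennreal_leI norm_cauchy_schwarz)
  also have "norm (abs_l2 (\<lambda>x. \<bar>fn (Y (Suc k)) x - fn (Y k) x\<bar>)) = norm (Y (Suc k) - Y k)"
  proof -
   have "(norm (abs_l2 (\<lambda>x. \<bar>fn (Y (Suc k)) x - fn (Y k) x\<bar>)))^2 = (norm (Y (Suc k) - Y k))^2"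
    unfolding norm_abs_sq[OF s] norm_l2_sq
    by (rule integral_cong_AE) (use fn_diff[of "Y (Suc k)" "Y k"] fn_abs[OF s] in \<open>auto elim: AE_mp\<close>)
   then show ?thesis by simp
  qed
  also have "ennreal (norm (Y (Suc k) - Y k) * norm (abs_l2 g)) \<le> ennreal ((1/2)^k * norm (abs_l2 g))"
   using Y[of k "Suc k" k] by (intro ennreal_leI mult_right_mono) auto
  finally show ?thesis .
 qed
 have "(NN x. (\<Sum>k. ennreal (\<bar>fn (Y (Suc k)) x - fn (Y k) x\<bar> * g x))) =
   (\<Sum>k. (NN x. ennreal (\<bar>fn (Y (Suc k)) x - fn (Y k) x\<bar> * g x)))"
  by (rule nn_integral_suminf) auto
 also have "\<dots> \<le> (\<Sum>k. ennreal ((1/2)^k * norm (abs_l2 g)))"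
  by (intro suminf_le Yi) auto
 also have "\<dots> = ennreal (\<Sum>k. (1/2)^k * norm (abs_l2 g))"
  by (intro suminf_ennreal2 summable_mult2) (auto intro: summable_geometric)
 finally have "(NN x. (\<Sum>k. ennreal (\<bar>fn (Y (Suc k)) x - fn (Y k) x\<bar> * g x))) \<noteq> \<infinity>"
  by (auto simp: top_unique)
 then have "AE x in lborel. (\<Sum>k. ennreal (\<bar>fn (Y (Suc k)) x - fn (Y k) x\<bar> * g x)) \<noteq> \<infinity>"
  by (intro nn_integral_noteq_infinite) auto
 then have ae: "AE x in lborel. convergent (\<lambda>k. fn (Y k) x)"
 proof (eventually_elim)
  case (elim x)
  then have "summable (\<lambda>k. \<bar>fn (Y (Suc k)) x - fn (Y k) x\<bar> * g x)"
   by (intro summable_suminf_not_top) (auto simp: g(2) less_imp_le infinity_ennreal_def)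
  then have "summable (\<lambda>k. \<bar>fn (Y (Suc k)) x - fn (Y k) x\<bar>)"
   using summable_mult2[of "\<lambda>k. \<bar>fn (Y (Suc k)) x - fn (Y k) x\<bar> * g x" "inverse (g x)"] g(2)[of x] by (simp add: mult.assoc less_imp_neq[symmetric])
  then have "summable (\<lambda>k. fn (Y (Suc k)) x - fn (Y k) x)"
   by (rule summable_rabs_cancel)
  then have "convergent (\<lambda>n. \<Sum>k<n. fn (Y (Suc k)) x - fn (Y k) x)"
   by (simp add: summable_iff_convergent)
  then have "convergent (\<lambda>n. (fn (Y n) x - fn (Y 0) x) + fn (Y 0) x)"
   by (subst (asm) sum_lessThan_telescope) (intro convergent_add convergent_const)
  then show ?case by simp
 qed
 define u where "u x = lim (\<lambda>k. fn (Y k) x)" for x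
 have um [measurable]: "u \<in> borel_measurable borel" unfolding u_def by measurable
 \<comment> \<open>Fatou's lemma in the second index keeps the rate \<open>(1/2)^n\<close> and at
   the same time proves that \<open>u\<close> is square integrable.\<close>
 have bd: "(NN x. ennreal ((fn (Y n) x - u x)^2)) \<le> ennreal (((1/2)^n)^2)" for n
 proof -
  have "(NN x. ennreal ((fn (Y n) x - u x)^2)) =
    (NN x. liminf (\<lambda>m. ennreal ((fn (Y n) x - fn (Y m) x)^2)))"
  proof (rule nn_integral_cong_AE, use ae in eventually_elim)
   case (elim x)
   then have "(\<lambda>m. fn (Y m) x) \<longlonglongrightarrow> u x" by (simp add: u_def convergent_LIMSEQ_iff)
   then have "(\<lambda>m. ennreal ((fn (Y n) x - fn (Y m) x)^2)) \<longlonglongrightarrow> ennreal ((fn (Y n) x - u x)^2)"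
    by (intro tendsto_intros)
   then show ?case by (rule lim_imp_Liminf[OF trivial_limit_sequentially, symmetric])
  qed
  also have "\<dots> \<le> liminf (\<lambda>m. (NN x. ennreal ((fn (Y n) x - fn (Y m) x)^2)))"
   by (rule nn_integral_liminf) auto
  also have "\<dots> \<le> ennreal (((1/2)^n)^2)"
  proof (rule Liminf_le)
   show "\<forall>\<^sub>F m in sequentially. (NN x. ennreal ((fn (Y n) x - fn (Y m) x)^2)) \<le> ennreal (((1/2)^n)^2)"
   proof (rule eventually_sequentiallyI[of n])
    fix m assume "n \<le> m"
    have "(NN x. ennreal ((fn (Y n) x - fn (Y m) x)^2)) = (NN x. ennreal ((fn (Y n - Y m) x)^2))"
     by (rule nn_integral_cong_AE) (use fn_diff[of "Y n" "Y m"] in auto)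
    also have "\<dots> \<le> ennreal (((1/2)^n)^2)"
     unfolding nn_norm_sq using Y[of n n m] \<open>n \<le> m\<close> by (intro ennreal_leI power_mono) auto
    finally show "(NN x. ennreal ((fn (Y n) x - fn (Y m) x)^2)) \<le> ennreal (((1/2)^n)^2)" .
   qed
  qed simp
  finally show ?thesis .
 qed
 have us: "sqint u"
 proof -
  have "sqint (\<lambda>x. fn (Y 0) x - u x)" by (rule sqint_nn[OF _ bd[of 0]]) auto
  from sqint_diff[OF fn_sqint[of "Y 0"] this] show ?thesis by simp
 qed
 have "norm (Y n - abs_l2 u) \<le> (1/2)^n" for n
 proof -
  have "Y n - abs_l2 u = abs_l2 (\<lambda>x. fn (Y n) x - u x)"
   using sqint_diff[OF fn_sqint[of "Y n"] us] fn_abs[OF us] fn_abs[of "\<lambda>x. fn (Y n) x - u x"] fn_diff[of "Y n" "abs_l2 u"]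
   by (intro l2_eqI) (auto elim: AE_mp)
  then show ?thesis using norm_abs_le[OF _ bd[of n]] by simp
 qed
 moreover have "(\<lambda>n. (1/2::real)^n) \<longlonglongrightarrow> 0" by (intro LIMSEQ_power_zero) auto
 ultimately have Yl: "(\<lambda>n. Y n - abs_l2 u) \<longlonglongrightarrow> 0"
  by (intro Lim_null_comparison[of "\<lambda>n. Y n - abs_l2 u" "\<lambda>n. (1/2)^n"]) auto
 have "X \<longlonglongrightarrow> abs_l2 u"
 proof (rule metric_LIMSEQ_I)
  fix e :: real assume e: "e > 0"
  obtain k where k: "(1/2::real)^k < e/2" using real_arch_pow_inv[of "e/2" "1/2"] e by auto
  obtain M where M: "\<And>n. n \<ge> M \<Longrightarrow> norm (Y n - abs_l2 u) < e/2"
   using LIMSEQ_D[OF Yl, of "e/2"] e by auto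
  have "norm (X n - abs_l2 u) < e" if "n \<ge> N k" for n
  proof -
   have "norm (X n - Y (max k M)) < (1/2)^k" unfolding Y_def by (intro N rN that) auto
   then have "norm (X n - Y (max k M)) + norm (Y (max k M) - abs_l2 u) < e" using M[of "max k M"] k by simp
   then show ?thesis using norm_triangle_ineq[of "X n - Y (max k M)" "Y (max k M) - abs_l2 u"] by simp
  qed
  then show "\<exists>no. \<forall>n\<ge>no. dist (X n) (abs_l2 u) < e" by (auto simp: dist_norm)
 qed
 then show "convergent X" by (auto simp: convergent_def)
qed

section \<open>The truncated Riesz kernel\<close>

lemma nn_integral_cmult_ennreal:
 assumes "0 \<le> c" "f \<in> borel_measurable M" "\<And>x. 0 \<le> f x"
 shows "(\<integral>\<^sup>+x. ennreal (c * f x) \<partial>M) = ennreal c * (\<integral>\<^sup>+x. ennreal (f x) \<partial>M)"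
 using assms by (subst nn_integral_cmult[symmetric]) (auto simp: ennreal_mult)

lemma ball_borel [measurable]: "ball (x::R4) r \<in> sets borel" by simp

lemma emeasure_cball_R4: "r \<ge> 0 \<Longrightarrow> emeasure lborel (cball (x::R4) r) = ennreal (pi^2 / 2 * r ^ 4)"
 by (subst emeasure_cball) (simp_all add: unit_ball_vol_numeral)

lemma emeasure_ball_R4: "r \<ge> 0 \<Longrightarrow> emeasure lborel (ball (x::R4) r) = ennreal (pi^2 / 2 * r ^ 4)"
 by (subst emeasure_ball) (simp_all add: unit_ball_vol_numeral)

text \<open>The ball of radius sqrt v in dimension 4 has volume \<open>pi^2 v^2 / 2\<close>, whose
  derivative is \<open>pi^2 v\<close>. Using the squared norm as radial variable keeps all radial
  integrands rational.\<close>

lemma distr_norm_square: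
 "distr lborel borel (\<lambda>x::R4. (norm x)^2) = density lborel (\<lambda>v. ennreal (pi^2 * v) * indicator {0..} v)"
proof (rule measure_eqI_generator_eq[where E = "range atMost" and \<Omega> = UNIV and A = "\<lambda>n. {..real n}"])
 let ?M = "distr lborel borel (\<lambda>x::R4. (norm x)^2)"
 show "Int_stable (range (atMost :: real \<Rightarrow> real set))" by (auto simp: Int_stable_def)
 show "sets ?M = sigma_sets UNIV (range atMost)"
  by (simp add: borel_eq_atMost)
 show "sets (density lborel (\<lambda>v. ennreal (pi^2 * v) * indicator {0..} v)) = sigma_sets UNIV (range atMost)"
  by (simp add: borel_eq_atMost)
 show "(\<Union>n. {..real n}) = UNIV" using real_arch_simple by auto
 have M: "emeasure ?M {..a} = (if a \<ge> 0 then ennreal (pi^2 / 2 * a^2) else 0)" for a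
 proof -
  have "emeasure ?M {..a} = emeasure lborel {x::R4. (norm x)\<^sup>2 \<le> a}"
   by (subst emeasure_distr) (auto intro!: arg_cong[where f = "emeasure lborel"])
  also have "{x::R4. (norm x)\<^sup>2 \<le> a} = (if a \<ge> 0 then cball 0 (sqrt a) else {})"
   using real_le_rsqrt by (auto simp: sqrt_ge_absD real_sqrt_le_iff intro: real_le_rsqrt) (smt (verit) zero_le_power2)+
  moreover have "sqrt a ^ 4 = a^2" if "a \<ge> 0"
   using that power_mult[of "sqrt a" 2 2] by simp
  ultimately show ?thesis by (auto simp: emeasure_cball_R4)
 qed
 show "emeasure ?M {..real n} \<noteq> \<infinity>" for n by (simp add: M)
 fix X :: "real set" assume "X \<in> range atMost"
 then obtain a where X: "X = {..a}" by auto
 have "emeasure (density lborel (\<lambda>v. ennreal (pi^2 * v) * indicator {0..} v)) {..a}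
   = (NN v. ennreal (pi^2 * v) * indicator {0..a} v)"
  by (subst emeasure_density) (auto intro!: nn_integral_cong split: split_indicator)
 also have "\<dots> = (if a \<ge> 0 then ennreal (pi^2 / 2 * a^2) else 0)"
 proof (cases "a \<ge> 0")
  case True
  have "(NN v. ennreal (pi^2 * v) * indicator {0..a} v) = ennreal (pi^2 / 2 * a^2 - pi\<^sup>2 / 2 * 0^2)"
   by (rule nn_integral_FTC_Icc) (use True in \<open>auto intro!: derivative_eq_intros\<close>)
  then show ?thesis using True by simp
 qed simp
 finally show "emeasure ?M X = emeasure (density lborel (\<lambda>v. ennreal (pi^2 * v) * indicator {0..} v)) X"
  by (simp add: M X)
qed auto

lemma nn_integral_radial:
 assumes [measurable]: "g \<in> borel_measurable borel"
 shows "(NN x. g ((norm (x::R4))^2)) = (NN v. ennreal (pi^2 * v) * indicator {0..} v * g v)"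
proof -
 have "(NN x. g ((norm (x::R4))^2)) = integral\<^sup>N (distr lborel borel (\<lambda>x::R4. (norm x)^2)) g"
  by (subst nn_integral_distr) auto
 also have "\<dots> = (NN v. ennreal (pi^2 * v) * indicator {0..} v * g v)"
  unfolding distr_norm_square by (subst nn_integral_density) auto
 finally show ?thesis .
qed

lemma nn_integral_inverse_square_ball:
 assumes "\<rho> \<ge> 0"
 shows "(NN x. ennreal (indicator (ball 0 \<rho>) x / (norm (x::R4))^2)) = ennreal (pi^2 * \<rho>^2)"
proof -
 have *: "norm x < \<rho> \<longleftrightarrow> (norm x)\<^sup>2 < \<rho>^2" for x :: R4
  using assms by (metis norm_ge_zero pos2 power2_less_imp_less power_strict_mono)
 have "(NN x. ennreal (indicator (ball 0 \<rho>) x / (norm (x::R4))^2))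
   = (NN x. (\<lambda>v. ennreal (indicator {..<\<rho>^2} v / v)) ((norm (x::R4))^2))"
  by (intro nn_integral_cong) (auto simp: * split: split_indicator)
 also have "\<dots> = (NN v. ennreal (pi^2 * v) * indicator {0..} v * ennreal (indicator {..<\<rho>^2} v / v))"
  by (rule nn_integral_radial) auto
 also have "\<dots> = (NN v. ennreal (pi^2) * indicator {0<..<\<rho>^2} v)"
  by (intro nn_integral_cong) (auto simp: ennreal_mult[symmetric] split: split_indicator)
 also have "\<dots> = ennreal (pi^2 * \<rho>^2)"
  by (subst nn_integral_cmult) (auto simp: ennreal_mult)
 finally show ?thesis .
qed

lemma nn_integral_inverse_fourth_annulus:
 assumes "0 < a"
 shows "(NN x. ennreal (indicator {x. a \<le> norm x \<and> norm x \<le> b} x / (norm (x::R4)) ^ 4))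
  \<le> ennreal (2 * pi^2 * max 0 (ln (b / a)))"
proof (cases "a \<le> b")
 case True
 have *: "a \<le> norm x \<and> norm x \<le> b \<longleftrightarrow> a\<^sup>2 \<le> (norm x)^2 \<and> (norm x)^2 \<le> b^2" for x :: R4
  using assms True by (smt (verit) norm_ge_zero power2_le_imp_le power_mono)
 have "(NN x. ennreal (indicator {x. a \<le> norm x \<and> norm x \<le> b} x / (norm (x::R4)) ^ 4))
   = (NN x. (\<lambda>v. ennreal (indicator {a\<^sup>2..b\<^sup>2} v / v^2)) ((norm (x::R4))^2))"
  by (intro nn_integral_cong) (auto simp: * split: split_indicator)
 also have "\<dots> = (NN v. ennreal (pi^2 * v) * indicator {0..} v * ennreal (indicator {a\<^sup>2..b\<^sup>2} v / v^2))"
  by (rule nn_integral_radial) auto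
 also have "\<dots> = (NN v. ennreal (pi^2 / v) * indicator {a\<^sup>2..b\<^sup>2} v)"
 proof (intro nn_integral_cong)
  fix v :: real
  show "ennreal (pi^2 * v) * indicator {0..} v * ennreal (indicator {a\<^sup>2..b\<^sup>2} v / v^2) = ennreal (pi^2 / v) * indicator {a\<^sup>2..b\<^sup>2} v"
   using assms less_le_trans[of 0 "a^2" v]
   by (auto simp: ennreal_mult[symmetric] power2_eq_square split: split_indicator)
 qed
 also have "\<dots> = ennreal (pi^2 * ln (b^2) - pi\<^sup>2 * ln (a^2))"
 proof (rule nn_integral_FTC_Icc)
  fix v :: real assume v: "v \<in> {a\<^sup>2..b\<^sup>2}"
  then have "v > 0" using assms less_le_trans[of 0 "a^2" v] by auto
  then show "((\<lambda>v. pi^2 * ln v) has_real_derivative pi\<^sup>2 / v) (at v)" "0 \<le> pi^2 / v"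
   by (auto intro!: derivative_eq_intros)
 qed (use assms True in \<open>auto intro!: power_mono\<close>)
 also have "pi^2 * ln (b^2) - pi\<^sup>2 * ln (a^2) = 2 * pi^2 * ln (b / a)"
  using assms True by (simp add: ln_div ln_realpow algebra_simps)
 finally show ?thesis using assms True by (auto intro!: ennreal_leI mult_left_mono)
next
 case False
 then have "(NN x. ennreal (indicator {x. a \<le> norm x \<and> norm x \<le> b} x / (norm (x::R4)) ^ 4)) = (\<integral>\<^sup>+x. 0 \<partial>(lborel :: R4 measure))"
  by (intro nn_integral_cong) (auto split: split_indicator)
 then show ?thesis by simp
qed

text \<open>The normalization of the approximate identity \<open>ke\<close>: this profile is what
  remains of the Laplacian of the regularized kernel 1/(|z|^2 + r^2) after rescaling. Its radial
  primitive is v^2/(1+v)^2.\<close>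

lemma nn_integral_bubble:
 "(NN x. ennreal (2 / pi^2 / (1 + (norm (x::R4))^2) ^ 3)) = 1"
proof -
 have "(NN x. ennreal (2 / pi^2 / (1 + (norm (x::R4))^2) ^ 3))
   = (NN v. ennreal (pi^2 * v) * indicator {0..} v * ennreal (2 / pi^2 / (1 + v) ^ 3))"
  by (rule nn_integral_radial[of "\<lambda>v. ennreal (2 / pi^2 / (1 + v) ^ 3)"]) auto
 also have "\<dots> = (NN v. ennreal (2 * v / (1 + v) ^ 3) * indicator {0..} v)"
  by (intro nn_integral_cong) (auto simp: ennreal_mult[symmetric] split: split_indicator)
 also have "\<dots> = ennreal (1 - 0\<^sup>2 / (1 + 0)^2)"
 proof (rule nn_integral_FTC_atLeast[where F = "\<lambda>v. v^2 / (1 + v)^2" and f = "\<lambda>v. 2 * v / (1 + v) ^ 3" and a = 0 and T = 1])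
  show "((\<lambda>v::real. v\<^sup>2 / (1 + v)^2) \<longlongrightarrow> 1) at_top" by real_asymp
  fix v :: real assume v: "0 \<le> v"
  then show "0 \<le> 2 * v / (1 + v) ^ 3" by simp
  have "((\<lambda>v. v^2 / (1 + v)^2) has_real_derivative (2 * v * (1 + v)^2 - v\<^sup>2 * (2 * (1 + v))) / ((1 + v)^2 * (1 + v)^2)) (at v)"
   using v by (auto intro!: derivative_eq_intros)
  also have "(2 * v * (1 + v)^2 - v\<^sup>2 * (2 * (1 + v))) / ((1 + v)^2 * (1 + v)^2) = 2 * v / (1 + v) ^ 3"
   using v by (simp add: divide_simps) (simp add: algebra_simps eval_nat_numeral)
  finally show "((\<lambda>v. v^2 / (1 + v)^2) has_real_derivative 2 * v / (1 + v) ^ 3) (at v)" .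
 qed auto
 finally show ?thesis by simp
qed

text \<open>The function 1/(4 pi^2 |z|^2) is the fundamental solution of minus the Laplacian in
  dimension 4, here cut to the unit ball.\<close>

definition rk :: "R4 \<Rightarrow> real" where
 "rk z = indicator (ball 0 1) z / (4 * pi^2 * (norm z)^2)"

lemma rk_meas [measurable]: "rk \<in> borel_measurable borel" unfolding rk_def by measurable
lemma rk_nonneg [simp]: "0 \<le> rk z" by (simp add: rk_def)
lemma rk_minus: "rk (- z) = rk z" by (simp add: rk_def indicator_def)

lemma nn_integral_reflect:
 assumes [measurable]: "g \<in> borel_measurable borel"
 shows "(NN y. g (z - y)) = (NN y. g (y::R4))"
proof -
 have *: "(lborel :: R4 measure) = distr lborel borel (\<lambda>x. z - x)"
  using lborel_affine[of "-1" z] by (simp add: density_1)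
 have "(NN y. g y) = (\<integral>\<^sup>+y. g y \<partial>distr lborel borel (\<lambda>x. z - x))"
  by (subst *) rule
 also have "\<dots> = (NN y. g (z - y))"
  by (subst nn_integral_distr) auto
 finally show ?thesis by simp
qed

lemma nn_integral_translate:
 assumes [measurable]: "g \<in> borel_measurable borel"
 shows "(NN y. g (z + y)) = (NN y. g (y::R4))"
proof -
 have "(NN y. g y) = (\<integral>\<^sup>+y. g y \<partial>distr lborel borel ((+) z))"
  by (simp add: lborel_distr_plus)
 also have "\<dots> = (NN y. g (z + y))" by (subst nn_integral_distr) auto
 finally show ?thesis by simp
qed

definition rk2 :: "R4 \<Rightarrow> ennreal" where
 "rk2 z = (NN y. ennreal (rk y * rk (z - y)))"

lemma rk2_meas [measurable]: "rk2 \<in> borel_measurable borel" unfolding rk2_def by measurable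

text \<open>Only the region M|z| <= |y| <= 1 produces a logarithm. There |z - y| is at least (1 -
  1/M)|y|, and the integral of |y|^(-4) contributes 2 pi^2 ln(1/|z|), which with the factor 1/(16
  pi^4) gives 1/(8 pi^2). All other regions are scale invariant, hence bounded; M large brings the
  constant close to the sharp one.\<close>

lemma rk2_bound:
 assumes M: "M > 1"
 shows "\<exists>C\<ge>0. \<forall>z. z \<noteq> 0 \<longrightarrow> rk2 z \<le> ennreal (1 / (1 - 1 / M)^2 / (8 * pi^2) * max 0 (ln (1 / norm z)) + C)"
proof (intro exI conjI allI impI)
 define C where "C = 1 / (8 * pi^2) + M ^ 4 / (2 * pi^2)"
 show "C \<ge> 0" unfolding C_def using M by simp
 fix z :: R4 assume z: "z \<noteq> 0"
 define a where "a = norm z"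
 have a: "a > 0" using z by (simp add: a_def)
 define b where "b = 1 - 1 / M"
 have b: "b > 0" using M by (simp add: b_def)
 define t1 where "t1 y = 1 / (4 * pi ^ 4 * a^2) * (indicator (ball 0 (a/2)) y / (norm y)^2)" for y :: R4
 define t3 where "t3 y = 1 / (pi ^ 4 * a ^ 4) * indicator (ball 0 (M * a)) y" for y :: R4
 define t4 where "t4 y = 1 / (16 * pi ^ 4 * b^2) * (indicator {y. M * a \<le> norm y \<and> norm y \<le> 1} y / (norm y) ^ 4)" for y :: R4
 have [measurable]: "t1 \<in> borel_measurable borel" "t3 \<in> borel_measurable borel" "t4 \<in> borel_measurable borel"
  unfolding t1_def t3_def t4_def by measurable
 have nn: "0 \<le> t1 y" "0 \<le> t3 y" "0 \<le> t4 y" for y using a b by (auto simp: t1_def t3_def t4_def)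
 have rkle: "rk y \<le> 1 / (4 * pi^2 * c^2)" if "c \<le> norm y" "c > 0" for y c
  unfolding rk_def using that by (auto split: split_indicator intro!: divide_left_mono mult_left_mono power_mono mult_pos_pos)
 have c1: "rk y * rk (z - y) \<le> t1 y" if "norm y < a / 2" for y
 proof -
  have "a / 2 \<le> norm (z - y)" using that norm_triangle_ineq2[of z y] by (simp add: a_def)
  then have "rk (z - y) \<le> 1 / (4 * pi^2 * (a/2)^2)" by (rule rkle) (use a in simp)
  moreover have "rk y \<le> 1 / (4 * pi^2) * (indicator (ball 0 (a/2)) y / (norm y)^2)"
   using that by (auto simp: rk_def split: split_indicator)
  ultimately have "rk y * rk (z - y) \<le> 1 / (4 * pi^2) * (indicator (ball 0 (a/2)) y / (norm y)^2) * (1 / (4 * pi^2 * (a/2)^2))"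
   by (intro mult_mono) auto
  then show ?thesis by (simp add: t1_def field_simps power2_eq_square power4_eq_xxxx)
 qed
 \<comment> \<open>Four regions: y near 0, y near z, y away from both but within M|z|, and y beyond
   that. The second is the first reflected by y to z - y.\<close>
 have c: "rk y * rk (z - y) \<le> t1 y + t1 (z - y) + t3 y + t4 y" for y
 proof (cases "norm y < a / 2 \<or> norm (z - y) < a / 2")
  case True
  then have "rk y * rk (z - y) \<le> t1 y \<or> rk y * rk (z - y) \<le> t1 (z - y)"
   using c1[of y] c1[of "z - y"] by (auto simp: mult.commute)
  then show ?thesis using nn[of y] nn[of "z - y"] by linarith
 next
  case False
  show ?thesis
  proof (cases "norm y < M * a")
   case True
   have "rk y * rk (z - y) \<le> (1 / (4 * pi^2 * (a/2)^2)) * (1 / (4 * pi^2 * (a/2)^2))"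
    using False a by (intro mult_mono rkle) auto
   also have "\<dots> = t3 y" using True by (simp add: t3_def field_simps power2_eq_square power4_eq_xxxx)
   finally show ?thesis using nn[of y] nn[of "z - y"] by linarith
  next
   case False2: False
   show ?thesis
   proof (cases "norm y < 1")
    case True
    have ny: "norm y > 0" using False2 M a by (smt (verit) mult_pos_pos)
    have "a \<le> norm y / M" using False2 M by (simp add: field_simps)
    then have "b * norm y \<le> norm (z - y)"
     using norm_triangle_ineq2[of y z] by (simp add: a_def b_def norm_minus_commute left_diff_distrib)
    then have "rk (z - y) \<le> 1 / (4 * pi^2 * (b * norm y)^2)" by (rule rkle) (use b ny in simp)
    then have "rk y * rk (z - y) \<le> (1 / (4 * pi^2 * (norm y)^2)) * (1 / (4 * pi^2 * (b * norm y)^2))"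
     using ny by (intro mult_mono rkle[of "norm y" y] \<open>rk (z - y) \<le> _\<close>) auto
    also have "\<dots> = t4 y" using True False2 by (simp add: t4_def field_simps power2_eq_square power4_eq_xxxx)
    finally show ?thesis using nn[of y] nn[of "z - y"] by linarith
   next
    case False
    then have "rk y = 0" by (simp add: rk_def)
    then show ?thesis using nn[of y] nn[of "z - y"] by simp
   qed
  qed
 qed
 have I1: "(NN y. ennreal (t1 y)) = ennreal (1 / (16 * pi^2))"
 proof -
  have "(NN y. ennreal (t1 y)) = ennreal (1 / (4 * pi ^ 4 * a^2)) * (NN y. ennreal (indicator (ball 0 (a/2)) y / (norm (y::R4))^2))"
   unfolding t1_def by (rule nn_integral_cmult_ennreal) auto
  also have "\<dots> = ennreal (1 / (4 * pi ^ 4 * a^2)) * ennreal (pi^2 * (a/2)^2)"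
   by (subst nn_integral_inverse_square_ball) (use a in auto)
  also have "\<dots> = ennreal (1 / (16 * pi^2))"
   using a by (simp add: ennreal_mult[symmetric]) (simp add: field_simps power2_eq_square power4_eq_xxxx)
  finally show ?thesis .
 qed
 have I3: "(NN y. ennreal (t3 y)) = ennreal (M ^ 4 / (2 * pi^2))"
 proof -
  have "(NN y. ennreal (t3 y)) = ennreal (1 / (pi ^ 4 * a ^ 4)) * emeasure lborel (ball (0::R4) (M * a))"
   unfolding t3_def by (subst nn_integral_cmult_ennreal) (auto simp: ennreal_indicator)
  also have "\<dots> = ennreal (1 / (pi ^ 4 * a ^ 4)) * ennreal (pi^2 / 2 * (M * a) ^ 4)"
   using M a by (subst emeasure_ball_R4) auto
  also have "\<dots> = ennreal (M ^ 4 / (2 * pi^2))"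
   using a M by (simp add: ennreal_mult[symmetric]) (simp add: field_simps power2_eq_square power4_eq_xxxx)
  finally show ?thesis .
 qed
 have I4: "(NN y. ennreal (t4 y)) \<le> ennreal (1 / b^2 / (8 * pi^2) * max 0 (ln (1 / a)))"
 proof -
  have "(NN y. ennreal (t4 y)) = ennreal (1 / (16 * pi ^ 4 * b^2)) * (NN y. ennreal (indicator {y. M * a \<le> norm y \<and> norm y \<le> 1} y / (norm (y::R4)) ^ 4))"
   unfolding t4_def by (rule nn_integral_cmult_ennreal) auto
  also have "\<dots> \<le> ennreal (1 / (16 * pi ^ 4 * b^2)) * ennreal (2 * pi^2 * max 0 (ln (1 / (M * a))))"
   by (intro mult_left_mono nn_integral_inverse_fourth_annulus) (use M a in auto)
  also have "\<dots> \<le> ennreal (1 / (16 * pi ^ 4 * b^2)) * ennreal (2 * pi^2 * max 0 (ln (1 / a)))"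
  proof -
   have "ln (1 / (M * a)) \<le> ln (1 / a)" using M a by (subst ln_le_cancel_iff) (auto simp: field_simps)
   then show ?thesis by (intro mult_left_mono ennreal_leI) auto
  qed
  also have "\<dots> = ennreal (1 / b^2 / (8 * pi^2) * max 0 (ln (1 / a)))"
   using b by (simp add: ennreal_mult[symmetric]) (simp add: field_simps power2_eq_square power4_eq_xxxx)
  finally show ?thesis .
 qed
 have "rk2 z \<le> (NN y. ennreal (t1 y) + ennreal (t1 (z - y)) + ennreal (t3 y) + ennreal (t4 y))"
  unfolding rk2_def using c nn by (intro nn_integral_mono) (simp flip: ennreal_plus)
 also have "\<dots> = (NN y. ennreal (t1 y)) + (NN y. ennreal (t1 (z - y))) + (NN y. ennreal (t3 y)) + (NN y. ennreal (t4 y))"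
  by (simp add: nn_integral_add)
 also have "(NN y. ennreal (t1 (z - y))) = (NN y. ennreal (t1 y))"
  by (rule nn_integral_reflect[of "\<lambda>y. ennreal (t1 y)"]) auto
 also have "(NN y. ennreal (t1 y)) + (NN y. ennreal (t1 y)) + (NN y. ennreal (t3 y)) + (NN y. ennreal (t4 y))
   \<le> ennreal (1 / (16 * pi^2)) + ennreal (1 / (16 * pi^2)) + ennreal (M ^ 4 / (2 * pi^2)) + ennreal (1 / b^2 / (8 * pi^2) * max 0 (ln (1 / a)))"
  unfolding I1 I3 by (intro add_left_mono I4)
 also have "\<dots> = ennreal (1 / b^2 / (8 * pi^2) * max 0 (ln (1 / a)) + C)"
  using b M by (simp flip: ennreal_plus add: C_def)
 finally show "rk2 z \<le> ennreal (1 / (1 - 1 / M)^2 / (8 * pi^2) * max 0 (ln (1 / norm z)) + C)"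
  by (simp add: a_def b_def)
qed

section \<open>Adams' inequality for potentials\<close>

lemma ennreal_square_leD:
 assumes "x^2 \<le> (ennreal c)^2" "0 \<le> c" shows "x \<le> ennreal c"
 using assms by (cases x) (auto simp: ennreal_power power2_le_iff_abs_le top_unique)

lemma ennreal_le_suminf: "f j \<le> (\<Sum>i. f i :: ennreal)"
 using sum_le_suminf[of f "{j}"] by simp

text \<open>Below the radius \<rho> the excess ln(\<rho>/r) is at most \<rho>/r, hence at most its
  square, since the ratio exceeds 1. The square is integrable over the ball with an explicit
  value.\<close>

lemma max_ln_le:
 fixes r \<rho> :: real
 assumes "\<rho> > 0" "r > 0"
 shows "max 0 (ln (1 / r)) \<le> max 0 (ln (1 / \<rho>)) + \<rho>^2 * (indicator {..<\<rho>} r / r^2)"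
proof (cases "r < \<rho>")
 case True
 have "ln (1 / r) = ln (1 / \<rho>) + ln (\<rho> / r)" using assms by (simp add: ln_div ln_inverse inverse_eq_divide[symmetric])
 moreover have "ln (\<rho> / r) \<le> \<rho>^2 / r^2"
 proof -
  have "ln (\<rho> / r) \<le> \<rho> / r" using assms by (intro less_imp_le ln_less_self) auto
  also have "\<rho> / r \<le> (\<rho> / r)^2" using assms True by (intro self_le_power) auto
  finally show ?thesis by (simp add: power_divide)
 qed
 ultimately show ?thesis using True by simp
next
 case False
 then have "ln (1 / r) \<le> ln (1 / \<rho>)" using assms by (intro ln_mono) (auto simp: divide_left_mono)
 with False show ?thesis by simp
qed

text \<open>Splitting the logarithm at the radius whose fourth power is \<open>t\<close> replaces a
  rearrangement argument. It yields ln(1/t)/4, the origin of the factor 4 between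
  \<open>8 pi^2\<close> and \<open>32 pi^2\<close>, and leaves an error proportional to
  \<open>t\<close>.\<close>

lemma rk2_set_bound:
 assumes M: "M > 1"
 shows "\<exists>C\<ge>0. \<forall>E t x. E \<in> sets borel \<longrightarrow> emeasure lborel E = ennreal t \<longrightarrow> t > 0 \<longrightarrow>
   (NN x'. rk2 (x - x') * indicator E x')
    \<le> ennreal (t * (1 / (1 - 1 / M)^2 / (32 * pi^2) * max 0 (ln (1 / t)) + C))"
proof -
 define A where "A = 1 / (1 - 1 / M)^2 / (8 * pi^2)"
 have A: "A \<ge> 0" by (simp add: A_def)
 obtain C where C: "C \<ge> 0" "\<And>z. z \<noteq> 0 \<Longrightarrow> rk2 z \<le> ennreal (A * max 0 (ln (1 / norm z)) + C)"
  using rk2_bound[OF M] unfolding A_def by blast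
 show ?thesis
 proof (intro exI[of _ "A * pi^2 + C"] conjI allI impI)
  show "A * pi^2 + C \<ge> 0" using A C by simp
  fix E :: "R4 set" and t x assume E [measurable]: "E \<in> sets borel" and t: "emeasure lborel E = ennreal t" "t > 0"
  define \<rho> where "\<rho> = root 4 t"
  have \<rho>: "\<rho> > 0" "\<rho> ^ 4 = t" using t by (simp_all add: \<rho>_def)
  have l4: "max 0 (ln (1 / \<rho>)) = max 0 (ln (1 / t)) / 4"
   using \<rho>(1) by (simp add: ln_div ln_realpow max_def flip: \<rho>(2))
  have "(NN x'. rk2 (x - x') * indicator E x')
   \<le> (NN x'. ennreal (A * max 0 (ln (1 / \<rho>)) + C) * indicator E x' + ennreal (A * \<rho>^2 * (indicator (ball 0 \<rho>) (x - x') / (norm (x - x'))^2)))"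
  proof (rule nn_integral_mono_AE)
   have "AE x' in lborel. x' \<noteq> x"
    by (rule AE_I[of _ _ "{x}"]) auto
   then show "AE x' in lborel. rk2 (x - x') * indicator E x'
    \<le> ennreal (A * max 0 (ln (1 / \<rho>)) + C) * indicator E x' + ennreal (A * \<rho>^2 * (indicator (ball 0 \<rho>) (x - x') / (norm (x - x'))^2))"
   proof eventually_elim
    case (elim x')
    then have n: "norm (x - x') > 0" by simp
    have "A * max 0 (ln (1 / norm (x - x'))) \<le> A * (max 0 (ln (1 / \<rho>)) + \<rho>^2 * (indicator {..<\<rho>} (norm (x - x')) / (norm (x - x'))^2))"
     using A by (intro mult_left_mono max_ln_le \<rho> n) auto
    also have "indicator {..<\<rho>} (norm (x - x')) = (indicator (ball 0 \<rho>) (x - x') :: real)"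
     by (auto split: split_indicator)
    finally have "rk2 (x - x') \<le> ennreal ((A * max 0 (ln (1 / \<rho>)) + C) + A * \<rho>^2 * (indicator (ball 0 \<rho>) (x - x') / (norm (x - x'))^2))"
     by (intro order_trans[OF C(2)] ennreal_leI) (use elim in \<open>auto simp: algebra_simps\<close>)
    also have "\<dots> = ennreal (A * max 0 (ln (1 / \<rho>)) + C) + ennreal (A * \<rho>^2 * (indicator (ball 0 \<rho>) (x - x') / (norm (x - x'))^2))"
     using A C by (intro ennreal_plus) auto
    finally show ?case by (auto split: split_indicator)
   qed
  qed
  also have "\<dots> = ennreal (A * max 0 (ln (1 / \<rho>)) + C) * ennreal t + (NN x'. ennreal (A * \<rho>^2 * (indicator (ball 0 \<rho>) (x - x') / (norm (x - x'))^2)))"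
   by (subst nn_integral_add) (auto simp: nn_integral_cmult_indicator t)
  also have "(NN x'. ennreal (A * \<rho>^2 * (indicator (ball 0 \<rho>) (x - x') / (norm (x - x'))^2)))
    = (NN z. ennreal (A * \<rho>^2 * (indicator (ball 0 \<rho>) z / (norm (z::R4))^2)))"
   using nn_integral_reflect[of "\<lambda>z. ennreal (A * \<rho>^2 * (indicator (ball 0 \<rho>) z / (norm z)^2))" x]
   by simp
  also have "\<dots> = ennreal (A * \<rho>^2) * ennreal (pi^2 * \<rho>^2)"
   using A \<rho> by (subst nn_integral_cmult_ennreal) (auto simp: nn_integral_inverse_square_ball)
  also have "ennreal (A * max 0 (ln (1 / \<rho>)) + C) * ennreal t + ennreal (A * \<rho>^2) * ennreal (pi^2 * \<rho>^2)
    = ennreal ((A * max 0 (ln (1 / \<rho>)) + C) * t + A * \<rho>^2 * (pi^2 * \<rho>^2))"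
   using A C t by (simp flip: ennreal_mult ennreal_plus)
  also have "(A * max 0 (ln (1 / \<rho>)) + C) * t + A * \<rho>^2 * (pi^2 * \<rho>^2) = t * (1 / (1 - 1 / M)^2 / (32 * pi^2) * max 0 (ln (1 / t)) + (A * pi^2 + C))"
  proof -
   have "\<rho>^2 * \<rho>^2 = t" using \<rho>(2) by (simp flip: power_add)
   then have "A * \<rho>^2 * (pi^2 * \<rho>^2) = A * pi^2 * t" by simp
   moreover have "1 / (1 - 1 / M)^2 / (32 * pi^2) = A / 4" by (simp add: A_def)
   ultimately show ?thesis unfolding l4 \<open>1 / (1 - 1 / M)^2 / (32 * pi^2) = A / 4\<close>
    \<open>A * \<rho>^2 * (pi^2 * \<rho>^2) = A * pi^2 * t\<close> by (simp add: field_simps)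
  qed
  finally show "(NN x'. rk2 (x - x') * indicator E x')
    \<le> ennreal (t * (1 / (1 - 1 / M)^2 / (32 * pi^2) * max 0 (ln (1 / t)) + (A * pi^2 + C)))" .
 qed
qed

text \<open>Duality replaces rearrangement: integrating the potential over a set of measure \<open>t\<close> pairs
 the density with the potential of the set, whose energy is controlled by the iterated kernel.\<close>
lemma potential_set_bound:
 assumes M: "M > 1"
 shows "\<exists>C\<ge>0. \<forall>E t g D. E \<in> sets borel \<longrightarrow> emeasure lborel E = ennreal t \<longrightarrow> t > 0 \<longrightarrow>
    g \<in> borel_measurable borel \<longrightarrow> (NN x. ennreal ((g x)^2)) \<le> ennreal D \<longrightarrow> D \<ge> 0 \<longrightarrow>
   (NN x. (NN y. ennreal (\<bar>g y\<bar> * rk (x - y))) * indicator E x)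
    \<le> ennreal (t * sqrt (D * (1 / (1 - 1 / M)^2 / (32 * pi^2) * max 0 (ln (1 / t)) + C)))"
proof -
 define a where "a = 1 / (1 - 1 / M)^2 / (32 * pi^2)"
 have a: "a \<ge> 0" by (simp add: a_def)
 obtain C where C: "C \<ge> 0"
  "\<And>E t x. \<lbrakk>E \<in> sets borel; emeasure lborel E = ennreal t; t > 0\<rbrakk> \<Longrightarrow>
   (NN x'. rk2 (x - x') * indicator E x') \<le> ennreal (t * (a * max 0 (ln (1 / t)) + C))"
  using rk2_set_bound[OF M] unfolding a_def[symmetric] by (elim exE conjE) (rule that, auto)
 show ?thesis
 proof (intro exI[of _ C] conjI allI impI C(1))
  fix E :: "R4 set" and t D and g :: "R4 \<Rightarrow> real"
  assume E [measurable]: "E \<in> sets borel" and t: "emeasure lborel E = ennreal t" "t > 0"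
   and g [measurable]: "g \<in> borel_measurable borel" and D: "(NN x. ennreal ((g x)^2)) \<le> ennreal D" "D \<ge> 0"
  define K where "K y = (NN x. ennreal (rk (x - y)) * indicator E x)" for y
  have [measurable]: "K \<in> borel_measurable borel" unfolding K_def by measurable
  let ?I = "NN x. (NN y. ennreal (\<bar>g y\<bar> * rk (x - y))) * indicator E x"
  let ?B = "a * max 0 (ln (1 / t)) + C"
  have "?I = (NN x. (NN y. ennreal (\<bar>g y\<bar> * rk (x - y)) * indicator E x))"
   by (intro nn_integral_cong nn_integral_multc[symmetric]) auto
  also have "\<dots> = (NN y. (NN x. ennreal (\<bar>g y\<bar> * rk (x - y)) * indicator E x))"
   by (rule lborel_pair.Fubini') measurable
  also have "\<dots> = (NN y. ennreal \<bar>g y\<bar> * K y)"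
   unfolding K_def by (intro nn_integral_cong) (subst nn_integral_cmult[symmetric], auto simp: ennreal_mult mult.assoc)
  finally have I: "?I = (NN y. ennreal \<bar>g y\<bar> * K y)" .
  \<comment> \<open>Expanding the square and integrating in \<open>y\<close> first turns the energy
    of the potential of \<open>E\<close> into the double integral of \<open>rk2\<close> over
    \<open>E\<close> times \<open>E\<close>.\<close>
  have KK: "(NN y. (K y)^2) \<le> ennreal (t * (t * ?B))"
  proof -
   have "(NN y. (K y)^2) = (NN y. (NN x. (NN x'. ennreal (rk (x - y) * rk (x' - y)) * indicator E x') * indicator E x))"
   proof (intro nn_integral_cong)
    fix y
    have "(K y)^2 = (NN x. ennreal (rk (x - y)) * indicator E x * K y)"
     unfolding power2_eq_square by (subst nn_integral_multc) (auto simp: K_def[of y])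
    also have "\<dots> = (NN x. (NN x'. ennreal (rk (x - y) * rk (x' - y)) * indicator E x') * indicator E x)"
    proof (intro nn_integral_cong)
     fix x
     have "ennreal (rk (x - y)) * K y = (NN x'. ennreal (rk (x - y) * rk (x' - y)) * indicator E x')"
      unfolding K_def by (subst nn_integral_cmult[symmetric]) (auto simp: ennreal_mult mult.assoc)
     then show "ennreal (rk (x - y)) * indicator E x * K y = (NN x'. ennreal (rk (x - y) * rk (x' - y)) * indicator E x') * indicator E x"
      by (simp only: mult_ac) (metis mult.left_commute mult.commute)
    qed
    finally show "(K y)^2 = (NN x. (NN x'. ennreal (rk (x - y) * rk (x' - y)) * indicator E x') * indicator E x)" .
   qed
   also have "\<dots> = (NN x. (NN y. (NN x'. ennreal (rk (x - y) * rk (x' - y)) * indicator E x') * indicator E x))"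
    by (rule lborel_pair.Fubini') measurable
   also have "\<dots> = (NN x. (NN y. (NN x'. ennreal (rk (x - y) * rk (x' - y)) * indicator E x')) * indicator E x)"
    by (intro nn_integral_cong nn_integral_multc) measurable
   also have "\<dots> = (NN x. (NN x'. rk2 (x - x') * indicator E x') * indicator E x)"
   proof (rule nn_integral_cong, rule arg_cong2[where f = "(*)", OF _ refl])
    fix x
    have "(NN y. (NN x'. ennreal (rk (x - y) * rk (x' - y)) * indicator E x'))
     = (NN x'. (NN y. ennreal (rk (x - y) * rk (x' - y)) * indicator E x'))"
     by (rule lborel_pair.Fubini') measurable
    also have "\<dots> = (NN x'. (NN y. ennreal (rk (x - y) * rk (x' - y))) * indicator E x')"
     by (intro nn_integral_cong nn_integral_multc) measurable
    also have "\<dots> = (NN x'. rk2 (x - x') * indicator E x')"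
    proof (rule nn_integral_cong, rule arg_cong2[where f = "(*)", OF _ refl])
     fix x'
     have "(NN y. ennreal (rk (x - y) * rk (x' - y))) = (NN y. (\<lambda>z. ennreal (rk z * rk ((x - x') - z))) (x - y))"
     proof (intro nn_integral_cong)
      fix y have "rk (x' - y) = rk ((x - x') - (x - y))" using rk_minus[of "x' - y"] by simp
      then show "ennreal (rk (x - y) * rk (x' - y)) = (\<lambda>z. ennreal (rk z * rk ((x - x') - z))) (x - y)" by simp
     qed
     also have "\<dots> = rk2 (x - x')" unfolding rk2_def by (rule nn_integral_reflect) measurable
     finally show "(NN y. ennreal (rk (x - y) * rk (x' - y))) = rk2 (x - x')" .
    qed
    finally show "(NN y. (NN x'. ennreal (rk (x - y) * rk (x' - y)) * indicator E x')) = (NN x'. rk2 (x - x') * indicator E x')" .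
   qed
   also have "\<dots> \<le> (NN x. ennreal (t * ?B) * indicator E x)"
    by (intro nn_integral_mono mult_right_mono C(2)[OF E t]) simp
   also have "\<dots> = ennreal (t * (t * ?B))"
    by (subst nn_integral_cmult_indicator) (use t a C in \<open>auto simp: ennreal_mult[symmetric] mult_ac\<close>)
   finally show ?thesis .
  qed
  have "?I^2 \<le> (NN y. (ennreal \<bar>g y\<bar>)^2) * (NN y. (K y)^2)"
   unfolding I by (rule Cauchy_Schwarz_nn_integral) measurable
  also have "(NN y. (ennreal \<bar>g y\<bar>)^2) = (NN y. ennreal ((g y)^2))"
   by (simp add: ennreal_power)
  also have "\<dots> * (NN y. (K y)^2) \<le> ennreal D * ennreal (t * (t * ?B))"
   by (intro mult_mono D KK) auto
  also have "\<dots> = (ennreal (t * sqrt (D * ?B)))^2"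
   using D t a C by (simp add: ennreal_mult[symmetric] ennreal_power power_mult_distrib) (simp add: power2_eq_square mult_ac)
  finally have I2: "?I^2 \<le> (ennreal (t * sqrt (D * ?B)))^2" .
  have "?I \<le> ennreal (t * sqrt (D * ?B))"
   by (rule ennreal_square_leD[OF I2]) (use t D a C in auto)
  then show "?I \<le> ennreal (t * sqrt (D * (1 / (1 - 1 / M)^2 / (32 * pi^2) * max 0 (ln (1 / t)) + C)))"
   by (simp add: a_def)
 qed
qed

text \<open>The density \<open>g\<close> carries the quantity compared with the critical constant,
  while \<open>C0\<close> absorbs a bounded part of arbitrary size. Finite level sets are included
  so that their measures are real numbers.\<close>

definition pot_dominated :: "real \<Rightarrow> real \<Rightarrow> (R4 \<Rightarrow> real) \<Rightarrow> bool" where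
 "pot_dominated C0 D u \<longleftrightarrow> u \<in> borel_measurable borel \<and>
   (\<forall>s>0. emeasure lborel {x. s < \<bar>u x\<bar>} < \<infinity>) \<and>
   (\<exists>g \<in> borel_measurable borel. (NN x. ennreal ((g x)^2)) \<le> ennreal D \<and>
    (AE x in lborel. ennreal \<bar>u x\<bar> \<le> ennreal C0 + (NN y. ennreal (\<bar>g y\<bar> * rk (x - y)))))"

text \<open>On the level set E of measure t, integrating |u| > s over E gives s t <= C0 t + t sqrt(D
  (a ln(1/t) + C)). Solving for t yields Gaussian decay in s with every rate below 1/(a D).\<close>

lemma adams_level_sets:
 assumes D: "D > 0" and \<beta>: "\<beta> > 0" "\<beta> * D < 32 * pi^2" and C0: "C0 \<ge> 0"
 obtains A s0 where "A > 0" "s0 > 0"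
  "\<And>u s. pot_dominated C0 D u \<Longrightarrow> s \<ge> s0 \<Longrightarrow> emeasure lborel {x. s < \<bar>u x\<bar>} \<le> ennreal (A * exp (- \<beta> * s^2))"
proof -
 \<comment> \<open>As M grows the kernel constant tends to 1/(32 pi^2), so the strict inequality
   between \<open>\<beta> * D\<close> and \<open>32 * pi^2\<close> leaves room for a finite
   M.\<close>
 have "((\<lambda>M. 1 / (1 - 1 / M)^2 / (32 * pi^2) * (\<beta> * D)) \<longlongrightarrow> 1 / (1 - 0)^2 / (32 * pi^2) * (\<beta> * D)) at_top"
  by (intro tendsto_intros tendsto_divide_0[OF tendsto_const] filterlim_at_top_imp_at_infinity filterlim_ident) auto
 moreover have "1 / (1 - 0)^2 / (32 * pi^2) * (\<beta> * D) < 1" using \<beta> by simp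
 ultimately have "\<forall>\<^sub>F M in at_top. 1 / (1 - 1 / M)^2 / (32 * pi^2) * (\<beta> * D) < 1"
  by (rule order_tendstoD)
 moreover have "\<forall>\<^sub>F M::real in at_top. M > 1" by (rule eventually_gt_at_top)
 ultimately have "\<forall>\<^sub>F M in at_top. M > 1 \<and> 1 / (1 - 1 / M)^2 / (32 * pi^2) * (\<beta> * D) < 1"
  by eventually_elim auto
 then obtain M where M: "M > 1" "1 / (1 - 1 / M)^2 / (32 * pi^2) * (\<beta> * D) < 1"
  using eventually_happens'[OF trivial_limit_at_top_linorder] by blast
 define a where "a = 1 / (1 - 1 / M)^2 / (32 * pi^2)"
 have a: "a > 0" "a * \<beta> * D < 1" using M by (auto simp: a_def)
 obtain C where C: "C \<ge> 0"
  "\<And>E t g D. \<lbrakk>E \<in> sets borel; emeasure lborel E = ennreal t; t > 0; g \<in> borel_measurable borel;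
    (NN x. ennreal ((g x)^2)) \<le> ennreal D; D \<ge> 0\<rbrakk> \<Longrightarrow>
   (NN x. (NN y. ennreal (\<bar>g y\<bar> * rk (x - y))) * indicator E x)
    \<le> ennreal (t * sqrt (D * (a * max 0 (ln (1 / t)) + C)))"
  using potential_set_bound[OF M(1)] unfolding a_def[symmetric] by (elim exE conjE) (rule that, auto)
 define \<gamma> where "\<gamma> = 1 / (D * a)"
 have \<gamma>: "\<gamma> > \<beta>" using a D by (simp add: \<gamma>_def field_simps)
 \<comment> \<open>Completing the square: the slack \<open>\<gamma> - \<beta>\<close> pays for the
   linear term produced by the shift \<open>C0\<close>.\<close>
 define C2 where "C2 = (\<gamma> * C0)^2 / (\<gamma> - \<beta>) + C / a"
 have C2: "\<gamma> * (s - C0)^2 - C / a \<ge> \<beta> * s^2 - C2" for s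
 proof -
  have "0 \<le> ((\<gamma> - \<beta>) * s - \<gamma> * C0)^2 / (\<gamma> - \<beta>)" using \<gamma> by simp
  also have "\<dots> = (\<gamma> - \<beta>) * s^2 - 2 * \<gamma> * C0 * s + (\<gamma> * C0)^2 / (\<gamma> - \<beta>)"
   using \<gamma> by (simp add: power2_diff add_divide_distrib diff_divide_distrib) (simp add: power2_eq_square field_simps)
  finally have "0 \<le> (\<gamma> - \<beta>) * s^2 - 2 * \<gamma> * C0 * s + (\<gamma> * C0)^2 / (\<gamma> - \<beta>)" .
  moreover have "\<gamma> * (s - C0)^2 = \<gamma> * s^2 - 2 * \<gamma> * C0 * s + \<gamma> * C0^2" by (simp add: power2_diff algebra_simps)
  moreover have "\<gamma> * C0^2 \<ge> 0" using \<gamma> \<beta> by simp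
  ultimately show ?thesis unfolding C2_def by (simp add: left_diff_distrib)
 qed
 \<comment> \<open>Large enough that \<open>\<beta> * s^2 - C2\<close> is positive for
   \<open>s \<ge> s0\<close>, which forces \<open>ln (1 / t)\<close> to be the active branch of the
   maximum.\<close>
 define s0 where "s0 = C0 + sqrt (\<bar>C2\<bar> / \<beta>) + 1"
 have s0: "s0 > 0" "s0 \<ge> C0" "\<beta> * s0^2 > C2"
 proof -
  have "sqrt (\<bar>C2\<bar> / \<beta>) \<ge> 0" using \<beta> by simp
  then show "s0 > 0" "s0 \<ge> C0" using C0 unfolding s0_def by linarith+
  have "(sqrt (\<bar>C2\<bar> / \<beta>))^2 < s0^2"
   using C0 \<beta> by (intro power_strict_mono) (auto simp: s0_def)
  then show "\<beta> * s0^2 > C2" using \<beta> by (simp add: field_simps)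
 qed
 show thesis
 proof (rule that[of "exp C2" s0])
  fix u s assume u: "pot_dominated C0 D u" and s: "s \<ge> s0"
  then obtain g where um [measurable]: "u \<in> borel_measurable borel" and fin: "\<And>s. s > 0 \<Longrightarrow> emeasure lborel {x. s < \<bar>u x\<bar>} < \<infinity>"
   and g [measurable]: "g \<in> borel_measurable borel" "(NN x. ennreal ((g x)^2)) \<le> ennreal D"
   and ug: "AE x in lborel. ennreal \<bar>u x\<bar> \<le> ennreal C0 + (NN y. ennreal (\<bar>g y\<bar> * rk (x - y)))"
   unfolding pot_dominated_def by blast
  define E where "E = {x. s < \<bar>u x\<bar>}"
  have E [measurable]: "E \<in> sets borel" unfolding E_def by measurable
  define t where "t = measure lborel E"
  have t: "emeasure lborel E = ennreal t" unfolding t_def using fin[of s] s s0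
   by (intro emeasure_eq_ennreal_measure) (auto simp: E_def)
  show "emeasure lborel {x. s < \<bar>u x\<bar>} \<le> ennreal (exp C2 * exp (- \<beta> * s^2))"
  proof (cases "t > 0")
   case False
   then have "emeasure lborel E = 0" using t by (simp add: ennreal_neg)
   then show ?thesis by (simp add: E_def)
  next
   case True
   define \<l> where "\<l> = max 0 (ln (1 / t))"
   have "ennreal (s * t) = (NN x. ennreal s * indicator E x)"
    using t s s0 True by (simp add: nn_integral_cmult_indicator ennreal_mult)
   also have "\<dots> \<le> (NN x. ennreal C0 * indicator E x + (NN y. ennreal (\<bar>g y\<bar> * rk (x - y))) * indicator E x)"
   proof (rule nn_integral_mono_AE, use ug in eventually_elim)
    case (elim x)
    show ?case
    proof (cases "x \<in> E")
     case True
     then have "ennreal s \<le> ennreal \<bar>u x\<bar>" by (auto simp: E_def intro: ennreal_leI)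
     also note elim
     finally show ?thesis using True by simp
    qed simp
   qed
   also have "\<dots> = ennreal C0 * ennreal t + (NN x. (NN y. ennreal (\<bar>g y\<bar> * rk (x - y))) * indicator E x)"
    by (subst nn_integral_add) (auto simp: nn_integral_cmult_indicator t)
   also have "\<dots> \<le> ennreal C0 * ennreal t + ennreal (t * sqrt (D * (a * \<l> + C)))"
    unfolding \<l>_def using D by (intro add_left_mono C(2)[OF E t True g]) simp
   also have "\<dots> = ennreal (t * (C0 + sqrt (D * (a * \<l> + C))))"
    using True C0 D a C by (simp flip: ennreal_mult ennreal_plus add: \<l>_def algebra_simps)
   finally have "s * t \<le> t * (C0 + sqrt (D * (a * \<l> + C)))"
    using True C0 D a C by (subst (asm) ennreal_le_iff) (auto simp: \<l>_def)
   then have "s - C0 \<le> sqrt (D * (a * \<l> + C))" using True by (simp add: mult.commute)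
   then have "(s - C0)^2 \<le> D * (a * \<l> + C)"
    using power_mono[of "s - C0" "sqrt (D * (a * \<l> + C))" 2] s s0 D a C by (simp add: \<l>_def)
   then have "\<gamma> * (s - C0)^2 \<le> \<l> + C / a"
    using D a by (simp add: \<gamma>_def field_simps)
   then have le: "\<beta> * s^2 - C2 \<le> \<l>" using C2[of s] by linarith
   moreover have "\<beta> * s0^2 \<le> \<beta> * s^2" using s s0 \<beta> by (intro mult_left_mono power_mono) auto
   ultimately have "\<l> = ln (1 / t)" using s0 unfolding \<l>_def by linarith
   then have "\<beta> * s^2 - C2 \<le> - ln t" using le True by (simp add: ln_div)
   then have "exp (ln t) \<le> exp (C2 - \<beta> * s^2)" by simp
   then have "t \<le> exp (C2 - \<beta> * s^2)" using True by simp
   then show ?thesis using t by (simp add: E_def[symmetric] exp_diff exp_minus field_simps ennreal_leI)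
  qed
 qed (use s0 in auto)
qed

text \<open>Summing the level-set estimate over the shells \<open>j < u\<^sup>2 \<le> j + 1\<close> gives a geometric series.\<close>
lemma adams_tail:
 assumes D: "D > 0" and \<alpha>: "\<alpha> > 0" "\<alpha> * D < 32 * pi^2" and C0: "C0 \<ge> 0" and \<epsilon>: "\<epsilon> > 0"
 shows "\<exists>K>0. \<forall>u. pot_dominated C0 D u \<longrightarrow>
  (NN x. ennreal (exp (\<alpha> * (u x)^2)) * indicator {x. K < \<bar>u x\<bar>} x) \<le> ennreal \<epsilon>"
proof -
 \<comment> \<open>A rate strictly above \<open>\<alpha>\<close> makes the level sets beat the
   weight, with geometric ratio \<open>exp (- (\<beta> - \<alpha>))\<close>.\<close>
 obtain \<beta> where \<beta>: "\<alpha> < \<beta>" "\<beta> < 32 * pi^2 / D"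
  using dense[of \<alpha> "32 * pi^2 / D"] \<alpha> D by (auto simp: field_simps)
 then have \<beta>0: "\<beta> > 0" "\<beta> * D < 32 * pi^2" using \<alpha> D by (auto simp: field_simps)
 obtain A s0 where A: "A > 0" "s0 > 0"
  "\<And>u s. pot_dominated C0 D u \<Longrightarrow> s \<ge> s0 \<Longrightarrow> emeasure lborel {x. s < \<bar>u x\<bar>} \<le> ennreal (A * exp (- \<beta> * s^2))"
  by (rule adams_level_sets[OF D \<beta>0 C0]) (rule that)
 define q where "q = exp (- (\<beta> - \<alpha>))"
 have q: "0 < q" "q < 1" using \<beta> by (auto simp: q_def)
 have "(\<lambda>J. A * exp \<alpha> / (1 - q) * q ^ J) \<longlonglongrightarrow> A * exp \<alpha> / (1 - q) * 0"
  using q by (intro tendsto_intros LIMSEQ_power_zero) auto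
 then have "\<forall>\<^sub>F J in sequentially. A * exp \<alpha> / (1 - q) * q ^ J < \<epsilon>"
  using \<epsilon> by (intro order_tendstoD(2)[of _ "A * exp \<alpha> / (1 - q) * 0"]) auto
 moreover have "\<forall>\<^sub>F J in sequentially. real J \<ge> s0^2"
  using filterlim_real_sequentially by (simp add: filterlim_at_top)
 ultimately have "\<forall>\<^sub>F J in sequentially. A * exp \<alpha> / (1 - q) * q ^ J < \<epsilon> \<and> real J \<ge> s0^2"
  by eventually_elim auto
 then obtain J where J: "A * exp \<alpha> / (1 - q) * q ^ J < \<epsilon>" "real J \<ge> s0^2"
  using eventually_happens'[OF trivial_limit_sequentially] by blast
 show ?thesis
 proof (intro exI[of _ "sqrt J"] conjI allI impI)
  have "s0^2 > 0" using A by simp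
  with J show "sqrt J > 0" by (intro real_sqrt_gt_zero) linarith
  fix u assume u: "pot_dominated C0 D u"
  then have um [measurable]: "u \<in> borel_measurable borel" by (simp add: pot_dominated_def)
  have shell: "ennreal (exp (\<alpha> * (u x)^2)) * indicator {x. sqrt J < \<bar>u x\<bar>} x
    \<le> (\<Sum>j. ennreal (exp (\<alpha> * real (j + J + 1))) * indicator {x. sqrt (j + J) < \<bar>u x\<bar>} x)" for x
  proof (cases "sqrt J < \<bar>u x\<bar>")
   case True
   then have "(sqrt J)^2 < (\<bar>u x\<bar>)^2" by (intro power_strict_mono) auto
   then have 1: "real J < (u x)^2" by simp
   define j where "j = nat (\<lceil>(u x)\<^sup>2\<rceil> - 1) - J"
   have j: "real (j + J) < (u x)^2" "(u x)^2 \<le> real (j + J + 1)"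
    using 1 unfolding j_def by linarith+
   then have "sqrt (j + J) < \<bar>u x\<bar>" by (intro real_less_lsqrt) auto
   then have "ennreal (exp (\<alpha> * (u x)^2)) * indicator {x. sqrt J < \<bar>u x\<bar>} x
     \<le> ennreal (exp (\<alpha> * real (j + J + 1))) * indicator {x. sqrt (j + J) < \<bar>u x\<bar>} x"
    using True j \<alpha> by (auto intro!: ennreal_leI mult_left_mono)
   also have "\<dots> \<le> (\<Sum>j. ennreal (exp (\<alpha> * real (j + J + 1))) * indicator {x. sqrt (j + J) < \<bar>u x\<bar>} x)"
    by (rule ennreal_le_suminf)
   finally show ?thesis .
  qed simp
  have "(NN x. ennreal (exp (\<alpha> * (u x)^2)) * indicator {x. sqrt J < \<bar>u x\<bar>} x)
   \<le> (NN x. (\<Sum>j. ennreal (exp (\<alpha> * real (j + J + 1))) * indicator {x. sqrt (j + J) < \<bar>u x\<bar>} x))"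
   by (intro nn_integral_mono shell)
  also have "\<dots> = (\<Sum>j. (NN x. ennreal (exp (\<alpha> * real (j + J + 1))) * indicator {x. sqrt (j + J) < \<bar>u x\<bar>} x))"
   by (rule nn_integral_suminf) measurable
  also have "\<dots> = (\<Sum>j. ennreal (exp (\<alpha> * real (j + J + 1))) * emeasure lborel {x. sqrt (j + J) < \<bar>u x\<bar>})"
   by (intro arg_cong[where f = suminf] ext nn_integral_cmult_indicator) measurable
  also have "\<dots> \<le> (\<Sum>j. ennreal (A * exp \<alpha> * q ^ J * q ^ j))"
  proof (intro suminf_le)
   fix j
   have "s0 \<le> sqrt (j + J)" using J(2) A(2) by (intro real_le_rsqrt) auto
   from A(3)[OF u this] have "ennreal (exp (\<alpha> * real (j + J + 1))) * emeasure lborel {x. sqrt (j + J) < \<bar>u x\<bar>}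
     \<le> ennreal (exp (\<alpha> * real (j + J + 1))) * ennreal (A * exp (- \<beta> * (sqrt (j + J))^2))"
    by (intro mult_left_mono) auto
   also have "\<dots> = ennreal (A * exp \<alpha> * q ^ J * q ^ j)"
   proof -
    have "exp (\<alpha> * real (j + J + 1)) * exp (- \<beta> * (sqrt (j + J))^2) = exp \<alpha> * q ^ J * q ^ j"
     unfolding q_def by (simp flip: exp_add exp_of_nat_mult add: algebra_simps)
    then have "exp (\<alpha> * real (j + J + 1)) * (A * exp (- \<beta> * (sqrt (j + J))^2)) = A * exp \<alpha> * q ^ J * q ^ j"
     by (metis mult.assoc mult.left_commute)
    then show ?thesis using A(1) by (simp only: ennreal_mult[symmetric] exp_ge_zero mult_nonneg_nonneg less_imp_le)
   qed
   finally show "ennreal (exp (\<alpha> * real (j + J + 1))) * emeasure lborel {x. sqrt (j + J) < \<bar>u x\<bar>}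
     \<le> ennreal (A * exp \<alpha> * q ^ J * q ^ j)" .
  qed auto
  also have "\<dots> = ennreal (\<Sum>j. A * exp \<alpha> * q ^ J * q ^ j)"
   using A q by (intro suminf_ennreal2 summable_mult summable_geometric) auto
  also have "(\<Sum>j. A * exp \<alpha> * q ^ J * q ^ j) = A * exp \<alpha> / (1 - q) * q ^ J"
   using q by (subst suminf_mult) (auto simp: suminf_geometric intro!: summable_geometric)
  also have "ennreal \<dots> \<le> ennreal \<epsilon>" using J by (intro ennreal_leI) simp
  finally show "(NN x. ennreal (exp (\<alpha> * (u x)^2)) * indicator {x. sqrt J < \<bar>u x\<bar>} x) \<le> ennreal \<epsilon>" .
 qed
qed

section \<open>Test functions\<close>

lemma sm_diff: "sm f \<Longrightarrow> sm g \<Longrightarrow> sm (\<lambda>x. f x - g x)"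
 using sm_add[of f "\<lambda>x. (- 1) * g x"] sm_mult[OF sm_const[of "-1"], of g] by simp

lemma sm_sum: "finite I \<Longrightarrow> (\<And>i. i \<in> I \<Longrightarrow> sm (f i)) \<Longrightarrow> sm (\<lambda>x. \<Sum>i\<in>I. f i x)"
 by (induction I rule: finite_induct) (auto intro: sm_const sm_add)

lemma sm_prod: "finite I \<Longrightarrow> (\<And>i. i \<in> I \<Longrightarrow> sm (f i)) \<Longrightarrow> sm (\<lambda>x. \<Prod>i\<in>I. f i x)"
 by (induction I rule: finite_induct) (auto intro: sm_const sm_mult)

lemma norm_sq_R4: "(norm (x::R4))^2 = (\<Sum>i\<in>UNIV. (x $ i)\<^sup>2)"
 unfolding power2_norm_eq_inner by (simp add: inner_vec_def power2_eq_square)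

lemma sm_norm_sq: "sm (\<lambda>y. (norm (x - y))^2)"
 unfolding norm_sq_R4 unfolding power2_eq_square vector_minus_component
 by (intro sm_sum) (auto intro!: sm_mult sm_diff[OF sm_const sm_coord])

lemma test_fun_continuous: "test_fun f \<Longrightarrow> continuous_on UNIV f"
 by (simp add: test_fun_def smooth_fun_continuous)

lemma test_fun_meas: "test_fun f \<Longrightarrow> f \<in> borel_measurable borel"
 by (simp add: test_fun_continuous borel_measurable_continuous_onI)

lemma test_fun_support:
 assumes "test_fun f"
 obtains B R where "B \<ge> 0" "R > 0" "\<And>x. \<bar>f x\<bar> \<le> B * indicator (cball 0 R) x"
proof -
 obtain R where R: "R > 0" "\<And>x. f x \<noteq> 0 \<Longrightarrow> norm x \<le> R"
  using assms unfolding test_fun_def bounded_pos by auto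
 have "compact (f ` cball 0 R)"
  using test_fun_continuous[OF assms] continuous_on_subset by (intro compact_continuous_image) auto
 then obtain B where B: "\<And>x. x \<in> cball 0 R \<Longrightarrow> \<bar>f x\<bar> \<le> B"
  unfolding bounded_iff using compact_imp_bounded bounded_iff by (metis imageI real_norm_def)
 show thesis
  by (rule that[of "max B 0" R]) (use R B in \<open>fastforce simp: le_max_iff_disj split: split_indicator\<close>)+
qed

lemma integrable_indicator_bounded: "bounded A \<Longrightarrow> A \<in> sets borel \<Longrightarrow> integrable lborel (indicator A :: 'a::euclidean_space \<Rightarrow> real)"
 using emeasure_bounded_finite[of A] by (simp add: less_top)

lemma sqint_bounded_support:
 assumes "f \<in> borel_measurable borel" "\<And>x. \<bar>f x\<bar> \<le> B * indicator (cball a R) x"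
 shows "sqint f"
proof -
 have "(\<lambda>x. (B * indicator (cball a R) x)^2) = (\<lambda>x. B^2 * indicator (cball a R) x)"
  by (auto split: split_indicator)
 then have "sqint (\<lambda>x. B * indicator (cball a R) x)"
  unfolding sqint_def by (auto intro!: integrable_indicator_bounded borel_measurable_times borel_measurable_indicator simp del: mult_cancel_left)
 then show ?thesis
  by (rule sqint_bound) (use assms in \<open>auto intro: order_trans[OF _ abs_ge_self]\<close>)
qed

lemma test_fun_sqint: "test_fun f \<Longrightarrow> sqint f"
 by (meson test_fun_support sqint_bounded_support test_fun_meas)

lemma En_tendsto_1: "x > 0 \<Longrightarrow> (\<lambda>n. En 1 (real n * x)) \<longlonglongrightarrow> 1"
proof -
 assume x: "x > 0"
 have "(\<lambda>n. exp (- (1 / x) * (1 / real n))) \<longlonglongrightarrow> exp (- (1/x) * 0)"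
  by (intro tendsto_intros lim_1_over_n)
 then have "(\<lambda>n. exp (- (1 / x) * (1 / real n))) \<longlonglongrightarrow> 1" by simp
 then show ?thesis
  by (rule Lim_transform_eventually) (use x in \<open>auto simp: En_def intro!: eventually_sequentiallyI[of 1]\<close>)
qed

lemma En_1_bounds: "0 \<le> En 1 x" "En 1 x \<le> 1"
 by (auto simp: En_def)

lemma test_fun_mult_bounded:
 assumes "sm f" "\<And>x. f x \<noteq> 0 \<Longrightarrow> norm x \<le> R" shows "test_fun f"
 using assms by (auto simp: test_fun_def smooth_fun_iff_sm bounded_iff)

text \<open>Products of the functions \<open>En 1\<close> in each coordinate increase to indicators
  of boxes, so \<open>h\<close> has integral 0 over every box. Its positive and negative parts are
  then measures agreeing on an intersection-stable generator.\<close>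

lemma fundamental_lemma:
 fixes h :: "R4 \<Rightarrow> real"
 assumes h [measurable]: "h \<in> borel_measurable borel"
  and loc: "\<And>R. integrable lborel (\<lambda>x. h x * indicator (cball 0 R) x)"
  and z: "\<And>\<psi>. test_fun \<psi> \<Longrightarrow> (LBINT x. h x * \<psi> x) = 0"
 shows "AE x in lborel. h x = 0"
proof -
 have box0: "(LBINT x. h x * indicator (box a b) x) = 0" for a b
 proof -
  define \<psi> where "\<psi> n x = (\<Prod>i\<in>UNIV. En 1 (real n * (x $ i - a $ i)) * En 1 (real n * (b $ i - x $ i)))" for n and x :: R4
  obtain R where R: "box a b \<subseteq> cball 0 R"
   using bounded_box[of a b] unfolding bounded_iff by (auto simp: subset_eq)
  have box: "x \<in> box a b \<longleftrightarrow> (\<forall>i. a $ i < x $ i \<and> x $ i < b $ i)" for x by (simp add: mem_box_cart)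
  have out: "\<psi> n x = 0" if "x \<notin> box a b" for n x
  proof -
   have "\<exists>i. \<not> (a $ i < x $ i \<and> x $ i < b $ i)" using that unfolding box by simp
   then obtain i where "\<not> (a $ i < x $ i \<and> x $ i < b $ i)" ..
   then have "En 1 (real n * (x $ i - a $ i)) * En 1 (real n * (b $ i - x $ i)) = 0"
    by (auto simp: En_def zero_less_mult_iff)
   then show ?thesis unfolding \<psi>_def by (intro prod_zero) auto
  qed
  have test: "test_fun (\<psi> n)" for n
  proof (rule test_fun_mult_bounded)
   show "sm (\<psi> n)" unfolding \<psi>_def
    by (intro sm_prod sm_mult sm_En sm_diff sm_const sm_coord) auto
   show "norm x \<le> R" if "\<psi> n x \<noteq> 0" for x using out[of x n] that R by (metis mem_cball_0 subsetD)
  qed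
  have le1: "\<bar>\<psi> n x\<bar> \<le> 1" for n x
   unfolding \<psi>_def abs_prod using En_1_bounds by (intro prod_le_1) (auto simp: abs_mult mult_le_one)
  have lim: "(\<lambda>n. \<psi> n x) \<longlonglongrightarrow> indicator (box a b) x" for x
  proof (cases "x \<in> box a b")
   case True
   have "(\<lambda>n. \<psi> n x) \<longlonglongrightarrow> (\<Prod>i\<in>(UNIV::4 set). 1 * 1)"
    unfolding \<psi>_def using True by (intro tendsto_prod tendsto_mult En_tendsto_1) (auto simp: box)
   then show ?thesis using True by simp
  qed (simp add: out)
  have "(\<lambda>n. (LBINT x. h x * \<psi> n x)) \<longlonglongrightarrow> (LBINT x. h x * indicator (box a b) x)"
  proof (rule integral_dominated_convergence[where w = "\<lambda>x. \<bar>h x * indicator (cball 0 R) x\<bar>"])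
   have [measurable]: "\<psi> n \<in> borel_measurable borel" for n by (rule test_fun_meas[OF test])
   show "(\<lambda>x. h x * \<psi> n x) \<in> borel_measurable lborel" for n by measurable
   show "integrable lborel (\<lambda>x. \<bar>h x * indicator (cball 0 R) x\<bar>)" using loc by simp
   show "AE x in lborel. (\<lambda>n. h x * \<psi> n x) \<longlonglongrightarrow> h x * indicator (box a b) x"
    by (intro AE_I2 tendsto_intros lim)
   show "AE x in lborel. norm (h x * \<psi> n x) \<le> \<bar>h x * indicator (cball 0 R) x\<bar>" for n
   proof (intro AE_I2)
    fix x show "norm (h x * \<psi> n x) \<le> \<bar>h x * indicator (cball 0 R) x\<bar>"
     using le1[of n x] out[of x n] R by (cases "x \<in> box a b") (auto simp: abs_mult mult_left_le)
   qed
  qed measurable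
  then show ?thesis using z[OF test] by (simp add: LIMSEQ_const_iff)
 qed
 have "AE x in lborel. x \<in> box (- N) N \<longrightarrow> h x = 0" for N :: R4
 proof -
  \<comment> \<open>Cutting off to a bounded box makes both measures finite, as uniqueness on a
    generator demands.\<close>
  define k where "k x = h x * indicator (box (- N) N) x" for x
  have [measurable]: "k \<in> borel_measurable borel" unfolding k_def by measurable
  obtain R where R: "box (- N) N \<subseteq> cball 0 R"
   using bounded_box[of "-N" N] unfolding bounded_iff by (auto simp: subset_eq)
  have ki: "integrable lborel k"
  proof (rule Bochner_Integration.integrable_bound[OF loc[of R]])
   have "\<bar>k x\<bar> \<le> \<bar>h x * indicator (cball 0 R) x\<bar>" for x
    using R by (cases "x \<in> box (- N) N") (auto simp: k_def)
   then show "AE x in lborel. norm (k x) \<le> norm (h x * indicator (cball 0 R) x)" by simp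
  qed simp
  define P where "P = density lborel (\<lambda>x. ennreal (k x))"
  define Q where "Q = density lborel (\<lambda>x. ennreal (- k x))"
  have PQ: "P = Q"
  proof (rule measure_eqI_generator_eq[where E = "range (\<lambda>(a, b). box a b :: R4 set)" and \<Omega> = UNIV
     and A = "\<lambda>n. box (- (\<chi> i. real n)) (\<chi> i. real n)"])
   show "Int_stable (range (\<lambda>(a, b). box a b :: R4 set))"
    by (auto simp: Int_stable_def box_Int_box)
   show "sets P = sigma_sets UNIV (range (\<lambda>(a, b). box a b))" "sets Q = sigma_sets UNIV (range (\<lambda>(a, b). box a b))"
    unfolding P_def Q_def by (auto simp: borel_eq_box)
   show "(\<Union>n. box (- (\<chi> i. real n)) (\<chi> i. real n)) = (UNIV :: R4 set)"
   proof -
    have "\<exists>n. \<forall>i. - real n < x $ i \<and> x $ i < real n" for x :: R4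
    proof -
     obtain n where n: "norm x < real n" using reals_Archimedean2 by blast
     have "\<bar>x $ i\<bar> < real n" for i using component_le_norm_cart[of x i] n by linarith
     then show ?thesis by (intro exI[of _ n]) (auto simp: abs_less_iff minus_less_iff)
    qed
    then show ?thesis by (auto simp: mem_box_cart)
   qed
   have eq: "emeasure P X = emeasure Q X \<and> emeasure P X < \<infinity>" if "X \<in> range (\<lambda>(a, b). box a b)" for X
   proof -
    from that obtain a b where X: "X = box a b" by auto
    obtain c d where cd: "box (- N) N \<inter> X = box c d" unfolding X box_Int_box by blast
    have [measurable]: "X \<in> sets borel" by (simp add: X)
    have i: "integrable lborel (\<lambda>x. k x * indicator X x)"
     by (rule Bochner_Integration.integrable_bound[OF ki]) (auto split: split_indicator)
    have "(LBINT x. k x * indicator X x) = (LBINT x. h x * indicator (box c d) x)"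
     unfolding k_def cd[symmetric] by (intro Bochner_Integration.integral_cong) (auto split: split_indicator)
    then have 0: "(LBINT x. k x * indicator X x) = 0" by (simp add: box0)
    have P: "emeasure P X = (NN x. ennreal (k x * indicator X x))" "emeasure Q X = (NN x. ennreal (- (k x * indicator X x)))"
     unfolding P_def Q_def by (subst emeasure_density; auto intro!: nn_integral_cong split: split_indicator)+
    have fin: "emeasure P X < \<infinity>" "emeasure Q X < \<infinity>" unfolding P
     using i unfolding real_integrable_def by (auto simp: less_top infinity_ennreal_def)
    have "enn2real (emeasure P X) = enn2real (emeasure Q X)"
     using real_lebesgue_integral_def[OF i] 0 unfolding P by simp
    moreover have "ennreal (enn2real (emeasure P X)) = emeasure P X" "ennreal (enn2real (emeasure Q X)) = emeasure Q X"
     using fin by (auto simp: less_top)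
    ultimately show ?thesis using fin(1) by (metis (no_types))
   qed
   show "emeasure P X = emeasure Q X" if "X \<in> range (\<lambda>(a, b). box a b)" for X using eq[OF that] by simp
   show "emeasure P (box (- (\<chi> i. real n)) (\<chi> i. real n)) \<noteq> \<infinity>" for n
    using eq[OF rangeI, of "(- (\<chi> i. real n), \<chi> i. real n)"] by auto
  qed auto
  \<comment> \<open>On the set where \<open>c * k\<close> is positive one of the two densities
    vanishes, so by equality the other integrates to 0 there.\<close>
  have ae: "AE x in lborel. \<not> 0 < c * k x" if c: "c = 1 \<or> c = -1" for c
  proof -
   let ?A = "{x. 0 < c * k x}"
   have "(NN x. ennreal (c * k x) * indicator ?A x) = (NN x. ennreal (- (c * k x)) * indicator ?A x)"
    using arg_cong[OF PQ, of "\<lambda>M. emeasure M ?A"] c unfolding P_def Q_def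
    by (auto simp: emeasure_density)
   also have "\<dots> = (\<integral>\<^sup>+x. 0 \<partial>(lborel::R4 measure))"
    by (intro nn_integral_cong) (auto simp: ennreal_neg split: split_indicator)
   finally have "(NN x. ennreal (c * k x) * indicator ?A x) = 0" by simp
   then have "AE x in lborel. ennreal (c * k x) * indicator ?A x = 0"
    by (subst (asm) nn_integral_0_iff_AE) auto
   then show ?thesis by eventually_elim (auto split: split_indicator_asm)
  qed
  have "AE x in lborel. k x = 0" using ae[of 1] ae[of "-1"] by (auto elim: AE_mp)
  then show ?thesis by eventually_elim (auto simp: k_def)
 qed
 then have "AE x in lborel. \<forall>n::nat. x \<in> box (- (\<chi> i. real n)) (\<chi> i. real n) \<longrightarrow> h x = 0"
  by (subst AE_all_countable) blast
 then show ?thesis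
 proof eventually_elim
  case (elim x)
  obtain n where n: "norm x < real n" using reals_Archimedean2 by blast
  have "\<bar>x $ i\<bar> < real n" for i using component_le_norm_cart[of x i] n by linarith
  then have "x \<in> box (- (\<chi> i. real n)) (\<chi> i. real n)" by (auto simp: mem_box_cart abs_less_iff minus_less_iff)
  then show ?case using elim by blast
 qed
qed

text \<open>A cut-off in the squared radius q: value 1 at q = 0 thanks to the factor
  \<open>exp 1\<close>, and 0 from q = s on. The functions \<open>chi1\<close> and
  \<open>chi2\<close> are its derivatives in q.\<close>

definition chi :: "real \<Rightarrow> real \<Rightarrow> real" where
 "chi s q = exp 1 * En 1 (1 - (q / s)\<^sup>2)"
definition chi1 :: "real \<Rightarrow> real \<Rightarrow> real" where
 "chi1 s q = exp 1 * (En (En_deriv 1) (1 - (q / s)\<^sup>2) * (- 2 * q / s^2))"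
definition chi2 :: "real \<Rightarrow> real \<Rightarrow> real" where
 "chi2 s q = exp 1 * (En (En_deriv (En_deriv 1)) (1 - (q / s)\<^sup>2) * (2 * q / s^2)^2 - 2 / s^2 * En (En_deriv 1) (1 - (q / s)\<^sup>2))"

lemma chi_deriv: "s > 0 \<Longrightarrow> (chi s has_real_derivative chi1 s q) (at q)"
 unfolding chi_def[abs_def] chi1_def
 by (auto intro!: derivative_eq_intros DERIV_chain2[OF En_has_deriv] simp: power2_eq_square)

lemma chi1_deriv: "s > 0 \<Longrightarrow> (chi1 s has_real_derivative chi2 s q) (at q)"
 unfolding chi1_def[abs_def] chi2_def
 by (auto intro!: derivative_eq_intros DERIV_chain2[OF En_has_deriv] simp: power2_eq_square) (simp add: field_simps)?

lemma chi_0: "chi s 0 = 1" by (simp add: chi_def En_def flip: exp_add)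

lemma chi_bounds: "0 \<le> chi s q" "chi s q \<le> 1"
proof -
 show "0 \<le> chi s q" by (simp add: chi_def En_1_bounds)
 have "En 1 (1 - (q / s)\<^sup>2) \<le> exp (- 1)"
  by (auto simp: En_def le_divide_eq)
 then have "exp 1 * En 1 (1 - (q / s)\<^sup>2) \<le> exp 1 * exp (- 1)" by (intro mult_left_mono) auto
 then show "chi s q \<le> 1" by (simp add: chi_def flip: exp_add)
qed

lemma chi_support: "s > 0 \<Longrightarrow> q \<ge> s \<Longrightarrow> chi s q = 0 \<and> chi1 s q = 0 \<and> chi2 s q = 0"
proof -
 assume "s > 0" "q \<ge> s"
 then have "1 \<le> (q / s)^2" by (simp add: one_le_power)
 then have "\<not> 1 - (q / s)\<^sup>2 > 0" by simp
 then show ?thesis by (simp add: chi_def chi1_def chi2_def En_def)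
qed

lemma En_bounded: "\<exists>C\<ge>0. \<forall>x\<le>1. \<bar>En p x\<bar> \<le> C"
proof -
 have "compact (En p ` {0..1})"
  by (intro compact_continuous_image) (auto intro!: continuous_intros)
 then obtain C where C: "\<And>x. x \<in> {0..1} \<Longrightarrow> \<bar>En p x\<bar> \<le> C"
  using compact_imp_bounded bounded_iff by (metis imageI real_norm_def)
 have "\<bar>En p x\<bar> \<le> C" if "x \<le> 1" for x
  using C[of x] C[of 0] that by (cases "x > 0") (auto simp: En_def)
 moreover have "0 \<le> C" using order_trans[OF abs_ge_zero C[of 0]] by simp
 ultimately show ?thesis by blast
qed

text \<open>The bound is linear in \<open>q\<close>, not merely constant: the extra factor is what
  cancels a singular denominator in \<open>kb_bound\<close>.\<close>

lemma chi1_bounds: "s > 0 \<Longrightarrow> \<exists>C\<ge>0. \<forall>q\<ge>0. \<bar>chi1 s q\<bar> \<le> C * q"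
proof -
 assume s: "s > 0"
 obtain C where C: "C \<ge> 0" "\<And>x. x \<le> 1 \<Longrightarrow> \<bar>En (En_deriv 1) x\<bar> \<le> C" using En_bounded by blast
 show ?thesis
 proof (intro exI[of _ "exp 1 * (C * (2 / s^2))"] conjI allI impI)
  fix q :: real assume q: "q \<ge> 0"
  have "\<bar>chi1 s q\<bar> = exp 1 * (\<bar>En (En_deriv 1) (1 - (q / s)\<^sup>2)\<bar> * (2 / s^2 * q))"
   using q by (simp add: chi1_def abs_mult)
  also have "\<dots> \<le> exp 1 * (C * (2 / s^2 * q))"
   using q C by (intro mult_left_mono mult_right_mono) auto
  finally show "\<bar>chi1 s q\<bar> \<le> exp 1 * (C * (2 / s^2)) * q" by simp
 qed (use C in auto)
qed

text \<open>The constant does not depend on \<open>s\<close>, and the explicit factor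
  \<open>1 / s^2\<close> is exactly compensated by the volume of the ball of radius sqrt s. This
  makes the L1 norms of \<open>kS s\<close> uniformly bounded.\<close>

lemma chi2_bounds: "\<exists>C\<ge>0. \<forall>s>0. \<forall>q\<ge>0. \<bar>chi2 s q\<bar> \<le> C / s^2 * indicator {..<s} q"
proof -
 obtain C1 where C1: "C1 \<ge> 0" "\<And>x. x \<le> 1 \<Longrightarrow> \<bar>En (En_deriv 1) x\<bar> \<le> C1" using En_bounded by blast
 obtain C2 where C2: "C2 \<ge> 0" "\<And>x. x \<le> 1 \<Longrightarrow> \<bar>En (En_deriv (En_deriv 1)) x\<bar> \<le> C2" using En_bounded by blast
 show ?thesis
 proof (intro exI[of _ "exp 1 * (C2 * 4 + 2 * C1)"] conjI allI impI)
  fix s q :: real assume s: "s > 0" and q: "q \<ge> 0"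
  show "\<bar>chi2 s q\<bar> \<le> exp 1 * (C2 * 4 + 2 * C1) / s^2 * indicator {..<s} q"
  proof (cases "q < s")
   case True
   have "(2 * q / s^2)^2 \<le> (2 * s / s^2)^2" using s q True by (intro power_mono divide_right_mono) auto
   also have "\<dots> = 4 / s^2" using s by (simp add: power2_eq_square)
   finally have "\<bar>En (En_deriv (En_deriv 1)) (1 - (q / s)\<^sup>2) * (2 * q / s^2)^2\<bar> \<le> C2 * (4 / s^2)"
    unfolding abs_mult using C2 by (intro mult_mono) auto
   moreover have "\<bar>2 / s^2 * En (En_deriv 1) (1 - (q / s)\<^sup>2)\<bar> \<le> 2 / s^2 * C1"
    unfolding abs_mult using C1 by (intro mult_mono) auto
   ultimately have "\<bar>En (En_deriv (En_deriv 1)) (1 - (q / s)\<^sup>2) * (2 * q / s^2)^2 - 2 / s^2 * En (En_deriv 1) (1 - (q / s)\<^sup>2)\<bar> \<le> (C2 * 4 + 2 * C1) / s^2"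
    by (intro order_trans[OF abs_triangle_ineq4]) (simp add: add_divide_distrib)
   then have "exp 1 * \<bar>En (En_deriv (En_deriv 1)) (1 - (q / s)\<^sup>2) * (2 * q / s^2)^2 - 2 / s^2 * En (En_deriv 1) (1 - (q / s)\<^sup>2)\<bar> \<le> exp 1 * ((C2 * 4 + 2 * C1) / s^2)"
    by (intro mult_left_mono) auto
   then show ?thesis using True by (simp add: chi2_def abs_mult)
  qed (use chi_support[OF s] in auto)
 qed (use C1 C2 in auto)
qed

lemma sm_chi: "sm f \<Longrightarrow> sm (\<lambda>x. chi s (f x))"
 unfolding chi_def power2_eq_square divide_inverse by (intro sm_mult sm_En sm_diff sm_const)

lemma sm_chi2: "sm f \<Longrightarrow> sm (\<lambda>x. chi2 s (f x))"
 unfolding chi2_def power2_eq_square divide_inverse by (intro sm_mult sm_En sm_diff sm_const)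

definition lapl :: "(R4 \<Rightarrow> real) \<Rightarrow> R4 \<Rightarrow> real" where
 "lapl \<phi> x = (\<Sum>i\<in>UNIV. iter_partial [i, i] \<phi> x)"

lemma norm_sq_line_deriv:
 "((\<lambda>t. (norm (x - (y + t *\<^sub>R axis i 1)))^2) has_real_derivative - 2 * (x - y) $ i) (at 0)"
proof -
 have "(norm (x - (y + t *\<^sub>R axis i 1)))^2 = (norm (x - y))^2 - 2 * t * (x - y) $ i + t^2" for t
 proof -
  have "x - (y + t *\<^sub>R axis i 1) = (x - y) - t *\<^sub>R axis i (1::real)" by simp
  then show ?thesis
   by (simp only: power2_norm_eq_inner inner_diff_left inner_diff_right inner_scaleR_left inner_scaleR_right)
     (simp add: inner_axis inner_axis' inner_commute power2_eq_square algebra_simps)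
 qed
 then show ?thesis by (simp only:) (auto intro!: derivative_eq_intros)
qed

text \<open>The coefficient 8 is twice the dimension. Assuming derivatives for
  \<open>q > - \<delta>\<close> supplies two-sided ones at \<open>q = 0\<close>, the value taken at
  \<open>y = x\<close>.\<close>

lemma lapl_radial:
 assumes d: "\<delta> > 0" and B: "\<And>q. q > - \<delta> \<Longrightarrow> (B has_real_derivative B1 q) (at q)"
  "\<And>q. q > - \<delta> \<Longrightarrow> (B1 has_real_derivative B2 q) (at q)"
 shows "lapl (\<lambda>y. B ((norm (x - y))^2)) y = 4 * (norm (x - y))^2 * B2 ((norm (x - y))^2) + 8 * B1 ((norm (x - y))^2)"
proof -
 have q: "(norm (x - y))^2 > - \<delta>" for y using d zero_le_power2[of "norm (x - y)"] by linarith
 have 1: "partial_dir i (\<lambda>y. B ((norm (x - y))^2)) = (\<lambda>y. B1 ((norm (x - y))^2) * (- 2 * (x - y) $ i))" for i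
  by (rule partial_dir_eqI, rule DERIV_chain2[OF _ norm_sq_line_deriv]) (use B q in auto)
 have 2: "partial_dir i (\<lambda>y. B1 ((norm (x - y))^2) * (- 2 * (x - y) $ i)) =
  (\<lambda>y. B1 ((norm (x - y))^2) * 2 + B2 ((norm (x - y))^2) * (- 2 * (x - y) $ i) * (- 2 * (x - y) $ i))" for i
 proof (rule partial_dir_eqI)
  fix y
  have "((\<lambda>t. B1 ((norm (x - (y + t *\<^sub>R axis i 1)))^2)) has_real_derivative B2 ((norm (x - y))^2) * (- 2 * (x - y) $ i)) (at 0)"
   by (rule DERIV_chain2[OF _ norm_sq_line_deriv]) (use B q in auto)
  moreover have "((\<lambda>t. - 2 * (x - (y + t *\<^sub>R axis i 1)) $ i) has_real_derivative 2) (at 0)"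
   by (auto intro!: derivative_eq_intros simp: axis_def)
  ultimately show "((\<lambda>t. B1 ((norm (x - (y + t *\<^sub>R axis i 1)))^2) * (- 2 * (x - (y + t *\<^sub>R axis i 1)) $ i)) has_real_derivative
   B1 ((norm (x - y))^2) * 2 + B2 ((norm (x - y))^2) * (- 2 * (x - y) $ i) * (- 2 * (x - y) $ i)) (at 0)"
   by (rule DERIV_cong[OF DERIV_mult]) simp
 qed
 have "lapl (\<lambda>y. B ((norm (x - y))^2)) y = (\<Sum>i\<in>UNIV. B1 ((norm (x - y))^2) * 2 + 4 * B2 ((norm (x - y))^2) * ((x - y) $ i)^2)"
  unfolding lapl_def iter_partial.simps 1 2
  by (intro sum.cong refl) (simp add: power2_eq_square algebra_simps)
 also have "\<dots> = 4 * (norm (x - y))^2 * B2 ((norm (x - y))^2) + 8 * B1 ((norm (x - y))^2)"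
  by (simp add: sum.distrib norm_sq_R4[of "x - y"] sum_distrib_left[symmetric])
 finally show ?thesis .
qed

text \<open>Young's inequality for an integrable kernel acting on square integrable functions: write
  the kernel as a product of two square roots, apply Cauchy-Schwarz, then exchange the
  integrals.\<close>

lemma young_nn:
 assumes [measurable]: "k \<in> borel_measurable borel" "u \<in> borel_measurable borel"
  and k: "(NN z. ennreal (k z)) \<le> ennreal c" "\<And>z. 0 \<le> k z" and c: "0 \<le> c"
 shows "(NN x. (NN y. ennreal (\<bar>u y\<bar> * k (x - y)))^2) \<le> ennreal (c^2) * (\<integral>\<^sup>+y. ennreal ((u y)^2) \<partial>(lborel::R4 measure))"
proof -
 have "(NN y. ennreal (\<bar>u y\<bar> * k (x - y)))^2 \<le> (NN y. ennreal ((u y)^2 * k (x - y))) * ennreal c" for x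
 proof -
  have "(NN y. ennreal (\<bar>u y\<bar> * k (x - y))) = (NN y. ennreal (\<bar>u y\<bar> * sqrt (k (x - y))) * ennreal (sqrt (k (x - y))))"
   using k(2) by (intro nn_integral_cong) (simp add: ennreal_mult[symmetric] mult.assoc)
  then have "(NN y. ennreal (\<bar>u y\<bar> * k (x - y)))^2 \<le>
   (NN y. (ennreal (\<bar>u y\<bar> * sqrt (k (x - y))))^2) * (NN y. (ennreal (sqrt (k (x - y))))^2)"
   by (simp only:) (rule Cauchy_Schwarz_nn_integral; measurable)
  also have "(NN y. (ennreal (\<bar>u y\<bar> * sqrt (k (x - y))))^2) = (NN y. ennreal ((u y)^2 * k (x - y)))"
   using k(2) by (intro nn_integral_cong) (simp add: ennreal_power power_mult_distrib)
  also have "(NN y. (ennreal (sqrt (k (x - y))))^2) = (NN y. ennreal (k (x - y)))"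
   using k(2) by (intro nn_integral_cong) (simp add: ennreal_power)
  also have "\<dots> = (NN z. ennreal (k z))"
   by (rule nn_integral_reflect[of "\<lambda>z. ennreal (k z)"]) measurable
  finally show ?thesis using k(1) by (meson mult_left_mono order_trans zero_le)
 qed
 then have "(NN x. (NN y. ennreal (\<bar>u y\<bar> * k (x - y)))^2) \<le> (NN x. (NN y. ennreal ((u y)^2 * k (x - y))) * ennreal c)"
  by (intro nn_integral_mono)
 also have "\<dots> = (NN x. (NN y. ennreal ((u y)^2 * k (x - y)))) * ennreal c"
  by (rule nn_integral_multc) measurable
 also have "(NN x. (NN y. ennreal ((u y)^2 * k (x - y)))) = (NN y. (NN x. ennreal ((u y)^2 * k (x - y))))"
  by (rule lborel_pair.Fubini') measurable
 also have "\<dots> = (NN y. ennreal ((u y)^2) * (NN z. ennreal (k z)))"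
 proof (intro nn_integral_cong)
  fix y
  have "(NN x. ennreal ((u y)^2 * k (x - y))) = ennreal ((u y)^2) * (NN x. ennreal (k (x - y)))"
   using k(2) by (intro nn_integral_cmult_ennreal) auto
  also have "(NN x. ennreal (k (x - y))) = (NN z. ennreal (k z))"
   using nn_integral_translate[of "\<lambda>z. ennreal (k z)" "- y"] by simp
  finally show "(NN x. ennreal ((u y)^2 * k (x - y))) = ennreal ((u y)^2) * (NN z. ennreal (k z))" .
 qed
 also have "\<dots> \<le> (NN y. ennreal ((u y)^2) * ennreal c)"
  by (intro nn_integral_mono mult_left_mono k) auto
 also have "\<dots> = (NN y. ennreal ((u y)^2)) * ennreal c"
  by (rule nn_integral_multc) measurable
 finally show ?thesis using c by (simp add: power2_eq_square ennreal_mult mult_ac mult_right_mono)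
qed

section \<open>The weak Laplacian\<close>

text \<open>With B(q) = chi(q) / (4 pi^2 q), the radial formula 4 q B'' + 8 B' collapses to chi''(q)
  / pi^2, since in dimension 4 the terms in chi and chi' cancel. So \<open>kS s\<close> is the
  Laplacian of \<open>kG s\<close> away from the origin.\<close>

definition kS :: "real \<Rightarrow> R4 \<Rightarrow> real" where
 "kS s z = chi2 s ((norm z)^2) / pi^2"
definition kG :: "real \<Rightarrow> R4 \<Rightarrow> real" where
 "kG s z = chi s ((norm z)^2) / (4 * pi^2 * (norm z)^2)"

lemma chi_meas [measurable]: "chi s \<in> borel_measurable borel"
 unfolding chi_def[abs_def] divide_inverse by (intro borel_measurable_continuous_onI continuous_intros)
lemma chi1_meas [measurable]: "chi1 s \<in> borel_measurable borel"
 unfolding chi1_def[abs_def] divide_inverse by (intro borel_measurable_continuous_onI continuous_intros)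
lemma chi2_meas [measurable]: "chi2 s \<in> borel_measurable borel"
 unfolding chi2_def[abs_def] divide_inverse by (intro borel_measurable_continuous_onI continuous_intros)
lemma kS_meas [measurable]: "kS s \<in> borel_measurable borel" unfolding kS_def[abs_def] by measurable
lemma kG_meas [measurable]: "kG s \<in> borel_measurable borel" unfolding kG_def[abs_def] by measurable
lemma kS_minus: "kS s (- z) = kS s z" by (simp add: kS_def)
lemma kG_nonneg: "0 \<le> kG s z" by (simp add: kG_def chi_bounds)

lemma norm_sq_less_iff: "s > 0 \<Longrightarrow> (norm z)^2 < s \<longleftrightarrow> z \<in> ball 0 (sqrt s)"
 by (auto simp: real_less_lsqrt intro: real_less_rsqrt) (metis norm_ge_zero real_sqrt_less_iff real_sqrt_abs abs_norm_cancel)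

lemma kG_le: "s > 0 \<Longrightarrow> kG s z \<le> 1 / (4 * pi^2) * (indicator (ball 0 (sqrt s)) z / (norm z)^2)"
proof (cases "z \<in> ball 0 (sqrt s)")
 case True
 then show ?thesis using chi_bounds[of s "(norm z)^2"] by (simp add: kG_def divide_right_mono)
next
 case False
 assume s: "s > 0"
 with False have "(norm z)^2 \<ge> s" using norm_sq_less_iff[OF s, of z] by simp
 then show ?thesis using chi_support[OF s] by (simp add: kG_def)
qed

lemma kG_le_rk: "kG 1 z \<le> rk z"
 using kG_le[of 1 z] by (simp add: rk_def)

lemma nn_integral_kG: "s > 0 \<Longrightarrow> (NN z. ennreal (kG s z)) \<le> ennreal (s / 4)"
proof -
 assume s: "s > 0"
 have "(NN z. ennreal (kG s z)) \<le> (NN z. ennreal (1 / (4 * pi^2) * (indicator (ball 0 (sqrt s)) z / (norm (z::R4))^2)))"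
  by (intro nn_integral_mono ennreal_leI kG_le s)
 also have "\<dots> = ennreal (1 / (4 * pi^2)) * ennreal (pi^2 * (sqrt s)^2)"
  by (subst nn_integral_cmult_ennreal) (use s in \<open>auto simp: nn_integral_inverse_square_ball\<close>)
 also have "\<dots> = ennreal (s / 4)" using s by (simp add: ennreal_mult[symmetric])
 finally show ?thesis .
qed

lemma kS_bound: "\<exists>C\<ge>0. \<forall>s>0. \<forall>z. \<bar>kS s z\<bar> \<le> C / s^2 * indicator (ball 0 (sqrt s)) z"
proof -
 obtain C where C: "C \<ge> 0" "\<And>s q. s > 0 \<Longrightarrow> q \<ge> 0 \<Longrightarrow> \<bar>chi2 s q\<bar> \<le> C / s^2 * indicator {..<s} q"
  using chi2_bounds by blast
 show ?thesis
 proof (intro exI[of _ "C / pi^2"] conjI allI impI)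
  fix s :: real and z :: R4 assume s: "s > 0"
  have "\<bar>kS s z\<bar> = \<bar>chi2 s ((norm z)^2)\<bar> / pi^2" by (simp add: kS_def)
  also have "\<dots> \<le> (C / s^2 * indicator {..<s} ((norm z)^2)) / pi^2"
   by (intro divide_right_mono C s) auto
  also have "indicator {..<s} ((norm z)^2) = (indicator (ball 0 (sqrt s)) z :: real)"
   using norm_sq_less_iff[OF s, of z] by (simp add: indicator_def)
  finally show "\<bar>kS s z\<bar> \<le> C / pi^2 / s^2 * indicator (ball 0 (sqrt s)) z" by (simp add: field_simps)
 qed (use C in auto)
qed

lemma nn_integral_kS: "\<exists>C\<ge>0. \<forall>s>0. (NN z. ennreal \<bar>kS s z\<bar>) \<le> ennreal C"
proof -
 obtain C where C: "C \<ge> 0" "\<And>s z. s > 0 \<Longrightarrow> \<bar>kS s z\<bar> \<le> C / s^2 * indicator (ball 0 (sqrt s)) z"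
  using kS_bound by blast
 have "(NN z. ennreal \<bar>kS s z\<bar>) \<le> ennreal (C * (pi^2 / 2))" if s: "s > 0" for s
 proof -
  have "(NN z. ennreal \<bar>kS s z\<bar>) \<le> (NN z. ennreal (C / s^2) * indicator (ball 0 (sqrt s)) (z::R4))"
  proof (intro nn_integral_mono)
   fix z show "ennreal \<bar>kS s z\<bar> \<le> ennreal (C / s^2) * indicator (ball 0 (sqrt s)) z"
    using C(2)[OF s, of z] by (cases "z \<in> ball 0 (sqrt s)") (auto intro!: ennreal_leI)
  qed
  also have "\<dots> = ennreal (C / s^2) * ennreal (pi^2 / 2 * (sqrt s) ^ 4)"
   by (subst nn_integral_cmult_indicator) (use s in \<open>auto simp: emeasure_ball_R4\<close>)
  also have "\<dots> = ennreal (C * (pi^2 / 2))"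
  proof -
   have "(sqrt s) ^ 4 = s^2" using power_mult[of "sqrt s" 2 2] s by simp
   then show ?thesis using s C by (simp add: ennreal_mult[symmetric])
  qed
  finally show ?thesis .
 qed
 then show ?thesis using C(1) by (intro exI[of _ "C * (pi^2 / 2)"]) auto
qed

lemma kS_test: "s > 0 \<Longrightarrow> test_fun (\<lambda>y. kS s (x - y))"
proof (rule test_fun_mult_bounded)
 assume s: "s > 0"
 show "sm (\<lambda>y. kS s (x - y))"
  unfolding kS_def divide_inverse by (intro sm_mult sm_const sm_chi2 sm_norm_sq)
 fix y assume "kS s (x - y) \<noteq> 0"
 then have "(norm (x - y))^2 < s" using chi_support[OF s, of "(norm (x - y))^2"] by (auto simp: kS_def not_le[symmetric])
 then have "norm (x - y) < sqrt s" using norm_sq_less_iff[OF s, of "x - y"] by simp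
 then show "norm y \<le> norm x + sqrt s" using norm_triangle_ineq2[of y x] by (simp add: norm_minus_commute)
qed

section \<open>Convolution with integrable kernels, and the graph of the weak Laplacian\<close>

definition cv :: "(R4 \<Rightarrow> real) \<Rightarrow> (R4 \<Rightarrow> real) \<Rightarrow> R4 \<Rightarrow> real" where
 "cv k u x = (LBINT y. u y * k (x - y))"

lemma cv_meas [measurable]:
 assumes [measurable]: "k \<in> borel_measurable borel" "u \<in> borel_measurable borel"
 shows "cv k u \<in> borel_measurable borel"
 unfolding cv_def[abs_def] by measurable

text \<open>Holds at every point: where the product is not integrable the Bochner integral has the
  default value 0.\<close>

lemma cv_le_nn:
 assumes [measurable]: "k \<in> borel_measurable borel" "u \<in> borel_measurable borel"
 shows "ennreal \<bar>cv k u x\<bar> \<le> (NN y. ennreal (\<bar>u y\<bar> * \<bar>k (x - y)\<bar>))"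
proof (cases "integrable lborel (\<lambda>y. u y * k (x - y))")
 case True
 from integral_norm_bound_ennreal[OF this] show ?thesis by (simp add: cv_def abs_mult)
qed (simp add: cv_def not_integrable_integral_eq)

text \<open>Besides the norm bound, the last two conclusions control the convolution of absolute
  values. They provide the dominating functions in later limit arguments.\<close>

lemma conv_l2:
 assumes k [measurable]: "k \<in> borel_measurable borel" and u: "sqint u"
  and kc: "(NN z. ennreal \<bar>k z\<bar>) \<le> ennreal c" "0 \<le> c"
 shows "sqint (cv k u)" "norm (abs_l2 (cv k u)) \<le> c * norm (abs_l2 u)"
  "AE x in lborel. (NN y. ennreal (\<bar>u y\<bar> * \<bar>k (x - y)\<bar>)) < \<infinity>"
  "(NN x. (NN y. ennreal (\<bar>u y\<bar> * \<bar>k (x - y)\<bar>))^2) \<le> ennreal ((c * norm (abs_l2 u))^2)"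
proof -
 have [measurable]: "u \<in> borel_measurable borel" using u by (simp add: sqint_def)
 have nu: "(NN y. ennreal ((u y)^2)) = ennreal ((norm (abs_l2 u))^2)"
  unfolding norm_abs_sq[OF u] by (rule nn_integral_eq_integral) (use u in \<open>auto simp: sqint_def\<close>)
 show 4: "(NN x. (NN y. ennreal (\<bar>u y\<bar> * \<bar>k (x - y)\<bar>))^2) \<le> ennreal ((c * norm (abs_l2 u))^2)"
  using young_nn[of "\<lambda>z. \<bar>k z\<bar>" u c] kc nu by (simp add: ennreal_mult[symmetric] power_mult_distrib)
 have "(NN x. ennreal ((cv k u x)^2)) \<le> (NN x. (NN y. ennreal (\<bar>u y\<bar> * \<bar>k (x - y)\<bar>))^2)"
 proof (intro nn_integral_mono)
  fix x
  have "ennreal ((cv k u x)^2) = (ennreal \<bar>cv k u x\<bar>)^2" by (simp add: ennreal_power)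
  also have "\<dots> \<le> (NN y. ennreal (\<bar>u y\<bar> * \<bar>k (x - y)\<bar>))^2"
   by (intro power_mono cv_le_nn) auto
  finally show "ennreal ((cv k u x)^2) \<le> (NN y. ennreal (\<bar>u y\<bar> * \<bar>k (x - y)\<bar>))^2" .
 qed
 also note 4
 finally have le: "(NN x. ennreal ((cv k u x)^2)) \<le> ennreal ((c * norm (abs_l2 u))^2)" .
 show "sqint (cv k u)" by (rule sqint_nn[OF _ le]) measurable
 show "norm (abs_l2 (cv k u)) \<le> c * norm (abs_l2 u)"
  using kc(2) by (intro norm_abs_le[OF _ le]) auto
 have "(NN x. (NN y. ennreal (\<bar>u y\<bar> * \<bar>k (x - y)\<bar>))^2) \<noteq> \<infinity>"
  using 4 by (auto simp: top_unique)
 then have "AE x in lborel. (NN y. ennreal (\<bar>u y\<bar> * \<bar>k (x - y)\<bar>))\<^sup>2 \<noteq> \<infinity>"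
  by (intro nn_integral_noteq_infinite) auto
 then show "AE x in lborel. (NN y. ennreal (\<bar>u y\<bar> * \<bar>k (x - y)\<bar>)) < \<infinity>"
  by eventually_elim (auto simp: less_top power2_eq_square ennreal_mult_eq_top_iff)
qed

text \<open>The graph of the distributional Laplacian is a closed subspace of
  \<open>l2 \<times> l2\<close>. Its elements with the product norm stand for W^{2,2}, and carrying
  the Laplacian along avoids choosing it each time.\<close>

definition wlap :: "(l2 \<times> l2) set" where
 "wlap = {(p, w). \<forall>\<phi>. test_fun \<phi> \<longrightarrow> inner p (abs_l2 (lapl \<phi>)) = inner w (abs_l2 \<phi>)}"

lemma lapl_test: "test_fun \<phi> \<Longrightarrow> test_fun (lapl \<phi>)"
proof -
 assume \<phi>: "test_fun \<phi>"
 have t: "test_fun (iter_partial [i, i] \<phi>)" for i by (rule test_fun_iter[OF \<phi>])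
 have "sm (lapl \<phi>)" unfolding lapl_def[abs_def]
  using t by (intro sm_sum) (auto simp: test_fun_def smooth_fun_iff_sm simp del: iter_partial.simps)
 moreover have "bounded (\<Union>i. {x. iter_partial [i, i] \<phi> x \<noteq> 0})"
  using t by (intro bounded_UN) (auto simp: test_fun_def simp del: iter_partial.simps)
 then have "bounded {x. lapl \<phi> x \<noteq> 0}"
  by (rule bounded_subset) (auto simp: lapl_def simp del: iter_partial.simps intro: ccontr)
 ultimately show ?thesis by (simp add: test_fun_def smooth_fun_iff_sm)
qed

lemma wlapD: "(p, w) \<in> wlap \<Longrightarrow> test_fun \<phi> \<Longrightarrow> (LBINT y. fn p y * lapl \<phi> y) = (LBINT y. fn w y * \<phi> y)"
 unfolding wlap_def by (auto simp: inner_abs_right test_fun_sqint lapl_test)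

lemma wlap_add: "(p, w) \<in> wlap \<Longrightarrow> (p', w') \<in> wlap \<Longrightarrow> (p + p', w + w') \<in> wlap"
 by (auto simp: wlap_def inner_add_left)
lemma wlap_scale: "(p, w) \<in> wlap \<Longrightarrow> (c *\<^sub>R p, c *\<^sub>R w) \<in> wlap"
 by (auto simp: wlap_def)
lemma wlap_diff: "(p, w) \<in> wlap \<Longrightarrow> (p', w') \<in> wlap \<Longrightarrow> (p - p', w - w') \<in> wlap"
 by (auto simp: wlap_def inner_diff_left)

lemma wlap_weak_closed:
 assumes "\<And>n. (P n, W n) \<in> wlap" "\<And>\<phi>. (\<lambda>n. inner (P n) \<phi>) \<longlonglongrightarrow> inner p \<phi>" "\<And>\<phi>. (\<lambda>n. inner (W n) \<phi>) \<longlonglongrightarrow> inner w \<phi>"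
 shows "(p, w) \<in> wlap"
 unfolding wlap_def
proof (clarsimp)
 fix \<phi> assume "test_fun \<phi>"
 then have "inner (P n) (abs_l2 (lapl \<phi>)) = inner (W n) (abs_l2 \<phi>)" for n
  using assms(1)[of n] by (auto simp: wlap_def)
 then show "inner p (abs_l2 (lapl \<phi>)) = inner w (abs_l2 \<phi>)"
  using assms(2)[of "abs_l2 (lapl \<phi>)"] assms(3)[of "abs_l2 \<phi>"] LIMSEQ_unique by simp
qed

lemma wlap_closed: "closed wlap"
 unfolding closed_sequential_limits
proof (intro allI impI, elim conjE)
 fix X and l assume X: "\<forall>n. X n \<in> wlap" "X \<longlonglongrightarrow> l"
 have "(fst l, snd l) \<in> wlap"
  by (rule wlap_weak_closed[of "\<lambda>n. fst (X n)" "\<lambda>n. snd (X n)"]) (use X in \<open>auto intro!: tendsto_intros\<close>)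
 then show "l \<in> wlap" by simp
qed

text \<open>Self-adjointness of convolution with an even kernel. Absolute integrability of the
  double integral comes from Young's inequality and Cauchy-Schwarz.\<close>

lemma cv_swap:
 assumes [measurable]: "k \<in> borel_measurable borel" and ev: "\<And>z. k (- z) = k z"
  and kc: "(NN z. ennreal \<bar>k z\<bar>) \<le> ennreal c" "0 \<le> c" and u: "sqint u" and v: "sqint v"
 shows "(LBINT x. v x * cv k u x) = (LBINT y. u y * cv k v y)"
proof -
 have [measurable]: "u \<in> borel_measurable borel" "v \<in> borel_measurable borel" using u v by (auto simp: sqint_def)
 define I where "I x = (NN y. ennreal (\<bar>u y\<bar> * \<bar>k (x - y)\<bar>))" for x
 have [measurable]: "I \<in> borel_measurable borel" unfolding I_def by measurable
 have fin: "(NN x. ennreal \<bar>v x\<bar> * I x) < \<infinity>"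
 proof -
  have "(NN x. ennreal \<bar>v x\<bar> * I x)^2 \<le> (NN x. (ennreal \<bar>v x\<bar>)^2) * (NN x. (I x)^2)"
   by (rule Cauchy_Schwarz_nn_integral) measurable
  also have "\<dots> < \<infinity>"
  proof -
   have "(NN x. (ennreal \<bar>v x\<bar>)^2) = ennreal (LBINT x. (v x)^2)"
    using v by (subst nn_integral_eq_integral[symmetric]) (auto simp: sqint_def ennreal_power)
   then show ?thesis using conv_l2(4)[OF _ u kc]
    by (auto simp: I_def[abs_def] ennreal_mult_less_top intro: le_less_trans)
  qed
  finally show ?thesis by (auto simp: power2_eq_square ennreal_mult_less_top less_top)
 qed
 have int: "integrable (lborel \<Otimes>\<^sub>M lborel) (\<lambda>(x, y). v x * (u y * k (x - y)))"
 proof (rule integrableI_bounded)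
  have "(\<integral>\<^sup>+z. ennreal (norm (case z of (x, y) \<Rightarrow> v x * (u y * k (x - y)))) \<partial>(lborel \<Otimes>\<^sub>M lborel))
    = (NN x. (NN y. ennreal (norm (v x * (u y * k (x - y))))))"
   by (subst lborel.nn_integral_fst[symmetric]) auto
  also have "\<dots> = (NN x. ennreal \<bar>v x\<bar> * I x)"
   unfolding I_def by (intro nn_integral_cong, subst nn_integral_cmult[symmetric]) (auto simp: abs_mult ennreal_mult)
  finally show "(\<integral>\<^sup>+z. ennreal (norm (case z of (x, y) \<Rightarrow> v x * (u y * k (x - y)))) \<partial>(lborel \<Otimes>\<^sub>M lborel)) < \<infinity>"
   using fin by simp
 qed measurable
 have "(LBINT x. v x * cv k u x) = (LBINT x. (LBINT y. v x * (u y * k (x - y))))"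
  by (simp add: cv_def)
 also have "\<dots> = (LBINT y. (LBINT x. v x * (u y * k (x - y))))"
  by (rule lborel_pair.Fubini_integral[symmetric]) (use int in simp)
 also have "\<dots> = (LBINT y. u y * cv k v y)"
 proof (intro Bochner_Integration.integral_cong refl)
  fix y
  have "k (x - y) = k (y - x)" for x using ev[of "x - y"] by simp
  then have "(LBINT x. v x * (u y * k (x - y))) = (LBINT x. u y * (v x * k (y - x)))"
   by (simp add: mult_ac)
  then show "(LBINT x. v x * (u y * k (x - y))) = u y * cv k v y" by (simp add: cv_def)
 qed
 finally show ?thesis .
qed

lemma integral_scale_R4:
 fixes f :: "R4 \<Rightarrow> real"
 assumes "f \<in> borel_measurable borel" "c > 0"
 shows "(LBINT x. f x) = c ^ 4 * (LBINT x. f (a + c *\<^sub>R x))"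
proof -
 have "(LBINT x. f x) = (\<integral>x. f x \<partial>density (distr lborel borel (\<lambda>x::R4. a + c *\<^sub>R x)) (\<lambda>_. \<bar>c\<bar> ^ DIM(R4)))"
  using lborel_affine[of c a] assms by simp
 also have "\<dots> = (LBINT x. c ^ 4 * f (a + c *\<^sub>R x))"
  using assms by (subst integral_density) (auto simp: integral_distr)
 finally show ?thesis by simp
qed

lemma integral_reflect_R4:
 fixes f :: "R4 \<Rightarrow> real"
 assumes [measurable]: "f \<in> borel_measurable borel"
 shows "(LBINT y. f (x - y)) = (LBINT y. f y)"
proof -
 have *: "(lborel :: R4 measure) = distr lborel borel (\<lambda>y. x - y)"
  using lborel_affine[of "-1" x] by (simp add: density_1)
 have "(LBINT y. f y) = (\<integral>y. f y \<partial>distr lborel borel (\<lambda>y. x - y))" by (subst *) rule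
 also have "\<dots> = (LBINT y. f (x - y))" by (subst integral_distr) auto
 finally show ?thesis by simp
qed

section \<open>Representation by a local potential\<close>

text \<open>\<open>kg s r\<close> is \<open>kG s\<close> with the singular 1/|z|^2 replaced by
  1/(|z|^2 + r^2), which makes it an admissible test function. Its Laplacian splits into
  \<open>kb\<close>, which tends to \<open>kS\<close>, minus the approximate identity
  \<open>ke\<close>.\<close>

definition kb :: "real \<Rightarrow> real \<Rightarrow> R4 \<Rightarrow> real" where
 "kb s r z = (let q = (norm z)^2; v = inverse (q + r^2) in 1 / (4 * pi^2) * (4 * q * v * chi2 s q + 8 * r^2 * v^2 * chi1 s q))"
definition ke :: "real \<Rightarrow> real \<Rightarrow> R4 \<Rightarrow> real" where
 "ke s r z = (let q = (norm z)^2; v = inverse (q + r^2) in 2 / pi^2 * r^2 * v ^ 3 * chi s q)"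
definition kg :: "real \<Rightarrow> real \<Rightarrow> R4 \<Rightarrow> real" where
 "kg s r z = (let q = (norm z)^2; v = inverse (q + r^2) in 1 / (4 * pi^2) * chi s q * v)"

lemma kbeg_meas [measurable]:
 "kb s r \<in> borel_measurable borel" "ke s r \<in> borel_measurable borel" "kg s r \<in> borel_measurable borel"
 unfolding kb_def[abs_def] ke_def[abs_def] kg_def[abs_def] Let_def by measurable

lemma kg_test:
 assumes s: "s > 0" and r: "r > 0"
 shows "test_fun (\<lambda>y. kg s r (x - y))"
proof (rule test_fun_mult_bounded)
 have nz: "(norm (x - y))^2 + r^2 \<noteq> 0" for y
  using r zero_le_power2[of "norm (x - y)"] zero_less_power2[of r] by (smt (verit))
 show "sm (\<lambda>y. kg s r (x - y))" unfolding kg_def Let_def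
  by (intro sm_mult sm_const sm_chi sm_norm_sq sm_inverse sm_add nz)
 fix y assume "kg s r (x - y) \<noteq> 0"
 then have "(norm (x - y))^2 < s" using chi_support[OF s, of "(norm (x - y))^2"] by (auto simp: kg_def Let_def not_le[symmetric])
 then have "norm (x - y) < sqrt s" using norm_sq_less_iff[OF s, of "x - y"] by simp
 then show "norm y \<le> norm x + sqrt s" using norm_triangle_ineq2[of y x] by (simp add: norm_minus_commute)
qed

text \<open>Insert B(q) = chi(q) / (4 pi^2 (q + r^2)) into the radial formula. The terms where the
  cut-off is not differentiated combine to a rescaled bubble.\<close>

lemma lapl_kg:
 assumes s: "s > 0" and r: "r > 0"
 shows "lapl (\<lambda>y. kg s r (x - y)) y = kb s r (x - y) - ke s r (x - y)"
proof -
 let ?k = "1 / (4 * pi^2)"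
 let ?v = "\<lambda>q. inverse (q + r^2)"
 define B where "B q = ?k * (chi s q * ?v q)" for q
 define B1 where "B1 q = ?k * (chi1 s q * ?v q - chi s q * (?v q)^2)" for q
 define B2 where "B2 q = ?k * (chi2 s q * ?v q - 2 * chi1 s q * (?v q)^2 + 2 * chi s q * (?v q) ^ 3)" for q
 have dv: "(?v has_real_derivative - (?v q)\<^sup>2) (at q)" if "q > - r\<^sup>2" for q
  using that by (auto intro!: derivative_eq_intros simp: power2_eq_square)
 have 1: "(B has_real_derivative B1 q) (at q)" if "q > - r\<^sup>2" for q
  unfolding B_def[abs_def] B1_def
  by (rule DERIV_cong[OF DERIV_cmult[OF DERIV_mult[OF chi_deriv[OF s] dv[OF that]]]]) (simp add: algebra_simps)
 have 2: "(B1 has_real_derivative B2 q) (at q)" if "q > - r\<^sup>2" for q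
 proof -
  have "((\<lambda>q. (?v q)^2) has_real_derivative 2 * ?v q * (- (?v q)\<^sup>2)) (at q)"
   using DERIV_power[OF dv[OF that], of 2] by (simp add: mult_ac)
  from DERIV_cmult[OF DERIV_diff[OF DERIV_mult[OF chi1_deriv[OF s] dv[OF that]] DERIV_mult[OF chi_deriv[OF s] this]], of ?k]
  show ?thesis unfolding B1_def[abs_def] B2_def
   by (rule DERIV_cong) (simp add: algebra_simps power2_eq_square power3_eq_cube)
 qed
 define q where "q = (norm (x - y))^2"
 have q: "q \<ge> 0" "q + r^2 > 0" using r unfolding q_def by (auto simp: add_nonneg_pos)
 have "lapl (\<lambda>y. kg s r (x - y)) y = lapl (\<lambda>y. B ((norm (x - y))^2)) y"
  by (simp add: kg_def Let_def B_def mult.assoc)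
 also have "\<dots> = 4 * q * B2 q + 8 * B1 q"
  unfolding q_def by (rule lapl_radial[of "r^2" B B1 B2]) (use r 1 2 in auto)
 also have "\<dots> = kb s r (x - y) - ke s r (x - y)"
 proof -
  define v where "v = ?v q"
  \<comment> \<open>This relation trades every factor \<open>q\<close> for \<open>r^2\<close>,
    exposing what disappears as \<open>r\<close> tends to 0 and what concentrates.\<close>
  have v: "q * v = 1 - r\<^sup>2 * v" using q by (simp add: v_def field_simps)
  have "4 * q * B2 q + 8 * B1 q = ?k * (4 * (q * v) * chi2 s q + chi1 s q * (8 * v - 8 * (q * v) * v) + chi s q * (8 * (q * v) * v^2 - 8 * v^2))"
   unfolding B2_def B1_def v_def[symmetric] by (simp add: algebra_simps power2_eq_square power3_eq_cube)
  also have "\<dots> = ?k * (4 * (q * v) * chi2 s q + 8 * r^2 * v^2 * chi1 s q) - 2 / pi^2 * r^2 * v ^ 3 * chi s q"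
  proof -
   have "8 * v - 8 * (q * v) * v = 8 * r^2 * v^2" "8 * (q * v) * v^2 - 8 * v^2 = - (8 * r^2 * v ^ 3)"
    unfolding v by (simp_all add: algebra_simps power2_eq_square power3_eq_cube)
   then show ?thesis by (simp only:) (simp add: algebra_simps)
  qed
  also have "\<dots> = kb s r (x - y) - ke s r (x - y)"
   unfolding kb_def ke_def Let_def q_def[symmetric] v_def[symmetric] by (simp add: mult.assoc)
  finally show ?thesis .
 qed
 finally show ?thesis .
qed

text \<open>Uniform in \<open>r\<close> because \<open>q * v\<close> and \<open>r^2 * v\<close> are
  at most 1. The second power of \<open>v\<close> is tamed by the bound on \<open>chi1\<close> that
  is linear in \<open>q\<close>.\<close>

lemma kb_bound:
 assumes s: "s > 0"
 shows "\<exists>C\<ge>0. \<forall>r>0. \<forall>z. \<bar>kb s r z\<bar> \<le> C * indicator (cball 0 (sqrt s)) z"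
proof -
 obtain C1 where C1: "C1 \<ge> 0" "\<And>q. q \<ge> 0 \<Longrightarrow> \<bar>chi1 s q\<bar> \<le> C1 * q" using chi1_bounds[OF s] by blast
 obtain C2 where C2: "C2 \<ge> 0" "\<And>s q. s > 0 \<Longrightarrow> q \<ge> 0 \<Longrightarrow> \<bar>chi2 s q\<bar> \<le> C2 / s^2 * indicator {..<s} q" using chi2_bounds by blast
 have C2': "\<bar>chi2 s q\<bar> \<le> C2 / s^2" if "q \<ge> 0" for q
  using C2(2)[OF s that] C2(1) by (auto split: split_indicator_asm)
 show ?thesis
 proof (intro exI[of _ "1 / (4 * pi^2) * (4 * (C2 / s^2) + 8 * C1)"] conjI allI impI)
  fix r :: real and z :: R4 assume r: "r > 0"
  define q where "q = (norm z)^2"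
  define v where "v = inverse (q + r^2)"
  have q: "q \<ge> 0" "q + r^2 > 0" using r unfolding q_def by (auto simp: add_nonneg_pos)
  have v: "0 \<le> v" "q * v \<le> 1" "r^2 * v \<le> 1" using q by (auto simp: v_def field_simps)
  show "\<bar>kb s r z\<bar> \<le> 1 / (4 * pi^2) * (4 * (C2 / s^2) + 8 * C1) * indicator (cball 0 (sqrt s)) z"
  proof (cases "q < s")
   case True
   then have z: "z \<in> cball 0 (sqrt s)" using norm_sq_less_iff[OF s, of z] by (auto simp: q_def)
   have "\<bar>4 * q * v * chi2 s q\<bar> \<le> 4 * 1 * (C2 / s^2)"
   proof -
    have "\<bar>4 * q * v * chi2 s q\<bar> = 4 * (q * v) * \<bar>chi2 s q\<bar>" using q v by (simp add: abs_mult)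
    also have "\<dots> \<le> 4 * 1 * (C2 / s^2)" using q v C2'[OF q(1)] by (intro mult_mono) auto
    finally show ?thesis .
   qed
   moreover have "\<bar>8 * r^2 * v^2 * chi1 s q\<bar> \<le> 8 * (1 * (C1 * 1))"
   proof -
    have "\<bar>8 * r^2 * v^2 * chi1 s q\<bar> = 8 * (r^2 * v * (v * \<bar>chi1 s q\<bar>))" using v by (simp add: abs_mult power2_eq_square)
    also have "v * \<bar>chi1 s q\<bar> \<le> v * (C1 * q)" using C1(2)[OF q(1)] v by (intro mult_left_mono) auto
    also have "8 * (r^2 * v * (v * (C1 * q))) = 8 * (r^2 * v * (C1 * (q * v)))" by simp
    also have "\<dots> \<le> 8 * (1 * (C1 * 1))" using v q C1(1) by (intro mult_mono mult_left_mono) auto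
    finally show ?thesis using v by (simp add: mult_left_mono)
   qed
   ultimately have "\<bar>4 * q * v * chi2 s q + 8 * r^2 * v^2 * chi1 s q\<bar> \<le> 4 * (C2 / s^2) + 8 * C1"
    by (intro order_trans[OF abs_triangle_ineq]) linarith
   then have "1 / (4 * pi^2) * \<bar>4 * q * v * chi2 s q + 8 * r^2 * v^2 * chi1 s q\<bar> \<le> 1 / (4 * pi^2) * (4 * (C2 / s^2) + 8 * C1)"
    by (intro mult_left_mono) auto
   then show ?thesis using z unfolding kb_def Let_def q_def[symmetric] v_def[symmetric] by (simp add: abs_mult)
  next
   case False
   then have "kb s r z = 0" using chi_support[OF s, of q] unfolding kb_def Let_def q_def[symmetric] by simp
   then show ?thesis using C1 C2 by simp
  qed
 qed (use C1 C2 in auto)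
qed

lemma kg_bounds: "r > 0 \<Longrightarrow> 0 \<le> kg s r z" "r > 0 \<Longrightarrow> z \<noteq> 0 \<Longrightarrow> kg s r z \<le> kG s z"
proof -
 assume r: "r > 0"
 show "0 \<le> kg s r z" unfolding kg_def Let_def using chi_bounds by (intro mult_nonneg_nonneg) auto
 assume "z \<noteq> 0"
 then have "inverse ((norm z)^2 + r^2) \<le> inverse ((norm z)^2)" by (intro le_imp_inverse_le) auto
 then have "1 / (4 * pi^2) * chi s ((norm z)^2) * inverse ((norm z)^2 + r^2) \<le> 1 / (4 * pi^2) * chi s ((norm z)^2) * inverse ((norm z)^2)"
  using chi_bounds by (intro mult_left_mono) auto
 then show "kg s r z \<le> kG s z" by (simp add: kg_def Let_def kG_def field_simps)
qed

text \<open>The last property says that \<open>ke s r\<close> is the normalized bubble at scale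
  \<open>r\<close>, times a cut-off tending to 1 pointwise; this is why it approximates the
  identity.\<close>

lemma ke_props:
 assumes s: "s > 0" and r: "r > 0"
 shows "0 \<le> ke s r z" "ke s r (- z) = ke s r z" "\<bar>ke s r z\<bar> \<le> 2 / pi^2 / r ^ 4 * indicator (cball 0 (sqrt s)) z"
  "r ^ 4 * ke s r (r *\<^sub>R z) = 2 / pi^2 / (1 + (norm z)^2) ^ 3 * chi s (r^2 * (norm z)^2)"
proof -
 have p: "(norm z)^2 + r^2 > 0" for z :: R4 using r by (simp add: add_nonneg_pos)
 show 1: "0 \<le> ke s r z"
  unfolding ke_def Let_def using chi_bounds p[of z] by (intro mult_nonneg_nonneg) auto
 show "ke s r (- z) = ke s r z" by (simp add: ke_def)
 show "\<bar>ke s r z\<bar> \<le> 2 / pi^2 / r ^ 4 * indicator (cball 0 (sqrt s)) z"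
 proof (cases "(norm z)^2 < s")
  case True
  then have z: "z \<in> cball 0 (sqrt s)" using norm_sq_less_iff[OF s, of z] by auto
  have "inverse ((norm z)^2 + r^2) \<le> inverse (r^2)" using r by (intro le_imp_inverse_le) auto
  then have "inverse ((norm z)^2 + r^2) ^ 3 \<le> inverse (r^2) ^ 3" using p[of z] by (intro power_mono) auto
  then have "2 / pi^2 * r^2 * inverse ((norm z)^2 + r^2) ^ 3 * chi s ((norm z)^2) \<le> 2 / pi^2 * r^2 * inverse (r^2) ^ 3 * 1"
   using chi_bounds p[of z] by (intro mult_mono) auto
  also have "\<dots> = 2 / pi^2 / r ^ 4" using r by (simp add: field_simps power2_eq_square power4_eq_xxxx power3_eq_cube)
  finally show ?thesis using 1 z by (simp add: ke_def Let_def)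
 next
  case False
  then have "ke s r z = 0" using chi_support[OF s, of "(norm z)^2"] by (simp add: ke_def Let_def)
  then show ?thesis by simp
 qed
 show "r ^ 4 * ke s r (r *\<^sub>R z) = 2 / pi^2 / (1 + (norm z)^2) ^ 3 * chi s (r^2 * (norm z)^2)"
 proof -
  have "(norm (r *\<^sub>R z))^2 + r^2 = r^2 * (1 + (norm z)^2)" using r by (simp add: power_mult_distrib algebra_simps)
  moreover have "r ^ 4 * (2 / pi^2 * r^2 * inverse (r^2 * (1 + (norm z)^2)) ^ 3) = 2 / pi^2 / (1 + (norm z)^2) ^ 3"
  proof -
   have "inverse (r^2 * (1 + (norm z)^2)) ^ 3 = inverse (r ^ 6) * inverse ((1 + (norm z)^2) ^ 3)"
    by (simp add: power_mult_distrib power_inverse flip: power_mult)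
   moreover have "r ^ 4 * r^2 * inverse (r ^ 6) = 1" using r by (simp flip: power_add)
   ultimately show ?thesis by (simp add: divide_inverse)
  qed
  moreover have "(norm (r *\<^sub>R z))^2 = r^2 * (norm z)^2" by (simp add: power_mult_distrib)
  ultimately show ?thesis unfolding ke_def Let_def by (metis (no_types) mult.assoc)
 qed
qed

lemma bubble_integrable: "integrable lborel (\<lambda>z::R4. 2 / pi^2 / (1 + (norm z)^2) ^ 3)"
 "(LBINT z. 2 / pi^2 / (1 + (norm (z::R4))^2) ^ 3) = 1"
proof -
 have nn: "(NN z. ennreal (2 / pi^2 / (1 + (norm (z::R4))^2) ^ 3)) = ennreal 1"
  using nn_integral_bubble by simp
 have p: "0 \<le> 2 / pi^2 / (1 + (norm (z::R4))^2) ^ 3" for z by simp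
 show "integrable lborel (\<lambda>z::R4. 2 / pi^2 / (1 + (norm z)^2) ^ 3)"
  by (rule integrableI_nn_integral_finite[OF _ _ nn]) (auto simp: p)
 show "(LBINT z. 2 / pi^2 / (1 + (norm (z::R4))^2) ^ 3) = 1"
  by (subst integral_eq_nn_integral) (use nn p in auto)
qed

text \<open>After the substitution \<open>z\<close> to \<open>r n *\<^sub>R z\<close> the kernel
  becomes a fixed integrable profile of total mass 1, and dominated convergence applies.\<close>

lemma cv_ke_test:
 assumes s: "s > 0" and r: "\<And>n. r n > 0" "r \<longlonglongrightarrow> 0" and \<psi>: "test_fun \<psi>"
 shows "(\<lambda>n. cv (ke s (r n)) \<psi> y) \<longlonglongrightarrow> \<psi> y"
proof -
 have [measurable]: "\<psi> \<in> borel_measurable borel" by (rule test_fun_meas[OF \<psi>])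
 obtain B R where B: "B \<ge> 0" "\<And>x. \<bar>\<psi> x\<bar> \<le> B * indicator (cball 0 R) x" using test_fun_support[OF \<psi>] by metis
 have B': "\<bar>\<psi> x\<bar> \<le> B" for x using B(2)[of x] B(1) by (cases "x \<in> cball 0 R") auto
 define b where "b z = 2 / pi^2 / (1 + (norm z)^2) ^ 3" for z :: R4
 have b0: "0 \<le> b z" for z by (simp add: b_def)
 have [measurable]: "b \<in> borel_measurable borel" unfolding b_def by measurable
 have eq: "cv (ke s (r n)) \<psi> y = (LBINT z. \<psi> (y - r n *\<^sub>R z) * (b z * chi s ((r n)^2 * (norm z)^2)))" for n
 proof -
  have "cv (ke s (r n)) \<psi> y = (LBINT z. \<psi> (y - z) * ke s (r n) z)"
   unfolding cv_def using integral_reflect_R4[of "\<lambda>z. \<psi> (y - z) * ke s (r n) z" y] by simp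
  also have "\<dots> = (r n) ^ 4 * (LBINT z. \<psi> (y - (0 + r n *\<^sub>R z)) * ke s (r n) (0 + r n *\<^sub>R z))"
   by (rule integral_scale_R4) (use r(1) in auto)
  also have "\<dots> = (LBINT z. \<psi> (y - r n *\<^sub>R z) * ((r n) ^ 4 * ke s (r n) (r n *\<^sub>R z)))"
   by (simp flip: integral_mult_right_zero) (simp add: mult_ac)
  finally show ?thesis unfolding ke_props(4)[OF s r(1)] b_def .
 qed
 have "(\<lambda>n. (LBINT z. \<psi> (y - r n *\<^sub>R z) * (b z * chi s ((r n)^2 * (norm z)^2)))) \<longlonglongrightarrow> (LBINT z. \<psi> y * (b z * 1))"
 proof (rule integral_dominated_convergence[where w = "\<lambda>z. B * b z"])
  have "integrable lborel b" using bubble_integrable(1) unfolding b_def .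
  then show "integrable lborel (\<lambda>z. B * b z)" by simp
  show "AE z in lborel. (\<lambda>n. \<psi> (y - r n *\<^sub>R z) * (b z * chi s ((r n)^2 * (norm z)^2))) \<longlonglongrightarrow> \<psi> y * (b z * 1)"
  proof (intro AE_I2 tendsto_intros)
   fix z
   have "(\<lambda>n. y - r n *\<^sub>R z) \<longlonglongrightarrow> y - 0 *\<^sub>R z" by (intro tendsto_intros r)
   moreover have "isCont \<psi> y" using test_fun_continuous[OF \<psi>] by (simp add: continuous_on_eq_continuous_at)
   ultimately show "(\<lambda>n. \<psi> (y - r n *\<^sub>R z)) \<longlonglongrightarrow> \<psi> y" by (auto intro: isCont_tendsto_compose)
   have "(\<lambda>n. (r n)^2 * (norm z)^2) \<longlonglongrightarrow> 0^2 * (norm z)^2" by (intro tendsto_intros r)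
   moreover have "isCont (chi s) 0" using chi_deriv[OF s] DERIV_isCont by blast
   ultimately show "(\<lambda>n. chi s ((r n)^2 * (norm z)^2)) \<longlonglongrightarrow> 1"
    using isCont_tendsto_compose[of 0 "chi s"] by (simp add: chi_0)
  qed
  show "AE z in lborel. norm (\<psi> (y - r n *\<^sub>R z) * (b z * chi s ((r n)^2 * (norm z)^2))) \<le> B * b z" for n
  proof (intro AE_I2)
   fix z
   have "\<bar>\<psi> (y - r n *\<^sub>R z)\<bar> * (b z * chi s ((r n)^2 * (norm z)^2)) \<le> B * (b z * 1)"
    using B B' b0 chi_bounds by (intro mult_mono) auto
   then show "norm (\<psi> (y - r n *\<^sub>R z) * (b z * chi s ((r n)^2 * (norm z)^2))) \<le> B * b z"
    using b0 chi_bounds by (simp add: abs_mult)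
  qed
 qed measurable
 moreover have "(LBINT z. b z) = 1" using bubble_integrable(2) unfolding b_def .
 ultimately show ?thesis by (simp add: eq)
qed

lemma integrable_cv_bounded:
 assumes "sqint u" "k \<in> borel_measurable borel" "\<And>z. \<bar>k z\<bar> \<le> C * indicator (cball 0 R) z"
 shows "integrable lborel (\<lambda>y. u y * k (x - y))"
proof (rule sqint_mult[OF assms(1)], rule sqint_bounded_support)
 have [measurable]: "k \<in> borel_measurable borel" by fact
 show "(\<lambda>y. k (x - y)) \<in> borel_measurable borel" by measurable
 show "\<bar>k (x - y)\<bar> \<le> C * indicator (cball x R) y" for y
  using assms(3)[of "x - y"] by (auto simp: indicator_def dist_norm norm_minus_commute)
qed

text \<open>Testing the weak Laplacian with \<open>kg s r (x - y)\<close> gives an exact identity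
  for every r > 0. As r tends to 0 it converges after pairing with test functions, which suffices by
  the fundamental lemma.\<close>

theorem representation:
 assumes pw: "(p, w) \<in> wlap" and s: "s > 0"
 shows "AE x in lborel. fn p x = cv (kS s) (fn p) x - cv (kG s) (fn w) x"
proof -
 define r where "r n = inverse (real (Suc n))" for n
 have r: "r n > 0" "r \<longlonglongrightarrow> 0" for n unfolding r_def using LIMSEQ_inverse_real_of_nat by auto
 obtain Cb where Cb: "Cb \<ge> 0" "\<And>r z. r > 0 \<Longrightarrow> \<bar>kb s r z\<bar> \<le> Cb * indicator (cball 0 (sqrt s)) z" using kb_bound[OF s] by blast
 obtain CS where CS: "CS \<ge> 0" "\<And>s z. s > 0 \<Longrightarrow> \<bar>kS s z\<bar> \<le> CS / s^2 * indicator (ball 0 (sqrt s)) z" using kS_bound by blast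
 obtain cS where cS: "cS \<ge> 0" "\<And>s. s > 0 \<Longrightarrow> (NN z. ennreal \<bar>kS s z\<bar>) \<le> ennreal cS" using nn_integral_kS by blast
 have kGi: "(NN z. ennreal \<bar>kG s z\<bar>) \<le> ennreal (s / 4)"
  using nn_integral_kG[OF s] by (simp add: kG_nonneg)
 have [measurable]: "cball (0::R4) (sqrt s) \<in> sets borel" by simp
 have AE0: "AE y in lborel. y \<noteq> (x::R4)" for x by (rule AE_I[of _ _ "{x}"]) auto
 define I where "I x = (NN y. ennreal (\<bar>fn w y\<bar> * \<bar>kG s (x - y)\<bar>))" for x
 have [measurable]: "I \<in> borel_measurable borel" unfolding I_def by measurable
 note G = conv_l2[OF kG_meas fn_sqint kGi, of w, folded I_def]
 have s4: "0 \<le> s / 4" using s by simp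
 \<comment> \<open>The regularized representation, valid at every point. The three convolutions may
   be separated since all kernels are bounded with compact support.\<close>
 have star: "cv (ke s (r n)) (fn p) x = cv (kb s (r n)) (fn p) x - cv (kg s (r n)) (fn w) x" for n x
 proof -
  have "(LBINT y. fn p y * (kb s (r n) (x - y) - ke s (r n) (x - y))) = (LBINT y. fn w y * kg s (r n) (x - y))"
   using wlapD[OF pw kg_test[OF s r(1)[of n], of x]] by (simp add: lapl_kg[OF s r(1)])
  then have "(LBINT y. fn p y * kb s (r n) (x - y) - fn p y * ke s (r n) (x - y)) = cv (kg s (r n)) (fn w) x"
   by (simp add: cv_def right_diff_distrib)
  then show ?thesis
   by (subst (asm) Bochner_Integration.integral_diff)
    (auto simp: cv_def intro!: integrable_cv_bounded[OF fn_sqint] Cb(2) r ke_props(3)[OF s])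
 qed
 have limb: "(\<lambda>n. cv (kb s (r n)) (fn p) x) \<longlonglongrightarrow> cv (kS s) (fn p) x" for x
  unfolding cv_def
 proof (rule integral_dominated_convergence[where w = "\<lambda>y. Cb * \<bar>fn p y * indicator (cball 0 (sqrt s)) (x - y)\<bar>"])
  show "integrable lborel (\<lambda>y. Cb * \<bar>fn p y * indicator (cball 0 (sqrt s)) (x - y)\<bar>)"
   by (intro integrable_mult_right integrable_abs integrable_cv_bounded[OF fn_sqint, where C = 1 and R = "sqrt s"] borel_measurable_indicator) auto
  show "AE y in lborel. norm (fn p y * kb s (r n) (x - y)) \<le> Cb * \<bar>fn p y * indicator (cball 0 (sqrt s)) (x - y)\<bar>" for n
  proof (intro AE_I2)
   fix y
   have "\<bar>fn p y\<bar> * \<bar>kb s (r n) (x - y)\<bar> \<le> \<bar>fn p y\<bar> * (Cb * indicator (cball 0 (sqrt s)) (x - y))"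
    by (intro mult_left_mono Cb(2) r) auto
   then show "norm (fn p y * kb s (r n) (x - y)) \<le> Cb * \<bar>fn p y * indicator (cball 0 (sqrt s)) (x - y)\<bar>"
    by (simp add: abs_mult mult_ac)
  qed
  show "AE y in lborel. (\<lambda>n. fn p y * kb s (r n) (x - y)) \<longlonglongrightarrow> fn p y * kS s (x - y)"
   using AE0[of x]
  proof eventually_elim
   case (elim y)
   define q where "q = (norm (x - y))^2"
   have q: "q > 0" using elim by (simp add: q_def)
   have "(\<lambda>n. 1 / (4 * pi^2) * (4 * q * inverse (q + (r n)^2) * chi2 s q + 8 * (r n)^2 * (inverse (q + (r n)^2))^2 * chi1 s q))
    \<longlonglongrightarrow> 1 / (4 * pi^2) * (4 * q * inverse (q + 0^2) * chi2 s q + 8 * 0^2 * (inverse (q + 0^2))^2 * chi1 s q)"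
    using q by (intro tendsto_intros r) auto
   then have "(\<lambda>n. kb s (r n) (x - y)) \<longlonglongrightarrow> kS s (x - y)"
    using q by (simp add: kb_def kS_def Let_def q_def[symmetric] field_simps)
   then show ?case by (intro tendsto_intros)
  qed
 qed measurable
 have limg: "AE x in lborel. (\<lambda>n. cv (kg s (r n)) (fn w) x) \<longlonglongrightarrow> cv (kG s) (fn w) x"
  using G(3)[OF s4]
 proof eventually_elim
  case (elim x)
  show ?case unfolding cv_def
  proof (rule integral_dominated_convergence[where w = "\<lambda>y. \<bar>fn w y\<bar> * \<bar>kG s (x - y)\<bar>"])
   show "integrable lborel (\<lambda>y. \<bar>fn w y\<bar> * \<bar>kG s (x - y)\<bar>)"
    by (rule integrableI_bounded) (use elim in \<open>auto simp: I_def abs_mult\<close>)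
   show "AE y in lborel. norm (fn w y * kg s (r n) (x - y)) \<le> \<bar>fn w y\<bar> * \<bar>kG s (x - y)\<bar>" for n
    using AE0[of x] by eventually_elim (use r kg_bounds kG_nonneg in \<open>auto simp: abs_mult intro!: mult_left_mono\<close>)
   show "AE y in lborel. (\<lambda>n. fn w y * kg s (r n) (x - y)) \<longlonglongrightarrow> fn w y * kG s (x - y)"
    using AE0[of x]
   proof eventually_elim
    case (elim y)
    define q where "q = (norm (x - y))^2"
    have q: "q > 0" using elim by (simp add: q_def)
    have "(\<lambda>n. 1 / (4 * pi^2) * chi s q * inverse (q + (r n)^2)) \<longlonglongrightarrow> 1 / (4 * pi^2) * chi s q * inverse (q + 0^2)"
     using q by (intro tendsto_intros r) auto
    then have "(\<lambda>n. kg s (r n) (x - y)) \<longlonglongrightarrow> kG s (x - y)"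
     using q by (simp add: kg_def kG_def Let_def q_def[symmetric] field_simps)
    then show ?case by (intro tendsto_intros)
   qed
  qed measurable
 qed
 \<comment> \<open>The defect of the claimed identity. Pairing it with \<psi>, the mollification by
   \<open>ke\<close> is moved onto \<psi>, where its limit is known pointwise.\<close>
 define h where "h x = fn p x - (cv (kS s) (fn p) x - cv (kG s) (fn w) x)" for x
 have kSi: "(NN z. ennreal \<bar>kS s z\<bar>) \<le> ennreal cS" by (rule cS(2)[OF s])
 have sq: "sqint (cv (kS s) (fn p))" "sqint (cv (kG s) (fn w))"
  using conv_l2(1)[OF kS_meas fn_sqint kSi cS(1)] G(1)[OF s4] by auto
 have hs: "sqint h" unfolding h_def by (intro sqint_diff fn_sqint sq)
 have "AE x in lborel. h x = 0"
 proof (rule fundamental_lemma)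
  show "h \<in> borel_measurable borel" using hs by (simp add: sqint_def)
  show "integrable lborel (\<lambda>x. h x * indicator (cball 0 R) x)" for R
   by (rule sqint_mult[OF hs sqint_bounded_support[where B = 1]]) (auto intro!: borel_measurable_indicator)
  fix \<psi> assume \<psi>: "test_fun \<psi>"
  have [measurable]: "\<psi> \<in> borel_measurable borel" by (rule test_fun_meas[OF \<psi>])
  obtain B R where B: "B \<ge> 0" "R > 0" "\<And>x. \<bar>\<psi> x\<bar> \<le> B * indicator (cball 0 R) x" using test_fun_support[OF \<psi>] by metis
  have B': "\<bar>\<psi> x\<bar> \<le> B" for x using B(3)[of x] B(1) by (cases "x \<in> cball 0 R") auto
  have kei: "(NN z. ennreal \<bar>ke s (r n) z\<bar>) \<le> ennreal (2 / pi^2 / (r n) ^ 4 * (pi^2 / 2 * (sqrt s) ^ 4))" for n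
  proof -
   have "(NN z. ennreal \<bar>ke s (r n) z\<bar>) \<le> (NN z. ennreal (2 / pi^2 / (r n) ^ 4) * indicator (cball 0 (sqrt s)) (z::R4))"
   proof (intro nn_integral_mono)
    fix z show "ennreal \<bar>ke s (r n) z\<bar> \<le> ennreal (2 / pi^2 / (r n) ^ 4) * indicator (cball 0 (sqrt s)) z"
     using ke_props(3)[OF s r(1), of n z] by (cases "z \<in> cball 0 (sqrt s)") (auto intro!: ennreal_leI)
   qed
   also have "\<dots> = ennreal (2 / pi^2 / (r n) ^ 4) * ennreal (pi^2 / 2 * (sqrt s) ^ 4)"
    by (subst nn_integral_cmult_indicator) (use s in \<open>auto simp: emeasure_cball_R4\<close>)
   finally show ?thesis using r(1)[of n] by (simp add: ennreal_mult[symmetric])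
  qed
  have "(\<lambda>n. (LBINT y. fn p y * cv (ke s (r n)) \<psi> y)) \<longlonglongrightarrow> (LBINT y. fn p y * \<psi> y)"
  proof (rule integral_dominated_convergence[where w = "\<lambda>y. \<bar>fn p y * (B * indicator (cball 0 (R + sqrt s)) y)\<bar>"])
   show "integrable lborel (\<lambda>y. \<bar>fn p y * (B * indicator (cball 0 (R + sqrt s)) y)\<bar>)"
    by (intro integrable_abs sqint_mult fn_sqint sqint_bounded_support[where B = B and a = 0 and R = "R + sqrt s"] borel_measurable_times borel_measurable_indicator) (auto simp: B abs_mult)
   show "AE y in lborel. (\<lambda>n. fn p y * cv (ke s (r n)) \<psi> y) \<longlonglongrightarrow> fn p y * \<psi> y"
    by (intro AE_I2 tendsto_intros cv_ke_test s \<psi> r)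
   show "AE y in lborel. norm (fn p y * cv (ke s (r n)) \<psi> y) \<le> \<bar>fn p y * (B * indicator (cball 0 (R + sqrt s)) y)\<bar>" for n
   proof (intro AE_I2)
    fix y
    have "\<bar>cv (ke s (r n)) \<psi> y\<bar> \<le> B * indicator (cball 0 (R + sqrt s)) y"
    proof (cases "y \<in> cball 0 (R + sqrt s)")
     case True
     have "ennreal \<bar>cv (ke s (r n)) \<psi> y\<bar> \<le> (NN z. ennreal (\<bar>\<psi> z\<bar> * \<bar>ke s (r n) (y - z)\<bar>))"
      by (rule cv_le_nn) measurable
     also have "\<dots> \<le> (NN z. ennreal (B * \<bar>ke s (r n) (y - z)\<bar>))"
      by (intro nn_integral_mono ennreal_leI mult_right_mono B') auto
     also have "\<dots> = (NN z. ennreal (B * \<bar>ke s (r n) z\<bar>))"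
      by (rule nn_integral_reflect[of "\<lambda>z. ennreal (B * \<bar>ke s (r n) z\<bar>)"]) measurable
     also have "\<dots> = ennreal B * (NN z. ennreal \<bar>ke s (r n) z\<bar>)"
      using B(1) by (intro nn_integral_cmult_ennreal) auto
     also have "\<dots> \<le> ennreal B * 1"
     proof (intro mult_left_mono)
      \<comment> \<open>Dropping the cut-off leaves the full rescaled bubble, whose mass is 1 at
        every scale; so the mollified test function keeps the bound \<open>B\<close>.\<close>
      have "(NN z. ennreal \<bar>ke s (r n) z\<bar>) \<le> (NN z. ennreal ((2 / pi^2) * (r n)^2 * (inverse ((norm (z::R4))^2 + (r n)^2)) ^ 3))"
      proof (intro nn_integral_mono ennreal_leI)
       fix z :: R4
       have "2 / pi^2 * (r n)^2 * inverse ((norm z)^2 + (r n)^2) ^ 3 * chi s ((norm z)^2) \<le> 2 / pi^2 * (r n)^2 * inverse ((norm z)^2 + (r n)^2) ^ 3 * 1"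
        using chi_bounds by (intro mult_left_mono mult_nonneg_nonneg) auto
       then show "\<bar>ke s (r n) z\<bar> \<le> 2 / pi^2 * (r n)^2 * inverse ((norm z)^2 + (r n)^2) ^ 3"
        using ke_props(1)[OF s r(1), of n z] by (simp add: ke_def Let_def)
      qed
      also have "\<dots> = (\<integral>\<^sup>+z. ennreal ((r n) ^ 4) * ennreal ((2 / pi^2) * (r n)^2 * (inverse ((norm (r n *\<^sub>R z))^2 + (r n)^2)) ^ 3) \<partial>(lborel :: R4 measure))"
      proof -
       have "(NN x. f x) = (NN x. ennreal (c ^ 4) * f (c *\<^sub>R x))"
        if [measurable]: "f \<in> borel_measurable borel" and c: "c > 0" for f :: "R4 \<Rightarrow> ennreal" and c
       proof -
        have "(NN x. f x) = (\<integral>\<^sup>+x. f x \<partial>density (distr lborel borel (\<lambda>x::R4. 0 + c *\<^sub>R x)) (\<lambda>_. \<bar>c\<bar> ^ DIM(R4)))"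
         using lborel_affine[of c "0::R4"] c by simp
        then show ?thesis using c
         by (subst (asm) nn_integral_density) (auto simp: nn_integral_distr ennreal_power)
       qed
       from this[OF _ r(1)[of n], of "\<lambda>z. ennreal ((2 / pi^2) * (r n)^2 * (inverse ((norm z)^2 + (r n)^2)) ^ 3)"]
       show ?thesis by simp
      qed
      also have "\<dots> = (NN z. ennreal (2 / pi^2 / (1 + (norm (z::R4))^2) ^ 3))"
      proof (intro nn_integral_cong)
       fix z :: R4
       have rn: "r n > 0" by (rule r)
       have "(norm (r n *\<^sub>R z))^2 + (r n)^2 = (r n)^2 * (1 + (norm z)^2)" using rn by (simp add: power_mult_distrib algebra_simps)
       moreover have "inverse ((r n)^2 * (1 + (norm z)^2)) ^ 3 = inverse ((r n) ^ 6) * inverse ((1 + (norm z)^2) ^ 3)"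
        by (simp add: power_mult_distrib power_inverse flip: power_mult)
       moreover have "(r n) ^ 4 * (r n)^2 * inverse ((r n) ^ 6) = 1" using rn by (simp flip: power_add)
       ultimately have "(r n) ^ 4 * ((2 / pi^2) * (r n)^2 * (inverse ((norm (r n *\<^sub>R z))^2 + (r n)^2)) ^ 3) = 2 / pi^2 / (1 + (norm z)^2) ^ 3"
        by (simp add: divide_inverse)
       then show "ennreal ((r n) ^ 4) * ennreal ((2 / pi^2) * (r n)^2 * (inverse ((norm (r n *\<^sub>R z))^2 + (r n)^2)) ^ 3) = ennreal (2 / pi^2 / (1 + (norm z)^2) ^ 3)"
        by (subst ennreal_mult[symmetric]) (auto simp: add_nonneg_nonneg)
      qed
      also have "\<dots> = 1" by (rule nn_integral_bubble)
      finally show "(NN z. ennreal \<bar>ke s (r n) z\<bar>) \<le> 1" .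
     qed simp
     finally show ?thesis using True B(1) by simp
    next
     case False
     have "\<psi> z * ke s (r n) (y - z) = 0" for z
     proof (cases "z \<in> cball 0 R")
      case True
      then have "y - z \<notin> cball 0 (sqrt s)" using False norm_triangle_ineq2[of y z] by simp
      then show ?thesis using ke_props(3)[OF s r(1), of n "y - z"] by simp
     qed (use B(3)[of z] in auto)
     then have "cv (ke s (r n)) \<psi> y = (\<integral>z. 0 \<partial>(lborel::R4 measure))"
      unfolding cv_def by (intro Bochner_Integration.integral_cong refl)
     then have "cv (ke s (r n)) \<psi> y = 0" by simp
     then show ?thesis using B by simp
    qed
    then show "norm (fn p y * cv (ke s (r n)) \<psi> y) \<le> \<bar>fn p y * (B * indicator (cball 0 (R + sqrt s)) y)\<bar>"
     using B(1) by (auto simp: abs_mult intro!: mult_left_mono)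
   qed
  qed measurable
  moreover have "(LBINT y. fn p y * cv (ke s (r n)) \<psi> y) = (LBINT x. \<psi> x * cv (ke s (r n)) (fn p) x)" for n
   by (rule cv_swap[symmetric, OF _ _ kei]) (use ke_props(2)[OF s r(1)] r(1)[of n] s fn_sqint test_fun_sqint[OF \<psi>] in auto)
  moreover have "(\<lambda>n. (LBINT x. \<psi> x * cv (ke s (r n)) (fn p) x)) \<longlonglongrightarrow> (LBINT x. \<psi> x * (cv (kS s) (fn p) x - cv (kG s) (fn w) x))"
  \<comment> \<open>By the regularized identity the mollification of u is bounded independently of
    n: \<open>Cb\<close> times the mean of |u| over a ball, plus the potential \<open>I\<close> of
    |w|. Both are square integrable in x.\<close>
  proof (rule integral_dominated_convergence[where w = "\<lambda>x. \<bar>\<psi> x\<bar> * (Cb * enn2real (NN y. ennreal (\<bar>fn p y\<bar> * \<bar>indicator (cball 0 (sqrt s)) (x - y)\<bar>)) + enn2real (I x))"])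
   let ?J = "\<lambda>x. (NN y. ennreal (\<bar>fn p y\<bar> * \<bar>indicator (cball 0 (sqrt s)) (x - y)\<bar>))"
   have ii: "(NN z. ennreal \<bar>indicator (cball (0::R4) (sqrt s)) z\<bar>) \<le> ennreal (pi^2 / 2 * (sqrt s) ^ 4)"
    using s by (simp add: ennreal_indicator emeasure_cball_R4)
   have ip: "0 \<le> pi^2 / 2 * (sqrt s) ^ 4" using s by simp
   note J = conv_l2[OF _ fn_sqint ii ip, of p]
   have en: "sqint (\<lambda>x. enn2real (K x))" if [measurable]: "K \<in> borel_measurable borel" and K: "(NN x. (K x)^2) \<le> ennreal c" for K :: "R4 \<Rightarrow> ennreal" and c
   proof (rule sqint_nn)
    have "(NN x. ennreal ((enn2real (K x))^2)) \<le> (NN x. (K x)^2)"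
     by (intro nn_integral_mono) (metis enn2real_nonneg ennreal_enn2real_if ennreal_power power_mono zero_le order_refl)
    with K show "(NN x. ennreal ((enn2real (K x))^2)) \<le> ennreal c" by simp
   qed measurable
   have "sqint (\<lambda>x. Cb * enn2real (?J x) + enn2real (I x))"
    by (intro sqint_add sqint_scale en[OF _ J(4)] en[OF _ G(4)[OF s4]]) measurable
   moreover have "sqint (\<lambda>x. \<bar>\<psi> x\<bar>)" by (rule sqint_bound[OF test_fun_sqint[OF \<psi>]]) auto
   ultimately show "integrable lborel (\<lambda>x. \<bar>\<psi> x\<bar> * (Cb * enn2real (?J x) + enn2real (I x)))"
    by (intro sqint_mult)
   show "AE x in lborel. (\<lambda>n. \<psi> x * cv (ke s (r n)) (fn p) x) \<longlonglongrightarrow> \<psi> x * (cv (kS s) (fn p) x - cv (kG s) (fn w) x)"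
    using limg by eventually_elim (auto simp: star intro!: tendsto_intros limb)
   have "AE x in lborel. ?J x < \<infinity>" using J(3) by simp
   then show "AE x in lborel. norm (\<psi> x * cv (ke s (r n)) (fn p) x) \<le> \<bar>\<psi> x\<bar> * (Cb * enn2real (?J x) + enn2real (I x))" for n
    using G(3)[OF s4]
   proof eventually_elim
    case (elim x)
    have "ennreal \<bar>cv (kb s (r n)) (fn p) x\<bar> \<le> (NN y. ennreal (\<bar>fn p y\<bar> * \<bar>kb s (r n) (x - y)\<bar>))"
     by (rule cv_le_nn) measurable
    also have "\<dots> \<le> (NN y. ennreal (Cb * (\<bar>fn p y\<bar> * \<bar>indicator (cball 0 (sqrt s)) (x - y)\<bar>)))"
    proof (intro nn_integral_mono ennreal_leI)
     fix y
     have "\<bar>fn p y\<bar> * \<bar>kb s (r n) (x - y)\<bar> \<le> \<bar>fn p y\<bar> * (Cb * indicator (cball 0 (sqrt s)) (x - y))"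
      by (intro mult_left_mono Cb(2) r) auto
     then show "\<bar>fn p y\<bar> * \<bar>kb s (r n) (x - y)\<bar> \<le> Cb * (\<bar>fn p y\<bar> * \<bar>indicator (cball 0 (sqrt s)) (x - y)\<bar>)"
      by (simp add: mult_ac)
    qed
    also have "\<dots> = ennreal Cb * ?J x" by (rule nn_integral_cmult_ennreal) (use Cb in auto)
    also have "\<dots> = ennreal (Cb * enn2real (?J x))" using elim Cb by (simp add: ennreal_mult)
    finally have 1: "\<bar>cv (kb s (r n)) (fn p) x\<bar> \<le> Cb * enn2real (?J x)" using Cb(1) by (subst (asm) ennreal_le_iff) auto
    have "ennreal \<bar>cv (kg s (r n)) (fn w) x\<bar> \<le> (NN y. ennreal (\<bar>fn w y\<bar> * \<bar>kg s (r n) (x - y)\<bar>))"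
     by (rule cv_le_nn) measurable
    also have "\<dots> \<le> I x" unfolding I_def
    proof (rule nn_integral_mono_AE, use AE0[of x] in eventually_elim)
     case (elim y)
     then show ?case using kg_bounds(1)[where s=s and z="x - y", OF r(1)[of n]] kg_bounds(2)[where s=s and z="x - y", OF r(1)[of n]] kG_nonneg[of s "x - y"] by (auto intro!: ennreal_leI mult_left_mono)
    qed
    also have "I x = ennreal (enn2real (I x))" using elim by (simp add: less_top)
    finally have 2: "\<bar>cv (kg s (r n)) (fn w) x\<bar> \<le> enn2real (I x)" by (subst (asm) ennreal_le_iff) auto
    have "\<bar>cv (ke s (r n)) (fn p) x\<bar> \<le> Cb * enn2real (?J x) + enn2real (I x)"
     unfolding star using 1 2 by linarith
    then show ?case by (simp add: abs_mult mult_left_mono)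
   qed
  qed measurable
  ultimately have "(LBINT y. fn p y * \<psi> y) = (LBINT x. \<psi> x * (cv (kS s) (fn p) x - cv (kG s) (fn w) x))"
   using LIMSEQ_unique by auto
  moreover have "(LBINT x. h x * \<psi> x) = (LBINT y. fn p y * \<psi> y) - (LBINT x. \<psi> x * (cv (kS s) (fn p) x - cv (kG s) (fn w) x))"
   unfolding h_def left_diff_distrib[of "fn p _"]
   by (subst Bochner_Integration.integral_diff)
    (auto simp: mult.commute intro!: sqint_mult[OF test_fun_sqint[OF \<psi>] fn_sqint] sqint_mult[OF fn_sqint test_fun_sqint[OF \<psi>]] sqint_mult[OF test_fun_sqint[OF \<psi>] sqint_diff[OF sq]])
  ultimately show "(LBINT x. h x * \<psi> x) = 0" by simp
 qed
 then show ?thesis by eventually_elim (simp add: h_def)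
qed

section \<open>Second-order regularity\<close>

text \<open>Supplies an n-independent dominating function for difference quotients: the mean value
  theorem inside a ball enlarged by \<open>\<bar>T\<bar>\<close>, and zero outside.\<close>

lemma partial_dir_bounded:
 assumes "test_fun \<phi>"
 obtains B R where "B \<ge> 0" "R > 0" "\<And>z t. \<bar>t\<bar> \<le> T \<Longrightarrow> \<bar>\<phi> (z + t *\<^sub>R axis i 1) - \<phi> z\<bar> \<le> \<bar>t\<bar> * (B * indicator (cball 0 R) z)"
proof -
 obtain B1 R1 where 1: "B1 \<ge> 0" "R1 > 0" "\<And>x. \<bar>\<phi> x\<bar> \<le> B1 * indicator (cball 0 R1) x" using test_fun_support[OF assms] by metis
 obtain B R where B: "B \<ge> 0" "R > 0" "\<And>x. \<bar>partial_dir i \<phi> x\<bar> \<le> B * indicator (cball 0 R) x"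
  using test_fun_support[OF test_fun_partial[OF assms]] by metis
 have B': "\<bar>partial_dir i \<phi> x\<bar> \<le> B" for x using B(3)[of x] B(1) by (cases "x \<in> cball 0 R") auto
 have sm: "smooth_fun \<phi>" using assms by (simp add: test_fun_def)
 show thesis
 proof (rule that[of B "R1 + \<bar>T\<bar>"])
  fix z :: R4 and t assume t: "\<bar>t\<bar> \<le> T"
  show "\<bar>\<phi> (z + t *\<^sub>R axis i 1) - \<phi> z\<bar> \<le> \<bar>t\<bar> * (B * indicator (cball 0 (R1 + \<bar>T\<bar>)) z)"
  proof (cases "z \<in> cball 0 (R1 + \<bar>T\<bar>)")
   case True
   have "norm (\<phi> (z + t *\<^sub>R axis i 1) - \<phi> (z + 0 *\<^sub>R axis i 1)) \<le> B * norm (t - 0)"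
    by (rule field_differentiable_bound[of UNIV "\<lambda>t. \<phi> (z + t *\<^sub>R axis i 1)" "\<lambda>s. partial_dir i \<phi> (z + s *\<^sub>R axis i 1)"])
     (use line_deriv[OF sm] B' in auto)
   then show ?thesis using True by (simp add: mult.commute)
  next
   case False
   then have n: "norm z > R1 + \<bar>T\<bar>" by simp
   have "norm (z + t *\<^sub>R axis i 1) \<ge> norm z - norm (t *\<^sub>R axis i (1::real))" by (metis norm_diff_ineq)
   then have "norm (z + t *\<^sub>R axis i 1) > R1" using n t by simp
   then have "\<phi> (z + t *\<^sub>R axis i 1) = 0" "\<phi> z = 0" using 1(3)[of "z + t *\<^sub>R axis i 1"] 1(3)[of z] n by auto
   then show ?thesis using B(1) by (auto intro!: mult_nonneg_nonneg)
  qed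
 qed (use B 1 in auto)
qed

lemma cv_line_deriv_0:
 assumes \<phi>: "test_fun \<phi>" and u: "sqint u"
 shows "((\<lambda>t. cv \<phi> u (x + t *\<^sub>R axis i 1)) has_real_derivative cv (partial_dir i \<phi>) u x) (at 0)"
 unfolding DERIV_def tendsto_at_iff_sequentially
proof (intro allI impI)
 fix h :: "nat \<Rightarrow> real" assume h: "\<forall>n. h n \<in> UNIV - {0}" "h \<longlonglongrightarrow> 0"
 have [measurable]: "\<phi> \<in> borel_measurable borel" "u \<in> borel_measurable borel" "partial_dir i \<phi> \<in> borel_measurable borel"
  using test_fun_meas[OF \<phi>] test_fun_meas[OF test_fun_partial[OF \<phi>]] u by (auto simp: sqint_def)
 obtain T where T: "\<And>n. \<bar>h n\<bar> \<le> T"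
  using convergent_imp_Bseq[of h] h(2) unfolding convergent_def Bseq_def by auto
 obtain B R where B: "B \<ge> 0" "R > 0" "\<And>z t. \<bar>t\<bar> \<le> T \<Longrightarrow> \<bar>\<phi> (z + t *\<^sub>R axis i 1) - \<phi> z\<bar> \<le> \<bar>t\<bar> * (B * indicator (cball 0 R) z)"
  using partial_dir_bounded[OF \<phi>, of T i] by metis
 obtain B1 R1 where 1: "B1 \<ge> 0" "R1 > 0" "\<And>x. \<bar>\<phi> x\<bar> \<le> B1 * indicator (cball 0 R1) x" using test_fun_support[OF \<phi>] by metis
 let ?D = "\<lambda>n z. (\<phi> (z + h n *\<^sub>R axis i 1) - \<phi> z) / h n"
 have int: "integrable lborel (\<lambda>y. u y * \<phi> (x - y))" for x
  by (rule integrable_cv_bounded[OF u _ 1(3)]) measurable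
 have "(\<lambda>n. (LBINT y. u y * ?D n (x - y))) \<longlonglongrightarrow> (LBINT y. u y * partial_dir i \<phi> (x - y))"
 proof (rule integral_dominated_convergence[where w = "\<lambda>y. \<bar>u y * (B * indicator (cball 0 R) (x - y))\<bar>"])
  show "integrable lborel (\<lambda>y. \<bar>u y * (B * indicator (cball 0 R) (x - y))\<bar>)"
   by (intro integrable_abs integrable_cv_bounded[OF u, where C = B and R = R] borel_measurable_times borel_measurable_indicator) (auto simp: B abs_mult)
  show "AE y in lborel. (\<lambda>n. u y * ?D n (x - y)) \<longlonglongrightarrow> u y * partial_dir i \<phi> (x - y)"
  proof (intro AE_I2 tendsto_intros)
   fix y
   have "((\<lambda>t. \<phi> ((x - y) + t *\<^sub>R axis i 1)) has_real_derivative partial_dir i \<phi> (x - y)) (at 0)"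
    using \<phi> by (intro smooth_fun_has_deriv) (simp add: test_fun_def)
   then show "(\<lambda>n. ?D n (x - y)) \<longlonglongrightarrow> partial_dir i \<phi> (x - y)"
    unfolding DERIV_def tendsto_at_iff_sequentially using h by (auto simp: o_def)
  qed
  show "AE y in lborel. norm (u y * ?D n (x - y)) \<le> \<bar>u y * (B * indicator (cball 0 R) (x - y))\<bar>" for n
  proof (intro AE_I2)
   fix y
   have "\<bar>?D n (x - y)\<bar> \<le> B * indicator (cball 0 R) (x - y)"
    using B(3)[where t = "h n" and z = "x - y", OF T] h(1)[rule_format, of n] by (simp add: abs_divide pos_divide_le_eq mult.commute)
   moreover have "0 \<le> B * indicator (cball 0 R) (x - y)" using B by simp
   ultimately show "norm (u y * ?D n (x - y)) \<le> \<bar>u y * (B * indicator (cball 0 R) (x - y))\<bar>"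
    unfolding real_norm_def abs_mult[of "u y"] by (intro mult_left_mono) linarith+
  qed
 qed measurable
 moreover have "(cv \<phi> u (x + (0 + h n) *\<^sub>R axis i 1) - cv \<phi> u (x + 0 *\<^sub>R axis i 1)) / h n = (LBINT y. u y * ?D n (x - y))" for n
 proof -
  have "cv \<phi> u (x + h n *\<^sub>R axis i 1) - cv \<phi> u x = (LBINT y. u y * \<phi> (x + h n *\<^sub>R axis i 1 - y) - u y * \<phi> (x - y))"
   unfolding cv_def by (rule Bochner_Integration.integral_diff[symmetric, OF int int])
  then have "(cv \<phi> u (x + h n *\<^sub>R axis i 1) - cv \<phi> u x) / h n = (LBINT y. (u y * \<phi> (x + h n *\<^sub>R axis i 1 - y) - u y * \<phi> (x - y)) / h n)"
   by simp
  also have "\<dots> = (LBINT y. u y * ?D n (x - y))"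
   by (intro Bochner_Integration.integral_cong) (auto simp: algebra_simps diff_divide_distrib)
  finally show ?thesis by simp
 qed
 ultimately show "((\<lambda>ha. (cv \<phi> u (x + (0 + ha) *\<^sub>R axis i 1) - cv \<phi> u (x + 0 *\<^sub>R axis i 1)) / ha) \<circ> h) \<longlonglongrightarrow> cv (partial_dir i \<phi>) u x"
  by (simp only: o_def cv_def[of "partial_dir i \<phi>"])
qed

lemma line_shift_deriv:
 fixes g :: "R4 \<Rightarrow> real"
 assumes "\<And>x. ((\<lambda>t. g (x + t *\<^sub>R e)) has_real_derivative g' x) (at 0)"
 shows "((\<lambda>t. g (x + t *\<^sub>R e)) has_real_derivative g' (x + s *\<^sub>R e)) (at s)"
proof -
 have "((\<lambda>t. g ((x + s *\<^sub>R e) + t *\<^sub>R e)) has_real_derivative g' (x + s *\<^sub>R e)) (at (s - s))"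
  using assms[of "x + s *\<^sub>R e"] by simp
 then have "((\<lambda>t. g ((x + s *\<^sub>R e) + (t - s) *\<^sub>R e)) has_real_derivative g' (x + s *\<^sub>R e) * 1) (at s)"
  by (rule DERIV_chain2) (auto intro!: derivative_eq_intros)
 moreover have "x + s *\<^sub>R e + (t - s) *\<^sub>R e = x + t *\<^sub>R e" for t
  by (simp add: scaleR_left_diff_distrib)
 ultimately show ?thesis by simp
qed

lemma integral_translate_R4:
 fixes f :: "R4 \<Rightarrow> real"
 assumes [measurable]: "f \<in> borel_measurable borel"
 shows "(LBINT y. f (y + a)) = (LBINT y. f y)" "integrable lborel f \<Longrightarrow> integrable lborel (\<lambda>y. f (y + a))"
proof -
 have "(LBINT y. f y) = (\<integral>y. f y \<partial>distr lborel borel ((+) a))" by (simp add: lborel_distr_plus)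
 also have "\<dots> = (LBINT y. f (a + y))" by (subst integral_distr) auto
 finally show "(LBINT y. f (y + a)) = (LBINT y. f y)" by (simp add: add.commute)
 assume "integrable lborel f"
 then have "integrable (distr lborel borel ((+) a)) f" by (simp add: lborel_distr_plus)
 then have "integrable lborel (\<lambda>y. f (a + y))" by (subst (asm) integrable_distr_eq) auto
 then show "integrable lborel (\<lambda>y. f (y + a))" by (simp add: add.commute)
qed

text \<open>No compact support is available, so translation invariance is used: integrate the
  derivative over a unit segment and exchange integrals. One side is the integral of
  \<open>g'\<close>, the other a difference of two equal integrals.\<close>

lemma integral_line_deriv_zero:
 fixes g g' :: "R4 \<Rightarrow> real"
 assumes g: "integrable lborel g" and g': "integrable lborel g'"
  and d: "\<And>x. ((\<lambda>t. g (x + t *\<^sub>R e)) has_real_derivative g' x) (at 0)"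
  and c: "\<And>x. continuous_on UNIV (\<lambda>t. g' (x + t *\<^sub>R e))"
 shows "(LBINT x. g' x) = 0"
proof -
 have [measurable]: "g \<in> borel_measurable borel" "g' \<in> borel_measurable borel" using g g' by auto
 define f where "f = (\<lambda>(t::real, x). indicator {0..1} t * g' (x + t *\<^sub>R e))"
 have fm: "f \<in> borel_measurable (lborel \<Otimes>\<^sub>M lborel)" unfolding f_def by measurable
 have ti: "integrable lborel (\<lambda>x. g' (x + t *\<^sub>R e))" for t by (rule integral_translate_R4(2)[OF _ g']) measurable
 have fi: "integrable (lborel \<Otimes>\<^sub>M lborel) f"
 proof (rule lborel_pair.Fubini_integrable[OF fm])
  have "(LBINT x. norm (f (t, x))) = indicator {0..1} t * (LBINT x. \<bar>g' x\<bar>)" for t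
   using integral_translate_R4(1)[of "\<lambda>x. \<bar>g' x\<bar>" "t *\<^sub>R e"] by (simp add: f_def abs_mult)
  then show "integrable lborel (\<lambda>t. (LBINT x. norm (f (t, x))))" by simp
  show "AE t in lborel. integrable lborel (\<lambda>x. f (t, x))" using ti by (simp add: f_def)
 qed
 have ftc: "(LBINT t. f (t, x)) = g (x + e) - g x" for x
 proof -
  have "has_bochner_integral lborel (\<lambda>t. indicator {0..1} t *\<^sub>R g' (x + t *\<^sub>R e)) (g (x + 1 *\<^sub>R e) - g (x + 0 *\<^sub>R e))"
  proof (rule has_bochner_integral_FTC_Icc[of 0 1 "\<lambda>t. g (x + t *\<^sub>R e)"])
   show "((\<lambda>t. g (x + t *\<^sub>R e)) has_vector_derivative g' (x + t *\<^sub>R e)) (at t within {0..1})" for t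
    using line_shift_deriv[OF d, of x t] by (simp add: has_real_derivative_iff_has_vector_derivative has_vector_derivative_at_within)
   show "continuous_on {0..1} (\<lambda>t. g' (x + t *\<^sub>R e))" using c[of x] continuous_on_subset by blast
  qed simp
  then show ?thesis by (simp add: f_def has_bochner_integral_integral_eq)
 qed
 have "(LBINT x. (LBINT t. f (t, x))) = (LBINT t. (LBINT x. f (t, x)))"
  by (rule lborel_pair.Fubini_integral[of "\<lambda>t x. f (t, x)"]) (use fi in simp)
 also have "\<dots> = (LBINT t. indicator {0..1::real} t * (LBINT x. g' x))"
  by (simp add: f_def integral_translate_R4)
 also have "\<dots> = (LBINT x. g' x)" by (simp add: content_real)
 also have "(LBINT x. (LBINT t. f (t, x))) = (LBINT x. g (x + e)) - (LBINT x. g x)"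
  unfolding ftc by (rule Bochner_Integration.integral_diff[OF integral_translate_R4(2)[OF _ g] g]) measurable
 also have "\<dots> = 0" by (simp add: integral_translate_R4)
 finally show ?thesis by simp
qed

lemma integral_by_parts_line:
 assumes a: "sqint a" "sqint a'" and b: "sqint b" "sqint b'"
  and da: "\<And>x. ((\<lambda>t. a (x + t *\<^sub>R e)) has_real_derivative a' x) (at 0)"
  and db: "\<And>x. ((\<lambda>t. b (x + t *\<^sub>R e)) has_real_derivative b' x) (at 0)"
  and ca: "\<And>x. continuous_on UNIV (\<lambda>t. a' (x + t *\<^sub>R e))" and cb: "\<And>x. continuous_on UNIV (\<lambda>t. b' (x + t *\<^sub>R e))"
 shows "(LBINT x. a' x * b x) = - (LBINT x. a x * b' x)"
proof -
 have cont: "continuous_on UNIV (\<lambda>t. a (x + t *\<^sub>R e))" "continuous_on UNIV (\<lambda>t. b (x + t *\<^sub>R e))" for x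
  using DERIV_isCont[OF line_shift_deriv[OF da]] DERIV_isCont[OF line_shift_deriv[OF db]]
  by (simp_all add: continuous_on_eq_continuous_at)
 have "(LBINT x. a' x * b x + b' x * a x) = 0"
 proof (rule integral_line_deriv_zero[of "\<lambda>x. a x * b x" _ e])
  show "((\<lambda>t. a (x + t *\<^sub>R e) * b (x + t *\<^sub>R e)) has_real_derivative a' x * b x + b' x * a x) (at 0)" for x
   using DERIV_mult[OF da[of x] db[of x]] by simp
  show "continuous_on UNIV (\<lambda>t. a' (x + t *\<^sub>R e) * b (x + t *\<^sub>R e) + b' (x + t *\<^sub>R e) * a (x + t *\<^sub>R e))" for x
   by (intro continuous_intros ca cb cont)
 qed (use a b in \<open>auto intro!: sqint_mult\<close>)
 then show ?thesis
  by (subst (asm) Bochner_Integration.integral_add) (use a b in \<open>auto intro!: sqint_mult simp: mult.commute\<close>)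
qed

lemma test_fun_integrable_abs: "test_fun \<phi> \<Longrightarrow> \<exists>c\<ge>0. (NN z. ennreal \<bar>\<phi> z\<bar>) \<le> ennreal c"
proof -
 assume \<phi>: "test_fun \<phi>"
 have [measurable]: "\<phi> \<in> borel_measurable borel" using test_fun_meas[OF \<phi>] .
 obtain B R where B: "B \<ge> 0" "R > 0" "\<And>x. \<bar>\<phi> x\<bar> \<le> B * indicator (cball 0 R) x" using test_fun_support[OF \<phi>] by metis
 have "integrable lborel \<phi>"
  by (rule Bochner_Integration.integrable_bound[of _ "\<lambda>x. B * indicator (cball 0 R) x"])
   (use B in \<open>auto intro!: integrable_indicator_bounded intro: order_trans[OF _ abs_ge_self]\<close>)
 then have "(NN z. ennreal \<bar>\<phi> z\<bar>) = ennreal (LBINT z. \<bar>\<phi> z\<bar>)"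
  by (intro nn_integral_eq_integral) auto
 then show ?thesis by (intro exI[of _ "LBINT z. \<bar>\<phi> z\<bar>"]) auto
qed

lemma cv_test_sqint: "test_fun \<phi> \<Longrightarrow> sqint u \<Longrightarrow> sqint (cv \<phi> u)"
 by (metis conv_l2(1) test_fun_integrable_abs test_fun_meas)

lemma cv_test_line_cont: "test_fun \<phi> \<Longrightarrow> sqint u \<Longrightarrow> continuous_on UNIV (\<lambda>t. cv \<phi> u (x + t *\<^sub>R axis i 1))"
 using DERIV_isCont[OF line_shift_deriv[OF cv_line_deriv_0]] by (simp add: continuous_on_eq_continuous_at)

lemma cv_by_parts:
 assumes \<alpha>: "test_fun \<alpha>" and \<beta>: "test_fun \<beta>" and u: "sqint u"
 shows "(LBINT x. cv (partial_dir i \<alpha>) u x * cv \<beta> u x) = - (LBINT x. cv \<alpha> u x * cv (partial_dir i \<beta>) u x)"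
 by (rule integral_by_parts_line[where e = "axis i 1"])
  (intro cv_test_sqint cv_line_deriv_0 cv_test_line_cont test_fun_partial assms)+

lemma cv_test_by_parts:
 assumes \<alpha>: "test_fun \<alpha>" and \<phi>: "test_fun \<phi>" and u: "sqint u"
 shows "(LBINT x. cv \<alpha> u x * partial_dir i \<phi> x) = - (LBINT x. cv (partial_dir i \<alpha>) u x * \<phi> x)"
proof -
 have "(LBINT x. cv (partial_dir i \<alpha>) u x * \<phi> x) = - (LBINT x. cv \<alpha> u x * partial_dir i \<phi> x)"
 proof (rule integral_by_parts_line[where e = "axis i 1"])
  show "((\<lambda>t. \<phi> (x + t *\<^sub>R axis i 1)) has_real_derivative partial_dir i \<phi> x) (at 0)" for x
   using \<phi> by (intro smooth_fun_has_deriv) (simp add: test_fun_def)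
  show "continuous_on UNIV (\<lambda>t. partial_dir i \<phi> (x + t *\<^sub>R axis i 1))" for x
   by (intro continuous_on_compose2[OF test_fun_continuous[OF test_fun_partial[OF \<phi>]]] continuous_intros) auto
 qed (intro cv_test_sqint cv_line_deriv_0 cv_test_line_cont test_fun_partial test_fun_sqint assms)+
 then show ?thesis by simp
qed

lemma cv_test_iter_by_parts:
 assumes "test_fun \<alpha>" "test_fun \<phi>" "sqint u"
 shows "(LBINT x. cv \<alpha> u x * iter_partial ixs \<phi> x) = (-1) ^ length ixs * (LBINT x. cv (iter_partial (rev ixs) \<alpha>) u x * \<phi> x)"
 using assms(1)
proof (induction ixs arbitrary: \<alpha>)
 case (Cons i ixs)
 have "(LBINT x. cv \<alpha> u x * iter_partial (i # ixs) \<phi> x) = - (LBINT x. cv (partial_dir i \<alpha>) u x * iter_partial ixs \<phi> x)"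
  using cv_test_by_parts[OF Cons.prems test_fun_iter[OF assms(2)] assms(3), of i ixs] by simp
 then show ?case using Cons.IH[OF test_fun_partial[OF Cons.prems]] by (simp add: iter_partial_append)
qed simp

text \<open>The identity \<open>\<parallel>D\<^sup>2 v\<parallel> = \<parallel>\<Delta> v\<parallel>\<close> for \<open>v = \<alpha> * u\<close>; the sum over all pairs of directions is kept.\<close>
lemma hessian_identity:
 assumes \<alpha>: "test_fun \<alpha>" and u: "sqint u"
 shows "(LBINT x. (cv (partial_dir i (partial_dir j \<alpha>)) u x)^2)
  = (LBINT x. cv (partial_dir i (partial_dir i \<alpha>)) u x * cv (partial_dir j (partial_dir j \<alpha>)) u x)"
proof -
 note t = test_fun_partial
 have comm: "partial_dir i (partial_dir j \<phi>) = partial_dir j (partial_dir i \<phi>)" if "test_fun \<phi>" for \<phi>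
  using that partial_dir_commute by (auto simp: test_fun_def)
 let ?j = "partial_dir j \<alpha>" and ?ij = "partial_dir i (partial_dir j \<alpha>)"
 have "(LBINT x. cv ?ij u x * cv ?ij u x) = - (LBINT x. cv ?j u x * cv (partial_dir i ?ij) u x)"
  by (rule cv_by_parts) (intro t \<alpha> u)+
 also have "partial_dir i ?ij = partial_dir j (partial_dir i (partial_dir i \<alpha>))"
  by (simp add: comm[OF \<alpha>] comm[OF t[OF \<alpha>]])
 also have "- (LBINT x. cv ?j u x * cv (partial_dir j (partial_dir i (partial_dir i \<alpha>))) u x)
   = (LBINT x. cv (partial_dir j ?j) u x * cv (partial_dir i (partial_dir i \<alpha>)) u x)"
  by (rule cv_by_parts[symmetric]) (intro t \<alpha> u)+
 finally show ?thesis by (simp add: power2_eq_square mult.commute)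
qed

lemma cv_sum:
 assumes "finite J" "\<And>i. i \<in> J \<Longrightarrow> test_fun (\<phi> i)" "sqint u"
 shows "cv (\<lambda>z. \<Sum>i\<in>J. \<phi> i z) u x = (\<Sum>i\<in>J. cv (\<phi> i) u x)"
proof -
 have "integrable lborel (\<lambda>y. u y * \<phi> i (x - y))" if "i \<in> J" for i
  using test_fun_support[OF assms(2)[OF that]] integrable_cv_bounded[OF assms(3) test_fun_meas[OF assms(2)[OF that]]] by metis
 then show ?thesis unfolding cv_def by (simp add: sum_distrib_left Bochner_Integration.integral_sum)
qed

text \<open>Summed over all pairs, the Hessian identity is an equality between the squared norms of
  the Hessian and of the Laplacian. A single entry is therefore dominated.\<close>

lemma hessian_sum:
 assumes \<alpha>: "test_fun \<alpha>" and u: "sqint u"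
 shows "(LBINT x. (cv (partial_dir i (partial_dir j \<alpha>)) u x)^2) \<le> (LBINT x. (cv (lapl \<alpha>) u x)^2)"
proof -
 note t = test_fun_partial
 let ?d = "\<lambda>i. cv (partial_dir i (partial_dir i \<alpha>)) u"
 have s: "sqint (?d i)" for i by (intro cv_test_sqint t \<alpha> u)
 have l: "cv (lapl \<alpha>) u x = (\<Sum>i\<in>UNIV. ?d i x)" for x
  unfolding lapl_def[abs_def] iter_partial.simps by (rule cv_sum) (auto intro: t \<alpha> u)
 have "(LBINT x. (cv (lapl \<alpha>) u x)^2) = (LBINT x. (\<Sum>i\<in>UNIV. \<Sum>j\<in>UNIV. ?d i x * ?d j x))"
  by (simp add: l power2_eq_square sum_product)
 also have "\<dots> = (\<Sum>i\<in>UNIV. \<Sum>j\<in>UNIV. (LBINT x. ?d i x * ?d j x))"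
  by (simp add: Bochner_Integration.integral_sum sqint_mult s)
 also have "\<dots> = (\<Sum>i\<in>UNIV. \<Sum>j\<in>UNIV. (LBINT x. (cv (partial_dir i (partial_dir j \<alpha>)) u x)^2))"
  by (simp add: hessian_identity[OF \<alpha> u])
 also have "\<dots> \<ge> (\<Sum>j\<in>UNIV. (LBINT x. (cv (partial_dir i (partial_dir j \<alpha>)) u x)^2))"
  by (rule member_le_sum) (auto intro!: sum_nonneg)
 moreover have "(\<Sum>j\<in>UNIV. (LBINT x. (cv (partial_dir i (partial_dir j \<alpha>)) u x)^2)) \<ge> (LBINT x. (cv (partial_dir i (partial_dir j \<alpha>)) u x)^2)"
  by (rule member_le_sum) auto
 ultimately show ?thesis by linarith
qed

text \<open>Interpolation: one integration by parts moves a derivative across, and Cauchy-Schwarz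
  bounds the gradient by the function and a second derivative.\<close>

lemma gradient_bound:
 assumes \<alpha>: "test_fun \<alpha>" and u: "sqint u"
 shows "(LBINT x. (cv (partial_dir i \<alpha>) u x)^2) \<le> norm (abs_l2 (cv \<alpha> u)) * norm (abs_l2 (cv (partial_dir i (partial_dir i \<alpha>)) u))"
proof -
 note t = test_fun_partial
 have "(LBINT x. (cv (partial_dir i \<alpha>) u x)^2) = - (LBINT x. cv \<alpha> u x * cv (partial_dir i (partial_dir i \<alpha>)) u x)"
  using cv_by_parts[OF \<alpha> t[OF \<alpha>] u, of i i] by (simp add: power2_eq_square)
 also have "\<dots> = - inner (abs_l2 (cv \<alpha> u)) (abs_l2 (cv (partial_dir i (partial_dir i \<alpha>)) u))"
  by (subst inner_abs) (auto intro!: cv_test_sqint t \<alpha> u)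
 also have "\<dots> \<le> norm (abs_l2 (cv \<alpha> u)) * norm (abs_l2 (cv (partial_dir i (partial_dir i \<alpha>)) u))"
  using Cauchy_Schwarz_ineq2 by (metis abs_le_D2)
 finally show ?thesis .
qed

section \<open>Affine changes of variable in test functions, and mollification by
  \<open>kS\<close>\<close>

lemma iter_partial_affine:
 assumes "smooth_fun f"
 shows "iter_partial ixs (\<lambda>x. f (b + k *\<^sub>R x)) = (\<lambda>x. k ^ length ixs * iter_partial ixs f (b + k *\<^sub>R x))"
proof (induction ixs)
 case (Cons i ixs)
 have "((\<lambda>t. k ^ length ixs * iter_partial ixs f (b + k *\<^sub>R (x + t *\<^sub>R axis i 1))) has_real_derivative
   k ^ length ixs * (partial_dir i (iter_partial ixs f) (b + k *\<^sub>R x) * k)) (at 0)" for x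
 proof (intro DERIV_cmult)
  have "((\<lambda>t. iter_partial ixs f ((b + k *\<^sub>R x) + t *\<^sub>R axis i 1)) has_real_derivative partial_dir i (iter_partial ixs f) (b + k *\<^sub>R x)) (at (k * 0))"
   using smooth_fun_has_deriv[OF smooth_fun_iter[OF assms]] by simp
  then have "((\<lambda>t. iter_partial ixs f ((b + k *\<^sub>R x) + (k * t) *\<^sub>R axis i 1)) has_real_derivative partial_dir i (iter_partial ixs f) (b + k *\<^sub>R x) * k) (at 0)"
   by (rule DERIV_chain2) (auto intro!: derivative_eq_intros)
  then show "((\<lambda>t. iter_partial ixs f (b + k *\<^sub>R (x + t *\<^sub>R axis i 1))) has_real_derivative partial_dir i (iter_partial ixs f) (b + k *\<^sub>R x) * k) (at 0)"
   by (simp add: scaleR_add_right add.assoc)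
 qed
 then have "partial_dir i (\<lambda>x. k ^ length ixs * iter_partial ixs f (b + k *\<^sub>R x)) = (\<lambda>x. k ^ length ixs * (partial_dir i (iter_partial ixs f) (b + k *\<^sub>R x) * k))"
  by (rule partial_dir_eqI)
 then show ?case by (simp add: Cons mult_ac)
qed simp

lemma smooth_fun_affine: "smooth_fun f \<Longrightarrow> smooth_fun (\<lambda>x. f (b + k *\<^sub>R x))"
proof -
 assume f: "smooth_fun f"
 show ?thesis unfolding smooth_fun_def
 proof (intro allI conjI)
  fix ixs
  show "continuous_on UNIV (iter_partial ixs (\<lambda>x. f (b + k *\<^sub>R x)))"
   unfolding iter_partial_affine[OF f]
   by (intro continuous_intros continuous_on_compose2[OF smooth_fun_continuous[OF smooth_fun_iter[OF f]]]) auto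
  fix i x
  have "((\<lambda>t. iter_partial ixs f ((b + k *\<^sub>R x) + t *\<^sub>R axis i 1)) has_real_derivative partial_dir i (iter_partial ixs f) (b + k *\<^sub>R x)) (at (k * 0))"
   using smooth_fun_has_deriv[OF smooth_fun_iter[OF f]] by simp
  then have "((\<lambda>t. iter_partial ixs f ((b + k *\<^sub>R x) + (k * t) *\<^sub>R axis i 1)) has_real_derivative partial_dir i (iter_partial ixs f) (b + k *\<^sub>R x) * k) (at 0)"
   by (rule DERIV_chain2) (auto intro!: derivative_eq_intros)
  from DERIV_cmult[OF this, of "k ^ length ixs"]
  show "(\<lambda>t. iter_partial ixs (\<lambda>x. f (b + k *\<^sub>R x)) (x + t *\<^sub>R axis i 1)) differentiable at 0"
   unfolding iter_partial_affine[OF f] by (auto simp: real_differentiable_def scaleR_add_right add.assoc)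
 qed
qed

lemma test_fun_affine: "test_fun f \<Longrightarrow> k \<noteq> 0 \<Longrightarrow> test_fun (\<lambda>x. f (b + k *\<^sub>R x))"
proof -
 assume f: "test_fun f" and k: "k \<noteq> 0"
 obtain R where R: "\<And>x. f x \<noteq> 0 \<Longrightarrow> norm x \<le> R" using f by (auto simp: test_fun_def bounded_iff)
 show ?thesis
 proof (rule test_fun_mult_bounded)
  show "sm (\<lambda>x. f (b + k *\<^sub>R x))" using smooth_fun_affine f by (auto simp: test_fun_def smooth_fun_iff_sm)
  fix x assume "f (b + k *\<^sub>R x) \<noteq> 0"
  then have "norm (b + k *\<^sub>R x) \<le> R" by (rule R)
  then have "norm (k *\<^sub>R x) \<le> R + norm b" using norm_triangle_ineq4[of "b + k *\<^sub>R x" b] by simp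
  then show "norm x \<le> (R + norm b) / \<bar>k\<bar>" using k by (simp add: pos_le_divide_eq mult.commute)
 qed
qed

lemma lapl_affine: "smooth_fun f \<Longrightarrow> lapl (\<lambda>x. f (b + k *\<^sub>R x)) y = k^2 * lapl f (b + k *\<^sub>R y)"
 unfolding lapl_def by (subst iter_partial_affine) (auto simp: sum_distrib_left power2_eq_square simp del: iter_partial.simps)

lemma kS_test0: "s > 0 \<Longrightarrow> test_fun (kS s)"
 using kS_test[of s 0] by (simp add: kS_minus)

text \<open>Translates of the even kernel \<open>kS s\<close> are test functions, so the Laplacian
  can be moved from the kernel to the function.\<close>

lemma cv_lapl_kS:
 assumes "(p, w) \<in> wlap" "s > 0"
 shows "cv (lapl (kS s)) (fn p) x = cv (kS s) (fn w) x"
proof -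
 have "lapl (\<lambda>y. kS s (x - y)) y = lapl (kS s) (x - y)" for y
  using lapl_affine[of "kS s" x "-1" y] kS_test0[OF assms(2)] by (simp add: test_fun_def)
 then show ?thesis using wlapD[OF assms(1) kS_test[OF assms(2)], of x] by (simp add: cv_def)
qed

text \<open>The representation says that the mollification error is the convolution of
  \<open>w\<close> with \<open>kG s\<close>, a kernel of mass at most s/4. This rate underlies all
  compactness arguments below.\<close>

lemma kS_approx:
 assumes pw: "(p, w) \<in> wlap" and s: "s > 0"
 shows "norm (abs_l2 (cv (kS s) (fn p)) - p) \<le> s / 4 * norm w"
proof -
 have kGi: "(NN z. ennreal \<bar>kG s z\<bar>) \<le> ennreal (s / 4)"
  using nn_integral_kG[OF s] by (simp add: kG_nonneg)
 note G = conv_l2[OF kG_meas fn_sqint kGi, of w]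
 have S: "sqint (cv (kS s) (fn p))" by (intro cv_test_sqint kS_test0 s fn_sqint)
 have "abs_l2 (cv (kS s) (fn p)) - p = abs_l2 (cv (kG s) (fn w))"
  by (rule l2_eqI) (use fn_diff[of "abs_l2 (cv (kS s) (fn p))" p] fn_abs[OF S] fn_abs[OF G(1)] representation[OF pw s] s
    in \<open>auto elim!: AE_mp\<close>)
 then show ?thesis using G(2) s by simp
qed

text \<open>Membership in \<open>W22\<close> requires every derivative of order at most 2, while
  \<open>wlap\<close> knows only the Laplacian. The mollifications by \<open>kS\<close> have
  derivatives bounded through \<open>hessian_sum\<close> and \<open>gradient_bound\<close>, and a
  weak limit of these is the derivative sought.\<close>

lemma regularity:
 assumes pw: "(p, w) \<in> wlap" and len: "length ixs \<le> 2"
 shows "\<exists>g::l2. \<forall>\<phi>. test_fun \<phi> \<longrightarrow> inner p (abs_l2 (iter_partial ixs \<phi>)) = (-1) ^ length ixs * inner g (abs_l2 \<phi>)"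
proof -
 define s where "s n = inverse (real (Suc n))" for n
 have s: "s n > 0" for n by (simp add: s_def)
 have s0: "s \<longlonglongrightarrow> 0" unfolding s_def by (rule LIMSEQ_inverse_real_of_nat)
 obtain C where C: "C \<ge> 0" "\<And>s. s > 0 \<Longrightarrow> (NN z. ennreal \<bar>kS s z\<bar>) \<le> ennreal C" using nn_integral_kS by blast
 define v where "v n = abs_l2 (cv (kS (s n)) (fn p))" for n
 \<comment> \<open>Integration by parts peels directions off the test function from the outside, so
   they reach the kernel in reversed order.\<close>
 define h where "h n = abs_l2 (cv (iter_partial (rev ixs) (kS (s n))) (fn p))" for n
 note T = kS_test0[OF s]
 have sq: "sqint (cv (iter_partial js (kS (s n))) (fn q))" for n js q
  by (intro cv_test_sqint test_fun_iter T fn_sqint)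
 have vB: "norm (abs_l2 (cv (kS (s n)) (fn q))) \<le> C * norm q" for n q
  using conv_l2(2)[OF kS_meas fn_sqint C(2)[OF s] C(1), of n q] by simp
 have lB: "(LBINT x. (cv (lapl (kS (s n))) (fn p) x)^2) \<le> (C * norm w)^2" for n
 proof -
  have "(LBINT x. (cv (lapl (kS (s n))) (fn p) x)^2) = (norm (abs_l2 (cv (kS (s n)) (fn w))))^2"
   using sq[of "[]" n w] by (simp add: cv_lapl_kS[OF pw s] norm_abs_sq)
  then show ?thesis using vB[of n w] by (simp add: power_mono)
 qed
 have 2: "norm (abs_l2 (cv (iter_partial [i, j] (kS (s n))) (fn p))) \<le> C * norm w" for n i j
 proof (rule power2_le_imp_le)
  show "(norm (abs_l2 (cv (iter_partial [i, j] (kS (s n))) (fn p))))^2 \<le> (C * norm w)^2"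
   using order_trans[OF hessian_sum[OF T fn_sqint] lB] norm_abs_sq[OF sq[of "[i,j]" n p]] by simp
 qed (use C in simp)
 have 1: "norm (abs_l2 (cv (iter_partial [i] (kS (s n))) (fn p))) \<le> C * norm p + C * norm w" for n i
 proof (rule power2_le_imp_le)
  have "(norm (abs_l2 (cv (iter_partial [i] (kS (s n))) (fn p))))^2 \<le> (C * norm p) * (C * norm w)"
   using order_trans[OF gradient_bound[OF T fn_sqint, of i n p] mult_mono[OF vB 2[where n = n and i = i and j = i, simplified]]] C norm_abs_sq[OF sq[of "[i]" n p]] by simp
  also have "\<dots> \<le> (C * norm p + C * norm w) * (C * norm p + C * norm w)" using C by (intro mult_mono) auto
  finally show "(norm (abs_l2 (cv (iter_partial [i] (kS (s n))) (fn p))))^2 \<le> (C * norm p + C * norm w)^2"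
   by (simp add: power2_eq_square)
 qed (use C in simp)
 have hB: "norm (h n) \<le> C * norm p + C * norm w" for n
 proof -
  consider "ixs = []" | i where "ixs = [i]" | i j where "ixs = [i, j]"
   using len by (cases ixs rule: remdups_adj.cases) auto
  then show ?thesis
  proof cases
   case 1
   then show ?thesis using vB[of n p] C by (simp add: h_def add_increasing2)
  next
   case (2 i)
   then show ?thesis using 1[where n = n and i = i] by (simp add: h_def)
  next
   case (3 i j)
   then show ?thesis using 2[where n = n and i = j and j = i] C by (simp add: h_def add_increasing)
  qed
 qed
 obtain r g where r: "strict_mono (r :: nat \<Rightarrow> nat)" and g: "\<And>\<phi>. (\<lambda>n. inner (h (r n)) \<phi>) \<longlonglongrightarrow> inner g \<phi>"
  using bounded_weak_subseq[of h, OF hB] by metis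
 have "(\<lambda>n. v n - p) \<longlonglongrightarrow> 0"
 proof (rule Lim_null_comparison)
  show "\<forall>\<^sub>F n in sequentially. norm (v n - p) \<le> s n / 4 * norm w"
   unfolding v_def using kS_approx[OF pw s] by (intro always_eventually allI)
  show "(\<lambda>n. s n / 4 * norm w) \<longlonglongrightarrow> 0" using tendsto_mult[OF tendsto_divide[OF s0 tendsto_const[of 4]] tendsto_const[of "norm w"]] by simp
 qed
 then have vp: "v \<longlonglongrightarrow> p" by (simp add: LIM_zero_iff)
 show ?thesis
 proof (intro exI[of _ g] allI impI)
  fix \<phi> assume \<phi>: "test_fun \<phi>"
  have "inner (v n) (abs_l2 (iter_partial ixs \<phi>)) = (-1) ^ length ixs * inner (h n) (abs_l2 \<phi>)" for n
   unfolding v_def h_def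
   using cv_test_iter_by_parts[OF T \<phi> fn_sqint, of n p ixs] sq[of "[]" n p] sq[of "rev ixs" n p]
    test_fun_sqint[OF \<phi>] test_fun_sqint[OF test_fun_iter[OF \<phi>]]
   by (simp add: inner_abs)
  moreover have "(\<lambda>n. inner (v (r n)) (abs_l2 (iter_partial ixs \<phi>))) \<longlonglongrightarrow> inner p (abs_l2 (iter_partial ixs \<phi>))"
   using LIMSEQ_subseq_LIMSEQ[OF vp r] by (intro tendsto_intros) (simp add: o_def)
  ultimately have "(\<lambda>n. (-1) ^ length ixs * inner (h (r n)) (abs_l2 \<phi>)) \<longlonglongrightarrow> inner p (abs_l2 (iter_partial ixs \<phi>))" by simp
  moreover have "(\<lambda>n. (-1) ^ length ixs * inner (h (r n)) (abs_l2 \<phi>)) \<longlonglongrightarrow> (-1) ^ length ixs * inner g (abs_l2 \<phi>)"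
   by (intro tendsto_intros g)
  ultimately show "inner p (abs_l2 (iter_partial ixs \<phi>)) = (-1) ^ length ixs * inner g (abs_l2 \<phi>)" by (rule LIMSEQ_unique)
 qed
qed

lemma wlap_unique:
 assumes "(p, w) \<in> wlap" "(p, w') \<in> wlap" shows "w = w'"
proof -
 have "(0, w - w') \<in> wlap" using wlap_diff[OF assms] by simp
 then have z: "inner (w - w') (abs_l2 \<phi>) = 0" if "test_fun \<phi>" for \<phi> using that by (simp add: wlap_def)
 have "AE x in lborel. fn (w - w') x = 0"
 proof (rule fundamental_lemma)
  show "integrable lborel (\<lambda>x. fn (w - w') x * indicator (cball 0 R) x)" for R
   by (rule sqint_mult[OF fn_sqint sqint_bounded_support[where B = 1]]) (auto intro!: borel_measurable_indicator)
  show "(LBINT x. fn (w - w') x * \<psi> x) = 0" if "test_fun \<psi>" for \<psi>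
   using z[OF that] inner_abs_right[OF test_fun_sqint[OF that]] by simp
 qed simp
 then have "w - w' = 0" using fn_0 by (intro l2_eqI) auto
 then show ?thesis by simp
qed

section \<open>Passing between \<open>W22\<close> over Lebesgue measure and Borel
  representatives\<close>

lemma borel_lebesgue: "f \<in> borel_measurable borel \<Longrightarrow> f \<in> borel_measurable lebesgue"
 by (simp add: measurable_completion)

lemma L2_repr:
 assumes "u \<in> L2" obtains p where "AE x in lebesgue. u x = fn p x"
proof -
 have u: "u \<in> borel_measurable lebesgue" "integrable lebesgue (\<lambda>x. (u x)^2)" using assms by (auto simp: L2_def)
 obtain v where v: "v \<in> borel_measurable lborel" "AE x in lborel. u x = v x"
  using completion_ex_borel_measurable_real[OF u(1)] by auto
 have ae: "AE x in lebesgue. u x = v x" using v(2) by (rule AE_completion)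
 have vm: "v \<in> borel_measurable lebesgue" using v(1) by (simp add: measurable_completion)
 have "integrable lebesgue (\<lambda>x. (v x)^2)"
  by (rule Bochner_Integration.integrable_cong_AE_imp[OF u(2)]) (use ae vm in auto)
 then have s: "sqint v" using v(1) by (simp add: sqint_def integrable_completion)
 have "AE x in lebesgue. fn (abs_l2 v) x = v x" using fn_abs[OF s] by (rule AE_completion)
 with ae have "AE x in lebesgue. u x = fn (abs_l2 v) x" by auto
 then show thesis by (rule that)
qed

lemma lebesgue_transfer:
 assumes "u \<in> borel_measurable lebesgue" "f \<in> borel_measurable borel" "AE x in lebesgue. u x = f x"
 shows "integrable lebesgue u \<longleftrightarrow> integrable lborel f" "(\<integral>x. u x \<partial>lebesgue) = (LBINT x. (f x :: real))"
proof -
 note fm = borel_lebesgue[OF assms(2)]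
 show "integrable lebesgue u \<longleftrightarrow> integrable lborel f"
  using integrable_cong_AE[OF assms(1) fm assms(3)] assms(2) by (simp add: integrable_completion)
 show "(\<integral>x. u x \<partial>lebesgue) = (LBINT x. f x)"
  using integral_cong_AE[OF assms(1) fm assms(3)] assms(2) by (simp add: integral_completion)
qed

lemma fn_in_L2: "fn p \<in> L2"
 using fn_sqint[of p] borel_lebesgue[OF fn_meas] by (auto simp: L2_def sqint_def integrable_completion)

lemma weak_deriv_fn:
 assumes u: "u \<in> borel_measurable lebesgue" "AE x in lebesgue. u x = fn p x"
  and g: "\<And>\<phi>. test_fun \<phi> \<Longrightarrow> inner p (abs_l2 (iter_partial ixs \<phi>)) = (-1) ^ length ixs * inner g (abs_l2 \<phi>)"
 shows "weak_deriv ixs u (fn g)"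
 unfolding weak_deriv_def
proof (intro conjI allI impI)
 show "fn g \<in> borel_measurable lebesgue" by (rule borel_lebesgue) simp
 fix \<phi> assume \<phi>: "test_fun \<phi>"
 note m = test_fun_meas[OF \<phi>] test_fun_meas[OF test_fun_iter[OF \<phi>, of ixs]]
 have um: "(\<lambda>x. u x * iter_partial ixs \<phi> x) \<in> borel_measurable lebesgue"
  using u(1) borel_lebesgue[OF m(2)] by simp
 have ae: "AE x in lebesgue. u x * iter_partial ixs \<phi> x = fn p x * iter_partial ixs \<phi> x" using u(2) by auto
 note t = lebesgue_transfer[OF um _ ae]
 have gm: "(\<lambda>x. fn g x * \<phi> x) \<in> borel_measurable borel" using m by simp
 note t' = lebesgue_transfer[OF borel_lebesgue[OF gm] gm AE_I2]
 show "integrable lebesgue (\<lambda>x. u x * iter_partial ixs \<phi> x)"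
  using t(1) m(2) sqint_mult[OF fn_sqint test_fun_sqint[OF test_fun_iter[OF \<phi>]]] by simp
 show "integrable lebesgue (\<lambda>x. fn g x * \<phi> x)"
  using t'(1) sqint_mult[OF fn_sqint test_fun_sqint[OF \<phi>]] by simp
 show "(\<integral>x. u x * iter_partial ixs \<phi> x \<partial>lebesgue) = (-1) ^ length ixs * (\<integral>x. fn g x * \<phi> x \<partial>lebesgue)"
  using t(2) m(2) t'(2) g[OF \<phi>] inner_abs_right[OF test_fun_sqint[OF \<phi>], of g] inner_abs_right[OF test_fun_sqint[OF test_fun_iter[OF \<phi>, of ixs]], of p]
  by simp
qed

lemma wlap_fn_W22:
 assumes "(p, w) \<in> wlap" shows "fn p \<in> W22"
 unfolding W22_def
proof (intro CollectI conjI allI impI fn_in_L2)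
 fix ixs :: "4 list" assume len: "length ixs \<le> 2"
 from regularity[OF assms len] obtain g :: l2
  where g: "\<And>\<phi>. test_fun \<phi> \<Longrightarrow> inner p (abs_l2 (iter_partial ixs \<phi>)) = (-1) ^ length ixs * inner g (abs_l2 \<phi>)" by blast
 have "weak_deriv ixs (fn p) (fn g)"
  by (rule weak_deriv_fn[OF borel_lebesgue[OF fn_meas] AE_I2 g]) auto
 then show "\<exists>g\<in>L2. weak_deriv ixs (fn p) g" using fn_in_L2 by blast
qed

text \<open>A weak Laplacian is only assumed integrable against test functions. One that is bounded
  below on a ball upgrades this to local integrability.\<close>

lemma positive_test_fun:
 "\<exists>\<phi> c. test_fun \<phi> \<and> c > 0 \<and> (\<forall>x\<in>cball 0 R. c \<le> \<phi> x)"
proof -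
 define r where "r = \<bar>R\<bar> + 1"
 have r: "r > 0" "r > R" by (auto simp: r_def)
 define \<phi> where "\<phi> y = En 1 (2 * r^2 - (norm (0 - y))\<^sup>2)" for y :: R4
 have "test_fun \<phi>"
 proof (rule test_fun_mult_bounded)
  show "sm \<phi>" unfolding \<phi>_def by (intro sm_En sm_diff sm_const sm_norm_sq)
  fix x assume "\<phi> x \<noteq> 0"
  then have "(norm x)^2 < 2 * r^2" by (auto simp: \<phi>_def En_def split: if_splits)
  also have "\<dots> \<le> (2 * r)^2" by (simp add: power_mult_distrib)
  finally show "norm x \<le> 2 * r" using r by (meson less_imp_le mult_nonneg_nonneg power2_less_imp_less zero_le_numeral)
 qed
 moreover have "exp (- (1 / r^2)) \<le> \<phi> x" if "x \<in> cball 0 R" for x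
 proof -
  have "(norm x)^2 \<le> r^2" using that r by (intro power_mono) auto
  then have "r^2 \<le> 2 * r^2 - (norm x)\<^sup>2" by simp
  moreover have "r^2 > 0" using r by simp
  moreover from calculation have "2 * r^2 - (norm x)\<^sup>2 > 0" by linarith
  ultimately have "1 / (2 * r^2 - (norm x)\<^sup>2) \<le> 1 / r^2" "2 * r^2 - (norm x)\<^sup>2 > 0"
   by (simp_all only: divide_left_mono mult_pos_pos zero_le_one)
  then show ?thesis by (simp add: \<phi>_def En_def)
 qed
 ultimately show ?thesis by (intro exI[of _ \<phi>] exI[of _ "exp (- (1 / r^2))"]) auto
qed

text \<open>The function \<open>lap u\<close> is an arbitrary choice among all weak Laplacians, not
  known to be square integrable. It is compared with the sum of the pure second derivatives, which
  is, by the fundamental lemma.\<close>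

theorem W22_repr:
 assumes u: "u \<in> W22"
 obtains p w where "(p, w) \<in> wlap" "AE x in lebesgue. u x = fn p x" "AE x in lebesgue. lap u x = fn w x"
proof -
 have uL: "u \<in> L2" "u \<in> borel_measurable lebesgue" using u by (auto simp: W22_def L2_def)
 obtain p where p: "AE x in lebesgue. u x = fn p x" using L2_repr[OF uL(1)] .
 have "\<exists>q. \<forall>\<phi>. test_fun \<phi> \<longrightarrow> inner p (abs_l2 (iter_partial [i, i] \<phi>)) = inner q (abs_l2 \<phi>)" for i
 proof -
  have "\<exists>g\<in>L2. weak_deriv [i, i] u g" using u unfolding W22_def by force
  then obtain g where g: "g \<in> L2" "weak_deriv [i, i] u g" by blast
  obtain q where q: "AE x in lebesgue. g x = fn q x" using L2_repr[OF g(1)] .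
  have gm: "g \<in> borel_measurable lebesgue" using g(1) by (simp add: L2_def)
  show ?thesis
  proof (intro exI[of _ q] allI impI)
   fix \<phi> assume \<phi>: "test_fun \<phi>"
   note m = test_fun_meas[OF \<phi>] test_fun_meas[OF test_fun_iter[OF \<phi>, of "[i,i]"]]
   have "(\<integral>x. u x * iter_partial [i, i] \<phi> x \<partial>lebesgue) = (LBINT x. fn p x * iter_partial [i, i] \<phi> x)"
    using uL(2) m borel_lebesgue[OF m(2)] p by (intro lebesgue_transfer(2)) (auto simp del: iter_partial.simps)
   moreover have "(\<integral>x. g x * \<phi> x \<partial>lebesgue) = (LBINT x. fn q x * \<phi> x)"
    using gm m borel_lebesgue[OF m(1)] q by (intro lebesgue_transfer(2)) auto
   moreover have "(\<integral>x. u x * iter_partial [i, i] \<phi> x \<partial>lebesgue) = (\<integral>x. g x * \<phi> x \<partial>lebesgue)"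
    using g(2) \<phi> by (simp add: weak_deriv_def)
   ultimately show "inner p (abs_l2 (iter_partial [i, i] \<phi>)) = inner q (abs_l2 \<phi>)"
    using inner_abs_right[OF test_fun_sqint[OF \<phi>], of q] inner_abs_right[OF test_fun_sqint[OF test_fun_iter[OF \<phi>, of "[i,i]"]], of p] by simp
  qed
 qed
 then obtain q where q: "\<And>i \<phi>. test_fun \<phi> \<Longrightarrow> inner p (abs_l2 (iter_partial [i, i] \<phi>)) = inner (q i) (abs_l2 \<phi>)" by metis
 define w where "w = (\<Sum>i\<in>UNIV. q i)"
 have lap_eq: "inner p (abs_l2 (lapl \<phi>)) = (\<Sum>i\<in>UNIV. inner p (abs_l2 (iter_partial [i, i] \<phi>)))" if \<phi>: "test_fun \<phi>" for \<phi>
 proof -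
  note it = test_fun_sqint[OF test_fun_iter[OF \<phi>]]
  have "inner p (abs_l2 (lapl \<phi>)) = (LBINT x. (\<Sum>i\<in>UNIV. fn p x * iter_partial [i, i] \<phi> x))"
   using inner_abs_right[OF test_fun_sqint[OF lapl_test[OF \<phi>]], of p] by (simp add: lapl_def sum_distrib_left del: iter_partial.simps)
  also have "\<dots> = (\<Sum>i\<in>UNIV. (LBINT x. fn p x * iter_partial [i, i] \<phi> x))"
   by (intro Bochner_Integration.integral_sum sqint_mult fn_sqint it)
  finally show ?thesis by (simp add: inner_abs_right[OF it] del: iter_partial.simps)
 qed
 have pw: "(p, w) \<in> wlap"
  unfolding wlap_def w_def using lap_eq q by (auto simp: inner_sum_left simp del: iter_partial.simps)
 have wl: "weak_laplacian u (fn w)"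
  unfolding weak_laplacian_def
 proof (intro conjI allI impI)
  show "fn w \<in> borel_measurable lebesgue" by (rule borel_lebesgue) simp
  fix \<phi> assume \<phi>: "test_fun \<phi>"
  note m = test_fun_meas[OF \<phi>] test_fun_meas[OF lapl_test[OF \<phi>]]
  have um: "(\<lambda>x. u x * lapl \<phi> x) \<in> borel_measurable lebesgue" using uL(2) borel_lebesgue[OF m(2)] by simp
  have ae: "AE x in lebesgue. u x * lapl \<phi> x = fn p x * lapl \<phi> x" using p by auto
  note t = lebesgue_transfer[OF um _ ae]
  have gm: "(\<lambda>x. fn w x * \<phi> x) \<in> borel_measurable borel" using m by simp
  note t' = lebesgue_transfer[OF borel_lebesgue[OF gm] gm AE_I2]
  show "integrable lebesgue (\<lambda>x. u x * (\<Sum>i\<in>UNIV. iter_partial [i, i] \<phi> x))"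
   unfolding lapl_def[symmetric] using t(1) m(2) sqint_mult[OF fn_sqint test_fun_sqint[OF lapl_test[OF \<phi>]]] by simp
  show "integrable lebesgue (\<lambda>x. fn w x * \<phi> x)" using t'(1) sqint_mult[OF fn_sqint test_fun_sqint[OF \<phi>]] by simp
  show "(\<integral>x. u x * (\<Sum>i\<in>UNIV. iter_partial [i, i] \<phi> x) \<partial>lebesgue) = (\<integral>x. fn w x * \<phi> x \<partial>lebesgue)"
   unfolding lapl_def[symmetric] using t(2) m(2) t'(2) wlapD[OF pw \<phi>] by simp
 qed
 \<comment> \<open>The witness \<open>fn w\<close> is needed for this: without one the choice
   operator would say nothing about \<open>lap u\<close>.\<close>
 then have lu: "weak_laplacian u (lap u)" unfolding lap_def by (rule someI[of "weak_laplacian u"])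
 have lm: "lap u \<in> borel_measurable lebesgue" using lu by (simp add: weak_laplacian_def)
 obtain v where v: "v \<in> borel_measurable lborel" "AE x in lborel. lap u x = v x"
  using completion_ex_borel_measurable_real[OF lm] by auto
 have [measurable]: "v \<in> borel_measurable borel" using v by simp
 have lv: "AE x in lebesgue. lap u x = v x" using v(2) by (rule AE_completion)
 have tr: "integrable lborel (\<lambda>x. v x * \<phi> x)" "(LBINT x. v x * \<phi> x) = (LBINT x. fn w x * \<phi> x)" if \<phi>: "test_fun \<phi>" for \<phi>
 proof -
  note m = test_fun_meas[OF \<phi>]
  have "(\<lambda>x. lap u x * \<phi> x) \<in> borel_measurable lebesgue" using lm borel_lebesgue[OF m] by simp
  moreover have "AE x in lebesgue. lap u x * \<phi> x = v x * \<phi> x" using lv by auto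
  moreover have "(\<lambda>x. v x * \<phi> x) \<in> borel_measurable borel" using m by measurable
  ultimately have t: "integrable lebesgue (\<lambda>x. lap u x * \<phi> x) \<longleftrightarrow> integrable lborel (\<lambda>x. v x * \<phi> x)"
   "(\<integral>x. lap u x * \<phi> x \<partial>lebesgue) = (LBINT x. v x * \<phi> x)"
   using lebesgue_transfer[of "\<lambda>x. lap u x * \<phi> x" "\<lambda>x. v x * \<phi> x"] by blast+
  show "integrable lborel (\<lambda>x. v x * \<phi> x)" using t(1) lu \<phi> by (simp add: weak_laplacian_def)
  have gm: "(\<lambda>x. fn w x * \<phi> x) \<in> borel_measurable borel" using m by simp
  have "(\<integral>x. lap u x * \<phi> x \<partial>lebesgue) = (\<integral>x. fn w x * \<phi> x \<partial>lebesgue)"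
  proof -
   have "(\<integral>x. lap u x * \<phi> x \<partial>lebesgue) = (\<integral>x. u x * (\<Sum>i\<in>UNIV. iter_partial [i, i] \<phi> x) \<partial>lebesgue)"
    using lu \<phi> unfolding weak_laplacian_def by simp
   also have "\<dots> = (\<integral>x. fn w x * \<phi> x \<partial>lebesgue)" using wl \<phi> unfolding weak_laplacian_def by simp
   finally show ?thesis .
  qed
  also have "\<dots> = (LBINT x. fn w x * \<phi> x)" by (rule lebesgue_transfer(2)[OF borel_lebesgue[OF gm] gm AE_I2]) simp
  finally show "(LBINT x. v x * \<phi> x) = (LBINT x. fn w x * \<phi> x)" using t(2) by simp
 qed
 have "AE x in lborel. v x - fn w x = 0"
 proof (rule fundamental_lemma)
  fix R
  obtain \<phi> c where \<phi>: "test_fun \<phi>" "c > 0" "\<And>x. x \<in> cball 0 R \<Longrightarrow> c \<le> \<phi> x" using positive_test_fun[of R] by metis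
  have [measurable]: "cball (0::R4) R \<in> sets borel" by simp
  have "integrable lborel (\<lambda>x. v x * indicator (cball 0 R) x)"
  proof (rule Bochner_Integration.integrable_bound)
   show "integrable lborel (\<lambda>x. 1 / c * (v x * \<phi> x))" using tr(1)[OF \<phi>(1)] by simp
   show "AE x in lborel. norm (v x * indicator (cball 0 R) x) \<le> norm (1 / c * (v x * \<phi> x))"
   proof (intro AE_I2)
    fix x show "norm (v x * indicator (cball 0 R) x) \<le> norm (1 / c * (v x * \<phi> x))"
    proof (cases "x \<in> cball 0 R")
     case True
     have "\<bar>v x\<bar> * c \<le> \<bar>v x\<bar> * \<phi> x" using \<phi>(3)[OF True] by (intro mult_left_mono) auto
     then show ?thesis using True \<phi>(2) \<phi>(3)[of x] by (simp add: abs_mult field_simps)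
    qed simp
   qed
  qed measurable
  moreover have "integrable lborel (\<lambda>x. fn w x * indicator (cball 0 R) x)"
   by (rule sqint_mult[OF fn_sqint sqint_bounded_support[where B = 1]]) (auto intro!: borel_measurable_indicator)
  ultimately show "integrable lborel (\<lambda>x. (v x - fn w x) * indicator (cball 0 R) x)"
   by (simp add: left_diff_distrib)
 next
  fix \<psi> assume \<psi>: "test_fun \<psi>"
  have "(LBINT x. (v x - fn w x) * \<psi> x) = (LBINT x. v x * \<psi> x) - (LBINT x. fn w x * \<psi> x)"
   unfolding left_diff_distrib by (intro Bochner_Integration.integral_diff tr(1)[OF \<psi>] sqint_mult fn_sqint test_fun_sqint[OF \<psi>])
  then show "(LBINT x. (v x - fn w x) * \<psi> x) = 0" using tr(2)[OF \<psi>] by simp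
 qed measurable
 then have "AE x in lebesgue. v x - fn w x = 0" by (rule AE_completion)
 with lv have "AE x in lebesgue. lap u x = fn w x" by auto
 with pw p show thesis by (rule that)
qed

lemma AE_lebesgue_lborel:
 assumes "AE x in lebesgue. f x = (g x :: real)" "f \<in> borel_measurable borel" "g \<in> borel_measurable borel"
 shows "AE x in lborel. f x = g x"
 using assms by (simp add: AE_completion_iff)

lemma lap_fn:
 assumes "(p, w) \<in> wlap" shows "AE x in lebesgue. lap (fn p) x = fn w x"
proof -
 obtain p' w' where *: "(p', w') \<in> wlap" "AE x in lebesgue. fn p x = fn p' x" "AE x in lebesgue. lap (fn p) x = fn w' x"
  by (rule W22_repr[OF wlap_fn_W22[OF assms]])
 have "p = p'" by (rule l2_eqI[OF AE_lebesgue_lborel[OF *(2)]]) auto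
 then have "w' = w" using wlap_unique[OF *(1)] assms by blast
 with *(3) show ?thesis by simp
qed

section \<open>Translations and dilations\<close>

definition dil :: "R4 \<Rightarrow> real \<Rightarrow> l2 \<Rightarrow> l2" where
 "dil a c p = abs_l2 (\<lambda>x. fn p (a + c *\<^sub>R x))"

lemma integrable_scale_R4:
 fixes f :: "R4 \<Rightarrow> real"
 assumes "integrable lborel f" "c > 0" shows "integrable lborel (\<lambda>x. f (a + c *\<^sub>R x))"
proof -
 have f: "f \<in> borel_measurable borel" using assms by auto
 have "integrable (density (distr lborel borel (\<lambda>x::R4. a + c *\<^sub>R x)) (\<lambda>_. ennreal (\<bar>c\<bar> ^ DIM(R4)))) f"
  using lborel_affine[of c a] assms by simp
 then have "integrable (distr lborel borel (\<lambda>x::R4. a + c *\<^sub>R x)) (\<lambda>x. (\<bar>c\<bar> ^ DIM(R4)) *\<^sub>R f x)"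
  by (subst (asm) integrable_density) (use f in auto)
 then have "integrable lborel (\<lambda>x. (\<bar>c\<bar> ^ DIM(R4)) *\<^sub>R f (a + c *\<^sub>R x))"
  by (subst (asm) integrable_distr_eq) (use f in auto)
 then show ?thesis using assms(2) by simp
qed

lemma sqint_dil: "c > 0 \<Longrightarrow> sqint u \<Longrightarrow> sqint (\<lambda>x. u (a + c *\<^sub>R x))"
 unfolding sqint_def using integrable_scale_R4[of "\<lambda>x. (u x)^2" c a] by auto

lemma fn_dil: "c > 0 \<Longrightarrow> AE x in lborel. fn (dil a c p) x = fn p (a + c *\<^sub>R x)"
 unfolding dil_def by (intro fn_abs sqint_dil fn_sqint)

lemma inner_dil: "c > 0 \<Longrightarrow> inner (dil a c p) (dil a c q) = inner p q / c ^ 4"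
proof -
 assume c: "c > 0"
 have "inner (dil a c p) (dil a c q) = (LBINT x. fn p (a + c *\<^sub>R x) * fn q (a + c *\<^sub>R x))"
  unfolding dil_def by (intro inner_abs sqint_dil fn_sqint c)
 also have "\<dots> = inner p q / c ^ 4"
  using integral_scale_R4[of "\<lambda>x. fn p x * fn q x" c a] c by (simp add: inner_l2_def)
 finally show ?thesis .
qed

lemma norm_dil_sq: "c > 0 \<Longrightarrow> (norm (dil a c p))^2 = (norm p)^2 / c ^ 4"
 by (simp add: power2_norm_eq_inner inner_dil)

text \<open>The factor \<open>c^2\<close> on the Laplacian and the factor \<open>1 / c ^ 4\<close>
  on squared norms cancel: in dimension 4 dilations do not change the norm of the Laplacian.\<close>

lemma wlap_dil:
 assumes pw: "(p, w) \<in> wlap" and c: "c > 0"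
 shows "(dil a c p, c^2 *\<^sub>R dil a c w) \<in> wlap"
 unfolding wlap_def
proof (clarsimp)
 fix \<phi> assume \<phi>: "test_fun \<phi>"
 define k where "k = inverse c"
 define b where "b = - (k *\<^sub>R a)"
 have k: "k \<noteq> 0" using c by (simp add: k_def)
 have inv: "b + k *\<^sub>R (a + c *\<^sub>R x) = x" for x using c by (simp add: b_def k_def scaleR_add_right)
 define \<phi>' where "\<phi>' x = \<phi> (b + k *\<^sub>R x)" for x
 have \<phi>': "test_fun \<phi>'" unfolding \<phi>'_def by (rule test_fun_affine[OF \<phi> k])
 have l: "lapl \<phi>' y = k^2 * lapl \<phi> (b + k *\<^sub>R y)" for y
  unfolding \<phi>'_def using \<phi> by (intro lapl_affine) (simp add: test_fun_def)
 have [measurable]: "\<phi> \<in> borel_measurable borel" "lapl \<phi> \<in> borel_measurable borel"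
  using test_fun_meas[OF \<phi>] test_fun_meas[OF lapl_test[OF \<phi>]] by auto
 have "inner (dil a c p) (abs_l2 (lapl \<phi>)) = (LBINT x. fn p (a + c *\<^sub>R x) * lapl \<phi> x)"
  unfolding dil_def by (intro inner_abs sqint_dil fn_sqint c test_fun_sqint[OF lapl_test[OF \<phi>]])
 also have "\<dots> = c^2 * (LBINT x. fn p (a + c *\<^sub>R x) * lapl \<phi>' (a + c *\<^sub>R x))"
 proof -
  have "(LBINT x. fn p (a + c *\<^sub>R x) * lapl \<phi>' (a + c *\<^sub>R x)) = k^2 * (LBINT x. fn p (a + c *\<^sub>R x) * lapl \<phi> x)"
   by (simp add: l inv mult.left_commute)
  moreover have "c^2 * k^2 = 1" using c by (simp add: k_def power_inverse)
  ultimately show ?thesis by (simp flip: mult.assoc)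
 qed
 also have "\<dots> = c^2 * (LBINT y. fn p y * lapl \<phi>' y) / c ^ 4"
  using integral_scale_R4[of "\<lambda>y. fn p y * lapl \<phi>' y" c a] test_fun_meas[OF lapl_test[OF \<phi>']] c by (simp add: field_simps)
 also have "(LBINT y. fn p y * lapl \<phi>' y) = (LBINT y. fn w y * \<phi>' y)" by (rule wlapD[OF pw \<phi>'])
 also have "\<dots> = c ^ 4 * (LBINT x. fn w (a + c *\<^sub>R x) * \<phi> x)"
  using integral_scale_R4[of "\<lambda>y. fn w y * \<phi>' y" c a] test_fun_meas[OF \<phi>'] c by (simp add: \<phi>'_def inv)
 also have "(LBINT x. fn w (a + c *\<^sub>R x) * \<phi> x) = inner (dil a c w) (abs_l2 \<phi>)"
  unfolding dil_def by (intro inner_abs[symmetric] sqint_dil fn_sqint c test_fun_sqint[OF \<phi>])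
 finally have e: "inner (dil a c p) (abs_l2 (lapl \<phi>)) = c^2 * (c ^ 4 * inner (dil a c w) (abs_l2 \<phi>)) / c ^ 4" .
 show "inner (dil a c p) (abs_l2 (lapl \<phi>)) = c^2 * inner (dil a c w) (abs_l2 \<phi>)"
  unfolding e mult.left_commute[of "c^2" "c ^ 4"] using c by (intro nonzero_mult_div_cancel_left) simp
qed

section \<open>Compactness and vanishing\<close>

text \<open>Cauchy-Schwarz with the square norm of \<open>kS s\<close>, of order 1/s. The decay for
  large \<open>s\<close> serves \<open>norm_equivalence\<close>; for fixed \<open>s\<close> it is
  the uniform bound used elsewhere.\<close>

lemma cv_kS_sup: "\<exists>C\<ge>0. \<forall>s>0. \<forall>p x. \<bar>cv (kS s) (fn p) x\<bar> \<le> C / s * norm p"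
proof -
 obtain C where C: "C \<ge> 0" "\<And>s z. s > 0 \<Longrightarrow> \<bar>kS s z\<bar> \<le> C / s^2 * indicator (ball 0 (sqrt s)) z"
  using kS_bound by blast
 have "\<bar>cv (kS s) (fn p) x\<bar> \<le> (C * (pi + 1)) / s * norm p" if s: "s > 0" for s p x
 proof -
  note t = kS_test[OF s, of x]
  have "(NN y. ennreal ((kS s (x - y))^2)) = (NN y. ennreal ((kS s y)^2))"
   by (rule nn_integral_reflect[of "\<lambda>y. ennreal ((kS s y)^2)"]) measurable
  also have "\<dots> \<le> (NN y. ennreal ((C / s^2)^2) * indicator (ball 0 (sqrt s)) (y::R4))"
  proof (intro nn_integral_mono)
   fix y show "ennreal ((kS s y)^2) \<le> ennreal ((C / s^2)^2) * indicator (ball 0 (sqrt s)) y"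
    using C(2)[OF s, of y] by (cases "y \<in> ball 0 (sqrt s)") (auto intro!: ennreal_leI simp: abs_le_square_iff[symmetric] C)
  qed
  also have "\<dots> = ennreal ((C / s^2)^2) * ennreal (pi^2 / 2 * (sqrt s) ^ 4)"
   by (subst nn_integral_cmult_indicator) (use s in \<open>auto simp: emeasure_ball_R4\<close>)
  also have "\<dots> = ennreal ((C / s^2)^2 * (pi^2 / 2 * (sqrt s) ^ 4))" using s by (intro ennreal_mult[symmetric]) auto
  also have "\<dots> \<le> ennreal ((C * (pi + 1) / s)^2)"
  proof (rule ennreal_leI)
   have "(sqrt s) ^ 4 = s^2" using power_mult[of "sqrt s" 2 2] s by simp
   then have "(C / s^2)^2 * (pi^2 / 2 * (sqrt s) ^ 4) = C^2 / s^2 * (pi^2 / 2)"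
    using s by (simp add: power_divide power2_eq_square)
   also have "\<dots> \<le> C^2 / s^2 * (pi + 1)^2"
   proof (intro mult_left_mono)
    have "pi^2 \<le> (pi + 1)^2" by (intro power_mono) auto
    then show "pi^2 / 2 \<le> (pi + 1)^2" using zero_le_power2[of pi] by linarith
   qed auto
   finally show "(C / s^2)^2 * (pi^2 / 2 * (sqrt s) ^ 4) \<le> (C * (pi + 1) / s)^2" by (simp add: power_divide power_mult_distrib)
  qed
  finally have n: "norm (abs_l2 (\<lambda>y. kS s (x - y))) \<le> C * (pi + 1) / s"
   by (intro norm_abs_le) (use C s in auto)
  have "cv (kS s) (fn p) x = inner p (abs_l2 (\<lambda>y. kS s (x - y)))"
   unfolding cv_def by (rule inner_abs_right[symmetric, OF test_fun_sqint[OF t]])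
  then have "\<bar>cv (kS s) (fn p) x\<bar> \<le> norm p * norm (abs_l2 (\<lambda>y. kS s (x - y)))"
   by (simp add: Cauchy_Schwarz_ineq2)
  also have "\<dots> \<le> norm p * (C * (pi + 1) / s)" by (intro mult_left_mono n) auto
  finally show ?thesis by (simp add: mult.commute)
 qed
 then show ?thesis using C(1) by (intro exI[of _ "C * (pi + 1)"]) auto
qed

lemma level_set_bound:
 assumes u: "sqint u" and s: "s > 0"
 shows "emeasure lborel {x. s < \<bar>u x\<bar>} \<le> ennreal ((norm (abs_l2 u))^2 / s^2)"
proof -
 have [measurable]: "u \<in> borel_measurable borel" using u by (simp add: sqint_def)
 have "ennreal (s^2) * emeasure lborel {x. s < \<bar>u x\<bar>} = (NN x. ennreal (s^2) * indicator {x. s < \<bar>u x\<bar>} x)"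
  by (subst nn_integral_cmult_indicator) auto
 also have "\<dots> \<le> (NN x. ennreal ((u x)^2))"
 proof (intro nn_integral_mono)
  fix x show "ennreal (s^2) * indicator {x. s < \<bar>u x\<bar>} x \<le> ennreal ((u x)^2)"
   using s by (cases "s < \<bar>u x\<bar>") (auto intro!: ennreal_leI simp: abs_le_square_iff[symmetric])
 qed
 also have "\<dots> = ennreal ((norm (abs_l2 u))^2)"
  unfolding norm_abs_sq[OF u] by (rule nn_integral_eq_integral) (use u in \<open>auto simp: sqint_def\<close>)
 finally have "ennreal (1 / s^2) * (ennreal (s^2) * emeasure lborel {x. s < \<bar>u x\<bar>}) \<le> ennreal (1 / s^2) * ennreal ((norm (abs_l2 u))^2)"
  by (rule mult_left_mono) simp
 then show ?thesis using s by (simp add: mult.assoc[symmetric] ennreal_mult[symmetric])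
qed

lemma nn_integral_rk: "(NN z. ennreal (rk z)) = ennreal (1 / 4)"
proof -
 have "(NN z. ennreal (rk z)) = (NN z. ennreal (1 / (4 * pi^2) * (indicator (ball 0 1) z / (norm (z::R4))^2)))"
  by (simp add: rk_def)
 also have "\<dots> = ennreal (1 / (4 * pi^2)) * ennreal (pi^2 * 1^2)"
  by (subst nn_integral_cmult_ennreal) (auto simp: nn_integral_inverse_square_ball)
 also have "\<dots> = ennreal (1 / 4)" by (simp add: ennreal_mult[symmetric])
 finally show ?thesis .
qed

text \<open>The representation at \<open>s = 1\<close>: the smooth part is bounded by a multiple of
  the norm, and \<open>kG 1\<close> lies below the truncated kernel \<open>rk\<close>.\<close>

lemma potential_bound:
 obtains C where "C \<ge> 0"
  "\<forall>p w. (p, w) \<in> wlap \<longrightarrow> (AE x in lborel. ennreal \<bar>fn p x\<bar> \<le> ennreal (C * norm p) + (NN y. ennreal (\<bar>fn w y\<bar> * rk (x - y))))"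
proof -
 obtain C where C: "C \<ge> 0" "\<And>s p x. s > 0 \<Longrightarrow> \<bar>cv (kS s) (fn p) x\<bar> \<le> C / s * norm p" using cv_kS_sup by blast
 show thesis
 proof (rule that[OF C(1)], intro allI impI)
  fix p w assume pw: "(p, w) \<in> wlap"
  have "AE x in lborel. fn p x = cv (kS 1) (fn p) x - cv (kG 1) (fn w) x" by (rule representation[OF pw]) simp
  then show "AE x in lborel. ennreal \<bar>fn p x\<bar> \<le> ennreal (C * norm p) + (NN y. ennreal (\<bar>fn w y\<bar> * rk (x - y)))"
  proof eventually_elim
   case (elim x)
   have "\<bar>fn p x\<bar> \<le> C * norm p + \<bar>cv (kG 1) (fn w) x\<bar>" using C(2)[of 1 p x] elim by simp
   then have "ennreal \<bar>fn p x\<bar> \<le> ennreal (C * norm p + \<bar>cv (kG 1) (fn w) x\<bar>)" by (rule ennreal_leI)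
   also have "\<dots> = ennreal (C * norm p) + ennreal \<bar>cv (kG 1) (fn w) x\<bar>" using C(1) by (intro ennreal_plus) auto
   also have "ennreal \<bar>cv (kG 1) (fn w) x\<bar> \<le> (NN y. ennreal (\<bar>fn w y\<bar> * \<bar>kG 1 (x - y)\<bar>))"
    by (rule cv_le_nn) measurable
   also have "\<dots> \<le> (NN y. ennreal (\<bar>fn w y\<bar> * rk (x - y)))"
    using kG_le_rk kG_nonneg by (intro nn_integral_mono ennreal_leI mult_left_mono) auto
   finally show ?case by (simp add: add_left_mono)
  qed
 qed
qed

lemma finite_level_sets: "s > 0 \<Longrightarrow> emeasure lborel {x. s < \<bar>fn p x\<bar>} < \<infinity>"
 by (rule le_less_trans[OF level_set_bound[OF fn_sqint]]) auto

lemma wlap_pot_dominated: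
 "\<exists>C\<ge>0. \<forall>p w D M. (p, w) \<in> wlap \<longrightarrow> norm p \<le> M \<longrightarrow> (norm w)^2 \<le> D \<longrightarrow> pot_dominated (C * M) D (fn p)"
proof -
 obtain C where C: "C \<ge> 0"
  "\<forall>p w. (p, w) \<in> wlap \<longrightarrow> (AE x in lborel. ennreal \<bar>fn p x\<bar> \<le> ennreal (C * norm p) + (NN y. ennreal (\<bar>fn w y\<bar> * rk (x - y))))"
  by (rule potential_bound)
 show ?thesis
 proof (intro exI[of _ C] conjI allI impI C(1))
  fix p w D M assume pw: "(p, w) \<in> wlap" and M: "norm p \<le> M" "(norm w)^2 \<le> D"
  have "ennreal (C * norm p) \<le> ennreal (C * M)" using C(1) M by (intro ennreal_leI mult_left_mono)
  moreover from C(2) pw have "AE x in lborel. ennreal \<bar>fn p x\<bar> \<le> ennreal (C * norm p) + (NN y. ennreal (\<bar>fn w y\<bar> * rk (x - y)))" by blast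
  ultimately have "AE x in lborel. ennreal \<bar>fn p x\<bar> \<le> ennreal (C * M) + (NN y. ennreal (\<bar>fn w y\<bar> * rk (x - y)))"
  proof (elim AE_mp, intro AE_I2 impI)
   fix x assume "ennreal (C * norm p) \<le> ennreal (C * M)"
    "ennreal \<bar>fn p x\<bar> \<le> ennreal (C * norm p) + (NN y. ennreal (\<bar>fn w y\<bar> * rk (x - y)))"
   then show "ennreal \<bar>fn p x\<bar> \<le> ennreal (C * M) + (NN y. ennreal (\<bar>fn w y\<bar> * rk (x - y)))"
    by (meson add_right_mono order_trans)
  qed
  then show "pot_dominated (C * M) D (fn p)"
   unfolding pot_dominated_def using M(2) finite_level_sets by (auto intro!: bexI[of _ "fn w"] simp: nn_norm_sq ennreal_leI)
 qed
qed

text \<open>Truncating the Laplacian of a fixed function makes the square norm of the density arbitrarily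
 small, at the cost of the additive constant.\<close>
lemma pot_dominated_small:
 assumes pw: "(p, w) \<in> wlap" and D: "D > 0"
 shows "\<exists>C0\<ge>0. \<exists>d>0. \<forall>q v. (q, v) \<in> wlap \<longrightarrow> norm (q - p) \<le> d \<longrightarrow> norm (v - w) \<le> d \<longrightarrow> pot_dominated C0 D (fn q)"
proof -
 obtain C where C: "C \<ge> 0"
  "\<forall>p w. (p, w) \<in> wlap \<longrightarrow> (AE x in lborel. ennreal \<bar>fn p x\<bar> \<le> ennreal (C * norm p) + (NN y. ennreal (\<bar>fn w y\<bar> * rk (x - y))))"
  by (rule potential_bound)
 define t where "t M x = fn w x * indicator {x. M < \<bar>fn w x\<bar>} x" for M x
 have tm [measurable]: "t M \<in> borel_measurable borel" for M unfolding t_def by measurable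
 have "(\<lambda>n. (LBINT x. (t (real n) x)^2)) \<longlonglongrightarrow> (\<integral>x. 0 \<partial>(lborel::R4 measure))"
 proof (rule integral_dominated_convergence[where w = "\<lambda>x. (fn w x)^2"])
  show "integrable lborel (\<lambda>x. (fn w x)^2)" by (rule sqint_int[OF fn_sqint])
  show "AE x in lborel. (\<lambda>n. (t (real n) x)^2) \<longlonglongrightarrow> 0"
  proof (intro AE_I2)
   fix x
   obtain N where N: "\<bar>fn w x\<bar> < real N" using reals_Archimedean2 by blast
   have "t (real n) x = 0" if "n \<ge> N" for n
    using N of_nat_mono[OF that, where 'a = real] by (simp add: t_def)
   then show "(\<lambda>n. (t (real n) x)^2) \<longlonglongrightarrow> 0"
    by (intro tendsto_eventually eventually_sequentiallyI[of N]) auto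
  qed
 qed (auto simp: t_def split: split_indicator)
 then have "\<forall>\<^sub>F n in sequentially. (LBINT x. (t (real n) x)^2) < D / 4"
  using D by (intro order_tendstoD(2)[of _ 0]) auto
 then obtain n where n: "(LBINT x. (t (real n) x)^2) < D / 4"
  using eventually_happens'[OF trivial_limit_sequentially] by blast
 \<comment> \<open>Both the truncated tail of \<open>w\<close> and the perturbation
   \<open>v - w\<close> get a budget of D/4; the square of their sum costs a factor 2 on
   each.\<close>
 define d where "d = sqrt (D / 4)"
 have d: "d > 0" "d^2 = D / 4" using D by (auto simp: d_def)
 have main: "pot_dominated (C * (norm p + d) + real n / 4) D (fn q)"
  if qv: "(q, v) \<in> wlap" and qp: "norm (q - p) \<le> d" and vw: "norm (v - w) \<le> d" for q v
 proof -
  define g where "g x = \<bar>t (real n) x\<bar> + \<bar>fn (v - w) x\<bar>" for x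
  have [measurable]: "g \<in> borel_measurable borel" unfolding g_def by measurable
  have gD: "(NN x. ennreal ((g x)^2)) \<le> ennreal D"
  proof -
   have ts: "sqint (t (real n))" by (rule sqint_bound[OF fn_sqint[of w]]) (auto simp: t_def split: split_indicator)
   have "(NN x. ennreal ((g x)^2)) \<le> (NN x. ennreal (2 * (t (real n) x)^2 + 2 * (fn (v - w) x)^2))"
   proof (intro nn_integral_mono ennreal_leI)
    fix x show "(g x)^2 \<le> 2 * (t (real n) x)^2 + 2 * (fn (v - w) x)^2"
     using sum_squares_bound[of "\<bar>t (real n) x\<bar>" "\<bar>fn (v - w) x\<bar>"] unfolding g_def by (simp add: power2_sum)
   qed
   also have "\<dots> = ennreal (LBINT x. 2 * (t (real n) x)^2 + 2 * (fn (v - w) x)^2)"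
    using sqint_int[OF ts] sqint_int[OF fn_sqint[of "v - w"]] by (intro nn_integral_eq_integral) auto
   also have "(LBINT x. 2 * (t (real n) x)^2 + 2 * (fn (v - w) x)^2) = 2 * (LBINT x. (t (real n) x)^2) + 2 * (norm (v - w))^2"
    using sqint_int[OF ts] sqint_int[OF fn_sqint[of "v - w"]] by (simp add: norm_l2_sq)
   also have "\<dots> \<le> D" using n d(2) power_mono[OF vw norm_ge_zero, of 2] by simp
   finally show ?thesis by (simp add: ennreal_leI)
  qed
  have nq: "norm q \<le> norm p + d" using qp norm_triangle_ineq2[of q p] by linarith
  have "AE x in lborel. ennreal \<bar>fn q x\<bar> \<le> ennreal (C * norm q) + (NN y. ennreal (\<bar>fn v y\<bar> * rk (x - y)))"
   using C(2) qv by blast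
  then have "AE x in lborel. ennreal \<bar>fn q x\<bar> \<le> ennreal (C * (norm p + d) + real n / 4) + (NN y. ennreal (\<bar>g y\<bar> * rk (x - y)))"
  proof eventually_elim
   case (elim x)
   have "(NN y. ennreal (\<bar>fn v y\<bar> * rk (x - y))) \<le> (NN y. ennreal (real n * rk (x - y)) + ennreal (\<bar>g y\<bar> * rk (x - y)))"
   proof (rule nn_integral_mono_AE, use fn_diff[of v w] in eventually_elim)
    case (elim y)
    have "\<bar>fn w y\<bar> \<le> real n + \<bar>t (real n) y\<bar>" by (auto simp: t_def split: split_indicator)
    then have "\<bar>fn v y\<bar> \<le> real n + \<bar>g y\<bar>" using elim unfolding g_def by linarith
    then have "\<bar>fn v y\<bar> * rk (x - y) \<le> real n * rk (x - y) + \<bar>g y\<bar> * rk (x - y)"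
     using mult_right_mono[OF _ rk_nonneg] by (metis distrib_right)
    then have "ennreal (\<bar>fn v y\<bar> * rk (x - y)) \<le> ennreal (real n * rk (x - y) + \<bar>g y\<bar> * rk (x - y))" by (rule ennreal_leI)
    also have "\<dots> = ennreal (real n * rk (x - y)) + ennreal (\<bar>g y\<bar> * rk (x - y))" by (intro ennreal_plus) auto
    finally show ?case .
   qed
   also have "\<dots> = (NN y. ennreal (real n * rk (x - y))) + (NN y. ennreal (\<bar>g y\<bar> * rk (x - y)))"
    by (rule nn_integral_add) measurable
   also have "(NN y. ennreal (real n * rk (x - y))) = ennreal (real n) * (NN y. ennreal (rk (x - y)))"
    by (rule nn_integral_cmult_ennreal) auto
   also have "(NN y. ennreal (rk (x - y))) = ennreal (1 / 4)"
    using nn_integral_reflect[of "\<lambda>y. ennreal (rk y)" x] nn_integral_rk by simp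
   finally have "ennreal \<bar>fn q x\<bar> \<le> ennreal (C * norm q) + (ennreal (real n) * ennreal (1 / 4) + (NN y. ennreal (\<bar>g y\<bar> * rk (x - y))))"
    by (intro order_trans[OF elim] add_left_mono)
   also have "\<dots> = ennreal (C * norm q + real n / 4) + (NN y. ennreal (\<bar>g y\<bar> * rk (x - y)))"
    using C(1) by (simp add: ennreal_mult[symmetric] add.assoc[symmetric] ennreal_plus[symmetric] del: ennreal_plus)
   also have "\<dots> \<le> ennreal (C * (norm p + d) + real n / 4) + (NN y. ennreal (\<bar>g y\<bar> * rk (x - y)))"
    using C(1) nq by (intro add_right_mono ennreal_leI mult_left_mono) auto
   finally show ?case .
  qed
  then show "pot_dominated (C * (norm p + d) + real n / 4) D (fn q)"
   unfolding pot_dominated_def using gD finite_level_sets by (auto intro!: bexI[of _ g])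
 qed
 have "0 \<le> C * (norm p + d) + real n / 4" using C d by simp
 with main d(1) show ?thesis by blast
qed

text \<open>For fixed s the mollified differences tend to 0 pointwise, because each value is an
  inner product, and they are bounded. The mollification error is uniformly O(s). Together these
  give convergence in weighted L1 and a subsequence converging almost everywhere.\<close>

lemma rellich:
 assumes wl: "\<And>n. (P n, W n) \<in> wlap" and pw: "(p, w) \<in> wlap"
  and B: "\<And>n. norm (W n) \<le> B" "\<And>n. norm (P n) \<le> B" and weak: "\<And>\<phi>. (\<lambda>n. inner (P n) \<phi>) \<longlonglongrightarrow> inner p \<phi>"
 shows "\<exists>r. strict_mono (r :: nat \<Rightarrow> nat) \<and> (AE x in lborel. (\<lambda>n. fn (P (r n)) x) \<longlonglongrightarrow> fn p x)"
proof -
 obtain g :: "R4 \<Rightarrow> real" where g: "g \<in> borel_measurable borel" "\<And>x. 0 < g x" "\<And>x. g x \<le> 1" "integrable lborel g"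
  using weight_function by blast
 note [measurable] = g(1)
 have gs: "sqint g" unfolding sqint_def
 proof (intro conjI g(1) Bochner_Integration.integrable_bound[OF g(4)])
  have "(g x)^2 \<le> g x" for x using g(2,3)[of x] by (simp add: power2_eq_square mult_le_cancel_left1)
  then show "AE x in lborel. norm ((g x)^2) \<le> norm (g x)" using g(2) by (auto simp: less_imp_le)
 qed simp
 obtain C where C: "C \<ge> 0" "\<And>s p x. s > 0 \<Longrightarrow> \<bar>cv (kS s) (fn p) x\<bar> \<le> C / s * norm p" using cv_kS_sup by blast
 define d where "d n = P n - p" for n
 define dw where "dw n = W n - w" for n
 have dwl: "(d n, dw n) \<in> wlap" for n unfolding d_def dw_def by (rule wlap_diff[OF wl pw])
 define B2 where "B2 = B + norm w + norm p"
 have dB: "norm (d n) \<le> B2" "norm (dw n) \<le> B2" for n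
  unfolding d_def dw_def B2_def using B(1)[of n] B(2)[of n] norm_triangle_ineq4[of "P n" p] norm_triangle_ineq4[of "W n" w]
   norm_ge_zero[of p] norm_ge_zero[of w] by linarith+
 have B2: "B2 \<ge> 0" using norm_ge_zero order_trans dB(1)[of 0] by blast
 have di: "integrable lborel (\<lambda>x. fn (d n) x * g x)" for n by (rule sqint_mult[OF fn_sqint gs])
 have lim: "(\<lambda>n. (LBINT x. norm (fn (d n) x * g x))) \<longlonglongrightarrow> 0"
 proof (rule LIMSEQ_I)
  fix e :: real assume e: "e > 0"
  \<comment> \<open>Chosen so that the mollification error \<open>s / 4 * B2\<close>, paired with
    the weight, is at most e/4.\<close>
  define s where "s = e / (1 + B2 * norm (abs_l2 g))"
  have den: "1 + B2 * norm (abs_l2 g) > 0" using B2 by (simp add: add_pos_nonneg)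
  have s: "s > 0" using e den by (simp add: s_def)
  note t = kS_test[OF s]
  have S: "sqint (cv (kS s) (fn (d n)))" for n by (intro cv_test_sqint kS_test0 s fn_sqint)
  have "(\<lambda>n. (LBINT x. \<bar>cv (kS s) (fn (d n)) x\<bar> * g x)) \<longlonglongrightarrow> (\<integral>x. 0 \<partial>(lborel::R4 measure))"
  proof (rule integral_dominated_convergence[where w = "\<lambda>x. C / s * B2 * g x"])
   show "integrable lborel (\<lambda>x. C / s * B2 * g x)" using g(4) by simp
   show "AE x in lborel. (\<lambda>n. \<bar>cv (kS s) (fn (d n)) x\<bar> * g x) \<longlonglongrightarrow> 0"
   proof (intro AE_I2)
    fix x
    have "(\<lambda>n. inner (d n) (abs_l2 (\<lambda>y. kS s (x - y)))) \<longlonglongrightarrow> 0"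
     using tendsto_diff[OF weak[of "abs_l2 (\<lambda>y. kS s (x - y))"] tendsto_const[of "inner p (abs_l2 (\<lambda>y. kS s (x - y)))"]]
     by (simp add: d_def inner_diff_left)
    then have "(\<lambda>n. cv (kS s) (fn (d n)) x) \<longlonglongrightarrow> 0"
     by (simp add: cv_def inner_abs_right[OF test_fun_sqint[OF t]])
    then have "(\<lambda>n. \<bar>cv (kS s) (fn (d n)) x\<bar> * g x) \<longlonglongrightarrow> \<bar>0\<bar> * g x" by (intro tendsto_intros)
    then show "(\<lambda>n. \<bar>cv (kS s) (fn (d n)) x\<bar> * g x) \<longlonglongrightarrow> 0" by simp
   qed
   show "AE x in lborel. norm (\<bar>cv (kS s) (fn (d n)) x\<bar> * g x) \<le> C / s * B2 * g x" for n
   proof (intro AE_I2)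
    fix x
    have "\<bar>cv (kS s) (fn (d n)) x\<bar> \<le> C / s * norm (d n)" by (rule C(2)[OF s])
    also have "\<dots> \<le> C / s * B2" using C(1) s dB by (intro mult_left_mono) auto
    finally show "norm (\<bar>cv (kS s) (fn (d n)) x\<bar> * g x) \<le> C / s * B2 * g x"
     using g(2)[of x] mult_right_mono[of "\<bar>cv (kS s) (fn (d n)) x\<bar>" "C / s * B2" "g x"] by (simp add: abs_mult)
   qed
  qed (use S in \<open>auto simp: sqint_def\<close>)
  then have "\<forall>\<^sub>F n in sequentially. (LBINT x. \<bar>cv (kS s) (fn (d n)) x\<bar> * g x) < e / 2"
   using e by (intro order_tendstoD(2)[of _ 0]) auto
  then obtain N where N: "\<And>n. n \<ge> N \<Longrightarrow> (LBINT x. \<bar>cv (kS s) (fn (d n)) x\<bar> * g x) < e / 2"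
   by (auto simp: eventually_sequentially)
  have "norm ((LBINT x. norm (fn (d n) x * g x)) - 0) < e" if n: "n \<ge> N" for n
  proof -
   let ?r = "\<lambda>x. \<bar>cv (kS s) (fn (d n)) x - fn (d n) x\<bar>"
   have rs: "sqint ?r" by (rule sqint_bound[OF sqint_diff[OF S[of n] fn_sqint[of "d n"]]]) (use S[of n] in \<open>auto simp: sqint_def\<close>)
   have as: "sqint (\<lambda>x. \<bar>cv (kS s) (fn (d n)) x\<bar>)" by (rule sqint_bound[OF S[of n]]) (use S[of n] in \<open>auto simp: sqint_def\<close>)
   have "norm (abs_l2 ?r) = norm (abs_l2 (cv (kS s) (fn (d n))) - d n)"
   proof -
    have "(norm (abs_l2 ?r))^2 = (norm (abs_l2 (cv (kS s) (fn (d n))) - d n))^2"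
     unfolding norm_abs_sq[OF rs] norm_l2_sq
     by (rule integral_cong_AE) (use rs S[of n] fn_diff[of "abs_l2 (cv (kS s) (fn (d n)))" "d n"] fn_abs[OF S[of n]] fn_abs[OF rs] in \<open>auto simp: sqint_def elim!: AE_mp\<close>)
    then show ?thesis by simp
   qed
   also have "\<dots> \<le> s / 4 * norm (dw n)" by (rule kS_approx[OF dwl s])
   also have "\<dots> \<le> s / 4 * B2" using s dB by (intro mult_left_mono) auto
   finally have nr: "norm (abs_l2 ?r) \<le> s / 4 * B2" .
   have "(LBINT x. norm (fn (d n) x * g x)) \<le> (LBINT x. \<bar>cv (kS s) (fn (d n)) x\<bar> * g x + ?r x * g x)"
   proof (rule integral_mono)
    show "integrable lborel (\<lambda>x. norm (fn (d n) x * g x))" using di by simp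
    show "integrable lborel (\<lambda>x. \<bar>cv (kS s) (fn (d n)) x\<bar> * g x + ?r x * g x)"
     by (intro Bochner_Integration.integrable_add sqint_mult rs as gs)
    fix x
    have "\<bar>fn (d n) x\<bar> \<le> \<bar>cv (kS s) (fn (d n)) x\<bar> + ?r x" by linarith
    then show "norm (fn (d n) x * g x) \<le> \<bar>cv (kS s) (fn (d n)) x\<bar> * g x + ?r x * g x"
     using g(2)[of x] by (simp add: abs_mult mult_right_mono distrib_right[symmetric])
   qed
   also have "\<dots> = (LBINT x. \<bar>cv (kS s) (fn (d n)) x\<bar> * g x) + inner (abs_l2 ?r) (abs_l2 g)"
    unfolding inner_abs[OF rs gs] by (intro Bochner_Integration.integral_add sqint_mult rs as gs)
   also have "\<dots> < e / 2 + s / 4 * B2 * norm (abs_l2 g)"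
   proof (intro add_less_le_mono N n)
    show "inner (abs_l2 ?r) (abs_l2 g) \<le> s / 4 * B2 * norm (abs_l2 g)"
     by (rule order_trans[OF norm_cauchy_schwarz mult_right_mono[OF nr norm_ge_zero]])
   qed
   also have "\<dots> \<le> e"
   proof -
    have "s * (1 + B2 * norm (abs_l2 g)) = e" using den by (simp add: s_def)
    then have "s * (B2 * norm (abs_l2 g)) \<le> e" using s by (simp add: distrib_left)
    then show ?thesis using e by simp
   qed
   finally show ?thesis by simp
  qed
  then show "\<exists>no. \<forall>n\<ge>no. norm ((LBINT x. norm (fn (d n) x * g x)) - 0) < e" by blast
 qed
 obtain r :: "nat \<Rightarrow> nat" where r: "strict_mono r" "AE x in lborel. (\<lambda>n. fn (d (r n)) x * g x) \<longlonglongrightarrow> 0"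
  using tendsto_L1_AE_subseq[OF di lim] by blast
 have "AE x in lborel. \<forall>n. fn (d n) x = fn (P n) x - fn p x"
  unfolding AE_all_countable d_def using fn_diff by blast
 with r(2) have "AE x in lborel. (\<lambda>n. fn (P (r n)) x) \<longlonglongrightarrow> fn p x"
 proof eventually_elim
  case (elim x)
  have "(\<lambda>n. fn (d (r n)) x * g x * inverse (g x) + fn p x) \<longlonglongrightarrow> 0 * inverse (g x) + fn p x"
   by (intro tendsto_intros elim)
  then show ?case using g(2)[of x] elim(2) by (simp add: less_imp_neq[symmetric] mult.assoc)
 qed
 with r(1) show ?thesis by blast
qed

text \<open>The potential gives no control on the ball where it may vanish. There the function is
  its mollification plus an error governed by the Laplacian, and at a large scale \<open>s\<close>
  the mollification contributes only a small fraction of the norm, which is absorbed.\<close>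

lemma norm_equivalence:
 fixes V :: "R4 \<Rightarrow> real"
 assumes V: "V \<in> borel_measurable borel" "\<And>x. 0 \<le> V x" "\<And>x. V x \<le> Vi" and c0: "c0 > 0" "\<And>x. x \<notin> ball 0 r \<Longrightarrow> c0 \<le> V x" and r: "r > 0"
 shows "\<exists>C>0. \<forall>p w. (p, w) \<in> wlap \<longrightarrow> (norm p)^2 \<le> C * ((norm w)^2 + (LBINT x. V x * (fn p x)^2))"
proof -
 note [measurable] = V(1)
 obtain C where C: "C \<ge> 0" "\<And>s p x. s > 0 \<Longrightarrow> \<bar>cv (kS s) (fn p) x\<bar> \<le> C / s * norm p" using cv_kS_sup by blast
 define b where "b = pi^2 / 2 * r ^ 4"
 have b: "b > 0" using r by (simp add: b_def)
 \<comment> \<open>Makes the ball's share of the mollified part at most 2/16 of the squared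
   norm.\<close>
 define s where "s = 4 * C * sqrt b + 1"
 have s: "s > 0" using C b by (simp add: s_def add_nonneg_pos)
 have bs: "b * (C / s)^2 \<le> 1 / 16"
 proof -
  have "4 * (C * sqrt b) \<le> s" by (simp add: s_def)
  then have "(4 * (C * sqrt b))^2 \<le> s^2" using C b by (intro power_mono) auto
  then have "16 * (C^2 * b) \<le> s^2" using b by (simp add: power_mult_distrib)
  then show ?thesis using s by (simp add: power_divide field_simps)
 qed
 have "(norm p)^2 \<le> (s^2 + 2 / c0) * ((norm w)^2 + (LBINT x. V x * (fn p x)^2))" if pw: "(p, w) \<in> wlap" for p w
 proof -
  have S: "sqint (cv (kS s) (fn p))" by (intro cv_test_sqint kS_test0 s fn_sqint)
  have [measurable]: "cv (kS s) (fn p) \<in> borel_measurable borel" using S by (simp add: sqint_def)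
  let ?rr = "\<lambda>x. cv (kS s) (fn p) x - fn p x"
  have rs: "sqint ?rr" by (intro sqint_diff S fn_sqint)
  have pi: "integrable lborel (\<lambda>x. (fn p x)^2)" by (rule sqint_int[OF fn_sqint])
  have Vi: "integrable lborel (\<lambda>x. V x * (fn p x)^2)"
   by (rule Bochner_Integration.integrable_bound[of _ "\<lambda>x. Vi * (fn p x)^2"])
    (use pi V in \<open>auto simp: abs_mult intro!: mult_right_mono order_trans[OF V(3) abs_ge_self]\<close>)
  have rn: "(LBINT x. (?rr x)^2) \<le> (s / 4 * norm w)^2"
  proof -
   have "abs_l2 ?rr = abs_l2 (cv (kS s) (fn p)) - p"
    by (rule l2_eqI) (use fn_abs[OF rs] fn_diff[of "abs_l2 (cv (kS s) (fn p))" p] fn_abs[OF S] in \<open>auto elim!: AE_mp\<close>)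
   then have "norm (abs_l2 ?rr) \<le> s / 4 * norm w" using kS_approx[OF pw s] by simp
   then show ?thesis unfolding norm_abs_sq[OF rs, symmetric] by (intro power_mono) auto
  qed
  have ib: "integrable lborel (indicator (ball (0::R4) r) :: R4 \<Rightarrow> real)" by (rule integrable_indicator_bounded) auto
  have "(norm p)^2 = (LBINT x. (fn p x)^2)" by (rule norm_l2_sq)
  also have "\<dots> \<le> (LBINT x. 2 * (C / s * norm p)^2 * indicator (ball 0 r) x + (2 * (?rr x)^2 + 1 / c0 * (V x * (fn p x)^2)))"
  proof (rule integral_mono)
   show "integrable lborel (\<lambda>x. 2 * (C / s * norm p)^2 * indicator (ball 0 r) x + (2 * (?rr x)^2 + 1 / c0 * (V x * (fn p x)^2)))"
    using ib Vi sqint_int[OF rs] by auto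
   fix x
   show "(fn p x)^2 \<le> 2 * (C / s * norm p)^2 * indicator (ball 0 r) x + (2 * (?rr x)^2 + 1 / c0 * (V x * (fn p x)^2))"
   proof (cases "x \<in> ball 0 r")
    case True
    have "(fn p x)^2 \<le> 2 * (cv (kS s) (fn p) x)^2 + 2 * (?rr x)^2"
    proof -
     have "0 \<le> (cv (kS s) (fn p) x + ?rr x)^2" by simp
     then show ?thesis by (simp add: power2_eq_square algebra_simps)
    qed
    moreover have "(cv (kS s) (fn p) x)^2 \<le> (C / s * norm p)^2"
     using power_mono[OF C(2)[OF s, of p x] abs_ge_zero, of 2] by simp
    moreover have "0 \<le> 1 / c0 * (V x * (fn p x)^2)" using V c0 by simp
    ultimately show ?thesis using True by simp
   next
    case False
    then have "c0 * (fn p x)^2 \<le> V x * (fn p x)^2" using c0 by (intro mult_right_mono) auto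
    then have "(fn p x)^2 \<le> 1 / c0 * (V x * (fn p x)^2)" using c0 by (simp add: field_simps)
    then show ?thesis using False by (simp add: add_increasing)
   qed
  qed (use pi in simp)
  also have "\<dots> = 2 * (C / s * norm p)^2 * b + (2 * (LBINT x. (?rr x)^2) + 1 / c0 * (LBINT x. V x * (fn p x)^2))"
   using ib Vi sqint_int[OF rs] emeasure_ball_R4[of r 0] r by (simp add: measure_def b_def)
  also have "\<dots> \<le> 2 * (1 / 16) * (norm p)^2 + (2 * (s / 4 * norm w)^2 + 1 / c0 * (LBINT x. V x * (fn p x)^2))"
  proof -
   have "2 * (C / s * norm p)^2 * b = 2 * (b * (C / s)^2) * (norm p)^2" by (simp add: power_mult_distrib power_divide)
   also have "\<dots> \<le> 2 * (1 / 16) * (norm p)^2" using bs by (intro mult_right_mono mult_left_mono) auto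
   finally show ?thesis using rn by simp
  qed
  finally have fin: "(norm p)^2 \<le> 2 * (1 / 16) * (norm p)^2 + (2 * (s / 4 * norm w)^2 + 1 / c0 * (LBINT x. V x * (fn p x)^2))" .
  have "(s / 4 * norm w)^2 = s^2 * (norm w)^2 / 16" by (simp add: power_mult_distrib power_divide)
  moreover have "0 \<le> s^2 * (norm w)^2" by simp
  moreover have "0 \<le> 1 / c0 * (LBINT x. V x * (fn p x)^2)" using c0 V by simp
  moreover have "2 / c0 * (LBINT x. V x * (fn p x)^2) = 2 * (1 / c0 * (LBINT x. V x * (fn p x)^2))" by simp
  ultimately have "(norm p)^2 \<le> s^2 * (norm w)^2 + 2 / c0 * (LBINT x. V x * (fn p x)^2)"
   using fin by linarith
  also have "\<dots> \<le> (s^2 + 2 / c0) * ((norm w)^2 + (LBINT x. V x * (fn p x)^2))"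
   using c0 V by (simp add: algebra_simps add_nonneg_nonneg)
  finally show ?thesis .
 qed
 then show ?thesis using c0 by (intro exI[of _ "s^2 + 2 / c0"]) (auto intro!: add_nonneg_pos)
qed

text \<open>Vanishing is expressed through mollifications at small scales. Above height \<eta>
  either the mollification or its error must exceed \<eta>/2; the first is excluded and the second
  has small measure by Chebyshev.\<close>

lemma vanishing_level_sets:
 assumes wl: "\<And>n. (P n, W n) \<in> wlap" and B: "\<And>n. norm (W n) \<le> B" and s0: "s0 > 0"
  and van: "\<And>s e. 0 < s \<Longrightarrow> s < s0 \<Longrightarrow> e > 0 \<Longrightarrow> \<forall>\<^sub>F n in sequentially. \<forall>x. \<bar>cv (kS s) (fn (P n)) x\<bar> \<le> e"
  and \<eta>: "\<eta> > 0" and e: "e > 0"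
 shows "\<forall>\<^sub>F n in sequentially. emeasure lborel {x. \<eta> < \<bar>fn (P n) x\<bar>} \<le> ennreal e"
proof -
 have B0: "B \<ge> 0" using B[of 0] norm_ge_zero order_trans by blast
 define s where "s = min (s0 / 2) (sqrt e * \<eta> / (B + 1))"
 have s: "0 < s" "s < s0" "s \<le> sqrt e * \<eta> / (B + 1)" using s0 e \<eta> B0 by (auto simp: s_def)
 have "\<forall>\<^sub>F n in sequentially. \<forall>x. \<bar>cv (kS s) (fn (P n)) x\<bar> \<le> \<eta> / 2"
  by (rule van) (use s \<eta> in auto)
 then show ?thesis
 proof eventually_elim
  case (elim n)
  have S: "sqint (cv (kS s) (fn (P n)))" by (intro cv_test_sqint kS_test0 s fn_sqint)
  let ?r = "\<lambda>x. cv (kS s) (fn (P n)) x - fn (P n) x"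
  have rs: "sqint ?r" by (intro sqint_diff S fn_sqint)
  have [measurable]: "?r \<in> borel_measurable borel" using rs by (simp add: sqint_def)
  have "abs_l2 ?r = abs_l2 (cv (kS s) (fn (P n))) - P n"
   by (rule l2_eqI) (use fn_abs[OF rs] fn_diff[of "abs_l2 (cv (kS s) (fn (P n)))" "P n"] fn_abs[OF S] in \<open>auto elim!: AE_mp\<close>)
  then have "norm (abs_l2 ?r) \<le> s / 4 * norm (W n)" using kS_approx[OF wl s(1)] by simp
  also have "\<dots> \<le> s / 4 * (B + 1)" using s B[of n] by (intro mult_left_mono) auto
  also have "\<dots> \<le> sqrt e * \<eta> / 4" using s B0 by (simp add: field_simps)
  finally have nr: "norm (abs_l2 ?r) \<le> sqrt e * \<eta> / 4" .
  have "emeasure lborel {x. \<eta> < \<bar>fn (P n) x\<bar>} \<le> emeasure lborel {x. \<eta> / 2 < \<bar>?r x\<bar>}"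
  proof (rule emeasure_mono)
   show "{x. \<eta> < \<bar>fn (P n) x\<bar>} \<subseteq> {x. \<eta> / 2 < \<bar>?r x\<bar>}"
   proof (intro subsetI CollectI)
    fix x assume "x \<in> {x. \<eta> < \<bar>fn (P n) x\<bar>}"
    then have "\<eta> < \<bar>fn (P n) x\<bar>" by simp
    then show "\<eta> / 2 < \<bar>?r x\<bar>" using elim[rule_format, of x] by linarith
   qed
  qed measurable
  also have "\<dots> \<le> ennreal ((norm (abs_l2 ?r))^2 / (\<eta> / 2)^2)" by (rule level_set_bound[OF rs]) (use \<eta> in simp)
  also have "\<dots> \<le> ennreal e"
  proof (rule ennreal_leI)
   have "(norm (abs_l2 ?r))^2 \<le> (sqrt e * \<eta> / 4)^2" by (intro power_mono nr) auto
   also have "\<dots> = e * \<eta>^2 / 16" using e by (simp add: power_mult_distrib power_divide)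
   also have "\<dots> \<le> e * (\<eta> / 2)^2" using e by (simp add: power_divide)
   finally show "(norm (abs_l2 ?r))^2 / (\<eta> / 2)^2 \<le> e" using \<eta> by (simp add: pos_divide_le_eq)
  qed
  finally show ?case .
 qed
qed

section \<open>The energy functional\<close>

lemma wlap_scaleR: "x \<in> wlap \<Longrightarrow> t *\<^sub>R x \<in> wlap"
 using wlap_scale[of "fst x" "snd x" t] by (simp add: scaleR_prod_def)
lemma wlap_plus: "x \<in> wlap \<Longrightarrow> y \<in> wlap \<Longrightarrow> x + y \<in> wlap"
 using wlap_add[of "fst x" "snd x" "fst y" "snd y"] by (simp add: plus_prod_def)
text \<open>Uniqueness of the weak Laplacian: a pair with vanishing first component is zero.\<close>

lemma wlap_fst_nonzero: "x \<in> wlap \<Longrightarrow> x \<noteq> 0 \<Longrightarrow> fst x \<noteq> 0"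
proof
 assume x: "x \<in> wlap" "x \<noteq> 0" "fst x = 0"
 have "(0, 0) \<in> wlap" by (simp add: wlap_def)
 then have "snd x = 0" using x wlap_unique[of 0 "snd x" 0] by (metis prod.collapse)
 with x show False by (simp add: prod_eq_iff zero_prod_def)
qed

section \<open>The quadratic form with potential\<close>

definition pot :: "(R4 \<Rightarrow> real) \<Rightarrow> real \<Rightarrow> bool" where
 "pot V c \<longleftrightarrow> V \<in> borel_measurable borel \<and> (\<forall>x. 0 \<le> V x \<and> V x \<le> c)"
definition bil :: "(R4 \<Rightarrow> real) \<Rightarrow> l2 \<Rightarrow> l2 \<Rightarrow> real" where
 "bil V p q = (LBINT x. V x * (fn p x * fn q x))"
definition BV :: "(R4 \<Rightarrow> real) \<Rightarrow> l2 \<times> l2 \<Rightarrow> l2 \<times> l2 \<Rightarrow> real" where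
 "BV V x y = inner (snd x) (snd y) + bil V (fst x) (fst y)"

lemma pot_nonneg: "pot V c \<Longrightarrow> 0 \<le> c"
 unfolding pot_def using order_trans by blast

lemma pot_sqint: "pot V c \<Longrightarrow> sqint u \<Longrightarrow> sqint (\<lambda>x. V x * u x)"
proof (rule sqint_bound[OF sqint_scale[of u c]])
 assume V: "pot V c" and u: "sqint u"
 then show "(\<lambda>x. V x * u x) \<in> borel_measurable borel" by (auto simp: pot_def sqint_def)
 show "\<bar>V x * u x\<bar> \<le> \<bar>c * u x\<bar>" for x
  using V unfolding pot_def abs_mult by (intro mult_right_mono) (auto intro: order_trans[OF _ abs_ge_self])
qed

lemma bil_int: "pot V c \<Longrightarrow> integrable lborel (\<lambda>x. V x * (fn p x * fn q x))"
 using sqint_mult[OF pot_sqint[OF _ fn_sqint] fn_sqint, of V c p q] by (simp add: mult.assoc)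

text \<open>Writing the potential term as an inner product with the multiplied function gives
  linearity, bounds and weak continuity without integrals.\<close>

lemma bil_inner: "pot V c \<Longrightarrow> bil V p q = inner (abs_l2 (\<lambda>x. V x * fn p x)) q"
 using inner_abs_right[OF pot_sqint[OF _ fn_sqint], of V c q p] by (simp add: bil_def inner_commute mult_ac)

lemma bil_sym: "bil V p q = bil V q p" by (simp add: bil_def mult.commute)

lemma bil_bound: assumes "pot V c" shows "\<bar>bil V p q\<bar> \<le> c * norm p * norm q"
proof -
 have "norm (abs_l2 (\<lambda>x. V x * fn p x)) \<le> c * norm p"
 proof (rule norm_abs_le)
  show "(\<lambda>x. V x * fn p x) \<in> borel_measurable borel" using assms by (auto simp: pot_def)
  have "(NN x. ennreal ((V x * fn p x)^2)) \<le> (NN x. ennreal (c^2 * (fn p x)^2))"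
   using assms unfolding pot_def by (intro nn_integral_mono ennreal_leI) (auto simp: power_mult_distrib intro!: mult_right_mono power_mono)
  also have "\<dots> = ennreal (c^2) * ennreal ((norm p)^2)" by (subst nn_integral_cmult_ennreal) (auto simp: nn_norm_sq)
  finally show "(NN x. ennreal ((V x * fn p x)^2)) \<le> ennreal ((c * norm p)^2)"
   by (simp add: ennreal_mult[symmetric] power_mult_distrib)
  show "0 \<le> c * norm p" using pot_nonneg[OF assms] by simp
 qed
 then show ?thesis unfolding bil_inner[OF assms]
  by (rule order_trans[OF Cauchy_Schwarz_ineq2 mult_right_mono]) simp
qed

lemma bil_nonneg: "pot V c \<Longrightarrow> 0 \<le> bil V p p"
 unfolding bil_def pot_def by (intro Bochner_Integration.integral_nonneg) simp

lemma BV_sym: "BV V x y = BV V y x" by (simp add: BV_def bil_sym inner_commute)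
lemma BV_add: "pot V c \<Longrightarrow> BV V x (y + z) = BV V x y + BV V x z"
 by (simp add: BV_def bil_inner inner_add_right)
lemma BV_scale: "pot V c \<Longrightarrow> BV V x (t *\<^sub>R y) = t * BV V x y"
 by (simp add: BV_def bil_inner algebra_simps)
lemma BV_diff: "pot V c \<Longrightarrow> BV V x (y - z) = BV V x y - BV V x z"
 by (simp add: BV_def bil_inner inner_diff_right)
lemma BV_scale2: "pot V c \<Longrightarrow> BV V (t *\<^sub>R x) (t *\<^sub>R x) = t^2 * BV V x x"
 using BV_scale[of V c "t *\<^sub>R x" t x] BV_scale[of V c x t x] by (simp add: BV_sym power2_eq_square)
lemma BV_nonneg: "pot V c \<Longrightarrow> 0 \<le> BV V x x" by (simp add: BV_def bil_nonneg)
lemma norm_fst_le2: "norm (fst (x :: l2 \<times> l2)) \<le> norm x" "norm (snd x) \<le> norm x"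
 by (simp_all add: norm_prod_def real_le_rsqrt)
lemma BV_bound: "pot V c \<Longrightarrow> \<bar>BV V x y\<bar> \<le> (1 + c) * norm x * norm y"
proof -
 assume V: "pot V c"
 have c: "0 \<le> c" by (rule pot_nonneg[OF V])
 have "\<bar>inner (snd x) (snd y)\<bar> \<le> norm x * norm y"
  by (rule order_trans[OF Cauchy_Schwarz_ineq2]) (intro mult_mono norm_fst_le2; simp)
 moreover have "\<bar>bil V (fst x) (fst y)\<bar> \<le> c * norm x * norm y"
  by (rule order_trans[OF bil_bound[OF V]]) (intro mult_mono mult_left_mono norm_fst_le2 c; simp add: c)
 ultimately have "\<bar>BV V x y\<bar> \<le> norm x * norm y + c * norm x * norm y" unfolding BV_def by linarith
 then show ?thesis by (simp add: algebra_simps)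
qed

lemma BV_tendsto:
 assumes V: "pot V c" and X: "X \<longlonglongrightarrow> x" shows "(\<lambda>n. BV V (X n) (X n)) \<longlonglongrightarrow> BV V x x"
proof -
 have eq: "BV V (X n) (X n) - BV V x x = BV V (X n - x) (X n - x) + 2 * BV V x (X n - x)" for n
  using BV_diff[OF V, of "X n - x" "X n" x] BV_diff[OF V, of x "X n" x] BV_diff[OF V, of "X n" "X n" x]
   BV_sym[of V "X n - x" "X n"] BV_sym[of V "X n - x" x] BV_sym[of V x "X n"] by linarith
 have d: "(\<lambda>n. norm (X n - x)) \<longlonglongrightarrow> 0" using X by (simp add: LIM_zero tendsto_norm_zero)
 have "(\<lambda>n. BV V (X n) (X n) - BV V x x) \<longlonglongrightarrow> 0"
 proof (rule Lim_null_comparison)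
  show "\<forall>\<^sub>F n in sequentially. norm (BV V (X n) (X n) - BV V x x) \<le> (1 + c) * norm (X n - x) * norm (X n - x) + 2 * ((1 + c) * norm x * norm (X n - x))"
  proof (intro always_eventually allI)
   fix n
   show "norm (BV V (X n) (X n) - BV V x x) \<le> (1 + c) * norm (X n - x) * norm (X n - x) + 2 * ((1 + c) * norm x * norm (X n - x))"
    unfolding eq real_norm_def using BV_bound[OF V, of "X n - x" "X n - x"] BV_bound[OF V, of x "X n - x"] by linarith
  qed
  have "(\<lambda>n. (1 + c) * norm (X n - x) * norm (X n - x) + 2 * ((1 + c) * norm x * norm (X n - x))) \<longlonglongrightarrow> (1 + c) * 0 * 0 + 2 * ((1 + c) * norm x * 0)"
   by (intro tendsto_intros d)
  then show "(\<lambda>n. (1 + c) * norm (X n - x) * norm (X n - x) + 2 * ((1 + c) * norm x * norm (X n - x))) \<longlonglongrightarrow> 0" by simp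
 qed
 then show ?thesis by (simp add: LIM_zero_iff)
qed

lemma fn_scale_fst: "AE x in lborel. fn (fst (t *\<^sub>R z)) x = t * fn (fst z) x"
 using fn_scale[of t "fst z"] by simp

lemma exp_square_mono: "0 \<le> (a::real) \<Longrightarrow> \<bar>s\<bar> \<le> \<bar>t\<bar> \<Longrightarrow> s^2 * exp (a * s^2) \<le> t^2 * exp (a * t^2)"
 by (intro mult_mono) (auto simp: abs_le_square_iff[symmetric] intro!: mult_left_mono)

text \<open>The sum is at most twice the larger of the two numbers; adding both possibilities
  removes the case distinction at the price of a factor 4 in the exponent.\<close>

lemma exp_square_sum:
 fixes a k u v :: real
 assumes "0 \<le> a"
 shows "(k * (\<bar>u\<bar> + \<bar>v\<bar>))^2 * exp (a * (k * (\<bar>u\<bar> + \<bar>v\<bar>))^2) \<le> (2 * k)^2 * (u^2 * exp (a * (2 * k)^2 * u^2) + v^2 * exp (a * (2 * k)^2 * v^2))"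
proof -
 have *: "(k * (\<bar>u\<bar> + \<bar>v\<bar>))^2 * exp (a * (k * (\<bar>u\<bar> + \<bar>v\<bar>))^2) \<le> (2 * k)^2 * (m^2 * exp (a * (2 * k)^2 * m^2))" if "\<bar>u\<bar> \<le> \<bar>m\<bar>" "\<bar>v\<bar> \<le> \<bar>m\<bar>" for m
 proof -
  have "\<bar>k * (\<bar>u\<bar> + \<bar>v\<bar>)\<bar> \<le> \<bar>2 * k * m\<bar>"
   using mult_left_mono[of "\<bar>u\<bar> + \<bar>v\<bar>" "2 * \<bar>m\<bar>" "\<bar>k\<bar>"] that by (simp add: abs_mult)
  from exp_square_mono[OF assms this] show ?thesis by (simp add: power_mult_distrib mult.assoc)
 qed
 have nn: "0 \<le> (2 * k)^2 * (m^2 * exp (a * (2 * k)^2 * m^2))" for m by simp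
 show ?thesis
 proof (cases "\<bar>u\<bar> \<le> \<bar>v\<bar>")
  case True
  then show ?thesis using *[of v] nn[of u] unfolding distrib_left[of "(2 * k)^2"] by linarith
 next
  case False
  then show ?thesis using *[of u] nn[of v] unfolding distrib_left[of "(2 * k)^2"] by linarith
 qed
qed

text \<open>Every exponent is allowed, even far above the critical one, because only a small norm
  neighbourhood of a fixed function is considered: \<open>pot_dominated_small\<close> provides a
  density of as little energy as desired.\<close>

lemma unif_exp:
 assumes x: "x \<in> wlap" and b: "b \<ge> 0"
 shows "\<exists>M\<ge>0. \<exists>d>0. \<forall>y\<in>wlap. norm (y - x) \<le> d \<longrightarrow> integrable lborel (\<lambda>z. (fn (fst y) z)^2 * exp (b * (fn (fst y) z)^2)) \<and>
  (LBINT z. (fn (fst y) z)^2 * exp (b * (fn (fst y) z)^2)) \<le> M"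
proof -
 define \<beta> where "\<beta> = b + 1"
 have \<beta>: "\<beta> > 0" using b by (simp add: \<beta>_def)
 \<comment> \<open>Any energy below \<open>32 * pi^2 / \<beta>\<close> would do;
   \<open>pi^2 / \<beta>\<close> is a convenient one.\<close>
 have D: "pi^2 / \<beta> > 0" "\<beta> * (pi^2 / \<beta>) < 32 * pi^2" using \<beta> by auto
 have "(fst x, snd x) \<in> wlap" using x by simp
 from pot_dominated_small[OF this D(1)] obtain C0 d where C0: "C0 \<ge> 0" "d > 0"
  "\<And>q v. (q, v) \<in> wlap \<Longrightarrow> norm (q - fst x) \<le> d \<Longrightarrow> norm (v - snd x) \<le> d \<Longrightarrow> pot_dominated C0 (pi^2 / \<beta>) (fn q)" by blast
 obtain K where K: "K > 0" "\<forall>u. pot_dominated C0 (pi^2 / \<beta>) u \<longrightarrow> (NN x. ennreal (exp (\<beta> * (u x)^2)) * indicator {x. K < \<bar>u x\<bar>} x) \<le> ennreal 1"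
  using adams_tail[OF D(1) \<beta> D(2) C0(1), of 1] by auto
 have main: "integrable lborel (\<lambda>z. (fn (fst y) z)^2 * exp (b * (fn (fst y) z)^2))"
   "(LBINT z. (fn (fst y) z)^2 * exp (b * (fn (fst y) z)^2)) \<le> 1 + exp (b * K^2) * (norm x + d)^2"
  if y: "y \<in> wlap" "norm (y - x) \<le> d" for y
 proof -
  let ?u = "fn (fst y)"
  have pd: "pot_dominated C0 (pi^2 / \<beta>) ?u"
   by (rule C0(3)[of _ "snd y"]) (use y norm_fst_le2[of "y - x"] in \<open>auto intro: order_trans\<close>)
  have ny: "norm (fst y) \<le> norm x + d" using norm_fst_le2(1)[of y] y(2) norm_triangle_ineq2[of y x] by linarith
  have "(NN z. ennreal ((?u z)^2 * exp (b * (?u z)^2))) \<le>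
   (NN z. ennreal (exp (\<beta> * (?u z)^2)) * indicator {x. K < \<bar>?u x\<bar>} z + ennreal (exp (b * K^2) * (?u z)^2))"
  proof (intro nn_integral_mono)
   fix z
   show "ennreal ((?u z)^2 * exp (b * (?u z)^2)) \<le> ennreal (exp (\<beta> * (?u z)^2)) * indicator {x. K < \<bar>?u x\<bar>} z + ennreal (exp (b * K^2) * (?u z)^2)"
   proof (cases "K < \<bar>?u z\<bar>")
    case True
    have "(?u z)^2 \<le> exp ((?u z)^2)" using exp_ge_add_one_self[of "(?u z)^2"] by linarith
    then have "(?u z)^2 * exp (b * (?u z)^2) \<le> exp ((?u z)^2) * exp (b * (?u z)^2)" by (intro mult_right_mono) auto
    also have "\<dots> = exp (\<beta> * (?u z)^2)" by (simp add: exp_add[symmetric] \<beta>_def algebra_simps)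
    finally have "ennreal ((?u z)^2 * exp (b * (?u z)^2)) \<le> ennreal (exp (\<beta> * (?u z)^2))" by (rule ennreal_leI)
    then show ?thesis using True by (simp add: add_increasing2)
   next
    case False
    have "(?u z)^2 \<le> K^2" using False K(1) by (simp add: abs_le_square_iff[symmetric])
    then have "b * (?u z)^2 \<le> b * K^2" using b by (rule mult_left_mono)
    then have "(?u z)^2 * exp (b * (?u z)^2) \<le> exp (b * K^2) * (?u z)^2" by (subst mult.commute) (intro mult_right_mono, auto)
    then show ?thesis using False by (simp add: ennreal_leI)
   qed
  qed
  also have "\<dots> = (NN z. ennreal (exp (\<beta> * (?u z)^2)) * indicator {x. K < \<bar>?u x\<bar>} z) + (NN z. ennreal (exp (b * K^2) * (?u z)^2))"
   by (rule nn_integral_add) measurable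
  also have "(NN z. ennreal (exp (b * K^2) * (?u z)^2)) = ennreal (exp (b * K^2) * (norm (fst y))^2)"
   by (subst nn_integral_cmult_ennreal) (auto simp: nn_norm_sq ennreal_mult)
  also have "(NN z. ennreal (exp (\<beta> * (?u z)^2)) * indicator {x. K < \<bar>?u x\<bar>} z) + ennreal (exp (b * K^2) * (norm (fst y))^2) \<le> ennreal 1 + ennreal (exp (b * K^2) * (norm x + d)^2)"
   using K(2) pd ny by (intro add_mono ennreal_leI mult_left_mono power_mono) auto
  also have "\<dots> = ennreal (1 + exp (b * K^2) * (norm x + d)^2)" by (intro ennreal_plus[symmetric]) auto
  finally have le: "(NN z. ennreal ((?u z)^2 * exp (b * (?u z)^2))) \<le> ennreal (1 + exp (b * K^2) * (norm x + d)^2)" .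
  show "integrable lborel (\<lambda>z. (?u z)^2 * exp (b * (?u z)^2))"
   by (rule integrableI_nonneg) (use le_less_trans[OF le ennreal_less_top] in auto)
  show "(LBINT z. (?u z)^2 * exp (b * (?u z)^2)) \<le> 1 + exp (b * K^2) * (norm x + d)^2"
   by (subst integral_eq_nn_integral) (auto intro!: enn2real_leI le add_nonneg_nonneg simp del: ennreal_plus)
 qed
 show ?thesis
  by (rule exI[of _ "1 + exp (b * K^2) * (norm x + d)^2"]) (use main C0(2) in \<open>auto intro!: exI[of _ d] add_nonneg_nonneg\<close>)
qed

text \<open>F enters as an antiderivative vanishing at 0; the interval integral of the theorem is
  converted once, at the interpretation.\<close>

locale nonlinearity =
 fixes f F :: "real \<Rightarrow> real" and \<alpha>0 \<mu> M0 t0 :: real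
 assumes f0: "f 0 = 0" and F0: "F 0 = 0"
  and F_deriv: "\<And>t. (F has_real_derivative f t) (at t)"
  and f_cont: "continuous_on UNIV f"
  and a0: "\<alpha>0 > 0"
  and growth: "\<And>\<alpha>. \<alpha> > \<alpha>0 \<Longrightarrow> ((\<lambda>t. \<bar>f t\<bar> / exp (\<alpha> * t^2)) \<longlongrightarrow> 0) at_infinity"
  and mu: "\<mu> > 2" and AR: "\<And>t. t \<noteq> 0 \<Longrightarrow> 0 < \<mu> * F t \<and> \<mu> * F t \<le> t * f t"
  and M0: "M0 > 0" "\<And>t. \<bar>t\<bar> \<ge> t0 \<Longrightarrow> F t \<le> M0 * \<bar>f t\<bar>"
  and small: "((\<lambda>t. f t / t) \<longlongrightarrow> 0) (at 0)"
  and mono_pos: "\<And>s t. 0 < s \<Longrightarrow> s < t \<Longrightarrow> f s / s < f t / t"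
  and mono_neg: "\<And>s t. s < t \<Longrightarrow> t < 0 \<Longrightarrow> f s / s > f t / t"
begin

lemma f_meas [measurable]: "f \<in> borel_measurable borel" using f_cont by (rule borel_measurable_continuous_onI)
lemma F_cont: "continuous_on UNIV F" using DERIV_isCont[OF F_deriv] by (simp add: continuous_on_eq_continuous_at)
lemma F_meas [measurable]: "F \<in> borel_measurable borel" using F_cont by (rule borel_measurable_continuous_onI)

lemma F_pos: "t \<noteq> 0 \<Longrightarrow> 0 < F t" using AR[of t] mu by (simp add: zero_less_mult_iff)
lemma F_nonneg: "0 \<le> F t" using F_pos[of t] F0 by (cases "t = 0") auto
lemma AR': "\<mu> * F t \<le> f t * t" using AR[of t] f0 F0 by (cases "t = 0") (auto simp: mult.commute)
lemma ft_nonneg: "0 \<le> f t * t"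
proof -
 have "0 \<le> \<mu> * F t" using mu F_nonneg by simp
 then show ?thesis using AR'[of t] by linarith
qed
lemma F_le: "F t \<le> f t * t / 2"
proof -
 have "2 * F t \<le> \<mu> * F t" using mu F_nonneg by (intro mult_right_mono) auto
 then show ?thesis using AR'[of t] by simp
qed
lemma ft_abs: "f t * t = \<bar>f t\<bar> * \<bar>t\<bar>" using ft_nonneg[of t] by (simp flip: abs_mult)

lemma f_small: "\<eta> > 0 \<Longrightarrow> \<exists>a>0. \<forall>t. \<bar>t\<bar> \<le> a \<longrightarrow> \<bar>f t\<bar> \<le> \<eta> * \<bar>t\<bar>"
proof -
 assume e: "\<eta> > 0"
 obtain d where d: "d > 0" "\<And>t. t \<noteq> 0 \<Longrightarrow> \<bar>t\<bar> < d \<Longrightarrow> \<bar>f t / t\<bar> < \<eta>"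
  using LIM_D[OF small e] by auto
 have "\<bar>f t\<bar> \<le> \<eta> * \<bar>t\<bar>" if "\<bar>t\<bar> \<le> d / 2" for t
 proof (cases "t = 0")
  case False
  then have "\<bar>f t\<bar> / \<bar>t\<bar> < \<eta>" using d(2)[of t] that d(1) by (simp add: abs_divide)
  then show ?thesis using False by (simp add: pos_divide_less_eq)
 qed (simp add: f0)
 then show ?thesis using d(1) by (intro exI[of _ "d / 2"]) auto
qed

text \<open>The factor |t| is kept down to t = 0, where smallness of f supplies it: over a space of
  infinite measure only integrands comparable with t^2 near 0 are integrable.\<close>

lemma f_growth: "\<alpha> > \<alpha>0 \<Longrightarrow> \<exists>C>0. \<forall>t. \<bar>f t\<bar> \<le> C * \<bar>t\<bar> * exp (\<alpha> * t^2)"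
proof -
 assume al: "\<alpha> > \<alpha>0"
 obtain a where a: "a > 0" "\<And>t. \<bar>t\<bar> \<le> a \<Longrightarrow> \<bar>f t\<bar> \<le> 1 * \<bar>t\<bar>" using f_small[of 1] by auto
 have "\<forall>\<^sub>F t in at_infinity. \<bar>f t\<bar> / exp (\<alpha> * t^2) < 1" using growth[OF al] by (rule order_tendstoD) simp
 then obtain b where b: "\<And>t. \<bar>t\<bar> \<ge> b \<Longrightarrow> \<bar>f t\<bar> / exp (\<alpha> * t^2) < 1" by (auto simp: eventually_at_infinity)
 have "compact (f ` {-\<bar>b\<bar>..\<bar>b\<bar>})" using f_cont by (intro compact_continuous_image) (auto intro: continuous_on_subset)
 then obtain B where "\<forall>y\<in>f ` {-\<bar>b\<bar>..\<bar>b\<bar>}. norm y \<le> B"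
  using compact_imp_bounded bounded_iff by metis
 then have B: "\<And>t. \<bar>t\<bar> \<le> \<bar>b\<bar> \<Longrightarrow> \<bar>f t\<bar> \<le> B" by (auto simp: abs_le_iff)
 define C where "C = 1 + (\<bar>B\<bar> + 1) / a"
 have "(\<bar>B\<bar> + 1) / a * a = \<bar>B\<bar> + 1" using a(1) by simp
 then have "C * a = a + (\<bar>B\<bar> + 1)" by (simp only: C_def distrib_right mult_1)
 then have C: "C \<ge> 1" "C * a \<ge> \<bar>B\<bar> + 1" using a(1) by (auto simp: C_def)
 have "\<bar>f t\<bar> \<le> C * \<bar>t\<bar> * exp (\<alpha> * t^2)" for t
 proof -
  have e: "1 \<le> exp (\<alpha> * t^2)" using al a0 by simp
  show ?thesis
  proof (cases "\<bar>t\<bar> \<le> a")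
   case True
   have "\<bar>f t\<bar> \<le> 1 * \<bar>t\<bar> * 1" using a(2)[OF True] by simp
   also have "\<dots> \<le> C * \<bar>t\<bar> * exp (\<alpha> * t^2)" using C e by (intro mult_mono) auto
   finally show ?thesis .
  next
   case False
   have "C * a \<le> C * \<bar>t\<bar>" using False C by (intro mult_left_mono) auto
   then have Ct: "C * \<bar>t\<bar> \<ge> \<bar>B\<bar> + 1" using C by linarith
   show ?thesis
   proof (cases "\<bar>t\<bar> \<le> \<bar>b\<bar>")
    case True
    have "\<bar>f t\<bar> \<le> (C * \<bar>t\<bar>) * 1" using B[OF True] Ct by linarith
    also have "\<dots> \<le> C * \<bar>t\<bar> * exp (\<alpha> * t^2)" using C e by (intro mult_left_mono) auto
    finally show ?thesis .
   next
    case False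
    then have "\<bar>f t\<bar> \<le> 1 * exp (\<alpha> * t^2)" using b[of t] by (simp add: pos_divide_less_eq) linarith
    also have "\<dots> \<le> C * \<bar>t\<bar> * exp (\<alpha> * t^2)" using Ct by (intro mult_right_mono) auto
    finally show ?thesis .
   qed
  qed
 qed
 then show ?thesis using C by (intro exI[of _ C]) auto
qed

text \<open>How the monotonicity of \<open>f t / t\<close> enters: along a ray,
 \<open>\<tau> \<mapsto> F (\<tau> a) - \<tau>\<^sup>2 / 2 * f a * a\<close> has its minimum at \<open>\<tau> = 1\<close>.\<close>
lemma F_ray_strict:
 assumes t: "0 \<le> \<tau>" "\<tau> \<noteq> 1" and a: "a \<noteq> 0"
 shows "F (\<tau> * a) - F a > (\<tau>^2 - 1) / 2 * (f a * a)"
proof -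
 define g where "g s = F (s * a) - (s^2 - 1) / 2 * (f a * a)" for s
 define g' where "g' s = f (s * a) * a - s * (f a * a)" for s
 have d: "(g has_real_derivative g' s) (at s)" for s
  unfolding g_def[abs_def] g'_def by (auto intro!: derivative_eq_intros DERIV_chain2[OF F_deriv])
 have g'eq: "g' s = s * a^2 * (f (s * a) / (s * a) - f a / a)" if "s > 0" for s
  using that a by (simp add: g'_def field_simps power2_eq_square)
 have lt: "g' s < 0" if "0 < s" "s < 1" for s
 proof -
  have "f (s * a) / (s * a) < f a / a"
  proof (cases "a > 0")
   case True then show ?thesis using mono_pos[of "s * a" a] that by simp
  next
   case False then show ?thesis using mono_neg[of a "s * a"] that a by (simp add: mult_less_cancel_right2 mult_pos_neg)
  qed
  then show ?thesis unfolding g'eq[OF that(1)] using that a by (intro mult_pos_neg) auto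
 qed
 have gt: "g' s > 0" if "1 < s" for s
 proof -
  have "f a / a < f (s * a) / (s * a)"
  proof (cases "a > 0")
   case True then show ?thesis using mono_pos[of a "s * a"] that by simp
  next
   case False then show ?thesis using mono_neg[of "s * a" a] that a by (simp add: mult_less_cancel_right2)
  qed
  moreover have "s > 0" using that by simp
  ultimately show ?thesis using g'eq[of s] a by simp
 qed
 have "g \<tau> > g 1"
 proof (cases "\<tau> < 1")
  case True
  then obtain z where "\<tau> < z" "z < 1" "g 1 - g \<tau> = (1 - \<tau>) * g' z" using MVT2[OF True, of g g'] d by blast
  moreover have "(1 - \<tau>) * g' z < 0" using True lt[of z] t calculation by (intro mult_pos_neg) auto
  ultimately show ?thesis by simp
 next
  case False
  then have "1 < \<tau>" using t by simp
  then obtain z where "1 < z" "z < \<tau>" "g \<tau> - g 1 = (\<tau> - 1) * g' z" using MVT2[of 1 \<tau> g g'] d by blast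
  moreover have "(\<tau> - 1) * g' z > 0" using \<open>1 < \<tau>\<close> gt[of z] calculation by simp
  ultimately show ?thesis by simp
 qed
 then show ?thesis by (simp add: g_def)
qed

lemma F_ray: "0 \<le> \<tau> \<Longrightarrow> F (\<tau> * a) - F a \<ge> (\<tau>^2 - 1) / 2 * (f a * a)"
 using F_ray_strict[of \<tau> a] F0 f0 by (cases "\<tau> = 1 \<or> a = 0") auto

text \<open>The ray inequality at parameter 0. On the Nehari set this quantity is the energy
  density, so its sign makes Fatou's lemma applicable.\<close>

lemma H_nonneg: "0 \<le> f a * a / 2 - F a" using F_ray[of 0 a] F0 by simp

text \<open>The inequality \<open>\<mu> F t \<le> t f t\<close> says that F(s a) divided by s to the
  power \<mu> is nondecreasing in s; hence growth faster than quadratic along rays.\<close>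

lemma F_powr: "1 \<le> \<tau> \<Longrightarrow> \<tau> powr \<mu> * F a \<le> F (\<tau> * a)"
proof -
 assume t: "1 \<le> \<tau>"
 define g where "g s = F (s * a) * s powr (- \<mu>)" for s
 have "g 1 \<le> g \<tau>"
 proof (rule DERIV_nonneg_imp_nondecreasing[OF t])
  fix s :: real assume s: "1 \<le> s" "s \<le> \<tau>"
  have "(g has_real_derivative (f (s * a) * a * s powr (- \<mu>) + F (s * a) * (- \<mu> * s powr (- \<mu> - 1)))) (at s)"
   unfolding g_def[abs_def] using s by (auto intro!: derivative_eq_intros DERIV_chain2[OF F_deriv] simp: mult_ac)
  moreover have "f (s * a) * a * s powr (- \<mu>) + F (s * a) * (- \<mu> * s powr (- \<mu> - 1)) \<ge> 0"
  proof -
   have "s powr (- \<mu>) = s * s powr (- \<mu> - 1)" using s by (simp add: powr_diff)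
   then have "f (s * a) * a * s powr (- \<mu>) + F (s * a) * (- \<mu> * s powr (- \<mu> - 1)) = s powr (- \<mu> - 1) * (f (s * a) * (s * a) - \<mu> * F (s * a))"
    by (simp add: algebra_simps)
   then show ?thesis using AR'[of "s * a"] by simp
  qed
  ultimately show "\<exists>y. (g has_real_derivative y) (at s) \<and> 0 \<le> y" by blast
 qed
 then have "F a \<le> F (\<tau> * a) * \<tau> powr (- \<mu>)" by (simp add: g_def)
 then have "\<tau> powr \<mu> * F a \<le> \<tau> powr \<mu> * (F (\<tau> * a) * \<tau> powr (- \<mu>))" by (rule mult_left_mono) simp
 also have "\<dots> = F (\<tau> * a)" using t by (simp add: powr_minus)
 finally show ?thesis .
qed

text \<open>One fixed exponent above \<open>\<alpha>0\<close> gives a global bound on f that serves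
  all qualitative statements. Only \<open>no_vanishing\<close> needs an exponent close to
  \<open>\<alpha>0\<close>.\<close>

definition \<alpha>1 where "\<alpha>1 = \<alpha>0 + 1"
definition Cf where "Cf = (SOME C. C > 0 \<and> (\<forall>t. \<bar>f t\<bar> \<le> C * \<bar>t\<bar> * exp (\<alpha>1 * t^2)))"

lemma Cf: "Cf > 0" "\<bar>f t\<bar> \<le> Cf * \<bar>t\<bar> * exp (\<alpha>1 * t^2)"
proof -
 have "\<exists>C>0. \<forall>t. \<bar>f t\<bar> \<le> C * \<bar>t\<bar> * exp (\<alpha>1 * t^2)" by (rule f_growth) (simp add: \<alpha>1_def)
 from someI_ex[OF this] show "Cf > 0" "\<bar>f t\<bar> \<le> Cf * \<bar>t\<bar> * exp (\<alpha>1 * t^2)" unfolding Cf_def by auto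
qed

lemma a1: "\<alpha>1 \<ge> 0" using a0 by (simp add: \<alpha>1_def)

lemma ft_le: "f t * t \<le> Cf * (t^2 * exp (\<alpha>1 * t^2))"
proof -
 have "f t * t \<le> (Cf * \<bar>t\<bar> * exp (\<alpha>1 * t^2)) * \<bar>t\<bar>" unfolding ft_abs by (intro mult_right_mono Cf) auto
 also have "\<dots> = Cf * (t^2 * exp (\<alpha>1 * t^2))" by (simp add: power2_eq_square)
 finally show ?thesis .
qed

lemma F_diff_bound: "\<bar>F b - F a\<bar> \<le> \<bar>b - a\<bar> * (Cf * (\<bar>a\<bar> + \<bar>b\<bar>) * exp (\<alpha>1 * (\<bar>a\<bar> + \<bar>b\<bar>)^2))"
proof -
 have "norm (F b - F a) \<le> (Cf * (\<bar>a\<bar> + \<bar>b\<bar>) * exp (\<alpha>1 * (\<bar>a\<bar> + \<bar>b\<bar>)^2)) * norm (b - a)"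
 proof (rule field_differentiable_bound[of "closed_segment a b" F f])
  fix z assume z: "z \<in> closed_segment a b"
  then have z': "\<bar>z\<bar> \<le> \<bar>a\<bar> + \<bar>b\<bar>" unfolding closed_segment_eq_real_ivl by (auto split: if_splits)
  show "(F has_field_derivative f z) (at z within closed_segment a b)" using F_deriv has_field_derivative_at_within by blast
  have "\<bar>f z\<bar> \<le> Cf * \<bar>z\<bar> * exp (\<alpha>1 * z^2)" by (rule Cf)
  also have "\<dots> \<le> Cf * (\<bar>a\<bar> + \<bar>b\<bar>) * exp (\<alpha>1 * (\<bar>a\<bar> + \<bar>b\<bar>)^2)"
   using z' Cf(1) a1 by (intro mult_mono) (auto intro!: mult_left_mono simp: abs_le_square_iff[symmetric])
  finally show "norm (f z) \<le> Cf * (\<bar>a\<bar> + \<bar>b\<bar>) * exp (\<alpha>1 * (\<bar>a\<bar> + \<bar>b\<bar>)^2)" by simp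
 qed auto
 then show ?thesis by (simp add: mult.commute)
qed

section \<open>The nonlinear terms of the energy: integrability, continuity and derivative\<close>

definition Nf where "Nf p q = (LBINT x. f (fn p x) * fn q x)"
definition IF where "IF p = (LBINT x. F (fn p x))"
definition EV where "EV V x = BV V x x / 2 - IF (fst x)"

lemma exp2_int: "x \<in> wlap \<Longrightarrow> integrable lborel (\<lambda>z. (fn (fst x) z)^2 * exp (b * (fn (fst x) z)^2))"
proof -
 assume "x \<in> wlap"
 from unif_exp[OF this, of "\<bar>b\<bar>"] this have "integrable lborel (\<lambda>z. (fn (fst x) z)^2 * exp (\<bar>b\<bar> * (fn (fst x) z)^2))" by auto
 then show ?thesis
  by (rule Bochner_Integration.integrable_bound) (auto intro!: mult_left_mono mult_right_mono)
qed

text \<open>Bounding both factors by the larger of |u| and |v| reduces mixed products to integrals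
  of one function at a time.\<close>

lemma Nf_dom: "\<bar>f u * v\<bar> \<le> Cf * (u^2 * exp (\<alpha>1 * u^2)) + Cf * (v^2 * exp (\<alpha>1 * v^2))"
proof -
 have *: "\<bar>f u * v\<bar> \<le> Cf * (m^2 * exp (\<alpha>1 * m^2))" if "\<bar>u\<bar> \<le> \<bar>m\<bar>" "\<bar>v\<bar> \<le> \<bar>m\<bar>" for m
 proof -
  have "\<bar>f u * v\<bar> \<le> (Cf * \<bar>u\<bar> * exp (\<alpha>1 * u^2)) * \<bar>v\<bar>" unfolding abs_mult by (intro mult_right_mono Cf) auto
  also have "\<dots> \<le> (Cf * \<bar>m\<bar> * exp (\<alpha>1 * m^2)) * \<bar>m\<bar>"
   using that Cf(1) a1 by (intro mult_mono) (auto intro!: mult_left_mono simp: abs_le_square_iff[symmetric])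
  also have "\<dots> = Cf * (m^2 * exp (\<alpha>1 * m^2))" by (simp add: power2_eq_square)
  finally show ?thesis .
 qed
 have nn: "0 \<le> Cf * (m^2 * exp (\<alpha>1 * m^2))" for m using Cf(1) by simp
 show ?thesis using *[of u] *[of v] nn[of u] nn[of v] by (cases "\<bar>u\<bar> \<le> \<bar>v\<bar>") linarith+
qed

lemma Nf_int: "x \<in> wlap \<Longrightarrow> y \<in> wlap \<Longrightarrow> integrable lborel (\<lambda>z. f (fn (fst x) z) * fn (fst y) z)"
proof (rule Bochner_Integration.integrable_bound)
 assume "x \<in> wlap" "y \<in> wlap"
 then show "integrable lborel (\<lambda>z. Cf * ((fn (fst x) z)^2 * exp (\<alpha>1 * (fn (fst x) z)^2)) + Cf * ((fn (fst y) z)^2 * exp (\<alpha>1 * (fn (fst y) z)^2)))"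
  using exp2_int[of _ \<alpha>1] by simp
 show "AE z in lborel. norm (f (fn (fst x) z) * fn (fst y) z) \<le> norm (Cf * ((fn (fst x) z)^2 * exp (\<alpha>1 * (fn (fst x) z)^2)) + Cf * ((fn (fst y) z)^2 * exp (\<alpha>1 * (fn (fst y) z)^2)))"
  unfolding real_norm_def by (intro AE_I2 order_trans[OF Nf_dom abs_ge_self])
qed measurable

lemma IF_int: "x \<in> wlap \<Longrightarrow> integrable lborel (\<lambda>z. F (fn (fst x) z))"
proof (rule Bochner_Integration.integrable_bound)
 assume "x \<in> wlap"
 then show "integrable lborel (\<lambda>z. f (fn (fst x) z) * fn (fst x) z)" by (intro Nf_int)
 show "AE z in lborel. norm (F (fn (fst x) z)) \<le> norm (f (fn (fst x) z) * fn (fst x) z)"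
  using F_nonneg F_le ft_nonneg by (intro AE_I2) (smt (verit) real_norm_def field_sum_of_halves)
qed measurable

lemma IF_nonneg: "0 \<le> IF p" unfolding IF_def using F_nonneg by simp

lemma AE_pos_integral:
 fixes h :: "R4 \<Rightarrow> real"
 assumes "integrable lborel h" "\<And>x. 0 \<le> h x" "\<And>x. fn p x \<noteq> 0 \<Longrightarrow> 0 < h x" "p \<noteq> 0"
 shows "0 < (LBINT x. h x)"
proof (rule ccontr)
 assume "\<not> ?thesis"
 moreover have "0 \<le> (LBINT x. h x)" by (intro Bochner_Integration.integral_nonneg assms(2))
 ultimately have "(LBINT x. h x) = 0" by linarith
 then have "AE x in lborel. h x = 0" using integral_nonneg_eq_0_iff_AE[OF assms(1)] assms(2) by simp
 then have "AE x in lborel. fn p x = fn 0 x" using fn_0 by eventually_elim (metis assms(3) less_irrefl)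
 then show False using assms(4) l2_eqI by blast
qed

lemma IF_pos: "x \<in> wlap \<Longrightarrow> x \<noteq> 0 \<Longrightarrow> 0 < IF (fst x)"
 unfolding IF_def by (rule AE_pos_integral[OF IF_int F_nonneg F_pos wlap_fst_nonzero])

lemma IF_scale: "IF (fst (t *\<^sub>R x)) = (LBINT z. F (t * fn (fst x) z))"
 unfolding IF_def by (rule integral_cong_AE) (use fn_scale_fst[of t x] in auto)
lemma F_scale_int: "x \<in> wlap \<Longrightarrow> integrable lborel (\<lambda>z. F (t * fn (fst x) z))"
 using fn_scale_fst[of t x] by (intro Bochner_Integration.integrable_cong_AE_imp[OF IF_int[OF wlap_scaleR[of _ t]]]) (auto elim!: AE_mp)

text \<open>The mean value bound makes the difference an inner product of |y - x| with a factor
  \<open>k\<close>. By \<open>unif_exp\<close> this factor is bounded in norm near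
  \<open>x\<close>.\<close>

lemma IF_tendsto:
 assumes x: "x \<in> wlap" and X: "\<And>n. X n \<in> wlap" "X \<longlonglongrightarrow> x"
 shows "(\<lambda>n. IF (fst (X n))) \<longlonglongrightarrow> IF (fst x)"
proof -
 \<comment> \<open>The 2 comes from squaring the exponential, the 4 from
   \<open>exp_square_sum\<close>.\<close>
 define b where "b = 2 * \<alpha>1 * 4"
 have b: "b \<ge> 0" using a1 by (simp add: b_def)
 obtain M d where M: "M \<ge> 0" "d > 0" "\<And>y. y \<in> wlap \<Longrightarrow> norm (y - x) \<le> d \<Longrightarrow> (LBINT z. (fn (fst y) z)^2 * exp (b * (fn (fst y) z)^2)) \<le> M"
  using unif_exp[OF x b] by blast
 have est: "\<bar>IF (fst y) - IF (fst x)\<bar> \<le> norm (y - x) * (Cf * sqrt (8 * M))" if y: "y \<in> wlap" "norm (y - x) \<le> d" for y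
 proof -
  define k where "k z = Cf * (\<bar>fn (fst x) z\<bar> + \<bar>fn (fst y) z\<bar>) * exp (\<alpha>1 * (\<bar>fn (fst x) z\<bar> + \<bar>fn (fst y) z\<bar>)^2)" for z
  have km [measurable]: "k \<in> borel_measurable borel" unfolding k_def by measurable
  have kb: "(k z)^2 \<le> Cf^2 * (4 * ((fn (fst x) z)^2 * exp (b * (fn (fst x) z)^2) + (fn (fst y) z)^2 * exp (b * (fn (fst y) z)^2)))" for z
  proof -
   let ?m = "1 * (\<bar>fn (fst x) z\<bar> + \<bar>fn (fst y) z\<bar>)"
   have "(k z)^2 = Cf^2 * (?m^2 * exp (2 * \<alpha>1 * ?m^2))"
    by (simp add: k_def power_mult_distrib exp_of_nat_mult[symmetric] mult_ac flip: exp_double)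
   also have "\<dots> \<le> Cf^2 * ((2 * 1)^2 * ((fn (fst x) z)^2 * exp (2 * \<alpha>1 * (2 * 1)^2 * (fn (fst x) z)^2) + (fn (fst y) z)^2 * exp (2 * \<alpha>1 * (2 * 1)^2 * (fn (fst y) z)^2)))"
    using a1 by (intro mult_left_mono exp_square_sum) auto
   finally show ?thesis by (simp add: b_def)
  qed
  have ki: "integrable lborel (\<lambda>z. Cf^2 * (4 * ((fn (fst x) z)^2 * exp (b * (fn (fst x) z)^2) + (fn (fst y) z)^2 * exp (b * (fn (fst y) z)^2))))"
   using exp2_int[OF x, of b] exp2_int[OF y(1), of b] by simp
  have ks: "sqint k" unfolding sqint_def
  proof (intro conjI km Bochner_Integration.integrable_bound[OF ki])
   show "AE z in lborel. norm ((k z)^2) \<le> norm (Cf^2 * (4 * ((fn (fst x) z)^2 * exp (b * (fn (fst x) z)^2) + (fn (fst y) z)^2 * exp (b * (fn (fst y) z)^2))))"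
    by (intro AE_I2) (use kb in \<open>simp add: order_trans[OF _ abs_ge_self]\<close>)
  qed measurable
  have nk: "norm (abs_l2 k) \<le> Cf * sqrt (8 * M)"
  proof (rule power2_le_imp_le)
   have "(norm (abs_l2 k))^2 \<le> (LBINT z. Cf^2 * (4 * ((fn (fst x) z)^2 * exp (b * (fn (fst x) z)^2) + (fn (fst y) z)^2 * exp (b * (fn (fst y) z)^2))))"
    unfolding norm_abs_sq[OF ks] by (intro integral_mono ki sqint_int[OF ks] kb)
   also have "\<dots> = Cf^2 * (4 * ((LBINT z. (fn (fst x) z)^2 * exp (b * (fn (fst x) z)^2)) + (LBINT z. (fn (fst y) z)^2 * exp (b * (fn (fst y) z)^2))))"
    using exp2_int[OF x, of b] exp2_int[OF y(1), of b] by simp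
   also have "\<dots> \<le> Cf^2 * (4 * (M + M))" using M(2) M(3)[OF x] M(3)[OF y] by (intro mult_left_mono add_mono) auto
   also have "\<dots> = (Cf * sqrt (8 * M))^2" using M(1) by (simp add: power_mult_distrib)
   finally show "(norm (abs_l2 k))^2 \<le> (Cf * sqrt (8 * M))^2" .
  qed (use Cf(1) M(1) in simp)
  let ?d = "\<lambda>z. \<bar>fn (fst y) z - fn (fst x) z\<bar>"
  have ds: "sqint ?d" by (rule sqint_bound[OF sqint_diff[OF fn_sqint fn_sqint, of "fst y" "fst x"]]) auto
  have nd: "norm (abs_l2 ?d) \<le> norm (y - x)"
  proof -
   have "(norm (abs_l2 ?d))^2 = (norm (fst y - fst x))^2"
    unfolding norm_abs_sq[OF ds] norm_l2_sq[of "fst y - fst x"] by (rule integral_cong_AE) (use fn_diff[of "fst y" "fst x"] in auto)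
   then have "norm (abs_l2 ?d) = norm (fst (y - x))" by simp
   then show ?thesis using norm_fst_le2(1)[of "y - x"] by linarith
  qed
  have "\<bar>IF (fst y) - IF (fst x)\<bar> = \<bar>(LBINT z. F (fn (fst y) z) - F (fn (fst x) z))\<bar>"
   unfolding IF_def using IF_int[OF x] IF_int[OF y(1)] by simp
  also have "\<dots> \<le> (LBINT z. \<bar>F (fn (fst y) z) - F (fn (fst x) z)\<bar>)" by (rule integral_abs_bound)
  also have "\<dots> \<le> (LBINT z. ?d z * k z)"
   using IF_int[OF x] IF_int[OF y(1)] by (intro integral_mono sqint_mult ds ks) (auto simp: k_def F_diff_bound)
  also have "\<dots> = inner (abs_l2 ?d) (abs_l2 k)" by (rule inner_abs[OF ds ks, symmetric])
  also have "\<dots> \<le> norm (y - x) * (Cf * sqrt (8 * M))"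
   by (rule order_trans[OF norm_cauchy_schwarz mult_mono[OF nd nk]]) auto
  finally show ?thesis .
 qed
 have nd: "(\<lambda>n. norm (X n - x)) \<longlonglongrightarrow> 0" using X(2) by (simp add: LIM_zero tendsto_norm_zero)
 have "(\<lambda>n. IF (fst (X n)) - IF (fst x)) \<longlonglongrightarrow> 0"
 proof (rule Lim_null_comparison)
  have "\<forall>\<^sub>F n in sequentially. norm (X n - x) < d" using nd M(2) by (rule order_tendstoD)
  then show "\<forall>\<^sub>F n in sequentially. norm (IF (fst (X n)) - IF (fst x)) \<le> norm (X n - x) * (Cf * sqrt (8 * M))"
   by eventually_elim (use est X(1) in auto)
  show "(\<lambda>n. norm (X n - x) * (Cf * sqrt (8 * M))) \<longlonglongrightarrow> 0" using tendsto_mult_right[OF nd, of "Cf * sqrt (8 * M)"] by simp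
 qed
 then show ?thesis by (simp add: LIM_zero_iff)
qed

lemma EV_tendsto:
 assumes "pot V c" "x \<in> wlap" "\<And>n. X n \<in> wlap" "X \<longlonglongrightarrow> x"
 shows "(\<lambda>n. EV V (X n)) \<longlonglongrightarrow> EV V x"
 unfolding EV_def by (intro tendsto_intros BV_tendsto[OF assms(1)] IF_tendsto assms) simp

text \<open>Integrating the ray inequality, the quadratic terms cancel exactly because of the Nehari
  identity. Strictness holds where the function is nonzero and yields a unique maximum on each
  ray.\<close>

lemma nehari_max:
 assumes V: "pot V c" and x: "x \<in> wlap" and J: "BV V x x = Nf (fst x) (fst x)" and t: "0 \<le> t"
 shows "EV V (t *\<^sub>R x) \<le> EV V x" "x \<noteq> 0 \<Longrightarrow> t \<noteq> 1 \<Longrightarrow> EV V (t *\<^sub>R x) < EV V x"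
proof -
 let ?h = "\<lambda>z. F (t * fn (fst x) z) - F (fn (fst x) z) - (t^2 - 1) / 2 * (f (fn (fst x) z) * fn (fst x) z)"
 have hi: "integrable lborel ?h"
  by (intro Bochner_Integration.integrable_diff integrable_mult_right F_scale_int IF_int Nf_int x)
 have "(LBINT z. ?h z) = IF (fst (t *\<^sub>R x)) - IF (fst x) - (t^2 - 1) / 2 * Nf (fst x) (fst x)"
  unfolding IF_scale unfolding IF_def Nf_def using F_scale_int[OF x, of t] IF_int[OF x] Nf_int[OF x x] by simp
 then have e: "EV V x - EV V (t *\<^sub>R x) = (LBINT z. ?h z)"
  unfolding EV_def BV_scale2[OF V] J by (simp add: field_simps)
 have nn: "0 \<le> ?h z" for z using F_ray[OF t, of "fn (fst x) z"] by simp
 then have "0 \<le> (LBINT z. ?h z)" by simp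
 then show "EV V (t *\<^sub>R x) \<le> EV V x" using e by linarith
 assume "x \<noteq> 0" "t \<noteq> 1"
 then have "0 < (LBINT z. ?h z)"
  using F_ray_strict[OF t] by (intro AE_pos_integral[OF hi nn _ wlap_fst_nonzero[OF x]]) auto
 then show "EV V (t *\<^sub>R x) < EV V x" using e by linarith
qed

text \<open>A directional derivative with a moving scale \<open>t n\<close>, as needed when
  comparing maxima on neighbouring rays. One-sided steps suffice, since the direction can be
  reversed.\<close>

lemma gateaux:
 assumes V: "pot V c" and x: "x \<in> wlap" and z: "z \<in> wlap"
  and t: "\<And>n. 0 \<le> t n" "t \<longlonglongrightarrow> \<tau>" and s: "\<And>n. 0 < s n" "\<And>n. s n \<le> 1" "s \<longlonglongrightarrow> 0"
 shows "(\<lambda>n. (EV V (t n *\<^sub>R (x + s n *\<^sub>R z)) - EV V (t n *\<^sub>R x)) / s n)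
  \<longlonglongrightarrow> \<tau> * (BV V (\<tau> *\<^sub>R x) z - Nf (fst (\<tau> *\<^sub>R x)) (fst z))"
proof -
 let ?u = "fn (fst x)" and ?v = "fn (fst z)"
 obtain T where T: "\<And>n. \<bar>t n\<bar> \<le> T"
  using convergent_imp_Bseq[of t] t(2) unfolding convergent_def Bseq_def by auto
 have T0: "T \<ge> 0" using T[of 0] by linarith
 \<comment> \<open>All arguments occurring are at most 2 T (|u| + |v|) in absolute value;
   \<open>exp_square_sum\<close> with k = 2 T turns this into the exponent \<open>b\<close>.\<close>
 define b where "b = \<alpha>1 * (2 * (2 * T))^2"
 have ev: "integrable lborel (\<lambda>w. (?u w)^2 * exp (b * (?u w)^2) + (?v w)^2 * exp (b * (?v w)^2))"
  using exp2_int[OF x, of b] exp2_int[OF z, of b] by simp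
 have xz: "x + s n *\<^sub>R z \<in> wlap" for n by (intro wlap_plus wlap_scaleR x z)
 have IFs: "IF (fst (t n *\<^sub>R (x + s n *\<^sub>R z))) = (LBINT w. F (t n * (?u w + s n * ?v w)))" for n
 proof -
  have "AE w in lborel. fn (fst (x + s n *\<^sub>R z)) w = ?u w + s n * ?v w"
   using fn_add[of "fst x" "s n *\<^sub>R fst z"] fn_scale[of "s n" "fst z"] by (auto elim!: AE_mp)
  then show ?thesis unfolding IF_scale by (intro integral_cong_AE) auto
 qed
 have Fi: "integrable lborel (\<lambda>w. F (t n * (?u w + s n * ?v w)))" for n
 proof -
  have ae: "AE w in lborel. F (t n * fn (fst (x + s n *\<^sub>R z)) w) = F (t n * (?u w + s n * ?v w))"
   using fn_add[of "fst x" "s n *\<^sub>R fst z"] fn_scale[of "s n" "fst z"] by (auto elim!: AE_mp)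
  show ?thesis by (rule Bochner_Integration.integrable_cong_AE_imp[OF F_scale_int[OF xz]]) (use ae in \<open>auto elim: AE_mp\<close>)
 qed
 have lim: "(\<lambda>n. (LBINT w. (F (t n * (?u w + s n * ?v w)) - F (t n * ?u w)) / s n)) \<longlonglongrightarrow> (LBINT w. f (\<tau> * ?u w) * (\<tau> * ?v w))"
 proof (rule integral_dominated_convergence[where w = "\<lambda>w. Cf * ((2 * (2 * T))^2 * ((?u w)^2 * exp (b * (?u w)^2) + (?v w)^2 * exp (b * (?v w)^2)))"])
  show "integrable lborel (\<lambda>w. Cf * ((2 * (2 * T))^2 * ((?u w)^2 * exp (b * (?u w)^2) + (?v w)^2 * exp (b * (?v w)^2))))"
   using ev by (intro integrable_mult_right)
  show "AE w in lborel. norm ((F (t n * (?u w + s n * ?v w)) - F (t n * ?u w)) / s n) \<le> Cf * ((2 * (2 * T))^2 * ((?u w)^2 * exp (b * (?u w)^2) + (?v w)^2 * exp (b * (?v w)^2)))" for n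
  proof (intro AE_I2)
   fix w
   define m where "m = 2 * T * (\<bar>?u w\<bar> + \<bar>?v w\<bar>)"
   have m0: "m \<ge> 0" using T0 by (simp add: m_def)
   have tv: "\<bar>t n * ?v w\<bar> \<le> m"
   proof -
    have "\<bar>t n * ?v w\<bar> \<le> T * \<bar>?v w\<bar>" unfolding abs_mult by (intro mult_right_mono T) auto
    also have "\<dots> \<le> m" unfolding m_def using T0 by (simp add: distrib_left mult_right_mono)
    finally show ?thesis .
   qed
   have ab: "\<bar>t n * ?u w\<bar> + \<bar>t n * (?u w + s n * ?v w)\<bar> \<le> m"
   proof -
    have "\<bar>?u w + s n * ?v w\<bar> \<le> \<bar>?u w\<bar> + \<bar>?v w\<bar>"
     using mult_right_mono[OF s(2)[of n], of "\<bar>?v w\<bar>"] s(1)[of n] abs_triangle_ineq[of "?u w" "s n * ?v w"] by (simp add: abs_mult)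
    moreover have "a + a' \<le> 2 * (a + c)" if "a' \<le> a + c" "0 \<le> c" for a a' c :: real using that by simp
    ultimately have "\<bar>?u w\<bar> + \<bar>?u w + s n * ?v w\<bar> \<le> 2 * (\<bar>?u w\<bar> + \<bar>?v w\<bar>)" by simp
    then have "\<bar>t n\<bar> * (\<bar>?u w\<bar> + \<bar>?u w + s n * ?v w\<bar>) \<le> T * (2 * (\<bar>?u w\<bar> + \<bar>?v w\<bar>))"
     using T T0 by (intro mult_mono) auto
    also have "\<dots> = 2 * T * (\<bar>?u w\<bar> + \<bar>?v w\<bar>)" by simp
    finally show ?thesis unfolding m_def abs_mult distrib_left[of "\<bar>t n\<bar>", symmetric] .
   qed
   have "\<bar>F (t n * (?u w + s n * ?v w)) - F (t n * ?u w)\<bar> \<le> \<bar>t n * (?u w + s n * ?v w) - t n * ?u w\<bar> * (Cf * (\<bar>t n * ?u w\<bar> + \<bar>t n * (?u w + s n * ?v w)\<bar>) * exp (\<alpha>1 * (\<bar>t n * ?u w\<bar> + \<bar>t n * (?u w + s n * ?v w)\<bar>)^2))"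
    by (rule F_diff_bound)
   also have "\<dots> \<le> (s n * m) * (Cf * m * exp (\<alpha>1 * m^2))"
   proof (intro mult_mono)
    have "t n * (?u w + s n * ?v w) - t n * ?u w = s n * (t n * ?v w)" by (simp add: algebra_simps)
    then show "\<bar>t n * (?u w + s n * ?v w) - t n * ?u w\<bar> \<le> s n * m" using tv s(1)[of n] by (simp add: abs_mult)
    show "exp (\<alpha>1 * (\<bar>t n * ?u w\<bar> + \<bar>t n * (?u w + s n * ?v w)\<bar>)^2) \<le> exp (\<alpha>1 * m^2)"
     using ab a1 by (auto intro!: mult_left_mono power_mono)
   qed (use ab m0 Cf(1) s(1)[of n] in auto)
   also have "\<dots> = s n * (Cf * (m^2 * exp (\<alpha>1 * m^2)))" by (simp add: power2_eq_square)
   also have "\<dots> \<le> s n * (Cf * ((2 * (2 * T))^2 * ((?u w)^2 * exp (b * (?u w)^2) + (?v w)^2 * exp (b * (?v w)^2))))"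
    unfolding m_def b_def using exp_square_sum[OF a1, of "2 * T" "?u w" "?v w"] Cf(1) s(1)[of n] by (intro mult_left_mono) auto
   finally show "norm ((F (t n * (?u w + s n * ?v w)) - F (t n * ?u w)) / s n) \<le> Cf * ((2 * (2 * T))^2 * ((?u w)^2 * exp (b * (?u w)^2) + (?v w)^2 * exp (b * (?v w)^2)))"
    using s(1)[of n] by (simp add: abs_divide pos_divide_le_eq mult.commute)
  qed
  show "AE w in lborel. (\<lambda>n. (F (t n * (?u w + s n * ?v w)) - F (t n * ?u w)) / s n) \<longlonglongrightarrow> f (\<tau> * ?u w) * (\<tau> * ?v w)"
  proof (intro AE_I2)
   fix w
   \<comment> \<open>A mean value point between the two arguments; the case \<open>h = 0\<close> and
     both signs of \<open>h\<close> are covered, so no sign of u or v is assumed.\<close>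
   have "\<exists>\<xi>. \<bar>\<xi> - t n * ?u w\<bar> \<le> s n * \<bar>t n * ?v w\<bar> \<and> F (t n * (?u w + s n * ?v w)) - F (t n * ?u w) = s n * (t n * ?v w) * f \<xi>" for n
   proof -
    define h where "h = s n * (t n * ?v w)"
    have e: "t n * (?u w + s n * ?v w) = t n * ?u w + h" by (simp add: h_def algebra_simps)
    have ah: "\<bar>h\<bar> = s n * \<bar>t n * ?v w\<bar>" using s(1)[of n] by (simp add: h_def abs_mult)
    consider "h = 0" | "h > 0" | "h < 0" by linarith
    then show ?thesis
    proof cases
     case 1 then show ?thesis unfolding e by (intro exI[of _ "t n * ?u w"]) (use ah h_def in auto)
    next
     case 2
     then obtain y where "t n * ?u w < y" "y < t n * ?u w + h" "F (t n * ?u w + h) - F (t n * ?u w) = (t n * ?u w + h - t n * ?u w) * f y"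
      using MVT2[of "t n * ?u w" "t n * ?u w + h" F f] F_deriv by auto
     then show ?thesis unfolding e ah[symmetric] h_def[symmetric] by (intro exI[of _ y]) auto
    next
     case 3
     then obtain y where "t n * ?u w + h < y" "y < t n * ?u w" "F (t n * ?u w) - F (t n * ?u w + h) = (t n * ?u w - (t n * ?u w + h)) * f y"
      using MVT2[of "t n * ?u w + h" "t n * ?u w" F f] F_deriv by auto
     then show ?thesis unfolding e ah[symmetric] h_def[symmetric] by (intro exI[of _ y]) auto
    qed
   qed
   then obtain \<xi> where \<xi>: "\<And>n. \<bar>\<xi> n - t n * ?u w\<bar> \<le> s n * \<bar>t n * ?v w\<bar>" "\<And>n. F (t n * (?u w + s n * ?v w)) - F (t n * ?u w) = s n * (t n * ?v w) * f (\<xi> n)"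
    by metis
   have "(\<lambda>n. s n * \<bar>t n * ?v w\<bar>) \<longlonglongrightarrow> 0 * \<bar>\<tau> * ?v w\<bar>" by (intro tendsto_intros s t)
   then have "(\<lambda>n. \<xi> n - t n * ?u w) \<longlonglongrightarrow> 0"
    by (intro Lim_null_comparison[of "\<lambda>n. \<xi> n - t n * ?u w" "\<lambda>n. s n * \<bar>t n * ?v w\<bar>"]) (use \<xi>(1) in auto)
   then have "(\<lambda>n. (\<xi> n - t n * ?u w) + t n * ?u w) \<longlonglongrightarrow> 0 + \<tau> * ?u w" by (intro tendsto_intros t)
   then have "\<xi> \<longlonglongrightarrow> \<tau> * ?u w" by simp
   moreover have "isCont f (\<tau> * ?u w)" using f_cont by (simp add: continuous_on_eq_continuous_at)
   ultimately have "(\<lambda>n. f (\<xi> n)) \<longlonglongrightarrow> f (\<tau> * ?u w)" by (rule isCont_tendsto_compose[rotated])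
   then have "(\<lambda>n. f (\<xi> n) * (t n * ?v w)) \<longlonglongrightarrow> f (\<tau> * ?u w) * (\<tau> * ?v w)" by (intro tendsto_intros t)
   moreover have "(F (t n * (?u w + s n * ?v w)) - F (t n * ?u w)) / s n = f (\<xi> n) * (t n * ?v w)" for n
    unfolding \<xi>(2) using s(1)[of n] by (simp add: field_simps)
   ultimately show "(\<lambda>n. (F (t n * (?u w + s n * ?v w)) - F (t n * ?u w)) / s n) \<longlonglongrightarrow> f (\<tau> * ?u w) * (\<tau> * ?v w)" by simp
  qed
 qed measurable
 have Q: "(BV V (t n *\<^sub>R (x + s n *\<^sub>R z)) (t n *\<^sub>R (x + s n *\<^sub>R z)) / 2 - BV V (t n *\<^sub>R x) (t n *\<^sub>R x) / 2) / s n
   = (t n)^2 * (BV V x z + s n * BV V z z / 2)" for n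
 proof -
  have "BV V (x + s n *\<^sub>R z) (x + s n *\<^sub>R z) = BV V x x + 2 * s n * BV V x z + (s n)^2 * BV V z z"
   using BV_add[OF V, of "x + s n *\<^sub>R z" x "s n *\<^sub>R z"] BV_add[OF V, of x x "s n *\<^sub>R z"] BV_add[OF V, of z x "s n *\<^sub>R z"]
    BV_scale[OF V, of "x + s n *\<^sub>R z" "s n" z] BV_scale[OF V, of x "s n" z] BV_scale[OF V, of z "s n" z]
    BV_sym[of V "x + s n *\<^sub>R z" x] BV_sym[of V "x + s n *\<^sub>R z" z] BV_sym[of V z x]
   by (simp add: algebra_simps power2_eq_square)
  then show ?thesis unfolding BV_scale2[OF V] using s(1)[of n] by (simp add: field_simps power2_eq_square)
 qed
 have eq: "(EV V (t n *\<^sub>R (x + s n *\<^sub>R z)) - EV V (t n *\<^sub>R x)) / s n = (t n)^2 * (BV V x z + s n * BV V z z / 2) - (LBINT w. (F (t n * (?u w + s n * ?v w)) - F (t n * ?u w)) / s n)" for n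
 proof -
  have "(LBINT w. (F (t n * (?u w + s n * ?v w)) - F (t n * ?u w)) / s n) = (IF (fst (t n *\<^sub>R (x + s n *\<^sub>R z))) - IF (fst (t n *\<^sub>R x))) / s n"
   unfolding IFs unfolding IF_scale[of "t n" x] using Fi[of n] F_scale_int[OF x, of "t n"] by simp
  moreover have "(EV V (t n *\<^sub>R (x + s n *\<^sub>R z)) - EV V (t n *\<^sub>R x)) / s n = (BV V (t n *\<^sub>R (x + s n *\<^sub>R z)) (t n *\<^sub>R (x + s n *\<^sub>R z)) / 2 - BV V (t n *\<^sub>R x) (t n *\<^sub>R x) / 2) / s n - (IF (fst (t n *\<^sub>R (x + s n *\<^sub>R z))) - IF (fst (t n *\<^sub>R x))) / s n"
   unfolding EV_def by (simp add: diff_divide_distrib)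
  ultimately show ?thesis unfolding Q by (simp only:)
 qed
 have "(\<lambda>n. (t n)^2 * (BV V x z + s n * BV V z z / 2) - (LBINT w. (F (t n * (?u w + s n * ?v w)) - F (t n * ?u w)) / s n))
   \<longlonglongrightarrow> \<tau>^2 * (BV V x z + 0 * BV V z z / 2) - (LBINT w. f (\<tau> * ?u w) * (\<tau> * ?v w))"
  by (intro tendsto_intros t s lim) simp
 moreover have "\<tau>^2 * (BV V x z + 0 * BV V z z / 2) - (LBINT w. f (\<tau> * ?u w) * (\<tau> * ?v w)) = \<tau> * (BV V (\<tau> *\<^sub>R x) z - Nf (fst (\<tau> *\<^sub>R x)) (fst z))"
 proof -
  have "Nf (fst (\<tau> *\<^sub>R x)) (fst z) = (LBINT w. f (\<tau> * ?u w) * ?v w)"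
   unfolding Nf_def by (rule integral_cong_AE) (use fn_scale_fst[of \<tau> x] in auto)
  moreover have "(LBINT w. f (\<tau> * ?u w) * (\<tau> * ?v w)) = \<tau> * (LBINT w. f (\<tau> * ?u w) * ?v w)"
   by (simp flip: integral_mult_right_zero) (simp add: mult_ac)
  moreover have "BV V (\<tau> *\<^sub>R x) z = \<tau> * BV V x z" using BV_scale[OF V, of z \<tau> x] BV_sym[of V z] by metis
  ultimately show ?thesis by (simp add: power2_eq_square algebra_simps)
 qed
 ultimately show ?thesis unfolding eq by simp
qed

end

section \<open>A Palais--Smale sequence on the Nehari set\<close>

text \<open>Small values are paid for by the L2 norm, middle values by the measure of a level set,
  large values by an Adams tail. It is applied to the ring of positive energy and twice to vanishing
  sequences.\<close>

lemma three_region: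
 fixes g h :: "real \<Rightarrow> real"
 assumes [measurable]: "h \<in> borel_measurable borel"
  and "\<eta> \<ge> 0" "C \<ge> 0" "\<And>t. 0 \<le> h t" and le: "\<And>t. g t \<le> \<eta> * t^2 + C * indicator {t. a < \<bar>t\<bar>} t + h t"
 shows "(NN x. ennreal (g (fn p x))) \<le>
  ennreal (\<eta> * (norm p)^2) + ennreal C * emeasure lborel {x. a < \<bar>fn p x\<bar>} + (NN x. ennreal (h (fn p x)))"
proof -
 have "(NN x. ennreal (g (fn p x))) \<le>
   (NN x. ennreal (\<eta> * (fn p x)^2) + ennreal C * indicator {x. a < \<bar>fn p x\<bar>} x + ennreal (h (fn p x)))"
 proof (intro nn_integral_mono)
  fix x
  have "ennreal (g (fn p x)) \<le> ennreal (\<eta> * (fn p x)^2 + C * indicator {t. a < \<bar>t\<bar>} (fn p x) + h (fn p x))" by (rule ennreal_leI[OF le])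
  also have "\<dots> = ennreal (\<eta> * (fn p x)^2) + ennreal C * indicator {x. a < \<bar>fn p x\<bar>} x + ennreal (h (fn p x))"
   using assms(2-4) by (auto simp: indicator_def)
  finally show "ennreal (g (fn p x)) \<le> \<dots>" .
 qed
 also have "\<dots> = (NN x. ennreal (\<eta> * (fn p x)^2) + ennreal C * indicator {x. a < \<bar>fn p x\<bar>} x) + (NN x. ennreal (h (fn p x)))"
  by (rule nn_integral_add) measurable
 also have "(NN x. ennreal (\<eta> * (fn p x)^2) + ennreal C * indicator {x. a < \<bar>fn p x\<bar>} x) =
   (NN x. ennreal (\<eta> * (fn p x)^2)) + (NN x. ennreal C * indicator {x. a < \<bar>fn p x\<bar>} x)"
  by (rule nn_integral_add) measurable
 also have "(NN x. ennreal (\<eta> * (fn p x)^2)) = ennreal (\<eta> * (norm p)^2)"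
  by (subst nn_integral_cmult_ennreal) (use assms(2) in \<open>auto simp: nn_norm_sq ennreal_mult\<close>)
 also have "(NN x. ennreal C * indicator {x. a < \<bar>fn p x\<bar>} x) = ennreal C * emeasure lborel {x. a < \<bar>fn p x\<bar>}"
  by (rule nn_integral_cmult_indicator) measurable
 finally show ?thesis .
qed

context nonlinearity
begin

lemma Nf_scale_right: "Nf p (c *\<^sub>R q) = c * Nf p q"
proof -
 have "Nf p (c *\<^sub>R q) = (LBINT x. c * (f (fn p x) * fn q x))"
  unfolding Nf_def by (rule integral_cong_AE) (use fn_scale[of c q] in auto)
 then show ?thesis by (simp add: Nf_def)
qed

lemma nn_IF: "x \<in> wlap \<Longrightarrow> (NN z. ennreal (F (t * fn (fst x) z))) = ennreal (IF (fst (t *\<^sub>R x)))"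
 unfolding IF_scale by (rule nn_integral_eq_integral[OF F_scale_int]) (auto simp: F_nonneg)

lemma nn_Nf: "x \<in> wlap \<Longrightarrow> (NN z. ennreal (f (fn (fst x) z) * fn (fst x) z)) = ennreal (Nf (fst x) (fst x))"
 unfolding Nf_def by (rule nn_integral_eq_integral[OF Nf_int]) (auto simp: ft_nonneg)

lemma Nf_nonneg: "0 \<le> Nf p p" unfolding Nf_def using ft_nonneg by simp

lemma IF_le_Nf: "x \<in> wlap \<Longrightarrow> \<mu> * IF (fst x) \<le> Nf (fst x) (fst x)"
 unfolding IF_def Nf_def integral_mult_right_zero[symmetric]
 by (intro integral_mono AR' integrable_mult_right IF_int Nf_int)

end

text \<open>Coercivity \<open>coer\<close> and the inequality \<open>level\<close> are the forms in
  which (V1) and the condition on \<open>gamma_star\<close> are used; both are derived before the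
  interpretation.\<close>

locale schroedinger = nonlinearity +
 fixes V :: "R4 \<Rightarrow> real" and Vi \<kappa> \<delta> :: real
 assumes V: "pot V Vi" and Vi: "Vi > 0" and Vcont: "continuous_on UNIV V" and Vlim: "(V \<longlongrightarrow> Vi) at_infinity"
  and \<kappa>: "\<kappa> > 0" and coer: "\<And>x. x \<in> wlap \<Longrightarrow> \<kappa> * (norm x)^2 \<le> BV V x x"
  and \<delta>: "\<delta> > 0" and Vball: "\<And>x. x \<in> ball 0 \<delta> \<Longrightarrow> V x = 0"
  and level: "\<exists>x\<in>wlap. (norm (snd x))\<^sup>2 \<le> 32 * pi^2 / \<alpha>0 \<and> Vi * (norm (fst x))^2 < 2 * IF (fst x)"
begin

text \<open>On the unit sphere the Adams tail at exponent 2 is uniformly small, 2 being far below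
  \<open>32 pi^2\<close>. Scaling down by r pushes all large values of r y into that tail.\<close>

lemma mountain_ring: "\<exists>r>0. \<exists>c>0. \<forall>y\<in>wlap. norm y = 1 \<longrightarrow> c \<le> EV V (r *\<^sub>R y)"
proof -
 obtain C where C: "C \<ge> 0" "\<forall>p w D M. (p, w) \<in> wlap \<longrightarrow> norm p \<le> M \<longrightarrow> (norm w)^2 \<le> D \<longrightarrow> pot_dominated (C * M) D (fn p)"
  using wlap_pot_dominated by blast
 have p9: "9 < pi^2" using power_strict_mono[of 3 pi 2] pi_gt3 by simp
 have e: "\<kappa> / (4 * Cf) > 0" using \<kappa> Cf(1) by simp
 obtain K where K: "K > 0" "\<forall>u. pot_dominated (C * 1) 1 u \<longrightarrow>
   (NN x. ennreal (exp (2 * (u x)^2)) * indicator {x. K < \<bar>u x\<bar>} x) \<le> ennreal (\<kappa> / (4 * Cf))"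
  using adams_tail[of 1 2 "C * 1", OF _ _ _ _ e] C(1) p9 by auto
 obtain a where a: "a > 0" "\<And>t. \<bar>t\<bar> \<le> a \<Longrightarrow> \<bar>f t\<bar> \<le> \<kappa> / 2 * \<bar>t\<bar>" using f_small[of "\<kappa> / 2"] \<kappa> by auto
 \<comment> \<open>The first entry makes |r t| > a imply |t| > K; the second keeps
   \<open>\<alpha>1 * (r * t)^2\<close> below t^2, leaving room to absorb the factor t^2 as
   well.\<close>
 define r where "r = min (a / K) (1 / (\<alpha>1 + 1))"
 have r: "r > 0" "r * K \<le> a" "r \<le> 1" "r * \<alpha>1 \<le> 1"
 proof -
  show "r > 0" using a1 a K by (auto simp: r_def)
  have "r \<le> a / K" by (simp add: r_def)
  then show "r * K \<le> a" using K(1) by (simp add: pos_le_divide_eq)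
  have "r \<le> 1 / (\<alpha>1 + 1)" by (simp add: r_def)
  then have *: "r * (\<alpha>1 + 1) \<le> 1" using a1 by (simp add: pos_le_divide_eq)
  then have **: "r * \<alpha>1 + r \<le> 1" by (simp add: algebra_simps)
  have "0 \<le> r * \<alpha>1" using \<open>r > 0\<close> a1 by simp
  then show "r \<le> 1" "r * \<alpha>1 \<le> 1" using ** \<open>r > 0\<close> by linarith+
 qed
 define h where "h t = Cf / 2 * r^2 * (exp (2 * t^2) * indicator {t. K < \<bar>t\<bar>} t)" for t :: real
 have F_le2: "F (r * t) \<le> (\<kappa> / 4 * r^2) * t^2 + 0 * indicator {t. 0 < \<bar>t\<bar>} t + h t" for t
 proof (cases "\<bar>r * t\<bar> \<le> a")
  case True
  have "f (r * t) * (r * t) \<le> \<kappa> / 2 * \<bar>r * t\<bar> * \<bar>r * t\<bar>" unfolding ft_abs by (intro mult_right_mono a(2)[OF True]) auto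
  also have "\<dots> = \<kappa> / 2 * (r * t)^2" by (simp add: power2_eq_square mult.assoc)
  finally have "F (r * t) \<le> \<kappa> / 4 * (r * t)^2" using F_le[of "r * t"] by simp
  moreover have "0 \<le> h t" using Cf(1) by (simp add: h_def)
  ultimately show ?thesis by (simp add: power_mult_distrib)
 next
  case False
  have Kt: "K < \<bar>t\<bar>"
  proof (rule ccontr)
   assume "\<not> ?thesis"
   then have "r * \<bar>t\<bar> \<le> r * K" using r(1) by simp
   moreover have "\<bar>r * t\<bar> = r * \<bar>t\<bar>" using r(1) by (simp add: abs_mult)
   ultimately show False using False r(2) by linarith
  qed
  have "\<alpha>1 * (r * t)^2 = (r * \<alpha>1) * r * t^2" by (simp add: power2_eq_square)
  also have "\<dots> \<le> 1 * 1 * t^2" using r a1 by (intro mult_mono) auto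
  finally have "exp (\<alpha>1 * (r * t)^2) \<le> exp (t^2)" by simp
  moreover have "t^2 \<le> exp (t^2)" using exp_ge_add_one_self[of "t^2"] by linarith
  ultimately have "t^2 * exp (\<alpha>1 * (r * t)^2) \<le> exp (t^2) * exp (t^2)" by (intro mult_mono) auto
  then have "Cf * r^2 * (t^2 * exp (\<alpha>1 * (r * t)^2)) \<le> Cf * r^2 * exp (2 * t^2)"
   using Cf(1) by (intro mult_left_mono) (simp_all add: exp_add[symmetric])
  moreover have "f (r * t) * (r * t) \<le> Cf * r^2 * (t^2 * exp (\<alpha>1 * (r * t)^2))"
   using ft_le[of "r * t"] by (simp add: power_mult_distrib)
  ultimately have "F (r * t) \<le> h t" using F_le[of "r * t"] Kt by (simp add: h_def)
  then show ?thesis using \<kappa> by (simp add: add_increasing)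
 qed
 \<comment> \<open>Coercivity gives \<open>\<kappa> * r^2 / 2\<close>; small values of y cost a
   quarter and the tail an eighth of \<open>\<kappa> * r^2\<close>.\<close>
 have main: "\<kappa> * r^2 / 8 \<le> EV V (r *\<^sub>R y)" if y: "y \<in> wlap" "norm y = 1" for y
 proof -
  have ny: "norm (fst y) \<le> 1" "norm (snd y) \<le> 1" using norm_fst_le2[of y] y(2) by auto
  then have nw: "(norm (snd y))^2 \<le> 1" "(norm (fst y))^2 \<le> 1" by (simp_all add: power_le_one)
  have "(fst y, snd y) \<in> wlap" using y by simp
  then have pd: "pot_dominated (C * 1) 1 (fn (fst y))" using C(2) ny nw by blast
  have "(NN x. ennreal (h (fn (fst y) x))) = (NN x. ennreal (Cf / 2 * r^2) * (ennreal (exp (2 * (fn (fst y) x)^2)) * indicator {x. K < \<bar>fn (fst y) x\<bar>} x))"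
   unfolding h_def using Cf(1) by (intro nn_integral_cong) (auto simp: indicator_def ennreal_mult[symmetric])
  also have "\<dots> = ennreal (Cf / 2 * r^2) * (NN x. ennreal (exp (2 * (fn (fst y) x)^2)) * indicator {x. K < \<bar>fn (fst y) x\<bar>} x)"
   by (rule nn_integral_cmult) measurable
  also have "\<dots> \<le> ennreal (Cf / 2 * r^2) * ennreal (\<kappa> / (4 * Cf))" using K(2) pd by (intro mult_left_mono) auto
  also have "\<dots> = ennreal (\<kappa> * r^2 / 8)" using Cf(1) \<kappa> by (subst ennreal_mult[symmetric]) auto
  finally have hb: "(NN x. ennreal (h (fn (fst y) x))) \<le> ennreal (\<kappa> * r^2 / 8)" .
  have "ennreal (IF (fst (r *\<^sub>R y))) \<le> ennreal (\<kappa> / 4 * r^2 * (norm (fst y))^2) + ennreal 0 * emeasure lborel {x. 0 < \<bar>fn (fst y) x\<bar>} + (NN x. ennreal (h (fn (fst y) x)))"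
   unfolding nn_IF[OF y(1), symmetric]
  proof (rule three_region[where g = "\<lambda>t. F (r * t)"])
   show "h \<in> borel_measurable borel" unfolding h_def by measurable
  qed (use F_le2 \<kappa> Cf(1) in \<open>auto simp: h_def\<close>)
  also have "\<dots> \<le> ennreal (\<kappa> / 4 * r^2 * 1) + 0 + ennreal (\<kappa> * r^2 / 8)"
   using nw \<kappa> by (intro add_mono hb ennreal_leI mult_left_mono) auto
  also have "\<dots> = ennreal (\<kappa> / 4 * r^2 + \<kappa> * r^2 / 8)" using \<kappa> by (subst ennreal_plus) auto
  finally have "IF (fst (r *\<^sub>R y)) \<le> \<kappa> / 4 * r^2 + \<kappa> * r^2 / 8"
   by (rule ennreal_le_iff[THEN iffD1, rotated]) (use \<kappa> in simp)
  moreover have "\<kappa> * r^2 \<le> BV V (r *\<^sub>R y) (r *\<^sub>R y)" using coer[OF wlap_scaleR[OF y(1)], of r] y(2) r(1) by simp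
  ultimately show ?thesis unfolding EV_def by linarith
 qed
 show ?thesis using r(1) main \<kappa> by (intro exI[of _ r] conjI exI[of _ "\<kappa> * r^2 / 8"]) auto
qed

text \<open>Nonnegative energy at parameter t forces t to the power \<mu> - 2 to be bounded by the
  ratio of the quadratic form to the integral of F. Both converge along \<open>X\<close>, and the
  latter stays positive.\<close>

lemma fiber_bounded:
 assumes x: "x \<in> wlap" "x \<noteq> 0" and X: "\<And>k. X k \<in> wlap" "X \<longlonglongrightarrow> x" and t: "\<And>k. 0 \<le> t k" "\<And>k. 0 \<le> EV V (t k *\<^sub>R X k)"
 shows "Bseq t"
proof -
 define j where "j = IF (fst x) / 2"
 define b where "b = BV V x x + 1"
 have j: "j > 0" using IF_pos[OF x] by (simp add: j_def)
 define q where "q = b / (2 * j)"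
 have q0: "q > 0" using j BV_nonneg[OF V, of x] by (simp add: q_def b_def add_nonneg_pos)
 have "\<forall>\<^sub>F k in sequentially. IF (fst (X k)) > j"
  by (rule order_tendstoD[OF IF_tendsto[OF x(1) X]]) (use j in \<open>simp add: j_def\<close>)
 moreover have "\<forall>\<^sub>F k in sequentially. BV V (X k) (X k) < b"
  by (rule order_tendstoD[OF BV_tendsto[OF V X(2)]]) (simp add: b_def)
 ultimately have "\<forall>\<^sub>F k in sequentially. norm (t k) \<le> 1 + q powr (1 / (\<mu> - 2))"
 proof eventually_elim
  case (elim k)
  show ?case
  proof (cases "t k \<le> 1")
   case True then show ?thesis using t(1)[of k] by (simp add: add_increasing2)
  next
   case False
   let ?t = "t k"
   have "?t powr \<mu> * IF (fst (X k)) \<le> IF (fst (?t *\<^sub>R X k))"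
    unfolding IF_scale using False unfolding IF_def integral_mult_right_zero[symmetric]
    by (intro integral_mono F_powr integrable_mult_right IF_int F_scale_int X) auto
   moreover have "?t powr \<mu> * j \<le> ?t powr \<mu> * IF (fst (X k))" using elim by (intro mult_left_mono) auto
   moreover have "IF (fst (?t *\<^sub>R X k)) \<le> ?t^2 * BV V (X k) (X k) / 2" using t(2)[of k] unfolding EV_def BV_scale2[OF V] by linarith
   moreover have "?t^2 * BV V (X k) (X k) \<le> ?t^2 * b" using elim by (intro mult_left_mono) auto
   ultimately have "?t powr \<mu> * j \<le> ?t^2 * b / 2" by linarith
   moreover have "?t powr \<mu> = ?t^2 * ?t powr (\<mu> - 2)" using powr_add[of ?t 2 "\<mu> - 2"] False by simp
   ultimately have "?t^2 * (?t powr (\<mu> - 2) * j) \<le> ?t^2 * (b / 2)" by simp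
   then have "?t powr (\<mu> - 2) * j \<le> b / 2" using False by (simp add: mult_le_cancel_left)
   then have "?t powr (\<mu> - 2) \<le> q" using j by (simp add: q_def field_simps)
   then have "(?t powr (\<mu> - 2)) powr (1 / (\<mu> - 2)) \<le> q powr (1 / (\<mu> - 2))" using mu by (intro powr_mono2) auto
   moreover have "(?t powr (\<mu> - 2)) powr (1 / (\<mu> - 2)) = ?t" using mu False by (simp add: powr_powr)
   ultimately show ?thesis using False by simp
  qed
 qed
 then show ?thesis by (rule BfunI)
qed

text \<open>The derivative along the ray itself, taken in the directions x and -x, must be
  nonpositive in both cases.\<close>

lemma maximizer_nehari:
 assumes x: "x \<in> wlap" and t: "t > 0" and max: "\<And>s. 0 \<le> s \<Longrightarrow> EV V (s *\<^sub>R x) \<le> EV V (t *\<^sub>R x)"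
 shows "BV V (t *\<^sub>R x) (t *\<^sub>R x) = Nf (fst (t *\<^sub>R x)) (fst (t *\<^sub>R x))"
proof -
 define s where "s n = inverse (real (Suc n))" for n
 have s: "0 < s n" "s n \<le> 1" for n by (simp_all add: s_def inverse_le_1_iff)
 have s0: "s \<longlonglongrightarrow> 0" using LIMSEQ_inverse_real_of_nat by (simp add: s_def[abs_def])
 have *: "t * (c * (BV V (t *\<^sub>R x) x - Nf (fst (t *\<^sub>R x)) (fst x))) \<le> 0" if c: "\<bar>c\<bar> \<le> 1" for c
 proof -
  have "t * (BV V (t *\<^sub>R x) (c *\<^sub>R x) - Nf (fst (t *\<^sub>R x)) (fst (c *\<^sub>R x))) \<le> 0"
  proof (rule tendsto_upperbound[OF gateaux[OF V x wlap_scaleR[OF x, of c], of "\<lambda>_. t" t s]])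
   show "\<forall>\<^sub>F n in sequentially. (EV V (t *\<^sub>R (x + s n *\<^sub>R c *\<^sub>R x)) - EV V (t *\<^sub>R x)) / s n \<le> 0"
   proof (intro always_eventually allI divide_nonpos_pos s)
    fix n
    have "\<bar>s n * c\<bar> \<le> 1 * 1" unfolding abs_mult using s[of n] c by (intro mult_mono) auto
    then have "0 \<le> t * (1 + s n * c)" using t by (intro mult_nonneg_nonneg) auto
    moreover have "t *\<^sub>R (x + s n *\<^sub>R c *\<^sub>R x) = (t * (1 + s n * c)) *\<^sub>R x" by (simp add: algebra_simps)
    ultimately show "EV V (t *\<^sub>R (x + s n *\<^sub>R c *\<^sub>R x)) - EV V (t *\<^sub>R x) \<le> 0" using max by simp
   qed
  qed (use t s s0 in auto)
  then show ?thesis unfolding BV_scale[OF V] fst_scaleR[of c] Nf_scale_right by (simp add: right_diff_distrib)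
 qed
 have "BV V (t *\<^sub>R x) x - Nf (fst (t *\<^sub>R x)) (fst x) = 0"
  using *[of 1] *[of "-1"] t by (simp add: mult_le_0_iff zero_le_mult_iff)
 then show ?thesis unfolding BV_scale[OF V] fst_scaleR Nf_scale_right by simp
qed

text \<open>Maxima over rays turn the mountain-pass level into a plain infimum over the unit sphere,
  to which Ekeland's principle applies directly.\<close>

definition \<Psi> where "\<Psi> x = (SUP t\<in>{0..}. EV V (t *\<^sub>R x))"
definition m where "m = (INF x\<in>{x\<in>wlap. norm x = 1}. \<Psi> x)"

text \<open>The ring provides a positive value and \<open>fiber_bounded\<close> confines nonnegative
  values to a compact interval, so continuity gives a maximum at some t > 0.\<close>

lemma maximizer:
 assumes x: "x \<in> wlap" "x \<noteq> 0"
 shows "\<exists>t>0. \<Psi> x = EV V (t *\<^sub>R x) \<and> 0 < \<Psi> x \<and> (\<forall>s\<ge>0. EV V (s *\<^sub>R x) \<le> \<Psi> x) \<and>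
  BV V (t *\<^sub>R x) (t *\<^sub>R x) = Nf (fst (t *\<^sub>R x)) (fst (t *\<^sub>R x))"
proof -
 obtain r c where r: "r > 0" "c > 0" "\<And>y. y \<in> wlap \<Longrightarrow> norm y = 1 \<Longrightarrow> c \<le> EV V (r *\<^sub>R y)" using mountain_ring by blast
 define r' where "r' = r / norm x"
 have r': "r' > 0" "0 < EV V (r' *\<^sub>R x)"
  using r(1,2) r(3)[OF wlap_scaleR[OF x(1)], of "1 / norm x"] x(2) by (auto simp: r'_def)
 have "\<exists>T. \<forall>t\<ge>0. 0 \<le> EV V (t *\<^sub>R x) \<longrightarrow> t \<le> T"
 proof (rule ccontr)
  assume "\<not> ?thesis"
  then have "\<forall>k. \<exists>t. 0 \<le> t \<and> 0 \<le> EV V (t *\<^sub>R x) \<and> real k < t" by (auto simp: not_le)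
  then obtain t where t: "\<And>k. 0 \<le> t k" "\<And>k. 0 \<le> EV V (t k *\<^sub>R x)" "\<And>k. real k < t k" by metis
  have "Bseq t" by (rule fiber_bounded[OF x, of "\<lambda>_. x"]) (use x t in auto)
  then obtain K where "\<And>k. \<bar>t k\<bar> \<le> K" unfolding Bseq_def by auto
  moreover obtain k where "K < real k" using reals_Archimedean2 by blast
  ultimately show False using t(3)[of k] by (smt (verit))
 qed
 then obtain T where T: "\<And>t. 0 \<le> t \<Longrightarrow> 0 \<le> EV V (t *\<^sub>R x) \<Longrightarrow> t \<le> T" by blast
 have r'T: "r' \<in> {0..T}" using T[of r'] r' by auto
 have "continuous_on {0..T} (\<lambda>t. EV V (t *\<^sub>R x))"
  unfolding continuous_on_sequentially o_def
  by (intro allI impI ballI EV_tendsto[OF V] wlap_scaleR x tendsto_intros) auto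
 then obtain t where t: "t \<in> {0..T}" "\<And>s. s \<in> {0..T} \<Longrightarrow> EV V (s *\<^sub>R x) \<le> EV V (t *\<^sub>R x)"
  using continuous_attains_sup[of "{0..T}" "\<lambda>t. EV V (t *\<^sub>R x)"] r'T by blast
 have pos: "0 < EV V (t *\<^sub>R x)" using t(2)[OF r'T] r' by simp
 have le: "EV V (s *\<^sub>R x) \<le> EV V (t *\<^sub>R x)" if "s \<ge> 0" for s
  using T[of s] t(2)[of s] that pos by (cases "0 \<le> EV V (s *\<^sub>R x)") auto
 have "EV V (0 *\<^sub>R x) \<le> 0" using IF_nonneg BV_scale2[OF V, of 0 x] unfolding EV_def by simp
 then have "t > 0" using pos t(1) by (cases "t = 0") auto
 moreover have "\<Psi> x = EV V (t *\<^sub>R x)" unfolding \<Psi>_def by (rule cSup_eq_maximum) (use t(1) le in auto)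
 ultimately show ?thesis using pos le maximizer_nehari[OF x(1) \<open>t > 0\<close> le] by auto
qed

lemma Psi_upper: "x \<in> wlap \<Longrightarrow> x \<noteq> 0 \<Longrightarrow> 0 \<le> s \<Longrightarrow> EV V (s *\<^sub>R x) \<le> \<Psi> x"
 using maximizer by blast

lemma m_pos_le: "\<exists>c>0. \<forall>x\<in>wlap. norm x = 1 \<longrightarrow> c \<le> \<Psi> x"
proof -
 obtain r c where r: "r > 0" "c > 0" "\<And>y. y \<in> wlap \<Longrightarrow> norm y = 1 \<Longrightarrow> c \<le> EV V (r *\<^sub>R y)" using mountain_ring by blast
 show ?thesis by (intro exI[of _ c] conjI ballI impI r(2) order_trans[OF r(3) Psi_upper]) (use r(1) in auto)
qed

lemma sphere_nonempty: "{x\<in>wlap. norm x = 1} \<noteq> {}"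
proof -
 obtain x where x: "x \<in> wlap" "Vi * (norm (fst x))^2 < 2 * IF (fst x)" using level by blast
 have "x \<noteq> 0"
 proof
  assume x0: "x = 0"
  have "IF (fst x) = (\<integral>z. (0::real) \<partial>(lborel :: R4 measure))" unfolding IF_def x0 by (rule integral_cong_AE) (use fn_0 F0 in auto)
  then show False using x x0 by simp
 qed
 then have "(1 / norm x) *\<^sub>R x \<in> {x\<in>wlap. norm x = 1}" using wlap_scaleR[OF x(1), of "1 / norm x"] by simp
 then show ?thesis by blast
qed

lemma m_pos: "0 < m"
proof -
 obtain c where "c > 0" "\<forall>x\<in>wlap. norm x = 1 \<longrightarrow> c \<le> \<Psi> x" using m_pos_le by blast
 moreover from this have "c \<le> m" unfolding m_def using sphere_nonempty by (intro cINF_greatest) auto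
 ultimately show ?thesis by simp
qed

lemma bdd_Psi: "bdd_below (\<Psi> ` {x\<in>wlap. norm x = 1})"
 using m_pos_le by (metis (mono_tags, lifting) bdd_belowI2 mem_Collect_eq)

text \<open>The unit sphere meets every ray, and \<open>\<Psi>\<close> depends only on the
  ray.\<close>

lemma m_le_Psi: assumes x: "x \<in> wlap" "x \<noteq> 0" shows "m \<le> \<Psi> x"
proof -
 let ?y = "(1 / norm x) *\<^sub>R x"
 have y: "?y \<in> wlap" "norm ?y = 1" "?y \<noteq> 0" using x by (auto intro: wlap_scaleR)
 obtain t where t: "t > 0" "\<Psi> ?y = EV V (t *\<^sub>R ?y)" using maximizer[OF y(1,3)] by blast
 have "m \<le> \<Psi> ?y" unfolding m_def by (rule cINF_lower[OF bdd_Psi]) (use y in auto)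
 also have "\<dots> \<le> \<Psi> x" unfolding t(2) scaleR_scaleR by (rule Psi_upper[OF x]) (use t in simp)
 finally show ?thesis .
qed

lemma nehari_Psi: assumes "x \<in> wlap" "x \<noteq> 0" "BV V x x = Nf (fst x) (fst x)" shows "\<Psi> x = EV V x"
 unfolding \<Psi>_def by (rule cSup_eq_maximum) (use nehari_max(1)[OF V assms(1,3)] in \<open>auto intro: image_eqI[of _ _ 1]\<close>)

text \<open>Compare w with the normalized perturbations \<open>v n\<close> of w in direction z. The
  energy at the maximizing scale of the perturbed ray loses at most 2 e per unit step, while at the
  same scale w has energy at most \<open>\<Psi> w\<close>; dividing by the step yields the
  bound.\<close>

lemma ekeland_slope:
 assumes w: "w \<in> wlap" "norm w = 1" and e: "e > 0" and z: "z \<in> wlap" "norm z = 1"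
  and min: "\<And>v. v \<in> wlap \<Longrightarrow> norm v = 1 \<Longrightarrow> \<Psi> w - e * dist w v \<le> \<Psi> v"
  and t: "t > 0" "\<Psi> w = EV V (t *\<^sub>R w)" "BV V (t *\<^sub>R w) (t *\<^sub>R w) = Nf (fst (t *\<^sub>R w)) (fst (t *\<^sub>R w))"
 shows "- 2 * e \<le> t * (BV V (t *\<^sub>R w) z - Nf (fst (t *\<^sub>R w)) (fst z))"
proof -
 have w0: "w \<noteq> 0" using w by auto
 \<comment> \<open>Starting at 1/2 keeps \<open>w + s n *\<^sub>R z\<close> away from 0, so it can
   be normalized.\<close>
 define s where "s n = inverse (real (Suc (Suc n)))" for n
 have s: "0 < s n" "s n \<le> 1 / 2" for n by (simp_all add: s_def field_simps)
 have s0: "s \<longlonglongrightarrow> 0" using LIMSEQ_Suc[OF LIMSEQ_inverse_real_of_nat] by (simp add: s_def[abs_def])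
 define y where "y n = w + s n *\<^sub>R z" for n
 have y: "y n \<in> wlap" for n unfolding y_def by (intro wlap_plus wlap_scaleR w z)
 have ny: "\<bar>norm (y n) - 1\<bar> \<le> s n" for n
  using norm_triangle_ineq3[of "y n" w] w(2) z(2) s(1)[of n] by (simp add: y_def)
 have y0: "norm (y n) > 0" for n using ny[of n] s(2)[of n] by linarith
 have yl: "y \<longlonglongrightarrow> w + 0 *\<^sub>R z" unfolding y_def[abs_def] by (intro tendsto_intros s0)
 define v where "v n = (1 / norm (y n)) *\<^sub>R y n" for n
 have v: "v n \<in> wlap" "norm (v n) = 1" "v n \<noteq> 0" for n using y[of n] y0[of n] by (auto simp: v_def intro: wlap_scaleR)
 have dv: "dist w (v n) \<le> 2 * s n" for n
 proof -
  have "v n - y n = (1 / norm (y n) - 1) *\<^sub>R y n" by (simp add: v_def algebra_simps)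
  then have "norm (v n - y n) = \<bar>(1 / norm (y n) - 1) * norm (y n)\<bar>" by (simp add: abs_mult)
  also have "(1 / norm (y n) - 1) * norm (y n) = 1 - norm (y n)" using y0[of n] by (simp add: field_simps)
  finally have "norm (v n - y n) \<le> s n" using ny[of n] by linarith
  moreover have "norm (y n - w) = s n" using s(1)[of n] z(2) by (simp add: y_def)
  moreover have "dist w (v n) \<le> norm (v n - y n) + norm (y n - w)"
   using norm_triangle_ineq[of "v n - y n" "y n - w"] by (simp add: dist_norm norm_minus_commute)
  ultimately show ?thesis by linarith
 qed
 have "\<exists>\<tau>>0. \<Psi> (v n) = EV V (\<tau> *\<^sub>R v n)" for n using maximizer[OF v(1,3)] by blast
 then obtain \<tau> where \<tau>: "\<And>n. \<tau> n > 0" "\<And>n. \<Psi> (v n) = EV V (\<tau> n *\<^sub>R v n)" by metis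
 define T where "T n = \<tau> n / norm (y n)" for n
 have T: "T n > 0" "EV V (T n *\<^sub>R y n) = \<Psi> (v n)" for n using \<tau>[of n] y0[of n] by (auto simp: T_def v_def)
 have Ppos: "0 < \<Psi> (v n)" for n using maximizer[OF v(1,3)] by blast
 have "Bseq T" by (rule fiber_bounded[OF w(1) w0, of y]) (use y yl T Ppos in \<open>auto simp: less_imp_le\<close>)
 then have "bounded (range T)" by (simp add: Bseq_eq_bounded)
 then obtain l r where r: "strict_mono r" "(T \<circ> r) \<longlonglongrightarrow> l" using bounded_imp_convergent_subsequence by blast
 have l0: "l \<ge> 0" by (rule LIMSEQ_le_const[OF r(2)]) (use T in \<open>auto simp: less_imp_le\<close>)
 have sr: "(s \<circ> r) \<longlonglongrightarrow> 0" "(y \<circ> r) \<longlonglongrightarrow> w" using LIMSEQ_subseq_LIMSEQ[OF s0 r(1)] LIMSEQ_subseq_LIMSEQ[OF yl r(1)] by auto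
 have low: "\<Psi> w - 2 * e * s n \<le> EV V (T n *\<^sub>R y n)" for n
  using min[OF v(1,2), of n] mult_left_mono[OF dv[of n] less_imp_le[OF e]] unfolding T by linarith
 have EVl: "(\<lambda>n. EV V ((T \<circ> r) n *\<^sub>R (y \<circ> r) n)) \<longlonglongrightarrow> EV V (l *\<^sub>R w)"
  by (intro EV_tendsto[OF V] wlap_scaleR w tendsto_intros r sr) (simp add: y)
 have "(\<lambda>n. \<Psi> w - 2 * e * (s \<circ> r) n) \<longlonglongrightarrow> \<Psi> w - 2 * e * 0" by (intro tendsto_intros sr)
 from LIMSEQ_le[OF this EVl] have "\<Psi> w - 2 * e * 0 \<le> EV V (l *\<^sub>R w)" using low by auto
 then have ge: "EV V (t *\<^sub>R w) \<le> EV V ((l / t) *\<^sub>R (t *\<^sub>R w))" using t by simp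
 \<comment> \<open>The limiting scale attains the maximum on the ray of w, and that maximum is
   unique. This identifies where the derivative is evaluated.\<close>
 have "l / t = 1"
 proof (rule ccontr)
  assume "l / t \<noteq> 1"
  then have "EV V ((l / t) *\<^sub>R (t *\<^sub>R w)) < EV V (t *\<^sub>R w)"
   by (intro nehari_max(2)[OF V wlap_scaleR[OF w(1)] t(3)]) (use l0 t(1) w0 in auto)
  then show False using ge by simp
 qed
 then have lt: "l = t" using t(1) by simp
 have "(\<lambda>n. (EV V ((T \<circ> r) n *\<^sub>R (w + (s \<circ> r) n *\<^sub>R z)) - EV V ((T \<circ> r) n *\<^sub>R w)) / (s \<circ> r) n)
   \<longlonglongrightarrow> l * (BV V (l *\<^sub>R w) z - Nf (fst (l *\<^sub>R w)) (fst z))"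
 proof (rule gateaux[OF V w(1) z(1) _ r(2) _ _ sr(1)])
  show "(s \<circ> r) n \<le> 1" for n using s(2)[of "r n"] by simp
 qed (use T s in \<open>auto simp: less_imp_le\<close>)
 then show ?thesis unfolding lt
 proof (rule tendsto_lowerbound)
  show "\<forall>\<^sub>F n in sequentially. - 2 * e \<le> (EV V ((T \<circ> r) n *\<^sub>R (w + (s \<circ> r) n *\<^sub>R z)) - EV V ((T \<circ> r) n *\<^sub>R w)) / (s \<circ> r) n"
  proof (intro always_eventually allI)
   fix n
   have "EV V (T (r n) *\<^sub>R w) \<le> \<Psi> w" by (rule Psi_upper[OF w(1) w0]) (use T in \<open>simp add: less_imp_le\<close>)
   then have "- 2 * e * s (r n) \<le> EV V (T (r n) *\<^sub>R (w + s (r n) *\<^sub>R z)) - EV V (T (r n) *\<^sub>R w)"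
    using low[of "r n"] unfolding y_def by linarith
   then show "- 2 * e \<le> (EV V ((T \<circ> r) n *\<^sub>R (w + (s \<circ> r) n *\<^sub>R z)) - EV V ((T \<circ> r) n *\<^sub>R w)) / (s \<circ> r) n"
    using s(1)[of "r n"] by (simp add: pos_le_divide_eq)
  qed
 qed simp
qed

text \<open>A supremum of continuous functions is lower semicontinuous; it suffices to follow the
  one scale that is maximal for the limit.\<close>

lemma Psi_lsc:
 assumes X: "\<And>n. X n \<in> {x\<in>wlap. norm x = 1}" "X \<longlonglongrightarrow> x" "\<And>n. \<Psi> (X n) \<le> c" and x: "x \<in> wlap" "norm x = 1"
 shows "\<Psi> x \<le> c"
proof -
 have x0: "x \<noteq> 0" using x by auto
 obtain t where t: "t > 0" "\<Psi> x = EV V (t *\<^sub>R x)" using maximizer[OF x(1) x0] by blast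
 have "(\<lambda>n. EV V (t *\<^sub>R X n)) \<longlonglongrightarrow> EV V (t *\<^sub>R x)"
  using X by (intro EV_tendsto[OF V] wlap_scaleR x tendsto_intros) auto
 moreover have "EV V (t *\<^sub>R X n) \<le> c" for n
 proof -
  have "X n \<in> wlap" "X n \<noteq> 0" using X(1)[of n] by auto
  then have "EV V (t *\<^sub>R X n) \<le> \<Psi> (X n)" using t(1) by (intro Psi_upper) auto
  then show ?thesis using X(3)[of n] by linarith
 qed
 ultimately show ?thesis unfolding t(2) by (intro LIMSEQ_le_const2) auto
qed

text \<open>The slope estimate carries the scale t of the Nehari point as a factor. A lower bound
  for t turns it into a bound on the derivative itself, in all directions, not only tangential
  ones.\<close>

lemma palais_smale:
 "\<exists>u \<epsilon>. (\<forall>n. u n \<in> wlap) \<and> (\<lambda>n. EV V (u n)) \<longlonglongrightarrow> m \<and> (\<forall>n. BV V (u n) (u n) = Nf (fst (u n)) (fst (u n))) \<and>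
  \<epsilon> \<longlonglongrightarrow> 0 \<and> (\<forall>n. \<forall>z\<in>wlap. \<bar>BV V (u n) z - Nf (fst (u n)) (fst z)\<bar> \<le> \<epsilon> n * norm z)"
proof -
 let ?S = "{x\<in>wlap. norm x = (1::real)}"
 have cl: "closed ?S"
 proof -
  have "?S = wlap \<inter> {x. norm x = 1}" by auto
  then show ?thesis by (simp only:) (intro closed_Int wlap_closed closed_Collect_eq continuous_intros)
 qed
 define e where "e n = inverse (real (Suc n))" for n
 have e: "e n > 0" for n by (simp add: e_def)
 have e0: "e \<longlonglongrightarrow> 0" using LIMSEQ_inverse_real_of_nat by (simp add: e_def[abs_def])
 have lsc: "\<Psi> x \<le> c" if "\<And>n. X n \<in> ?S" "X \<longlonglongrightarrow> x" "\<And>n. \<Psi> (X n) \<le> c" for X x c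
 proof -
  have "x \<in> ?S" using closed_sequentially[OF cl] that(1,2) by blast
  then show ?thesis by (intro Psi_lsc[OF that]) auto
 qed
 have "\<exists>w. w \<in> ?S \<and> \<Psi> w \<le> m + e n \<and> (\<forall>v\<in>?S. \<Psi> w - e n * dist w v \<le> \<Psi> v)" for n
  by (rule ekeland[OF cl sphere_nonempty bdd_Psi e[of n] lsc]) (auto simp: m_def)
 from choice[OF allI[OF this]] obtain w where w': "\<forall>n. w n \<in> ?S \<and> \<Psi> (w n) \<le> m + e n \<and> (\<forall>v\<in>?S. \<Psi> (w n) - e n * dist (w n) v \<le> \<Psi> v)" ..
 then have w: "\<And>n. w n \<in> ?S" "\<And>n. \<Psi> (w n) \<le> m + e n" "\<And>n. \<forall>v\<in>?S. \<Psi> (w n) - e n * dist (w n) v \<le> \<Psi> v" by simp_all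
 have wS: "w n \<in> wlap" "norm (w n) = 1" "w n \<noteq> 0" for n using w(1)[of n] by auto
 have "\<exists>t>0. \<Psi> (w n) = EV V (t *\<^sub>R w n) \<and> BV V (t *\<^sub>R w n) (t *\<^sub>R w n) = Nf (fst (t *\<^sub>R w n)) (fst (t *\<^sub>R w n))" for n
  using maximizer[OF wS(1,3)] by blast
 then obtain t where t: "\<And>n. t n > 0" "\<And>n. \<Psi> (w n) = EV V (t n *\<^sub>R w n)"
  "\<And>n. BV V (t n *\<^sub>R w n) (t n *\<^sub>R w n) = Nf (fst (t n *\<^sub>R w n)) (fst (t n *\<^sub>R w n))" by metis
 have mP: "m \<le> \<Psi> (w n)" for n by (rule m_le_Psi[OF wS(1,3)])
 \<comment> \<open>From m <= energy <= t^2 (1 + Vi)/2: positivity of the level keeps the scales away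
   from 0.\<close>
 define q where "q = sqrt (2 * m / (1 + Vi))"
 have q0: "q > 0" using m_pos Vi by (simp add: q_def)
 have tq: "q \<le> t n" for n
 proof -
  have "m \<le> EV V (t n *\<^sub>R w n)" using mP[of n] t(2)[of n] by simp
  also have "\<dots> \<le> (t n)^2 * BV V (w n) (w n) / 2" unfolding EV_def BV_scale2[OF V] using IF_nonneg by simp
  also have "\<dots> \<le> (t n)^2 * (1 + Vi) / 2" using BV_bound[OF V, of "w n" "w n"] wS(2)[of n] by (intro divide_right_mono mult_left_mono) auto
  finally have "2 * m / (1 + Vi) \<le> (t n)^2" using Vi by (simp add: pos_divide_le_eq)
  then show ?thesis unfolding q_def using t(1)[of n] by (intro real_le_lsqrt) auto
 qed
 define u where "u n = t n *\<^sub>R w n" for n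
 have u: "u n \<in> wlap" for n unfolding u_def by (intro wlap_scaleR wS)
 have slope1: "- (2 * e n / q) \<le> BV V (u n) z - Nf (fst (u n)) (fst z)" if z: "z \<in> wlap" "norm z = 1" for n z
 proof -
  have "- 2 * e n \<le> t n * (BV V (u n) z - Nf (fst (u n)) (fst z))"
   unfolding u_def by (rule ekeland_slope[OF wS(1,2) e z _ t]) (use w(3) in auto)
  then have a: "- (2 * e n / t n) \<le> BV V (u n) z - Nf (fst (u n)) (fst z)" using t(1)[of n] by (simp add: field_simps)
  have "2 * e n / t n \<le> 2 * e n / q" using tq[of n] q0 e[of n] by (intro divide_left_mono) auto
  then show ?thesis using a by linarith
 qed
 have slope: "\<bar>BV V (u n) z - Nf (fst (u n)) (fst z)\<bar> \<le> 2 * e n / q * norm z" if z: "z \<in> wlap" for n z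
 proof (cases "z = 0")
  case True
  then show ?thesis using BV_scale[OF V, of "u n" 0 0] Nf_scale_right[of "fst (u n)" 0 0] by simp
 next
  case False
  define L where "L = BV V (u n) z - Nf (fst (u n)) (fst z)"
  have *: "- (2 * e n / q) \<le> c * L" if "\<bar>c\<bar> = 1 / norm z" for c
   using slope1[OF wlap_scaleR[OF z, of c], of n] that False unfolding BV_scale[OF V] fst_scaleR Nf_scale_right L_def by (simp add: right_diff_distrib)
  have "\<bar>L\<bar> / norm z \<le> 2 * e n / q" using *[of "1 / norm z"] *[of "- (1 / norm z)"] by (auto simp: abs_if)
  then show ?thesis unfolding L_def[symmetric] using False by (simp add: pos_divide_le_eq)
 qed
 have "(\<lambda>n. EV V (u n)) \<longlonglongrightarrow> m"
 proof (rule tendsto_sandwich[of "\<lambda>_. m" _ _ "\<lambda>n. m + e n"])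
  show "(\<lambda>n. m + e n) \<longlonglongrightarrow> m" using tendsto_add[OF tendsto_const e0, of m] by simp
 qed (use mP w(2) t(2) in \<open>auto simp: u_def\<close>)
 moreover have "(\<lambda>n. 2 * e n / q) \<longlonglongrightarrow> 0" using tendsto_mult_right[OF e0, of "2 / q"] by (simp add: mult.commute)
 ultimately show ?thesis using u slope t(3) by (intro exI[of _ u] exI[of _ "\<lambda>n. 2 * e n / q"]) (auto simp: u_def)
qed

text \<open>A dilation keeps the Laplacian within its budget D and adjusts the remaining integrals
  until the bound D plus the potential term balances the integral of f(u) u. By the ray inequality
  the maximum over the ray is then at most the value at t = 1, which the strict inequality of
  \<open>level\<close> puts below D/2.\<close>

lemma m_level: "m < 16 * pi^2 / \<alpha>0"
proof -
 obtain x where x: "x \<in> wlap" "(norm (snd x))^2 \<le> 32 * pi^2 / \<alpha>0" "Vi * (norm (fst x))^2 < 2 * IF (fst x)" using level by blast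
 define D where "D = 32 * pi^2 / \<alpha>0"
 define N where "N = Nf (fst x) (fst x)"
 define B where "B = Vi * (norm (fst x))^2"
 define I where "I = IF (fst x)"
 have D: "D > 0" using a0 by (simp add: D_def)
 have "B \<ge> 0" using Vi by (simp add: B_def)
 then have I: "I > 0" using x(3) by (simp add: B_def I_def)
 have "2 * I < \<mu> * I" using I mu by simp
 then have N: "2 * I < N" using IF_le_Nf[OF x(1)] by (simp add: I_def N_def)
 have BI: "B < 2 * I" using x(3) by (simp add: B_def I_def)
 then have NB: "N - B > 0" using N by simp
 \<comment> \<open>Integrals without derivatives are multiplied by D/(N - B), so their difference N
   - B becomes exactly D.\<close>
 define c where "c = root 4 ((N - B) / D)"
 have c: "c > 0" "c ^ 4 = (N - B) / D" using NB D by (auto simp: c_def)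
 define y where "y = (dil 0 c (fst x), c^2 *\<^sub>R dil 0 c (snd x))"
 have y: "y \<in> wlap" unfolding y_def by (rule wlap_dil) (use x c in auto)
 have ns: "(norm (snd y))^2 \<le> D"
 proof -
  have "(norm (snd y))^2 = (c^2)^2 * (norm (dil 0 c (snd x)))^2" by (simp add: y_def power_mult_distrib)
  also have "\<dots> = (norm (snd x))^2" unfolding norm_dil_sq[OF c(1)] using c(1) by (simp flip: power_mult)
  finally show ?thesis using x(2) by (simp add: D_def)
 qed
 have dilint: "(LBINT z. g (fn (fst y) z)) = (LBINT z. g (fn (fst x) z)) * (D / (N - B))" if [measurable]: "g \<in> borel_measurable borel" for g :: "real \<Rightarrow> real"
 proof -
  have "(LBINT z. g (fn (fst y) z)) = (LBINT z. g (fn (fst x) (0 + c *\<^sub>R z)))"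
   by (rule integral_cong_AE) (use fn_dil[OF c(1), of 0 "fst x"] in \<open>auto simp: y_def\<close>)
  moreover have "(LBINT z. g (fn (fst x) z)) = c ^ 4 * (LBINT z. g (fn (fst x) (0 + c *\<^sub>R z)))"
   by (rule integral_scale_R4[OF _ c(1)]) measurable
  ultimately show ?thesis unfolding c(2) using NB D by (simp add: field_simps)
 qed
 have Iy: "IF (fst y) = I * (D / (N - B))" unfolding IF_def I_def by (rule dilint) measurable
 have Ny: "Nf (fst y) (fst y) = N * (D / (N - B))"
 proof -
  have "Nf (fst y) (fst y) = Nf (fst x) (fst x) * (D / (N - B))" unfolding Nf_def by (rule dilint) measurable
  then show ?thesis by (simp add: N_def)
 qed
 have By: "bil V (fst y) (fst y) \<le> B * (D / (N - B))"
 proof -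
  have "bil V (fst y) (fst y) \<le> Vi * (norm (fst y))^2" using bil_bound[OF V, of "fst y" "fst y"] by (simp add: power2_eq_square mult.assoc)
  also have "\<dots> = B * (D / (N - B))" unfolding y_def fst_conv norm_dil_sq[OF c(1)] c(2) B_def by simp
  finally show ?thesis .
 qed
 have "IF (fst y) > 0" unfolding Iy using I D NB by simp
 have y0: "y \<noteq> 0"
 proof
  assume y0: "y = 0"
  have "IF (fst y) = (\<integral>z. (0::real) \<partial>(lborel :: R4 measure))" unfolding IF_def y0 by (rule integral_cong_AE) (use fn_0 F0 in auto)
  then show False using \<open>IF (fst y) > 0\<close> by simp
 qed
 obtain t where t: "t > 0" "\<Psi> y = EV V (t *\<^sub>R y)" using maximizer[OF y y0] by blast
 define k where "k = D / (N - B)"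
 have k: "k > 0" "k * (N - B) = D" using D NB by (auto simp: k_def)
 have IFt: "I * k + (t^2 - 1) / 2 * (N * k) \<le> IF (fst (t *\<^sub>R y))"
 proof -
  have "(LBINT z. F (fn (fst y) z) + (t^2 - 1) / 2 * (f (fn (fst y) z) * fn (fst y) z)) \<le> IF (fst (t *\<^sub>R y))"
   unfolding IF_scale
  proof (intro integral_mono Bochner_Integration.integrable_add integrable_mult_right F_scale_int IF_int Nf_int y)
   fix z
   show "F (fn (fst y) z) + (t^2 - 1) / 2 * (f (fn (fst y) z) * fn (fst y) z) \<le> F (t * fn (fst y) z)" using F_ray[of t "fn (fst y) z"] t(1) by linarith
  qed
  moreover have "(LBINT z. F (fn (fst y) z) + (t^2 - 1) / 2 * (f (fn (fst y) z) * fn (fst y) z)) = IF (fst y) + (t^2 - 1) / 2 * Nf (fst y) (fst y)"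
   unfolding IF_def Nf_def using IF_int[OF y] Nf_int[OF y y] by simp
  ultimately show ?thesis unfolding Iy Ny k_def by simp
 qed
 have "BV V y y \<le> D + B * k" unfolding BV_def using ns By by (simp add: k_def power2_norm_eq_inner)
 then have "t^2 * BV V y y \<le> t^2 * (D + B * k)" by (intro mult_left_mono) auto
 moreover have "EV V (t *\<^sub>R y) = t^2 * BV V y y / 2 - IF (fst (t *\<^sub>R y))" unfolding EV_def BV_scale2[OF V] ..
 \<comment> \<open>All terms in t^2 cancel, since \<open>D + B * k\<close> equals
   \<open>N * k\<close>; the estimate is the same for every scale t.\<close>
 ultimately have "EV V (t *\<^sub>R y) \<le> t^2 * (D + B * k) / 2 - (I * k + (t^2 - 1) / 2 * (N * k))" using IFt by linarith
 also have "\<dots> = (k * N - 2 * (k * I)) / 2" unfolding k(2)[symmetric] by (simp add: field_simps)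
 also have "\<dots> < (k * N - k * B) / 2" using BI k(1) by (simp add: mult.left_commute[of 2])
 also have "\<dots> = D / 2" unfolding k(2)[symmetric] by (simp add: right_diff_distrib)
 finally have "\<Psi> y < D / 2" unfolding t(2) .
 then show ?thesis using m_le_Psi[OF y y0] by (simp add: D_def)
qed

text \<open>On the Nehari set the energy is at least (1/2 - 1/\<mu>) times the quadratic form, and
  \<mu> > 2 makes the factor positive.\<close>

lemma nehari_bound:
 assumes "x \<in> wlap" "BV V x x = Nf (fst x) (fst x)" "EV V x \<le> c"
 shows "BV V x x \<le> c / (1 / 2 - 1 / \<mu>)" "(norm x)^2 \<le> c / (1 / 2 - 1 / \<mu>) / \<kappa>"
proof -
 have mu': "1 / 2 - 1 / \<mu> > 0" using mu by (simp add: field_simps)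
 have "IF (fst x) \<le> BV V x x / \<mu>" using IF_le_Nf[OF assms(1)] assms(2) mu by (simp add: pos_le_divide_eq mult.commute)
 then have "(1 / 2 - 1 / \<mu>) * BV V x x \<le> c" using assms(3) unfolding EV_def by (simp add: algebra_simps)
 then show *: "BV V x x \<le> c / (1 / 2 - 1 / \<mu>)" using mu' by (simp add: pos_le_divide_eq mult.commute)
 show "(norm x)^2 \<le> c / (1 / 2 - 1 / \<mu>) / \<kappa>"
  using order_trans[OF coer[OF assms(1)] *] \<kappa> by (subst pos_le_divide_eq) (auto simp: mult.commute)
qed

end

section \<open>Limits of translates\<close>

lemma pot_shift: "pot V c \<Longrightarrow> pot (\<lambda>z. V (a + z)) c"
 unfolding pot_def by (auto intro: measurable_compose[of "\<lambda>z. a + z" borel borel V])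

definition sh :: "R4 \<Rightarrow> l2 \<times> l2 \<Rightarrow> l2 \<times> l2" where "sh a x = (dil a 1 (fst x), dil a 1 (snd x))"

lemma sh_wlap: "x \<in> wlap \<Longrightarrow> sh a x \<in> wlap" using wlap_dil[of "fst x" "snd x" 1 a] by (simp add: sh_def)
lemma norm_sh: "norm (sh a x) = norm x" using norm_dil_sq[of 1 a] by (simp add: sh_def norm_prod_def)

lemma fn_sh: "AE z in lborel. fn (fst (sh a x)) z = fn (fst x) (a + z)"
 using fn_dil[of 1 a "fst x"] by (simp add: sh_def)

lemma integral_shift: "(f :: R4 \<Rightarrow> real) \<in> borel_measurable borel \<Longrightarrow> (LBINT z. f (a + z)) = (LBINT z. f z)"
 using integral_scale_R4[of f 1 a] by simp

lemma dil_inverse: "dil a 1 (dil (- a) 1 p) = p"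
proof (rule l2_eqI)
 have "AE z in distr lborel borel ((+) a). fn (dil (- a) 1 p) z = fn p (- a + z)"
  unfolding lborel_distr_plus using fn_dil[of 1 "- a" p] by simp
 then have "AE z in lborel. fn (dil (- a) 1 p) (a + z) = fn p (- a + (a + z))"
  by (subst (asm) AE_distr_iff) auto
 then show "AE z in lborel. fn (dil a 1 (dil (- a) 1 p)) z = fn p z"
  using fn_dil[of 1 a "dil (- a) 1 p"] by (auto elim!: AE_mp)
qed

lemma sh_inverse: "sh a (sh (- a) x) = x" by (simp add: sh_def dil_inverse)

lemma BV_sh: assumes [measurable]: "V \<in> borel_measurable borel" shows "BV (\<lambda>z. V (a + z)) (sh a x) (sh a y) = BV V x y"
proof -
 have "bil (\<lambda>z. V (a + z)) (fst (sh a x)) (fst (sh a y)) = (LBINT z. V (a + z) * (fn (fst x) (a + z) * fn (fst y) (a + z)))"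
  unfolding bil_def by (rule integral_cong_AE) (use fn_sh[of a x] fn_sh[of a y] in auto)
 also have "\<dots> = bil V (fst x) (fst y)"
  unfolding bil_def by (rule integral_shift[of "\<lambda>z. V z * (fn (fst x) z * fn (fst y) z)"]) measurable
 finally show ?thesis by (simp add: BV_def) (simp add: sh_def inner_dil)
qed

lemma cv_sh: assumes [measurable]: "k \<in> borel_measurable borel" shows "cv k (fn (fst (sh a x))) 0 = cv k (fn (fst x)) a"
proof -
 have "cv k (fn (fst (sh a x))) 0 = (LBINT y. fn (fst x) (a + y) * k (a - (a + y)))"
  unfolding cv_def by (rule integral_cong_AE) (use fn_sh[of a x] in auto)
 also have "\<dots> = cv k (fn (fst x)) a"
  unfolding cv_def by (rule integral_shift[of "\<lambda>y. fn (fst x) y * k (a - y)"]) measurable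
 finally show ?thesis .
qed

lemma weak_strong_inner:
 fixes v :: "nat \<Rightarrow> 'a::real_inner"
 assumes B: "\<And>n. norm (v n) \<le> B" and weak: "\<And>\<phi>. (\<lambda>n. inner (v n) \<phi>) \<longlonglongrightarrow> inner w \<phi>" and Q: "(\<lambda>n. norm (Q n - q)) \<longlonglongrightarrow> 0"
 shows "(\<lambda>n. inner (v n) (Q n)) \<longlonglongrightarrow> inner w q"
proof -
 have "(\<lambda>n. inner (v n) (Q n - q)) \<longlonglongrightarrow> 0"
 proof (rule Lim_null_comparison)
  show "\<forall>\<^sub>F n in sequentially. norm (inner (v n) (Q n - q)) \<le> B * norm (Q n - q)"
   unfolding real_norm_def by (intro always_eventually allI order_trans[OF Cauchy_Schwarz_ineq2] mult_right_mono B) auto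
  show "(\<lambda>n. B * norm (Q n - q)) \<longlonglongrightarrow> 0" using tendsto_mult_left[OF Q, of B] by simp
 qed
 from tendsto_add[OF this weak[of q]] show ?thesis by (simp add: inner_diff_right)
qed

text \<open>For fixed z the form is an inner product with a representer built from V. Bounded
  pointwise convergence of the potentials makes the representers converge strongly, which weak
  convergence of \<open>v\<close> tolerates.\<close>

lemma BV_weak_tendsto:
 assumes Vn: "\<And>n. pot (Vn n) c" "pot Vs c" "\<And>x. (\<lambda>n. Vn n x) \<longlonglongrightarrow> Vs x"
  and B: "\<And>n. norm (v n) \<le> B" and weak: "\<And>\<phi>. (\<lambda>n. inner (v n) \<phi>) \<longlonglongrightarrow> inner w \<phi>"
 shows "(\<lambda>n. BV (Vn n) (v n) z) \<longlonglongrightarrow> BV Vs w z"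
proof -
 let ?u = "fn (fst z)"
 define Q where "Q U = (abs_l2 (\<lambda>x. U x * ?u x), snd z)" for U
 have BQ: "BV U x z = inner x (Q U)" if "pot U c" for U x
  using bil_inner[OF that, of "fst z" "fst x"] bil_sym[of U "fst x" "fst z"] by (simp add: BV_def Q_def inner_prod_def inner_commute)
 have [measurable]: "Vn n \<in> borel_measurable borel" "Vs \<in> borel_measurable borel" for n using Vn by (auto simp: pot_def)
 have sq: "(norm (Q (Vn n) - Q Vs))^2 = (LBINT x. ((Vn n x - Vs x) * ?u x)^2)" for n
 proof -
  have s: "sqint (\<lambda>x. Vn n x * ?u x)" "sqint (\<lambda>x. Vs x * ?u x)" using pot_sqint[OF Vn(1) fn_sqint] pot_sqint[OF Vn(2) fn_sqint] by auto
  have "(norm (Q (Vn n) - Q Vs))^2 = (norm (abs_l2 (\<lambda>x. Vn n x * ?u x) - abs_l2 (\<lambda>x. Vs x * ?u x)))^2"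
   by (simp add: Q_def norm_prod_def)
  also have "\<dots> = (LBINT x. ((Vn n x - Vs x) * ?u x)^2)"
   unfolding norm_l2_sq
   by (rule integral_cong_AE) (use fn_diff[of "abs_l2 (\<lambda>x. Vn n x * ?u x)" "abs_l2 (\<lambda>x. Vs x * ?u x)"] fn_abs[OF s(1)] fn_abs[OF s(2)]
    in \<open>auto elim!: AE_mp simp: left_diff_distrib\<close>)
  finally show ?thesis .
 qed
 have "(\<lambda>n. (LBINT x. ((Vn n x - Vs x) * ?u x)^2)) \<longlonglongrightarrow> (\<integral>x. (0::real) \<partial>(lborel :: R4 measure))"
 proof (rule integral_dominated_convergence[where w = "\<lambda>x. c^2 * (?u x)^2"])
  show "integrable lborel (\<lambda>x. c^2 * (?u x)^2)" using sqint_int[OF fn_sqint] by simp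
  show "AE x in lborel. (\<lambda>n. ((Vn n x - Vs x) * ?u x)^2) \<longlonglongrightarrow> 0"
  proof (intro AE_I2)
   fix x
   have "(\<lambda>n. ((Vn n x - Vs x) * ?u x)^2) \<longlonglongrightarrow> ((Vs x - Vs x) * ?u x)^2" by (intro tendsto_intros Vn)
   then show "(\<lambda>n. ((Vn n x - Vs x) * ?u x)^2) \<longlonglongrightarrow> 0" by simp
  qed
  show "AE x in lborel. norm (((Vn n x - Vs x) * ?u x)^2) \<le> c^2 * (?u x)^2" for n
  proof (intro AE_I2)
   fix x
   have "0 \<le> Vn n x \<and> Vn n x \<le> c" "0 \<le> Vs x \<and> Vs x \<le> c" using Vn by (auto simp: pot_def)
   then have "\<bar>Vn n x - Vs x\<bar> \<le> \<bar>c\<bar>" by linarith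
   then have "(Vn n x - Vs x)^2 \<le> c^2" by (simp only: abs_le_square_iff)
   then show "norm (((Vn n x - Vs x) * ?u x)^2) \<le> c^2 * (?u x)^2" by (simp add: power_mult_distrib mult_right_mono)
  qed
 qed measurable
 then have "(\<lambda>n. sqrt ((norm (Q (Vn n) - Q Vs))^2)) \<longlonglongrightarrow> sqrt 0" unfolding sq by (intro tendsto_intros) simp
 then have "(\<lambda>n. norm (Q (Vn n) - Q Vs)) \<longlonglongrightarrow> 0" by simp
 from weak_strong_inner[OF B weak this] show ?thesis by (simp add: BQ Vn)
qed

lemma third_sum:
 assumes "x \<le> ennreal A + ennreal C * M + T" "A \<le> \<epsilon> / 3" "C \<ge> 0" "\<epsilon> > 0" "M \<le> ennreal (\<epsilon> / (3 * (C + 1)))" "T \<le> ennreal (\<epsilon> / 3)"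
 shows "x \<le> ennreal \<epsilon>"
proof -
 have "x \<le> ennreal (\<epsilon> / 3) + ennreal C * ennreal (\<epsilon> / (3 * (C + 1))) + ennreal (\<epsilon> / 3)"
  by (rule order_trans[OF assms(1)]) (intro add_mono mult_left_mono ennreal_leI assms; simp)
 also have "ennreal C * ennreal (\<epsilon> / (3 * (C + 1))) \<le> ennreal (\<epsilon> / 3)"
  using assms(3,4) by (subst ennreal_mult[symmetric]) (auto intro!: ennreal_leI simp: field_simps)
 also have "ennreal (\<epsilon> / 3) + ennreal (\<epsilon> / 3) + ennreal (\<epsilon> / 3) = ennreal (\<epsilon> / 3 + \<epsilon> / 3 + \<epsilon> / 3)"
  using assms(4) by (subst ennreal_plus, simp, simp)+
 finally show ?thesis by (simp add: add_left_mono add_right_mono)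
qed

context nonlinearity
begin

text \<open>Monotonicity of f(t)/t and its sign make |f| increasing in |t| on either half-line; this
  justifies clamping the argument.\<close>

lemma f_abs_mono: assumes "\<bar>s\<bar> \<le> \<bar>t\<bar>" "0 \<le> s * t" shows "\<bar>f s\<bar> \<le> \<bar>f t\<bar>"
proof (cases "s = 0 \<or> s = t")
 case True then show ?thesis using f0 by auto
next
 case False
 have q: "0 \<le> f r / r" for r using ft_nonneg[of r] by (simp add: zero_le_divide_iff zero_le_mult_iff)
 have "f s / s < f t / t"
 proof (cases "s > 0")
  case True
  then have "t > 0" using assms(2) False by (simp add: zero_le_mult_iff) (use assms(1) True in auto)
  then show ?thesis using mono_pos[of s t] assms(1) True False by simp
 next
  case neg: False
  then have "s < 0" using False by simp
  then have "t < 0" using assms by (auto simp: zero_le_mult_iff)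
  then show ?thesis using mono_neg[of t s] \<open>s < 0\<close> assms(1) False by simp
 qed
 then have "\<bar>s\<bar> * (f s / s) \<le> \<bar>t\<bar> * (f t / t)" using assms(1) q by (intro mult_mono) auto
 moreover have "\<bar>r\<bar> * (f r / r) = \<bar>f r\<bar>" if "r \<noteq> 0" for r
  using q[of r] that by (simp add: abs_if zero_le_divide_iff) (auto simp: field_simps)
 moreover have "t \<noteq> 0" using False assms(1) by auto
 ultimately show ?thesis using False by simp
qed

lemma Nf_sh: "Nf (fst (sh a x)) (fst (sh a z)) = Nf (fst x) (fst z)"
proof -
 have "Nf (fst (sh a x)) (fst (sh a z)) = (LBINT y. f (fn (fst x) (a + y)) * fn (fst z) (a + y))"
  unfolding Nf_def by (rule integral_cong_AE) (use fn_sh[of a x] fn_sh[of a z] in auto)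
 also have "\<dots> = Nf (fst x) (fst z)" unfolding Nf_def by (rule integral_shift[of "\<lambda>y. f (fn (fst x) y) * fn (fst z) y"]) measurable
 finally show ?thesis .
qed

lemma IF_sh: "IF (fst (sh a x)) = IF (fst x)"
proof -
 have "IF (fst (sh a x)) = (LBINT y. F (fn (fst x) (a + y)))"
  unfolding IF_def by (rule integral_cong_AE) (use fn_sh[of a x] in auto)
 also have "\<dots> = IF (fst x)" unfolding IF_def by (rule integral_shift[of "\<lambda>y. F (fn (fst x) y)"]) measurable
 finally show ?thesis .
qed

lemma EV_sh: "V \<in> borel_measurable borel \<Longrightarrow> EV (\<lambda>z. V (a + z)) (sh a x) = EV V x"
 by (simp add: EV_def BV_sh IF_sh)

text \<open>Clamping the first argument of \<open>f u * z\<close> to \<open>[-K |z|, K |z|]\<close> makes it dominated by a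
 function of \<open>z\<close> alone, at a cost controlled by \<open>f u * u / K\<close>.\<close>
lemma clamp_error:
 assumes K: "K > 0"
 defines "c \<equiv> \<lambda>t z. max (- (K * \<bar>z\<bar>)) (min (K * \<bar>z\<bar>) t)"
 shows "\<bar>f t * z - f (c t z) * z\<bar> \<le> 2 / K * (f t * t)" "\<bar>f (c t z) * z\<bar> \<le> Cf * K * (z^2 * exp (\<alpha>1 * K^2 * z^2))"
proof -
 have Kz: "0 \<le> K * \<bar>z\<bar>" using K by simp
 show "\<bar>f t * z - f (c t z) * z\<bar> \<le> 2 / K * (f t * t)"
 proof (cases "\<bar>t\<bar> \<le> K * \<bar>z\<bar>")
  case True
  then have "c t z = t" by (auto simp: c_def)
  then show ?thesis using ft_nonneg[of t] K by simp
 next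
  case False
  then have "\<bar>c t z\<bar> \<le> \<bar>t\<bar>" "0 \<le> c t z * t" using Kz by (auto simp: c_def max_def min_def zero_le_mult_iff)
  then have "\<bar>f (c t z)\<bar> \<le> \<bar>f t\<bar>" by (rule f_abs_mono)
  moreover have z: "\<bar>z\<bar> \<le> \<bar>t\<bar> / K" using False K by (simp add: pos_le_divide_eq mult.commute)
  moreover have "\<bar>f t * z - f (c t z) * z\<bar> \<le> \<bar>f t\<bar> * \<bar>z\<bar> + \<bar>f (c t z)\<bar> * \<bar>z\<bar>"
   using abs_triangle_ineq4[of "f t * z" "f (c t z) * z"] by (simp add: abs_mult)
  moreover have "\<bar>f t\<bar> * \<bar>z\<bar> \<le> \<bar>f t\<bar> * (\<bar>t\<bar> / K)" by (intro mult_left_mono z) auto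
  moreover have "\<bar>f (c t z)\<bar> * \<bar>z\<bar> \<le> \<bar>f t\<bar> * (\<bar>t\<bar> / K)" using calculation(1) by (intro mult_mono z) auto
  ultimately show ?thesis unfolding ft_abs by simp
 qed
 have ac: "\<bar>c t z\<bar> \<le> K * \<bar>z\<bar>" using Kz by (auto simp: c_def max_def min_def abs_le_iff)
 then have "(c t z)^2 \<le> (K * \<bar>z\<bar>)^2" using power_mono[OF ac, of 2] by simp
 then have e: "exp (\<alpha>1 * (c t z)^2) \<le> exp (\<alpha>1 * K^2 * z^2)" using a1 by (simp add: power_mult_distrib mult_left_mono mult.assoc)
 have "\<bar>f (c t z)\<bar> \<le> Cf * \<bar>c t z\<bar> * exp (\<alpha>1 * (c t z)^2)" by (rule Cf)
 also have "\<dots> \<le> Cf * (K * \<bar>z\<bar>) * exp (\<alpha>1 * K^2 * z^2)" using ac e Cf(1) Kz by (intro mult_mono) auto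
 finally have "\<bar>f (c t z)\<bar> * \<bar>z\<bar> \<le> Cf * (K * \<bar>z\<bar>) * exp (\<alpha>1 * K^2 * z^2) * \<bar>z\<bar>" by (intro mult_right_mono) auto
 also have "\<dots> = Cf * K * (z^2 * exp (\<alpha>1 * K^2 * z^2))" by (simp add: power2_eq_square)
 finally show "\<bar>f (c t z) * z\<bar> \<le> Cf * K * (z^2 * exp (\<alpha>1 * K^2 * z^2))" by (simp add: abs_mult)
qed

lemma Nf_weak_tendsto:
 assumes v: "\<And>n. v n \<in> wlap" and w: "w \<in> wlap" and z: "z \<in> wlap"
  and N: "\<And>n. Nf (fst (v n)) (fst (v n)) \<le> N" and ae: "AE x in lborel. (\<lambda>n. fn (fst (v n)) x) \<longlonglongrightarrow> fn (fst w) x"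
 shows "(\<lambda>n. Nf (fst (v n)) (fst z)) \<longlonglongrightarrow> Nf (fst w) (fst z)"
proof (rule tendstoI)
 fix e :: real assume e: "e > 0"
 let ?z = "fn (fst z)"
 define M where "M = \<bar>N\<bar> + Nf (fst w) (fst w) + 1"
 have M: "M > 0" "\<bar>N\<bar> + Nf (fst w) (fst w) < M" using Nf_nonneg[of "fst w"] by (simp_all add: M_def add_nonneg_pos)
 \<comment> \<open>Makes the two clamping errors, for \<open>v n\<close> and for \<open>w\<close>,
   add up to at most e/2.\<close>
 define K where "K = 4 * M / e"
 have K: "K > 0" "2 / K * M = e / 2" using M e by (simp_all add: K_def)
 define g where "g u x = f (max (- (K * \<bar>?z x\<bar>)) (min (K * \<bar>?z x\<bar>) (fn (fst u) x))) * ?z x" for u :: "l2 \<times> l2" and x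
 have [measurable]: "g u \<in> borel_measurable borel" for u unfolding g_def by measurable
 have di: "integrable lborel (\<lambda>x. Cf * K * ((?z x)^2 * exp (\<alpha>1 * K^2 * (?z x)^2)))" by (intro integrable_mult_right exp2_int z)
 have gb: "\<bar>g u x\<bar> \<le> Cf * K * ((?z x)^2 * exp (\<alpha>1 * K^2 * (?z x)^2))" for u x unfolding g_def by (rule clamp_error[OF K(1)])
 have gi: "integrable lborel (g u)" for u
  by (rule Bochner_Integration.integrable_bound[OF di]) (auto intro!: AE_I2 order_trans[OF gb abs_ge_self])
 have err: "\<bar>Nf (fst u) (fst z) - (LBINT x. g u x)\<bar> \<le> 2 / K * Nf (fst u) (fst u)" if u: "u \<in> wlap" for u
 proof -
  have "\<bar>Nf (fst u) (fst z) - (LBINT x. g u x)\<bar> = \<bar>(LBINT x. f (fn (fst u) x) * ?z x - g u x)\<bar>"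
   unfolding Nf_def using Nf_int[OF u z] gi by simp
  also have "\<dots> \<le> (LBINT x. \<bar>f (fn (fst u) x) * ?z x - g u x\<bar>)" by (rule integral_abs_bound)
  also have "\<dots> \<le> (LBINT x. 2 / K * (f (fn (fst u) x) * fn (fst u) x))"
  proof (intro integral_mono integrable_mult_right Nf_int u integrable_abs Bochner_Integration.integrable_diff gi z)
   show "\<bar>f (fn (fst u) x) * ?z x - g u x\<bar> \<le> 2 / K * (f (fn (fst u) x) * fn (fst u) x)" for x
    unfolding g_def by (rule clamp_error[OF K(1)])
  qed
  finally show ?thesis by (simp add: Nf_def)
 qed
 have "(\<lambda>n. (LBINT x. g (v n) x)) \<longlonglongrightarrow> (LBINT x. g w x)"
 proof (rule integral_dominated_convergence[OF _ _ di])
  show "AE x in lborel. (\<lambda>n. g (v n) x) \<longlonglongrightarrow> g w x"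
   using ae
  proof eventually_elim
   case (elim x)
   have "isCont f y" for y using f_cont by (simp add: continuous_on_eq_continuous_at)
   then show ?case unfolding g_def by (intro tendsto_intros isCont_tendsto_compose[of _ f] elim)
  qed
 qed (use gb in auto)
 then have "\<forall>\<^sub>F n in sequentially. dist (LBINT x. g (v n) x) (LBINT x. g w x) < e / 2" by (rule tendstoD) (use e in simp)
 then show "\<forall>\<^sub>F n in sequentially. dist (Nf (fst (v n)) (fst z)) (Nf (fst w) (fst z)) < e"
 proof eventually_elim
  case (elim n)
  have "2 / K * (Nf (fst (v n)) (fst (v n)) + Nf (fst w) (fst w)) \<le> 2 / K * M"
   using N[of n] M(2) K(1) by (intro mult_left_mono) auto
  then have "2 / K * Nf (fst (v n)) (fst (v n)) + 2 / K * Nf (fst w) (fst w) \<le> e / 2" unfolding K(2) distrib_left .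
  then show ?case using elim err[OF v[of n]] err[OF w] unfolding dist_real_def by linarith
 qed
qed

text \<open>Substituting the Nehari identity removes the quadratic form, leaving the integral of a
  nonnegative function of the values alone, as Fatou's lemma requires.\<close>

lemma nehari_EV: "x \<in> wlap \<Longrightarrow> BV V x x = Nf (fst x) (fst x) \<Longrightarrow>
 (NN z. ennreal (f (fn (fst x) z) * fn (fst x) z / 2 - F (fn (fst x) z))) = ennreal (EV V x)"
 using H_nonneg IF_int[of x] Nf_int[of x x] by (subst nn_integral_eq_integral) (auto intro!: AE_I2 simp: EV_def IF_def Nf_def)

text \<open>The potential may vary with n, which covers translates drifting to infinity. The
  equation passes to the limit first, so the limit is itself a Nehari point and its energy is again
  an integral of a nonnegative density.\<close>

lemma weak_limit:
 assumes Vn: "\<And>n. pot (Vn n) c" "pot Vs c" "\<And>x. (\<lambda>n. Vn n x) \<longlonglongrightarrow> Vs x"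
  and v: "\<And>n. v n \<in> wlap" "\<And>n. norm (v n) \<le> B" and w: "w \<in> wlap" and weak: "\<And>\<phi>. (\<lambda>n. inner (v n) \<phi>) \<longlonglongrightarrow> inner w \<phi>"
  and ae: "AE x in lborel. (\<lambda>n. fn (fst (v n)) x) \<longlonglongrightarrow> fn (fst w) x"
  and J: "\<And>n. BV (Vn n) (v n) (v n) = Nf (fst (v n)) (fst (v n))"
  and eps: "\<epsilon> \<longlonglongrightarrow> 0" "\<And>n z. z \<in> wlap \<Longrightarrow> \<bar>BV (Vn n) (v n) z - Nf (fst (v n)) (fst z)\<bar> \<le> \<epsilon> n * norm z"
  and E: "(\<lambda>n. EV (Vn n) (v n)) \<longlonglongrightarrow> l"
 shows "\<And>z. z \<in> wlap \<Longrightarrow> BV Vs w z = Nf (fst w) (fst z)" "EV Vs w \<le> l"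
proof -
 have c: "0 \<le> c" by (rule pot_nonneg[OF Vn(2)])
 have N: "Nf (fst (v n)) (fst (v n)) \<le> (1 + c) * B * B" for n
 proof -
  have "Nf (fst (v n)) (fst (v n)) \<le> (1 + c) * norm (v n) * norm (v n)" using BV_bound[OF Vn(1), of n "v n" "v n"] J[of n] by simp
  also have "\<dots> \<le> (1 + c) * B * B" using c v(2)[of n] order_trans[OF norm_ge_zero v(2)] by (intro mult_mono) auto
  finally show ?thesis .
 qed
 show eq: "BV Vs w z = Nf (fst w) (fst z)" if z: "z \<in> wlap" for z
 proof -
  have l1: "(\<lambda>n. BV (Vn n) (v n) z - Nf (fst (v n)) (fst z)) \<longlonglongrightarrow> BV Vs w z - Nf (fst w) (fst z)"
   by (intro tendsto_diff BV_weak_tendsto[OF Vn v(2) weak] Nf_weak_tendsto[OF v(1) w z N ae])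
  have "(\<lambda>n. BV (Vn n) (v n) z - Nf (fst (v n)) (fst z)) \<longlonglongrightarrow> 0"
  proof (rule Lim_null_comparison)
   show "\<forall>\<^sub>F n in sequentially. norm (BV (Vn n) (v n) z - Nf (fst (v n)) (fst z)) \<le> \<epsilon> n * norm z" using eps(2)[OF z] by simp
   show "(\<lambda>n. \<epsilon> n * norm z) \<longlonglongrightarrow> 0" using tendsto_mult_right[OF eps(1), of "norm z"] by simp
  qed
  from LIMSEQ_unique[OF l1 this] show ?thesis by simp
 qed
 define h where "h t = ennreal (f t * t / 2 - F t)" for t
 have [measurable]: "h \<in> borel_measurable borel" unfolding h_def by measurable
 have "ennreal (EV Vs w) = (NN x. h (fn (fst w) x))" using nehari_EV[OF w eq[OF w]] by (simp add: h_def)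
 also have "\<dots> = (NN x. liminf (\<lambda>n. h (fn (fst (v n)) x)))"
 proof (rule nn_integral_cong_AE)
  show "AE x in lborel. h (fn (fst w) x) = liminf (\<lambda>n. h (fn (fst (v n)) x))"
   using ae
  proof eventually_elim
   case (elim x)
   have "isCont f y" "isCont F y" for y using f_cont F_cont by (simp_all add: continuous_on_eq_continuous_at)
   then have "(\<lambda>n. h (fn (fst (v n)) x)) \<longlonglongrightarrow> h (fn (fst w) x)"
    unfolding h_def by (intro tendsto_intros isCont_tendsto_compose[of _ f] isCont_tendsto_compose[of _ F] elim) auto
   from lim_imp_Liminf[OF _ this] show ?case by simp
  qed
 qed
 also have "\<dots> \<le> liminf (\<lambda>n. (NN x. h (fn (fst (v n)) x)))" by (rule nn_integral_liminf) measurable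
 also have "\<dots> = liminf (\<lambda>n. ennreal (EV (Vn n) (v n)))" unfolding h_def nehari_EV[OF v(1) J] ..
 also have "\<dots> = ennreal l" using E by (intro lim_imp_Liminf tendsto_ennrealI) auto
 finally have le: "ennreal (EV Vs w) \<le> ennreal l" .
 have "EV (Vn n) (v n) = (LBINT x. f (fn (fst (v n)) x) * fn (fst (v n)) x / 2 - F (fn (fst (v n)) x))" for n
  using J[of n] IF_int[OF v(1)[of n]] Nf_int[OF v(1)[of n] v(1)[of n]] by (simp add: EV_def IF_def Nf_def)
 then have "0 \<le> EV (Vn n) (v n)" for n using H_nonneg by simp
 then have "0 \<le> l" by (intro LIMSEQ_le_const[OF E]) auto
 with le show "EV Vs w \<le> l" by simp
qed

end

context schroedinger
begin

text \<open>Two rounds of the three-region estimate. The first, using F <= M0 |f| for large values,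
  shows that the integral of F tends to 0, so the Laplacians become subcritical. The second then
  sends the integral of f(u) u below m, incompatible with an energy close to m.\<close>

lemma no_vanishing:
 assumes u: "\<And>n. u n \<in> wlap" "\<And>n. norm (u n) \<le> B" and J: "\<And>n. BV V (u n) (u n) = Nf (fst (u n)) (fst (u n))"
  and E: "(\<lambda>n. EV V (u n)) \<longlonglongrightarrow> m"
  and van: "\<And>s e. 0 < s \<Longrightarrow> s < s0 \<Longrightarrow> e > 0 \<Longrightarrow> \<forall>\<^sub>F n in sequentially. \<forall>x. \<bar>cv (kS s) (fn (fst (u n))) x\<bar> \<le> e" and s0: "s0 > 0"
 shows False
proof -
 have B: "B \<ge> 0" using u(2)[of 0] norm_ge_zero order_trans by blast
 define N where "N = (1 + Vi) * B * B"
 have N0: "N \<ge> 0" using B Vi by (simp add: N_def)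
 have N: "Nf (fst (u n)) (fst (u n)) \<le> N" for n
 proof -
  have "Nf (fst (u n)) (fst (u n)) \<le> (1 + Vi) * norm (u n) * norm (u n)" using BV_bound[OF V, of "u n" "u n"] J[of n] by simp
  also have "\<dots> \<le> N" unfolding N_def using Vi u(2)[of n] B by (intro mult_mono) auto
  finally show ?thesis .
 qed
 have nfu: "(norm (fst (u n)))^2 \<le> B^2" for n using norm_fst_le2(1)[of "u n"] u(2)[of n] by (intro power_mono) auto
 have lev: "\<forall>\<^sub>F n in sequentially. emeasure lborel {x. a < \<bar>fn (fst (u n)) x\<bar>} \<le> ennreal e" if "a > 0" "e > 0" for a e
 proof (rule vanishing_level_sets[of "\<lambda>n. fst (u n)" "\<lambda>n. snd (u n)" B s0])
  show "norm (snd (u n)) \<le> B" for n using norm_fst_le2(2)[of "u n"] u(2)[of n] by linarith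
 qed (use u van s0 that in auto)
 have small_part: "\<exists>a>0. \<forall>t. \<bar>t\<bar> \<le> a \<longrightarrow> f t * t \<le> \<epsilon> / (3 * (B^2 + 1)) * t^2" if e: "\<epsilon> > 0" for \<epsilon>
 proof -
  have "\<epsilon> / (3 * (B^2 + 1)) > 0" using e by (intro divide_pos_pos) (auto intro: add_nonneg_pos)
  from f_small[OF this] obtain a where a: "a > 0" "\<And>t. \<bar>t\<bar> \<le> a \<Longrightarrow> \<bar>f t\<bar> \<le> \<epsilon> / (3 * (B^2 + 1)) * \<bar>t\<bar>" by blast
  have "f t * t \<le> \<epsilon> / (3 * (B^2 + 1)) * t^2" if "\<bar>t\<bar> \<le> a" for t
  proof -
   have "f t * t \<le> \<epsilon> / (3 * (B^2 + 1)) * \<bar>t\<bar> * \<bar>t\<bar>" unfolding ft_abs by (intro mult_right_mono a that) auto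
   also have "\<dots> = \<epsilon> / (3 * (B^2 + 1)) * t^2" by (simp add: power2_eq_square)
   finally show ?thesis .
  qed
  then show ?thesis using a(1) by blast
 qed
 have A: "\<epsilon> / (3 * (B^2 + 1)) * (norm (fst (u n)))^2 \<le> \<epsilon> / 3" if "\<epsilon> > 0" for \<epsilon> n
 proof -
  have "\<epsilon> / (3 * (B^2 + 1)) * (norm (fst (u n)))^2 \<le> \<epsilon> / (3 * (B^2 + 1)) * (B^2 + 1)"
   using nfu[of n] that by (intro mult_left_mono) (auto intro!: divide_nonneg_nonneg add_nonneg_nonneg)
  also have "\<dots> = \<epsilon> / 3"
  proof -
   have "x / (3 * b) * b = x / 3" if "b > 0" for b x :: real using that by simp
   moreover have "B^2 + 1 > 0" by (intro add_nonneg_pos) auto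
   ultimately show ?thesis by blast
  qed
  finally show ?thesis .
 qed
 have middle: "f t * t \<le> Cf * (K^2 * exp (\<alpha>1 * K^2))" if "\<bar>t\<bar> \<le> K" for t K
 proof -
  have "t^2 * exp (\<alpha>1 * t^2) \<le> K^2 * exp (\<alpha>1 * K^2)" by (rule exp_square_mono[OF a1]) (use that in auto)
  then show ?thesis using ft_le[of t] mult_left_mono[of _ _ Cf] Cf(1) by (smt (verit))
 qed
 have IF0: "\<forall>\<^sub>F n in sequentially. IF (fst (u n)) \<le> \<epsilon>" if e: "\<epsilon> > 0" for \<epsilon>
 proof -
  obtain a where a: "a > 0" "\<And>t. \<bar>t\<bar> \<le> a \<Longrightarrow> f t * t \<le> \<epsilon> / (3 * (B^2 + 1)) * t^2" using small_part[OF e] by blast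
  \<comment> \<open>Beyond K the bound F <= M0 |f| <= (M0/K) f(t) t applies, and K is large enough
    for this part to cost at most a third of \<epsilon>.\<close>
  define K where "K = max (max 1 t0) (3 * M0 * (N + 1) / \<epsilon>)"
  have K: "K \<ge> 1" "K \<ge> t0" "3 * M0 * (N + 1) / \<epsilon> \<le> K" by (auto simp: K_def)
  have KN: "M0 / K * N \<le> \<epsilon> / 3"
  proof -
   have "3 * M0 * (N + 1) \<le> K * \<epsilon>" using K(3) e by (simp add: pos_divide_le_eq)
   moreover have "M0 * N \<le> M0 * (N + 1)" using M0(1) by simp
   ultimately have "3 * (M0 * N) \<le> K * \<epsilon>" by linarith
   then show ?thesis using K(1) by (simp add: field_simps)
  qed
  define C where "C = Cf * (K^2 * exp (\<alpha>1 * K^2))"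
  have C: "C \<ge> 0" using Cf(1) by (simp add: C_def)
  have eC: "\<epsilon> / (3 * (C + 1)) > 0" using e C by simp
  have pw: "F t \<le> \<epsilon> / (3 * (B^2 + 1)) * t^2 + C * indicator {t. a < \<bar>t\<bar>} t + M0 / K * (f t * t)" for t
  proof -
   have p1: "0 \<le> \<epsilon> / (3 * (B^2 + 1)) * t^2" using e by (intro mult_nonneg_nonneg divide_nonneg_nonneg) auto
   have p3: "0 \<le> M0 / K * (f t * t)" using M0(1) K(1) ft_nonneg[of t] by (intro mult_nonneg_nonneg[of "M0 / K"]) auto
   have p2: "0 \<le> C * indicator {t. a < \<bar>t\<bar>} t" using C by simp
   consider "\<bar>t\<bar> \<le> a" | "a < \<bar>t\<bar>" "\<bar>t\<bar> \<le> K" | "K < \<bar>t\<bar>" by linarith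
   then show ?thesis
   proof cases
    case 1 then show ?thesis using a(2)[of t] F_le[of t] ft_nonneg[of t] p2 p3 by linarith
   next
    case 2
    then have "F t \<le> C * indicator {t. a < \<bar>t\<bar>} t" using middle[of t K] F_le[of t] ft_nonneg[of t] by (simp add: C_def)
    then show ?thesis using p1 p3 by linarith
   next
    case 3
    then have "F t \<le> M0 * \<bar>f t\<bar>" using M0(2)[of t] K by simp
    also have "\<dots> \<le> M0 * (\<bar>f t\<bar> * \<bar>t\<bar> / K)"
    proof (intro mult_left_mono)
     have "\<bar>f t\<bar> * K \<le> \<bar>f t\<bar> * \<bar>t\<bar>" using 3 by (intro mult_left_mono) auto
     then show "\<bar>f t\<bar> \<le> \<bar>f t\<bar> * \<bar>t\<bar> / K" using K(1) by (simp add: pos_le_divide_eq)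
    qed (use M0 in simp)
    finally have "F t \<le> M0 / K * (f t * t)" unfolding ft_abs by simp
    then show ?thesis using p1 p2 by linarith
   qed
  qed
  show ?thesis using lev[OF a(1) eC]
  proof eventually_elim
   case (elim n)
   have "(NN x. ennreal (F (fn (fst (u n)) x))) \<le> ennreal (\<epsilon> / (3 * (B^2 + 1)) * (norm (fst (u n)))^2) + ennreal C * emeasure lborel {x. a < \<bar>fn (fst (u n)) x\<bar>}
     + (NN x. ennreal (M0 / K * (f (fn (fst (u n)) x) * fn (fst (u n)) x)))"
   proof (rule three_region[OF _ _ C _ pw])
    show "0 \<le> M0 / K * (f t * t)" for t using M0(1) K(1) ft_nonneg[of t] by (intro mult_nonneg_nonneg[of "M0 / K"]) auto
    show "0 \<le> \<epsilon> / (3 * (B^2 + 1))" using e by (intro divide_nonneg_nonneg) auto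
   qed measurable
   moreover have "(NN x. ennreal (M0 / K * (f (fn (fst (u n)) x) * fn (fst (u n)) x))) \<le> ennreal (\<epsilon> / 3)"
   proof -
    have "(NN x. ennreal (M0 / K * (f (fn (fst (u n)) x) * fn (fst (u n)) x))) = ennreal (M0 / K) * ennreal (Nf (fst (u n)) (fst (u n)))"
     using M0(1) K(1) by (subst nn_integral_cmult_ennreal) (auto simp: nn_Nf[OF u(1)] ft_nonneg)
    also have "\<dots> = ennreal (M0 / K * Nf (fst (u n)) (fst (u n)))" using M0(1) K(1) by (intro ennreal_mult[symmetric] Nf_nonneg) auto
    also have "\<dots> \<le> ennreal (\<epsilon> / 3)" using order_trans[OF mult_left_mono[OF N, of "M0 / K"] KN] M0(1) K(1) by (intro ennreal_leI) auto
    finally show ?thesis .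
   qed
   ultimately have "(NN x. ennreal (F (fn (fst (u n)) x))) \<le> ennreal \<epsilon>" by (rule third_sum[OF _ A[OF e] C e elim])
   then show ?case using nn_IF[OF u(1)[of n], of 1] e by simp
  qed
 qed
 \<comment> \<open>Midpoint between the limit of the quadratic form, 2 m, and the critical
   value.\<close>
 define D where "D = (2 * m + 32 * pi^2 / \<alpha>0) / 2"
 have "m * \<alpha>0 > 0" using m_pos a0 by simp
 then have D: "2 * m < D" "\<alpha>0 * D < 32 * pi^2" "D > 0"
  using m_level m_pos a0 by (auto simp: D_def field_simps add_pos_pos)
 have bd: "\<forall>\<^sub>F n in sequentially. (norm (snd (u n)))\<^sup>2 \<le> D"
 proof -
  define d where "d = (D - 2 * m) / 4"
  have d: "d > 0" using D by (simp add: d_def)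
  have "\<forall>\<^sub>F n in sequentially. EV V (u n) < m + d" by (rule order_tendstoD[OF E]) (use d in simp)
  with IF0[OF d] show ?thesis
  proof eventually_elim
   case (elim n)
   have "b < D" if "I \<le> (D - 2 * M) / 4" "b / 2 - I < M + (D - 2 * M) / 4" for b I M :: real using that by argo
   then have "BV V (u n) (u n) < D" using elim unfolding EV_def d_def by blast
   moreover have "(norm (snd (u n)))^2 \<le> BV V (u n) (u n)" using bil_nonneg[OF V] by (simp add: BV_def power2_norm_eq_inner)
   ultimately show ?case by linarith
  qed
 qed
 define \<alpha> where "\<alpha> = (\<alpha>0 + 32 * pi^2 / D) / 2"
 have al: "\<alpha> > \<alpha>0" "\<alpha> * D < 32 * pi^2" using D by (auto simp: \<alpha>_def field_simps)
 \<comment> \<open>Two exponents above \<open>\<alpha>0\<close>: the growth bound is taken at the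
   smaller one, and the gap absorbs the factor t^2.\<close>
 define \<alpha>' where "\<alpha>' = (\<alpha>0 + \<alpha>) / 2"
 have al': "\<alpha>' > \<alpha>0" "\<alpha>' < \<alpha>" using al by (auto simp: \<alpha>'_def)
 obtain C1 where C1: "C1 > 0" "\<And>t. \<bar>f t\<bar> \<le> C1 * \<bar>t\<bar> * exp (\<alpha>' * t^2)" using f_growth[OF al'(1)] by blast
 define C2 where "C2 = C1 / (\<alpha> - \<alpha>')"
 have C2: "C2 > 0" using C1 al' by (simp add: C2_def)
 have tailb: "f t * t \<le> C2 * exp (\<alpha> * t^2)" for t
 proof -
  have "(\<alpha> - \<alpha>') * t^2 \<le> exp ((\<alpha> - \<alpha>') * t^2)" using exp_ge_add_one_self[of "(\<alpha> - \<alpha>') * t^2"] by linarith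
  then have t2: "t^2 \<le> exp ((\<alpha> - \<alpha>') * t^2) / (\<alpha> - \<alpha>')" using al' by (simp add: pos_le_divide_eq mult.commute)
  have "f t * t \<le> C1 * \<bar>t\<bar> * exp (\<alpha>' * t^2) * \<bar>t\<bar>" unfolding ft_abs by (intro mult_right_mono C1) auto
  also have "\<dots> = C1 * exp (\<alpha>' * t^2) * t^2" by (simp add: power2_eq_square)
  also have "\<dots> \<le> C1 * exp (\<alpha>' * t^2) * (exp ((\<alpha> - \<alpha>') * t^2) / (\<alpha> - \<alpha>'))" using C1(1) by (intro mult_left_mono t2) auto
  also have "\<dots> = C2 * (exp (\<alpha>' * t^2) * exp ((\<alpha> - \<alpha>') * t^2))" by (simp add: C2_def)
  also have "\<dots> = C2 * exp (\<alpha> * t^2)" by (simp add: exp_add[symmetric] algebra_simps)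
  finally show ?thesis .
 qed
 obtain C where C: "C \<ge> 0" "\<forall>p w D M. (p, w) \<in> wlap \<longrightarrow> norm p \<le> M \<longrightarrow> (norm w)^2 \<le> D \<longrightarrow> pot_dominated (C * M) D (fn p)"
  using wlap_pot_dominated by blast
 \<comment> \<open>Already f(u) u with integral at most m suffices: the energy is then at most m/2,
   while it tends to m.\<close>
 define \<epsilon> where "\<epsilon> = m"
 have e: "\<epsilon> > 0" using m_pos by (simp add: \<epsilon>_def)
 have e': "\<epsilon> / (3 * C2) > 0" using e C2 by simp
 have CB: "C * B \<ge> 0" and al0: "\<alpha> > 0" using C B al a0 by auto
 obtain K where K: "K > 0" "\<forall>u. pot_dominated (C * B) D u \<longrightarrow>
   (NN x. ennreal (exp (\<alpha> * (u x)^2)) * indicator {x. K < \<bar>u x\<bar>} x) \<le> ennreal (\<epsilon> / (3 * C2))"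
  using adams_tail[OF D(3) al0 al(2) CB e'] by blast
 obtain a where a: "a > 0" "\<And>t. \<bar>t\<bar> \<le> a \<Longrightarrow> f t * t \<le> \<epsilon> / (3 * (B^2 + 1)) * t^2" using small_part[OF e] by blast
 define C3 where "C3 = Cf * (K^2 * exp (\<alpha>1 * K^2))"
 have C3: "C3 \<ge> 0" using Cf(1) by (simp add: C3_def)
 have eC: "\<epsilon> / (3 * (C3 + 1)) > 0" using e C3 by simp
 define h where "h t = C2 * (exp (\<alpha> * t^2) * indicator {t. K < \<bar>t\<bar>} t)" for t :: real
 have h0: "0 \<le> h t" for t using C2 by (simp add: h_def)
 have [measurable]: "h \<in> borel_measurable borel" unfolding h_def by measurable
 have pw: "f t * t \<le> \<epsilon> / (3 * (B^2 + 1)) * t^2 + C3 * indicator {t. a < \<bar>t\<bar>} t + h t" for t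
 proof -
  have p1: "0 \<le> \<epsilon> / (3 * (B^2 + 1)) * t^2" using e by (intro mult_nonneg_nonneg divide_nonneg_nonneg) auto
  have p2: "0 \<le> C3 * indicator {t. a < \<bar>t\<bar>} t" using C3 by simp
  consider "\<bar>t\<bar> \<le> a" | "a < \<bar>t\<bar>" "\<bar>t\<bar> \<le> K" | "K < \<bar>t\<bar>" by linarith
  then show ?thesis
  proof cases
   case 1 then show ?thesis using a(2)[of t] p2 h0[of t] by linarith
  next
   case 2
   then have "f t * t \<le> C3 * indicator {t. a < \<bar>t\<bar>} t" using middle[of t K] by (simp add: C3_def)
   then show ?thesis using p1 h0[of t] by linarith
  next
   case 3
   then have "f t * t \<le> h t" using tailb[of t] by (simp add: h_def)
   then show ?thesis using p1 p2 by linarith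
  qed
 qed
 have Nf0: "\<forall>\<^sub>F n in sequentially. Nf (fst (u n)) (fst (u n)) \<le> \<epsilon>"
  using lev[OF a(1) eC] bd
 proof eventually_elim
  case (elim n)
  have "(NN x. ennreal (f (fn (fst (u n)) x) * fn (fst (u n)) x)) \<le> ennreal (\<epsilon> / (3 * (B^2 + 1)) * (norm (fst (u n)))^2) + ennreal C3 * emeasure lborel {x. a < \<bar>fn (fst (u n)) x\<bar>}
    + (NN x. ennreal (h (fn (fst (u n)) x)))"
  proof (rule three_region[OF _ _ C3 h0 pw])
   show "0 \<le> \<epsilon> / (3 * (B^2 + 1))" using e by (intro divide_nonneg_nonneg) auto
  qed measurable
  moreover have "(NN x. ennreal (h (fn (fst (u n)) x))) \<le> ennreal (\<epsilon> / 3)"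
  proof -
   have "(NN x. ennreal (h (fn (fst (u n)) x))) = (NN x. ennreal C2 * (ennreal (exp (\<alpha> * (fn (fst (u n)) x)^2)) * indicator {x. K < \<bar>fn (fst (u n)) x\<bar>} x))"
    unfolding h_def using C2 by (intro nn_integral_cong) (auto simp: indicator_def ennreal_mult[symmetric])
   also have "\<dots> = ennreal C2 * (NN x. ennreal (exp (\<alpha> * (fn (fst (u n)) x)^2)) * indicator {x. K < \<bar>fn (fst (u n)) x\<bar>} x)"
    by (rule nn_integral_cmult) measurable
   also have "\<dots> \<le> ennreal C2 * ennreal (\<epsilon> / (3 * C2))"
   proof (intro mult_left_mono K(2)[rule_format] C(2)[rule_format])
    show "(fst (u n), snd (u n)) \<in> wlap" using u(1)[of n] by simp
    show "norm (fst (u n)) \<le> B" using norm_fst_le2(1)[of "u n"] u(2)[of n] by linarith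
   qed (use elim in auto)
   also have "\<dots> = ennreal (\<epsilon> / 3)" using C2 e by (subst ennreal_mult[symmetric]) auto
   finally show ?thesis .
  qed
  ultimately have "(NN x. ennreal (f (fn (fst (u n)) x) * fn (fst (u n)) x)) \<le> ennreal \<epsilon>" by (rule third_sum[OF _ A[OF e] C3 e elim(1)])
  then show ?case unfolding nn_Nf[OF u(1)] using e by simp
 qed
 have "\<forall>\<^sub>F n in sequentially. m / 2 < EV V (u n)" by (rule order_tendstoD[OF E]) (use m_pos in simp)
 with Nf0 have "\<forall>\<^sub>F n in sequentially. False"
 proof eventually_elim
  case (elim n)
  then show ?case using J[of n] IF_nonneg[of "fst (u n)"] unfolding EV_def \<epsilon>_def by linarith
 qed
 then show False by simp
qed

end

context schroedinger
begin

text \<open>Either the centres escape to infinity, where V tends to its limit, or a subsequence of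
  them converges and continuity of V applies.\<close>

lemma translation_subsequence:
 "\<exists>r Vs. strict_mono (r :: nat \<Rightarrow> nat) \<and> pot Vs Vi \<and> (\<forall>x. (\<lambda>n. V (y (r n) + x)) \<longlonglongrightarrow> Vs x) \<and> ((\<exists>a. Vs = (\<lambda>x. V (a + x))) \<or> Vs = (\<lambda>_. Vi))"
proof (cases "filterlim (\<lambda>n. norm (y n)) at_top sequentially")
 case True
 have "(\<lambda>n. V (y n + x)) \<longlonglongrightarrow> Vi" for x
 proof (rule filterlim_compose[OF Vlim])
  have "filterlim y at_infinity sequentially" by (rule filterlim_norm_at_top_imp_at_infinity[OF True])
  then show "filterlim (\<lambda>n. y n + x) at_infinity sequentially" by (rule tendsto_add_filterlim_at_infinity'[OF _ tendsto_const])
 qed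
 moreover have "pot (\<lambda>_. Vi) Vi" using Vi by (simp add: pot_def)
 ultimately show ?thesis by (intro exI[of _ id] exI[of _ "\<lambda>_. Vi"]) (auto simp: strict_mono_def)
next
 case False
 then obtain Z where "\<not> (\<forall>\<^sub>F n in sequentially. Z \<le> norm (y n))" by (auto simp: filterlim_at_top)
 then obtain r :: "nat \<Rightarrow> nat" where r: "strict_mono r" "\<forall>n. \<not> Z \<le> norm (y (r n))" using not_eventually_sequentiallyD by blast
 then have "bounded (range (y \<circ> r))" by (auto simp: bounded_iff not_le intro!: exI[of _ Z] less_imp_le)
 then obtain l r' where r': "strict_mono r'" "((y \<circ> r) \<circ> r') \<longlonglongrightarrow> l" using bounded_imp_convergent_subsequence by blast
 have "(\<lambda>n. V (y ((r \<circ> r') n) + x)) \<longlonglongrightarrow> V (l + x)" for x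
 proof (rule isCont_tendsto_compose[of "l + x" V])
  show "isCont V (l + x)" using Vcont by (simp add: continuous_on_eq_continuous_at)
  show "(\<lambda>n. y ((r \<circ> r') n) + x) \<longlonglongrightarrow> l + x" using tendsto_add[OF r'(2) tendsto_const] by (simp add: o_def)
 qed
 then show ?thesis
  by (intro exI[of _ "r \<circ> r'"] exI[of _ "\<lambda>x. V (l + x)"]) (use r r' V pot_shift strict_mono_o in auto)
qed

text \<open>The scale obeys s < \<delta>^2 so that the kernel detecting the mass is supported in the
  ball on which V vanishes; the final contradiction depends on it. Moving the detection points to 0
  transfers the motion to the potential.\<close>

lemma nonvanishing_translates:
 "\<exists>v y \<epsilon> B s e. (\<forall>n. v n \<in> wlap \<and> norm (v n) \<le> B \<and> BV (\<lambda>z. V (y n + z)) (v n) (v n) = Nf (fst (v n)) (fst (v n))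
   \<and> e < \<bar>cv (kS s) (fn (fst (v n))) 0\<bar> \<and> (\<forall>z\<in>wlap. \<bar>BV (\<lambda>z. V (y n + z)) (v n) z - Nf (fst (v n)) (fst z)\<bar> \<le> \<epsilon> n * norm z))
  \<and> (\<lambda>n. EV (\<lambda>z. V (y n + z)) (v n)) \<longlonglongrightarrow> m \<and> \<epsilon> \<longlonglongrightarrow> (0::real) \<and> 0 < s \<and> s < \<delta>^2 \<and> (0::real) < e"
proof -
 from palais_smale obtain u \<epsilon> where u: "\<And>n. u n \<in> wlap" "(\<lambda>n. EV V (u n)) \<longlonglongrightarrow> m" "\<And>n. BV V (u n) (u n) = Nf (fst (u n)) (fst (u n))"
  "\<epsilon> \<longlonglongrightarrow> 0" "\<And>n z. z \<in> wlap \<Longrightarrow> \<bar>BV V (u n) z - Nf (fst (u n)) (fst z)\<bar> \<le> \<epsilon> n * norm z"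
  by (elim exE conjE) blast
 have "Bseq (\<lambda>n. EV V (u n))" by (rule convergent_imp_Bseq) (use u(2) convergent_def in blast)
 then obtain b where b: "\<And>n. \<bar>EV V (u n)\<bar> \<le> b" unfolding Bseq_def by auto
 define B where "B = sqrt (b / (1 / 2 - 1 / \<mu>) / \<kappa>)"
 have B: "norm (u n) \<le> B" for n
  unfolding B_def using nehari_bound(2)[OF u(1,3), of n b] b[of n] by (intro real_le_rsqrt) auto
 have "\<exists>s e. 0 < s \<and> s < \<delta>^2 \<and> 0 < e \<and> \<not> (\<forall>\<^sub>F n in sequentially. \<forall>x. \<bar>cv (kS s) (fn (fst (u n))) x\<bar> \<le> e)"
 proof (rule ccontr)
  assume "\<not> ?thesis"
  then have "\<And>s e. 0 < s \<Longrightarrow> s < \<delta>^2 \<Longrightarrow> e > 0 \<Longrightarrow> \<forall>\<^sub>F n in sequentially. \<forall>x. \<bar>cv (kS s) (fn (fst (u n))) x\<bar> \<le> e" by blast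
  from no_vanishing[where ?s0.0 = "\<delta>^2", OF u(1) B u(3,2) this] show False using \<delta> by simp
 qed
 then obtain s e where s: "0 < s" "s < \<delta>^2" "0 < e" and nv: "\<not> (\<forall>\<^sub>F n in sequentially. \<forall>x. \<bar>cv (kS s) (fn (fst (u n))) x\<bar> \<le> e)" by blast
 from not_eventually_sequentiallyD[OF nv] obtain r :: "nat \<Rightarrow> nat" where r: "strict_mono r" "\<forall>n. \<not> (\<forall>x. \<bar>cv (kS s) (fn (fst (u (r n)))) x\<bar> \<le> e)" by blast
 then have "\<forall>n. \<exists>x. e < \<bar>cv (kS s) (fn (fst (u (r n)))) x\<bar>" by (simp add: not_le)
 from choice[OF this] obtain y where y: "\<forall>n. e < \<bar>cv (kS s) (fn (fst (u (r n)))) (y n)\<bar>" ..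
 define v where "v n = sh (y n) (u (r n))" for n
 have Vm: "V \<in> borel_measurable borel" using V by (simp add: pot_def)
 have eps: "\<bar>BV (\<lambda>z. V (y n + z)) (v n) z - Nf (fst (v n)) (fst z)\<bar> \<le> (\<epsilon> \<circ> r) n * norm z" if "z \<in> wlap" for n z
  using u(5)[OF sh_wlap[OF that, of "- y n"], of "r n"] BV_sh[OF Vm, of "y n" "u (r n)" "sh (- y n) z"] Nf_sh[of "y n" "u (r n)" "sh (- y n) z"]
  by (simp add: v_def sh_inverse norm_sh)
 have km: "kS s \<in> borel_measurable borel" by (rule test_fun_meas[OF kS_test0[OF s(1)]])
 show ?thesis
 proof (rule exI[of _ v], rule exI[of _ y], rule exI[of _ "\<epsilon> \<circ> r"], rule exI[of _ B], rule exI[of _ s], rule exI[of _ e], intro conjI allI)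
  show "(\<lambda>n. EV (\<lambda>z. V (y n + z)) (v n)) \<longlonglongrightarrow> m"
   unfolding v_def EV_sh[OF Vm] using LIMSEQ_subseq_LIMSEQ[OF u(2) r(1)] by (simp add: o_def)
  show "(\<epsilon> \<circ> r) \<longlonglongrightarrow> 0" by (rule LIMSEQ_subseq_LIMSEQ[OF u(4) r(1)])
  show "e < \<bar>cv (kS s) (fn (fst (v n))) 0\<bar>" for n using y by (simp add: v_def cv_sh[OF km])
  show "BV (\<lambda>z. V (y n + z)) (v n) (v n) = Nf (fst (v n)) (fst (v n))" for n by (simp add: v_def BV_sh[OF Vm] Nf_sh u(3))
 qed (use s eps in \<open>auto simp: v_def norm_sh B intro!: sh_wlap u\<close>)
qed

text \<open>The detected value is an inner product with a fixed test function, hence survives weak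
  convergence; almost everywhere convergence comes from \<open>rellich\<close>.\<close>

lemma limit_profile:
 "\<exists>w Vs. w \<in> wlap \<and> \<not> (AE x in lborel. x \<in> ball 0 \<delta> \<longrightarrow> fn (fst w) x = 0) \<and> (\<forall>z\<in>wlap. BV Vs w z = Nf (fst w) (fst z))
  \<and> EV Vs w \<le> m \<and> ((\<exists>a. Vs = (\<lambda>x. V (a + x))) \<or> Vs = (\<lambda>_. Vi))"
proof -
 from nonvanishing_translates obtain v y \<epsilon> B s e where
  v: "\<forall>n. v n \<in> wlap \<and> norm (v n) \<le> B \<and> BV (\<lambda>z. V (y n + z)) (v n) (v n) = Nf (fst (v n)) (fst (v n))
   \<and> e < \<bar>cv (kS s) (fn (fst (v n))) 0\<bar> \<and> (\<forall>z\<in>wlap. \<bar>BV (\<lambda>z. V (y n + z)) (v n) z - Nf (fst (v n)) (fst z)\<bar> \<le> \<epsilon> n * norm z)"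
  and E: "(\<lambda>n. EV (\<lambda>z. V (y n + z)) (v n)) \<longlonglongrightarrow> m" and eps: "\<epsilon> \<longlonglongrightarrow> 0" and s: "0 < s" "s < \<delta>^2" "0 < e"
  by (elim exE conjE) blast
 have vB: "norm (v n) \<le> B" for n using v by blast
 obtain r1 w where r1: "strict_mono r1" and weak1: "\<And>\<phi>. (\<lambda>n. inner (v (r1 n)) \<phi>) \<longlonglongrightarrow> inner w \<phi>"
  by (rule bounded_weak_subseq[of v B, OF vB]) (rule that)
 from translation_subsequence[of "y \<circ> r1"] obtain r2 Vs where r2: "strict_mono r2" "pot Vs Vi" "\<forall>x. (\<lambda>n. V ((y \<circ> r1) (r2 n) + x)) \<longlonglongrightarrow> Vs x"
  "(\<exists>a. Vs = (\<lambda>x. V (a + x))) \<or> Vs = (\<lambda>_. Vi)" by (elim exE conjE)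
 define \<rho> where "\<rho> = r1 \<circ> r2"
 have \<rho>: "strict_mono \<rho>" unfolding \<rho>_def by (rule strict_mono_o[OF r1 r2(1)])
 have weak2: "(\<lambda>n. inner (v (\<rho> n)) \<phi>) \<longlonglongrightarrow> inner w \<phi>" for \<phi>
  using LIMSEQ_subseq_LIMSEQ[OF weak1 r2(1)] by (simp add: \<rho>_def o_def)
 have wfst: "(\<lambda>n. inner (fst (v (\<rho> n))) \<phi>) \<longlonglongrightarrow> inner (fst w) \<phi>" for \<phi> using weak2[of "(\<phi>, 0)"] by (simp add: inner_prod_def)
 have wsnd: "(\<lambda>n. inner (snd (v (\<rho> n))) \<phi>) \<longlonglongrightarrow> inner (snd w) \<phi>" for \<phi> using weak2[of "(0, \<phi>)"] by (simp add: inner_prod_def)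
 have vw: "(fst (v (\<rho> n)), snd (v (\<rho> n))) \<in> wlap" for n using v by simp
 have "(fst w, snd w) \<in> wlap" by (rule wlap_weak_closed[OF vw wfst wsnd])
 then have w: "w \<in> wlap" by simp
 obtain r3 :: "nat \<Rightarrow> nat" where r3: "strict_mono r3" "AE x in lborel. (\<lambda>n. fn (fst (v (\<rho> (r3 n)))) x) \<longlonglongrightarrow> fn (fst w) x"
  using rellich[OF vw \<open>(fst w, snd w) \<in> wlap\<close> _ _ wfst, of B] vB norm_fst_le2 order_trans by (metis (no_types, lifting))
 define R where "R = \<rho> \<circ> r3"
 have R: "strict_mono R" unfolding R_def by (rule strict_mono_o[OF \<rho> r3(1)])
 have Vlim: "(\<lambda>n. V (y (R n) + x)) \<longlonglongrightarrow> Vs x" for x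
  using LIMSEQ_subseq_LIMSEQ[OF r2(3)[rule_format, of x] r3(1)] by (simp add: R_def \<rho>_def o_def)
 have weak: "(\<lambda>n. inner (v (R n)) \<phi>) \<longlonglongrightarrow> inner w \<phi>" for \<phi>
  using LIMSEQ_subseq_LIMSEQ[OF weak2 r3(1)] by (simp add: R_def o_def)
 have lim: "\<forall>z\<in>wlap. BV Vs w z = Nf (fst w) (fst z)" "EV Vs w \<le> m"
 proof -
  have ae: "AE x in lborel. (\<lambda>n. fn (fst (v (R n))) x) \<longlonglongrightarrow> fn (fst w) x" using r3(2) by (simp add: R_def)
  have eR: "(\<lambda>n. \<epsilon> (R n)) \<longlonglongrightarrow> 0" using LIMSEQ_subseq_LIMSEQ[OF eps R] by (simp add: o_def)
  have ER: "(\<lambda>n. EV (\<lambda>z. V (y (R n) + z)) (v (R n))) \<longlonglongrightarrow> m" using LIMSEQ_subseq_LIMSEQ[OF E R] by (simp add: o_def)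
  have vn: "v (R n) \<in> wlap" "BV (\<lambda>z. V (y (R n) + z)) (v (R n)) (v (R n)) = Nf (fst (v (R n))) (fst (v (R n)))" for n using v by blast+
  have ve: "\<bar>BV (\<lambda>z. V (y (R n) + z)) (v (R n)) z - Nf (fst (v (R n))) (fst z)\<bar> \<le> \<epsilon> (R n) * norm z" if "z \<in> wlap" for n z using v that by blast
  note wl = weak_limit[OF pot_shift[OF V] r2(2) Vlim vn(1) vB w weak ae vn(2) eR ve ER]
  show "\<forall>z\<in>wlap. BV Vs w z = Nf (fst w) (fst z)" using wl(1) by blast
  show "EV Vs w \<le> m" by (rule wl(2))
 qed
 define k where "k y = kS s (0 - y)" for y
 have k: "test_fun k" unfolding k_def by (rule kS_test[OF s(1)])
 have cvk: "cv (kS s) (fn p) 0 = inner p (abs_l2 k)" for p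
  unfolding inner_abs_right[OF test_fun_sqint[OF k]] by (simp add: cv_def k_def)
 have "(\<lambda>n. \<bar>inner (fst (v (\<rho> n))) (abs_l2 k)\<bar>) \<longlonglongrightarrow> \<bar>inner (fst w) (abs_l2 k)\<bar>" by (intro tendsto_rabs wfst)
 moreover have "e \<le> \<bar>inner (fst (v (\<rho> n))) (abs_l2 k)\<bar>" for n using v unfolding cvk by (simp add: less_imp_le)
 ultimately have "e \<le> \<bar>cv (kS s) (fn (fst w)) 0\<bar>" unfolding cvk by (intro LIMSEQ_le_const) auto
 then have nz: "cv (kS s) (fn (fst w)) 0 \<noteq> 0" using s(3) by auto
 \<comment> \<open>The kernel vanishes off the ball of radius sqrt s < \<delta>, so a nonzero
   convolution at 0 requires mass inside the \<delta>-ball.\<close>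
 have "\<not> (AE x in lborel. x \<in> ball 0 \<delta> \<longrightarrow> fn (fst w) x = 0)"
 proof
  assume z: "AE x in lborel. x \<in> ball 0 \<delta> \<longrightarrow> fn (fst w) x = 0"
  have sd: "sqrt s \<le> \<delta>" using s \<delta> by (intro real_le_lsqrt) auto
  obtain C where C: "\<forall>s>0. \<forall>z. \<bar>kS s z\<bar> \<le> C / s^2 * indicator (ball 0 (sqrt s)) z" using kS_bound by blast
  have k0: "kS s (0 - x) = 0" if "x \<notin> ball 0 \<delta>" for x
  proof -
   have "0 - x \<notin> ball 0 (sqrt s)" using that sd by auto
   then show ?thesis using C[rule_format, OF s(1), of "0 - x"] by simp
  qed
  have "cv (kS s) (fn (fst w)) 0 = (\<integral>x. (0::real) \<partial>(lborel :: R4 measure))"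
   unfolding cv_def
  proof (rule integral_cong_AE)
   show "(\<lambda>x. fn (fst w) x * kS s (0 - x)) \<in> borel_measurable lborel" using test_fun_meas[OF k] by (simp add: k_def)
   show "AE x in lborel. fn (fst w) x * kS s (0 - x) = 0" using z
   proof eventually_elim
    case (elim x)
    then show ?case using k0[of x] by (cases "x \<in> ball 0 \<delta>") auto
   qed
  qed simp
  then show False using nz by simp
 qed
 then show ?thesis using w lim r2(4) by (intro exI[of _ w] exI[of _ Vs]) blast
qed

lemma EV_potential_diff: "pot U c \<Longrightarrow> EV U x - EV V x = (LBINT z. (U z - V z) * (fn (fst x) z)^2) / 2"
 using bil_int[of U c "fst x" "fst x"] bil_int[OF V, of "fst x" "fst x"]
 by (simp add: EV_def BV_def bil_def left_diff_distrib power2_eq_square field_simps)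

text \<open>For the constant limit potential the chain m <= \<open>\<Psi> w\<close> = energy of t w
  with V <= energy of t w with the constant <= energy of w <= m collapses. So (Vi - V) u^2 vanishes
  almost everywhere, contradicting the mass in the ball where V = 0. In the remaining case the
  profile is translated back.\<close>

theorem minimizer: "\<exists>u\<in>wlap. u \<noteq> 0 \<and> (\<forall>z\<in>wlap. BV V u z = Nf (fst u) (fst z)) \<and>
 (\<forall>v\<in>wlap. v \<noteq> 0 \<longrightarrow> BV V v v = Nf (fst v) (fst v) \<longrightarrow> EV V u \<le> EV V v)"
proof -
 obtain w Vs where w: "w \<in> wlap" "\<not> (AE x in lborel. x \<in> ball 0 \<delta> \<longrightarrow> fn (fst w) x = 0)"
  "\<forall>z\<in>wlap. BV Vs w z = Nf (fst w) (fst z)" "EV Vs w \<le> m" and Vs: "(\<exists>a. Vs = (\<lambda>x. V (a + x))) \<or> Vs = (\<lambda>_. Vi)"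
  using limit_profile by (elim exE conjE)
 have Vm: "V \<in> borel_measurable borel" using V by (simp add: pot_def)
 have w0: "w \<noteq> 0"
 proof
  assume "w = 0"
  then have "AE x in lborel. x \<in> ball 0 \<delta> \<longrightarrow> fn (fst w) x = 0" using fn_0 by (auto elim!: AE_mp)
  then show False using w(2) by simp
 qed
 have "\<exists>a. Vs = (\<lambda>x. V (a + x))"
 proof (rule ccontr)
  assume "\<not> ?thesis"
  then have Vs: "Vs = (\<lambda>_. Vi)" using Vs by blast
  have pVi: "pot (\<lambda>_. Vi) Vi" using Vi by (simp add: pot_def)
  obtain t where t: "t > 0" "\<Psi> w = EV V (t *\<^sub>R w)" using maximizer[OF w(1) w0] by blast
  let ?u = "fn (fst (t *\<^sub>R w))"
  have nn: "0 \<le> (Vi - V z) * (?u z)^2" for z using V by (simp add: pot_def)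
  have "EV Vs (t *\<^sub>R w) \<le> EV Vs w" unfolding Vs by (rule nehari_max(1)[OF pVi w(1)]) (use w(1,3) t Vs in auto)
  \<comment> \<open>Both ends of the chain are used: energy at most m above, and m at most
    \<open>\<Psi> w\<close> below.\<close>
  then have "EV Vs (t *\<^sub>R w) - EV V (t *\<^sub>R w) \<le> 0" using w(4) m_le_Psi[OF w(1) w0] t(2) by linarith
  then have "(LBINT z. (Vi - V z) * (?u z)^2) \<le> 0" unfolding Vs EV_potential_diff[OF pVi] by simp
  moreover have "0 \<le> (LBINT z. (Vi - V z) * (?u z)^2)" using nn by (intro Bochner_Integration.integral_nonneg)
  ultimately have z: "(LBINT z. (Vi - V z) * (?u z)^2) = 0" by linarith
  have i: "integrable lborel (\<lambda>z. (Vi - V z) * (?u z)^2)"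
   using Bochner_Integration.integrable_diff[OF bil_int[OF pVi, of "fst (t *\<^sub>R w)" "fst (t *\<^sub>R w)"] bil_int[OF V, of "fst (t *\<^sub>R w)" "fst (t *\<^sub>R w)"]]
   by (simp add: left_diff_distrib power2_eq_square)
  have "AE z in lborel. (Vi - V z) * (?u z)^2 = 0" using integral_nonneg_eq_0_iff_AE[OF i AE_I2[OF nn]] z by simp
  then have "AE x in lborel. x \<in> ball 0 \<delta> \<longrightarrow> fn (fst w) x = 0"
   using fn_scale_fst[of t w]
  proof eventually_elim
   case (elim x)
   then show ?case using Vball[of x] Vi t(1) by (intro impI) simp
  qed
  then show False using w(2) by blast
 qed
 then obtain a where a: "Vs = (\<lambda>x. V (a + x))" by blast
 define u where "u = sh (- a) w"
 have wu: "w = sh a u" by (simp add: u_def sh_inverse)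
 have u: "u \<in> wlap" unfolding u_def by (rule sh_wlap[OF w(1)])
 have u0: "u \<noteq> 0" using w0 norm_sh[of a u] unfolding wu by auto
 have sol: "BV V u z = Nf (fst u) (fst z)" if "z \<in> wlap" for z
  using w(3)[rule_format, OF sh_wlap[OF that, of a]] unfolding a wu BV_sh[OF Vm] Nf_sh .
 have Em: "EV V u \<le> m" using w(4) unfolding a wu EV_sh[OF Vm] .
 have "EV V u \<le> EV V v" if "v \<in> wlap" "v \<noteq> 0" "BV V v v = Nf (fst v) (fst v)" for v
  using m_le_Psi[OF that(1,2)] nehari_Psi[OF that] Em by simp
 then show ?thesis using u u0 sol by blast
qed

end

section \<open>Ground states\<close>

text \<open>Completeness of Lebesgue measure lets transfers be stated with almost everywhere
  equality only, without a separate measurability proof for \<open>lap u\<close> or compositions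
  with f.\<close>

lemma lebesgue_measurable_AE_eq:
 fixes u f :: "R4 \<Rightarrow> real"
 assumes f: "f \<in> borel_measurable borel" and ae: "AE x in lebesgue. u x = f x"
 shows "u \<in> borel_measurable lebesgue"
proof (rule measurableI)
 fix A :: "real set" assume A: "A \<in> sets borel"
 have "f -` A \<inter> space lebesgue \<in> sets lebesgue" using borel_lebesgue[OF f] A by (rule measurable_sets)
 then show "u -` A \<inter> space lebesgue \<in> sets lebesgue"
  by (rule completion.in_sets_AE[rotated]) (use ae in \<open>auto elim!: AE_mp\<close>)
qed simp

lemma integral_lebesgue_lborel:
 fixes u f :: "R4 \<Rightarrow> real"
 assumes "f \<in> borel_measurable borel" "AE x in lebesgue. u x = f x"
 shows "(\<integral>x. u x \<partial>lebesgue) = (LBINT x. f x)"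
 by (rule lebesgue_transfer(2)[OF lebesgue_measurable_AE_eq[OF assms] assms])

lemma nontrivial_repr:
 assumes "nontrivial u" "AE x in lebesgue. u x = fn (fst x') x" "x' \<in> wlap" shows "x' \<noteq> 0"
proof
 assume x0: "x' = 0"
 have "AE x in lebesgue. fn 0 x = 0" by (rule AE_completion[OF fn_0])
 then have "AE x in lebesgue. u x = 0" using assms(2) unfolding x0 by (auto elim!: AE_mp)
 then show False using assms(1) by (simp add: nontrivial_def)
qed

lemma W22_pair:
 assumes "u \<in> W22" obtains x where "x \<in> wlap" "AE z in lebesgue. u z = fn (fst x) z" "AE z in lebesgue. lap u z = fn (snd x) z"
proof -
 obtain p w where "(p, w) \<in> wlap" "AE x in lebesgue. u x = fn p x" "AE x in lebesgue. lap u x = fn w x" by (rule W22_repr[OF assms])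
 then show thesis by (intro that[of "(p, w)"]) simp_all
qed

context nonlinearity
begin

lemma weak_form_transfer:
 assumes V: "pot V c" and u: "AE z in lebesgue. u z = fn (fst x) z" "AE z in lebesgue. lap u z = fn (snd x) z"
  and \<phi>: "AE z in lebesgue. \<phi> z = fn (fst y) z" "AE z in lebesgue. lap \<phi> z = fn (snd y) z"
 shows "(\<integral>z. lap u z * lap \<phi> z + V z * u z * \<phi> z \<partial>lebesgue) = BV V x y" "(\<integral>z. f (u z) * \<phi> z \<partial>lebesgue) = Nf (fst x) (fst y)"
proof -
 have [measurable]: "V \<in> borel_measurable borel" using V by (simp add: pot_def)
 have "AE z in lebesgue. lap u z * lap \<phi> z + V z * u z * \<phi> z = fn (snd x) z * fn (snd y) z + V z * (fn (fst x) z * fn (fst y) z)"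
  using u \<phi> by eventually_elim simp
 from integral_lebesgue_lborel[OF _ this]
 show "(\<integral>z. lap u z * lap \<phi> z + V z * u z * \<phi> z \<partial>lebesgue) = BV V x y"
  using sqint_mult[OF fn_sqint fn_sqint, of "snd x" "snd y"] bil_int[OF V, of "fst x" "fst y"] by (simp add: BV_def bil_def inner_l2_def)
 have "AE z in lebesgue. f (u z) * \<phi> z = f (fn (fst x) z) * fn (fst y) z" using u \<phi> by eventually_elim simp
 from integral_lebesgue_lborel[OF _ this] show "(\<integral>z. f (u z) * \<phi> z \<partial>lebesgue) = Nf (fst x) (fst y)" by (simp add: Nf_def)
qed

lemma energy_transfer:
 assumes V: "pot V c" and u: "AE z in lebesgue. u z = fn (fst x) z" "AE z in lebesgue. lap u z = fn (snd x) z"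
 shows "energy V F u = EV V x"
proof -
 have "AE z in lebesgue. F (u z) = F (fn (fst x) z)" using u by eventually_elim simp
 from integral_lebesgue_lborel[OF _ this] have "(\<integral>z. F (u z) \<partial>lebesgue) = IF (fst x)" by (simp add: IF_def)
 moreover have "(\<integral>z. (lap u z)\<^sup>2 + V z * (u z)^2 \<partial>lebesgue) = BV V x x"
  using weak_form_transfer(1)[OF V u u] by (simp add: power2_eq_square mult.assoc)
 ultimately show ?thesis by (simp add: energy_def EV_def)
qed

text \<open>Being below the supremum yields a competitor above Vi. Its integral of F is finite by
  \<open>nn_IF\<close>, so the extended-real inequality becomes a real one.\<close>

lemma gamma_star_witness:
 assumes Vi: "ereal Vi < gamma_star F \<alpha>0"
 shows "\<exists>x\<in>wlap. (norm (snd x))\<^sup>2 \<le> 32 * pi^2 / \<alpha>0 \<and> Vi * (norm (fst x))^2 < 2 * IF (fst x)"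
proof -
 from Vi obtain u where u: "u \<in> W22" "nontrivial u" "(\<integral>x. (lap u x)\<^sup>2 \<partial>lebesgue) \<le> 32 * pi^2 / \<alpha>0"
  "ereal Vi < ereal (2 / L2norm_sq u) * enn2ereal (\<integral>\<^sup>+x. ennreal (F (u x)) \<partial>lebesgue)"
  unfolding gamma_star_def less_Sup_iff by blast
 obtain x where x: "x \<in> wlap" "AE z in lebesgue. u z = fn (fst x) z" "AE z in lebesgue. lap u z = fn (snd x) z"
  by (rule W22_pair[OF u(1)])
 have "AE z in lebesgue. (lap u z)\<^sup>2 = (fn (snd x) z)^2" using x(3) by eventually_elim simp
 from integral_lebesgue_lborel[OF _ this] have D: "(norm (snd x))^2 \<le> 32 * pi^2 / \<alpha>0" using u(3) by (simp add: norm_l2_sq)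
 have "AE z in lebesgue. (u z)\<^sup>2 = (fn (fst x) z)^2" using x(2) by eventually_elim simp
 from integral_lebesgue_lborel[OF _ this] have L: "L2norm_sq u = (norm (fst x))^2" by (simp add: L2norm_sq_def norm_l2_sq)
 have "(\<integral>\<^sup>+z. ennreal (F (u z)) \<partial>lebesgue) = (\<integral>\<^sup>+z. ennreal (F (fn (fst x) z)) \<partial>lebesgue)"
  by (rule nn_integral_cong_AE) (use x(2) in \<open>auto elim!: AE_mp\<close>)
 also have "\<dots> = ennreal (IF (fst x))" using nn_IF[OF x(1), of 1] by (simp add: nn_integral_completion)
 finally have I: "(\<integral>\<^sup>+z. ennreal (F (u z)) \<partial>lebesgue) = ennreal (IF (fst x))" .
 have "norm (fst x) > 0" using wlap_fst_nonzero[OF x(1) nontrivial_repr[OF u(2) x(2,1)]] by simp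
 moreover have "Vi < 2 / (norm (fst x))^2 * IF (fst x)" using u(4) unfolding L I by (simp add: enn2ereal_ennreal IF_nonneg)
 ultimately have "Vi * (norm (fst x))^2 < 2 * IF (fst x)" by (simp add: pos_less_divide_eq)
 then show ?thesis using x(1) D by blast
qed

end

context schroedinger
begin

text \<open>Every nontrivial weak solution tested with itself is a Nehari point, so the minimality
  over Nehari points includes the comparison among weak solutions.\<close>

lemma ground_state_exists: "\<exists>u. ground_state V f F u"
proof -
 obtain x where x: "x \<in> wlap" "x \<noteq> 0" "\<forall>z\<in>wlap. BV V x z = Nf (fst x) (fst z)"
  "\<forall>v\<in>wlap. v \<noteq> 0 \<longrightarrow> BV V v v = Nf (fst v) (fst v) \<longrightarrow> EV V x \<le> EV V v" using minimizer by blast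
 let ?u = "fn (fst x)"
 have xp: "(fst x, snd x) \<in> wlap" using x by simp
 have u: "AE z in lebesgue. ?u z = fn (fst x) z" "AE z in lebesgue. lap ?u z = fn (snd x) z" using lap_fn[OF xp] by auto
 have "weak_solution V f ?u"
  unfolding weak_solution_def
 proof (intro conjI ballI)
  show "?u \<in> W22" by (rule wlap_fn_W22[OF xp])
  fix \<phi> assume "\<phi> \<in> W22"
  then obtain y where y: "y \<in> wlap" "AE z in lebesgue. \<phi> z = fn (fst y) z" "AE z in lebesgue. lap \<phi> z = fn (snd y) z" by (rule W22_pair)
  show "(\<integral>z. lap ?u z * lap \<phi> z + V z * ?u z * \<phi> z \<partial>lebesgue) = (\<integral>z. f (?u z) * \<phi> z \<partial>lebesgue)"
   unfolding weak_form_transfer[OF V u y(2,3)] using x(3) y(1) by blast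
 qed
 moreover have "nontrivial ?u"
  unfolding nontrivial_def
 proof
  assume "AE z in lebesgue. ?u z = 0"
  then have "AE z in lborel. ?u z = 0" by (rule AE_lebesgue_lborel) auto
  then have "AE z in lborel. ?u z = fn 0 z" using fn_0 by (auto elim!: AE_mp)
  then show False using l2_eqI wlap_fst_nonzero[OF x(1,2)] by blast
 qed
 moreover have "energy V F ?u \<le> energy V F v" if v: "weak_solution V f v" "nontrivial v" for v
 proof -
  have vW: "v \<in> W22" using v by (simp add: weak_solution_def)
  obtain y where y: "y \<in> wlap" "AE z in lebesgue. v z = fn (fst y) z" "AE z in lebesgue. lap v z = fn (snd y) z" by (rule W22_pair[OF vW])
  have "BV V y y = Nf (fst y) (fst y)" using v(1) vW unfolding weak_solution_def weak_form_transfer[OF V y(2,3) y(2,3), symmetric] by blast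
  then show ?thesis
   unfolding energy_transfer[OF V u] energy_transfer[OF V y(2,3)] using x(4) y(1) nontrivial_repr[OF v(2) y(2,1)] by blast
 qed
 ultimately show ?thesis unfolding ground_state_def by blast
qed

end

theorem theorem2p4:
 fixes f F :: "real \<Rightarrow> real" and V :: "real^4 \<Rightarrow> real"
  and \<alpha>0 V_inf :: real
 assumes f0: "f 0 = 0"
  and F_def: "\<And>t. F t = (LBINT s=0..t. f s)"
  and fi: "\<alpha>0 > 0"
    "\<And>\<alpha>. \<alpha> > \<alpha>0 \<Longrightarrow> ((\<lambda>t. \<bar>f t\<bar> / exp (\<alpha> * t\<^sup>2)) \<longlongrightarrow> 0) at_infinity"
    "\<And>\<alpha>. \<alpha> < \<alpha>0 \<Longrightarrow> filterlim (\<lambda>t. \<bar>f t\<bar> / exp (\<alpha> * t\<^sup>2)) at_top at_infinity"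
  and fii: "\<exists>\<mu>>2. \<forall>t. t \<noteq> 0 \<longrightarrow> 0 < \<mu> * F t \<and> \<mu> * F t \<le> t * f t"
  and fiii: "\<exists>t0. \<exists>M0>0. \<forall>t. \<bar>t\<bar> \<ge> t0 \<longrightarrow> F t \<le> M0 * \<bar>f t\<bar>"
  and fiv: "((\<lambda>t. f t / t) \<longlongrightarrow> 0) (at 0)"
  and fv: "\<exists>f'. (\<forall>t. (f has_real_derivative f' t) (at t)) \<and> continuous_on UNIV f'"
    "\<And>s t. 0 < s \<Longrightarrow> s < t \<Longrightarrow> f s / s < f t / t"
    "\<And>s t. s < t \<Longrightarrow> t < 0 \<Longrightarrow> f s / s > f t / t"
  and Vcont: "continuous_on UNIV V"
  and Vnn: "\<And>x. V x \<ge> 0"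
  and V1: "\<exists>c0>0. \<exists>\<delta>>0. (\<forall>x\<in>ball 0 \<delta>. V x = 0) \<and> (\<forall>x. x \<notin> ball 0 (2 * \<delta>) \<longrightarrow> V x \<ge> c0)"
  and V2: "V_inf > 0" "\<And>x. V x \<le> V_inf" "(V \<longlongrightarrow> V_inf) at_infinity"
  and Vgam: "ereal V_inf < gamma_star F \<alpha>0"
 shows "\<exists>u. ground_state V f F u"
proof -
 obtain \<mu> where mu: "\<mu> > 2" "\<And>t. t \<noteq> 0 \<Longrightarrow> 0 < \<mu> * F t \<and> \<mu> * F t \<le> t * f t" using fii by blast
 obtain t0 M0 where M0: "M0 > 0" "\<And>t. \<bar>t\<bar> \<ge> t0 \<Longrightarrow> F t \<le> M0 * \<bar>f t\<bar>" using fiii by blast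
 obtain c0 \<delta> where c0: "c0 > 0" "\<delta> > 0" "\<And>x. x \<in> ball 0 \<delta> \<Longrightarrow> V x = 0" "\<And>x. x \<notin> ball 0 (2 * \<delta>) \<Longrightarrow> c0 \<le> V x" using V1 by blast
 have f_cont: "continuous_on UNIV f" using fv(1) DERIV_isCont by (auto simp: continuous_on_eq_continuous_at)
 have F': "(F has_real_derivative f t) (at t)" for t
 proof -
  define T where "T = \<bar>t\<bar> + 1"
  have T: "-T < t" "t < T" "-T \<le> 0" "0 \<le> T" by (auto simp: T_def)
  have "((\<lambda>u. LBINT y=ereal 0..ereal u. f y) has_vector_derivative f t) (at t within {-T..T})"
   using T continuous_on_subset[OF f_cont] by (intro interval_integral_FTC2) auto
  then have "(F has_vector_derivative f t) (at t within {-T..T})" unfolding F_def[abs_def] zero_ereal_def .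
  then show ?thesis unfolding at_within_Icc_at[OF T(1,2)] by (simp add: has_real_derivative_iff_has_vector_derivative)
 qed
 have F0: "F 0 = 0" unfolding F_def zero_ereal_def by simp
 interpret nonlinearity f F \<alpha>0 \<mu> M0 t0
  by unfold_locales (use f0 F0 F' f_cont fi(1,2) mu M0 fiv fv(2,3) in auto)
 have Vm: "V \<in> borel_measurable borel" using Vcont by (rule borel_measurable_continuous_onI)
 have V: "pot V V_inf" using Vm Vnn V2 by (simp add: pot_def)
 have "\<exists>C>0. \<forall>p w. (p, w) \<in> wlap \<longrightarrow> (norm p)^2 \<le> C * ((norm w)^2 + (LBINT x. V x * (fn p x)^2))"
  by (rule norm_equivalence[where r = "2 * \<delta>", OF Vm Vnn V2(2) c0(1,4)]) (use c0(2) in auto)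
 then obtain C where C: "C > 0" "\<forall>p w. (p, w) \<in> wlap \<longrightarrow> (norm p)^2 \<le> C * ((norm w)^2 + (LBINT x. V x * (fn p x)^2))"
  by blast
 \<comment> \<open>\<open>C\<close> controls the function and 1 its Laplacian in the product norm,
   hence \<open>C + 1\<close>.\<close>
 have coer: "1 / (C + 1) * (norm x)^2 \<le> BV V x x" if x: "x \<in> wlap" for x
 proof -
  have B: "BV V x x = (norm (snd x))^2 + (LBINT z. V z * (fn (fst x) z)^2)"
   unfolding BV_def bil_def power2_norm_eq_inner by (simp add: power2_eq_square)
  have "(fst x, snd x) \<in> wlap" using x by simp
  then have "(norm (fst x))^2 \<le> C * BV V x x" unfolding B using C(2) by blast
  moreover have "(norm (snd x))^2 \<le> BV V x x" unfolding B using Vnn by simp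
  moreover have "(norm x)^2 = (norm (fst x))^2 + (norm (snd x))^2" by (simp add: norm_prod_def)
  ultimately have "(norm x)^2 \<le> (C + 1) * BV V x x" by (simp add: distrib_right)
  then show ?thesis using C(1) by (simp add: pos_divide_le_eq mult.commute)
 qed
 interpret schroedinger f F \<alpha>0 \<mu> M0 t0 V V_inf "1 / (C + 1)" \<delta>
  by unfold_locales (use V V2 Vcont C(1) coer c0 gamma_star_witness[OF Vgam] in auto)
 show ?thesis by (rule ground_state_exists)
qed

end
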